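(* Let $\mathscr C$ be a non-empty set of finite sets of even cardinality, let $\mathcal B=\mathcal B(\mathscr C)$ be the Brauer category over $\mathscr C$, let $\xi$ be the least cardinal strictly greater than $|A|$ for every $A\in\mathscr C$, and let $I_r=\{\alpha\in\mathcal B:\operatorname{rank}(\alpha)\le r\}$ for even $0\le r<\xi$, with $I_\omega=\mathcal B$ if $\xi=\omega$. Let $K=\{\mathrm{id}_4,(1,2)(3,4),(1,3)(2,4),(1,4)(2,3)\}\unlhd\mathcal S_4$. (i) The minimal ideal $I_0$ is (isomorphic to) a partial rectangular band, so its congruences are precisely those corresponding to the relations $\sigma_{\mathcal E_1,\mathcal E_2}$ described in the context. In particular, $\operatorname{Cong}(I_0)$ is isomorphic to the lattice direct product $$\prod_{A\in\mathscr C}\mathfrak{Eq}(\mathfrak{Eq}_2(A))\times\prod_{A\in\mathscr C}\mathfrak{Eq}(\mathfrak{Eq}_2(A)).$$ (ii) (If $\xi>2$.) The ideal $I_2$ is retractable, every congruence on $I_0$ is liftable to $I_2$, and $$\operatorname{Cong}(I_2)=\{\tau\cup\nu_{N^\natural}:\tau\in\operatorname{Cong}(I_0),\ N\unlhd\mathcal S_2\}\cup\{\theta^{I_2}_{I_2,\tau}:\tau\in\operatorname{Cong}(I_0)\}.$$ In particular, $\operatorname{Cong}(I_2)$ is isomorphic to the lattice direct product $\operatorname{Cong}(I_0)\times\mathbf 3$, where $\mathbf 3$ is the three-element chain. (iii) For even $r\ge4$ with $r<\xi$ (and also for $r=\omega$ if $\xi=\omega$), $$\begin{aligned}\operatorname{Cong}(I_r)=\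 &\{\mu^{I_r}_{I_0,N^\natural},\lambda^{I_r}_{I_0,N^\natural},\rho^{I_r}_{I_0,N^\natural},R^{I_r}_{I_0,N^\natural}:N\unlhd\mathcal S_2\}\\ &\cup\{\mu^{I_r}_{I_2,N^\natural},\lambda^{I_r}_{I_2,N^\natural},\rho^{I_r}_{I_2,N^\natural},R^{I_r}_{I_2,N^\natural}:N=\{\mathrm{id}_4\}\text{ or }N=K\}\\ &\cup\{R^{I_r}_{I_q,N^\natural}:2\le q<r,\ q\text{ even},\ N\unlhd\mathcal S_{q+2}\}\cup\{\widetilde\nabla_{I_r}\}.\end{aligned}$$ The inclusion order is as follows. Order pairs $(q,N)$ lexicographically: $(q,N)\le(q',N')$ iff $q<q'$, or $q=q'$ and $N\le N'$. For the pairs $(0,\{\mathrm{id}_2\})<(0,\mathcal S_2)<(2,\{\mathrm{id}_4\})<(2,K)$ and $\kappa,\kappa'\in\{\mu,\lambda,\rho,R\}$, $\kappa_{I_q,N^\natural}\subseteq\kappa'_{I_{q'},N'^\natural}$ iff $(q,N)\le(q',N')$ and $\kappa\le\kappa'$ in the diamond with bottom $\mu$, top $R$ and incomparable middle elements $\lambda,\rho$ (these 16 congruences being distinct); the congruences $R_{I_q,N^\natural}$ with $(q,N)\ge(2,K)$ form a chain in the lexicographic order lying above all of these 16; and $\widetilde\nabla_{I_r}$ is the top element.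
   Context: **Brauer category.** Let $X=\bigcup_{A\in\mathscr C}A$ with disjoint copies $X'$, $X''$. For $A,B\in\mathscr C$, a Brauer partition $\alpha\in\mathcal B_{A,B}$ is a set partition of $A\cup B'$ into blocks of size 2; $\mathbf d(\alpha)=A$, $\mathbf r(\alpha)=B$. For $\alpha\in\mathcal B_{A,B}$, $\beta\in\mathcal B_{B,C}$, regard them as equivalences, rename each $b'$ in $\alpha$ and each $b$ in $\beta$ to $b''$ ($b\in B$), take the join of the resulting equivalences on $A\cup B''\cup C'$, and restrict to $A\cup C'$: this is $\alpha\beta\in\mathcal B_{A,C}$. $\mathcal B=\bigcup\mathcal B_{A,B}$. A block of $\alpha\in\mathcal B_{A,B}$ is a transversal if it meets both $A$ and $B'$; $\operatorname{rank}(\alpha)$ is the number of transversals. The $\mathscr J=\mathscr D$-classes of $\mathcal B$ are $D_q=\{\alpha:\operatorname{rank}(\alpha)=q\}$, $q$ even, $0\le q<\xi$, all stable and regular. $\mathfrak{Eq}(Z)$ is the lattice of equivalences on $Z$. For $|A|$ even, $\mathfrak{Eq}_2(A)$ is the set of equivalences on $A$ all of whose classes have size 2. $\mathcal S_q$ is the symmetric group on $\{1,\ldots,q\}$. **Groups.** For even $0\le q<\xi$ fix $X_q\in\mathscr C$ with $n_q=|X_q|\ge q$, $X_q=\{x_1,\ldots,x_{n_q}\}$. For $\pi\in\mathcal S_q$, $\pi^\natural\in\mathcal B_{X_q,X_q}$ has blocks $\{x_i,x_{i\pi}'\}$ ($1\le i\le q$), and $\{x_{q+1},x_{q+2}\},\ldots,\{x_{n_q-1},x_{n_q}\}$,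 $\{x_{q+1}',x_{q+2}'\},\ldots,\{x_{n_q-1}',x_{n_q}'\}$. $N^\natural=\{\pi^\natural:\pi\in N\}$. $\mathcal S_q^\natural$ is a group $\mathscr H$-class in $D_q$. **Congruences.** For a partial semigroup (category without necessarily having identities) $S$, write $x\sim y$ if $\mathbf d(x)=\mathbf d(y)$ and $\mathbf r(x)=\mathbf r(y)$. A congruence on $S$ is an equivalence contained in $\sim$ and compatible with all defined left and right multiplications. $\operatorname{Cong}(S)$ is the lattice of congruences. $\Delta_S$ is equality, $\widetilde\nabla_S=\{(x,y):x\sim y\}$. For an ideal $I$ (non-empty, closed under defined multiplication by elements of $S$ on either side), $R_I^S=\widetilde\nabla_I\cup\Delta_S$. Green's relations: $x\mathrel{\mathscr R}y\Leftrightarrow xS^1=yS^1$, $x\mathrel{\mathscr L}y\Leftrightarrow S^1x=S^1y$, $x\mathrel{\mathscr J}y\Leftrightarrow S^1xS^1=S^1yS^1$, $\mathscr H=\mathscr R\cap\mathscr L$ ($S^1$ is $S$ with identities adjoined where needed). For $N$ a normal subgroup of a group $\mathscr H$-class in a $\mathscr J$-class $D$ minimal among those in $S\setminus I$, $\nu_N=\{(axb,ayb):x,y\in N,\ a,b\in S^1,\ axb,ayb\in D\}$ and $R^S_{I,N}=R_I^S\cup\nu_N$. Let $M$ be the minimal ideal of $S$. An ideal $I$ is retractable if there is a map $f:I\to M$ (then unique) with $x\sim xf$, $(xy)f=(xf)(yf)$ for all defined products, and $xf=x$ for $x\in M$. A congruence $\tau$ on $M$ is liftable to $S$ if $\tau\cup\Delta_S\in\operatorname{Cong}(S)$.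 For $I$ retractable and $\tau$ liftable, $\theta^S_{I,\tau}=\{(x,y)\in I\times I:(xf,yf)\in\tau\}\cup\Delta_S$. For $I$ retractable, $\lambda^S_{I,N}=\{(x,y)\in I\times I:x\sim y,\ (xf,yf)\in\mathscr L\}\cup\nu_N\cup\Delta_S$, and $\rho^S_{I,N}$, $\mu^S_{I,N}$ are defined likewise with $\mathscr R$, $\mathscr H$ in place of $\mathscr L$. **Partial rectangular bands.** Given non-empty sets $X_A,Y_A$ ($A\in\mathscr C$), the $X_A$ pairwise disjoint and the $Y_A$ pairwise disjoint, the partial rectangular band is $\bigcup_{A,B}X_A\times Y_B$ with $\mathbf d(x,y)=A$, $\mathbf r(x,y)=B$ for $x\in X_A,y\in Y_B$, and $(x_1,y_1)(x_2,y_2)=(x_1,y_2)$ when $\mathbf r(x_1,y_1)=\mathbf d(x_2,y_2)$. For tuples $\mathcal E_1=(\varepsilon^A_1)_A$, $\mathcal E_2=(\varepsilon_2^A)_A$ with $\varepsilon_1^A\in\mathfrak{Eq}(X_A)$, $\varepsilon_2^A\in\mathfrak{Eq}(Y_A)$, $\sigma_{\mathcal E_1,\mathcal E_2}$ relates $(x_1,y_1)$, $(x_2,y_2)$ iff both lie in a common $X_A\times Y_B$ and $(x_1,x_2)\in\varepsilon_1^A$, $(y_1,y_2)\in\varepsilon_2^B$. Isomorphisms preserve $\mathbf d$, $\mathbf r$. *)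

theory Defs
  imports "HOL-Algebra.Sym_Groups" "HOL-Algebra.Lattice"
    "HOL-Library.Disjoint_Sets" "HOL-Library.Extended_Nat"
begin

section \<open>Partial semigroups\<close>

text \<open>The product of \<open>x\<close> and \<open>y\<close> is defined iff \<open>rng S x = src S y\<close>; the values of \<open>prd\<close> on other
  arguments are irrelevant.\<close>

record ('s, 'o) psg =
  els :: "'s set"
  src :: "'s \<Rightarrow> 'o"
  rng :: "'s \<Rightarrow> 'o"
  prd :: "'s \<Rightarrow> 's \<Rightarrow> 's"

definition sub_psg :: "('s, 'o) psg \<Rightarrow> 's set \<Rightarrow> ('s, 'o) psg" where
  "sub_psg S I = S\<lparr>els := I\<rparr>"

definition psg_sim :: "('s, 'o) psg \<Rightarrow> 's \<Rightarrow> 's \<Rightarrow> bool" where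
  "psg_sim S x y \<longleftrightarrow> src S x = src S y \<and> rng S x = rng S y"

definition psg_iso :: "('s \<Rightarrow> 't) \<Rightarrow> ('s, 'o) psg \<Rightarrow> ('t, 'o) psg \<Rightarrow> bool" where
  "psg_iso f S T \<longleftrightarrow> bij_betw f (els S) (els T) \<and>
     (\<forall>x\<in>els S. src T (f x) = src S x \<and> rng T (f x) = rng S x) \<and>
     (\<forall>x\<in>els S. \<forall>y\<in>els S. rng S x = src S y \<longrightarrow> f (prd S x y) = prd T (f x) (f y))"

definition congruence :: "('s, 'o) psg \<Rightarrow> ('s \<times> 's) set \<Rightarrow> bool" where
  "congruence S \<sigma> \<longleftrightarrow> equiv (els S) \<sigma> \<and> (\<forall>(x, y)\<in>\<sigma>. psg_sim S x y) \<and>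
     (\<forall>(x, y)\<in>\<sigma>. \<forall>z\<in>els S.
        (rng S x = src S z \<longrightarrow> (prd S x z, prd S y z) \<in> \<sigma>) \<and>
        (rng S z = src S x \<longrightarrow> (prd S z x, prd S z y) \<in> \<sigma>))"

definition Cong :: "('s, 'o) psg \<Rightarrow> ('s \<times> 's) set set" where
  "Cong S = {\<sigma>. congruence S \<sigma>}"

definition Delta :: "('s, 'o) psg \<Rightarrow> ('s \<times> 's) set" where
  "Delta S = Id_on (els S)"

definition Nabla_on :: "('s, 'o) psg \<Rightarrow> 's set \<Rightarrow> ('s \<times> 's) set" where
  "Nabla_on S I = {(x, y) \<in> I \<times> I. psg_sim S x y}"

abbreviation Nabla :: "('s, 'o) psg \<Rightarrow> ('s \<times> 's) set" where
  "Nabla S \<equiv> Nabla_on S (els S)"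

definition is_ideal :: "('s, 'o) psg \<Rightarrow> 's set \<Rightarrow> bool" where
  "is_ideal S I \<longleftrightarrow> I \<noteq> {} \<and> I \<subseteq> els S \<and>
     (\<forall>x\<in>I. \<forall>s\<in>els S. (rng S x = src S s \<longrightarrow> prd S x s \<in> I) \<and>
                       (rng S s = src S x \<longrightarrow> prd S s x \<in> I))"

definition is_minimal_ideal :: "('s, 'o) psg \<Rightarrow> 's set \<Rightarrow> bool" where
  "is_minimal_ideal S M \<longleftrightarrow> is_ideal S M \<and> (\<forall>J. is_ideal S J \<and> J \<subseteq> M \<longrightarrow> J = M)"

definition minimal_ideal :: "('s, 'o) psg \<Rightarrow> 's set" where
  "minimal_ideal S = (THE M. is_minimal_ideal S M)"

section \<open>Green's relations\<close>

text \<open>An element of \<open>S\<^sup>1\<close> is encoded as an option, \<open>None\<close> being an adjoined identity (at whichever object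
  it is needed); \<open>sandwich S a x b\<close> is the product \<open>axb\<close>, which is defined under \<open>sandwichable\<close>.
  Adjoining an identity where \<open>S\<close> already has one does not change any of the sets below.\<close>

definition S1 :: "('s, 'o) psg \<Rightarrow> 's option set" where
  "S1 S = insert None (Some ` els S)"

definition sandwichable :: "('s, 'o) psg \<Rightarrow> 's option \<Rightarrow> 's \<Rightarrow> 's option \<Rightarrow> bool" where
  "sandwichable S a x b \<longleftrightarrow> (\<forall>a'. a = Some a' \<longrightarrow> rng S a' = src S x) \<and>
                           (\<forall>b'. b = Some b' \<longrightarrow> rng S x = src S b')"

definition sandwich :: "('s, 'o) psg \<Rightarrow> 's option \<Rightarrow> 's \<Rightarrow> 's option \<Rightarrow> 's" where
  "sandwich S a x b =
     (let y = (case a of None \<Rightarrow> x | Some a' \<Rightarrow> prd S a' x)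
      in case b of None \<Rightarrow> y | Some b' \<Rightarrow> prd S y b')"

definition pright :: "('s, 'o) psg \<Rightarrow> 's \<Rightarrow> 's set" where
  "pright S x = {sandwich S None x b | b. b \<in> S1 S \<and> sandwichable S None x b}"

definition pleft :: "('s, 'o) psg \<Rightarrow> 's \<Rightarrow> 's set" where
  "pleft S x = {sandwich S a x None | a. a \<in> S1 S \<and> sandwichable S a x None}"

definition pideal :: "('s, 'o) psg \<Rightarrow> 's \<Rightarrow> 's set" where
  "pideal S x = {sandwich S a x b | a b. a \<in> S1 S \<and> b \<in> S1 S \<and> sandwichable S a x b}"

definition green_R :: "('s, 'o) psg \<Rightarrow> ('s \<times> 's) set" where
  "green_R S = {(x, y) \<in> els S \<times> els S. pright S x = pright S y}"

definition green_L :: "('s, 'o) psg \<Rightarrow> ('s \<times> 's) set" where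
  "green_L S = {(x, y) \<in> els S \<times> els S. pleft S x = pleft S y}"

definition green_J :: "('s, 'o) psg \<Rightarrow> ('s \<times> 's) set" where
  "green_J S = {(x, y) \<in> els S \<times> els S. pideal S x = pideal S y}"

definition green_H :: "('s, 'o) psg \<Rightarrow> ('s \<times> 's) set" where
  "green_H S = green_R S \<inter> green_L S"

section \<open>Special congruences\<close>

text \<open>In \<open>nu\<close>, the set \<open>green_J S `` N\<close> is the \<open>\<J>\<close>-class \<open>D\<close> containing \<open>N\<close>.\<close>

definition nu :: "('s, 'o) psg \<Rightarrow> 's set \<Rightarrow> ('s \<times> 's) set" where
  "nu S N = {(sandwich S a x b, sandwich S a y b) | a x y b.
     x \<in> N \<and> y \<in> N \<and> a \<in> S1 S \<and> b \<in> S1 S \<and>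
     sandwichable S a x b \<and> sandwichable S a y b \<and>
     sandwich S a x b \<in> green_J S `` N \<and> sandwich S a y b \<in> green_J S `` N}"

definition R_cong :: "('s, 'o) psg \<Rightarrow> 's set \<Rightarrow> 's set \<Rightarrow> ('s \<times> 's) set" where
  "R_cong S I N = Nabla_on S I \<union> Delta S \<union> nu S N"

definition is_retraction :: "('s, 'o) psg \<Rightarrow> 's set \<Rightarrow> ('s \<Rightarrow> 's) \<Rightarrow> bool" where
  "is_retraction S I f \<longleftrightarrow> f \<in> I \<rightarrow> minimal_ideal S \<and>
     (\<forall>x\<in>I. psg_sim S x (f x)) \<and>
     (\<forall>x\<in>I. \<forall>y\<in>I. rng S x = src S y \<longrightarrow> f (prd S x y) = prd S (f x) (f y)) \<and>
     (\<forall>x\<in>minimal_ideal S. f x = x)"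

definition retractable :: "('s, 'o) psg \<Rightarrow> 's set \<Rightarrow> bool" where
  "retractable S I \<longleftrightarrow> is_ideal S I \<and> (\<exists>f. is_retraction S I f)"

text \<open>Extensionality fixes the values outside \<open>I\<close>, as needed for uniqueness in HOL.\<close>

definition retraction_of :: "('s, 'o) psg \<Rightarrow> 's set \<Rightarrow> 's \<Rightarrow> 's" where
  "retraction_of S I = (THE f. f \<in> extensional I \<and> is_retraction S I f)"

definition liftable :: "('s, 'o) psg \<Rightarrow> ('s \<times> 's) set \<Rightarrow> bool" where
  "liftable S \<tau> \<longleftrightarrow> \<tau> \<union> Delta S \<in> Cong S"

definition theta_cong :: "('s, 'o) psg \<Rightarrow> 's set \<Rightarrow> ('s \<times> 's) set \<Rightarrow> ('s \<times> 's) set" where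
  "theta_cong S I \<tau> =
     {(x, y) \<in> I \<times> I. (retraction_of S I x, retraction_of S I y) \<in> \<tau>} \<union> Delta S"

definition retract_cong ::
  "('s \<times> 's) set \<Rightarrow> ('s, 'o) psg \<Rightarrow> 's set \<Rightarrow> 's set \<Rightarrow> ('s \<times> 's) set" where
  "retract_cong K S I N =
     {(x, y) \<in> I \<times> I. psg_sim S x y \<and> (retraction_of S I x, retraction_of S I y) \<in> K}
       \<union> nu S N \<union> Delta S"

definition lambda_cong :: "('s, 'o) psg \<Rightarrow> 's set \<Rightarrow> 's set \<Rightarrow> ('s \<times> 's) set" where
  "lambda_cong S = retract_cong (green_L S) S"

definition rho_cong :: "('s, 'o) psg \<Rightarrow> 's set \<Rightarrow> 's set \<Rightarrow> ('s \<times> 's) set" where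
  "rho_cong S = retract_cong (green_R S) S"

definition mu_cong :: "('s, 'o) psg \<Rightarrow> 's set \<Rightarrow> 's set \<Rightarrow> ('s \<times> 's) set" where
  "mu_cong S = retract_cong (green_H S) S"

datatype kind = MuK | LambdaK | RhoK | RK

fun kind_cong :: "kind \<Rightarrow> ('s, 'o) psg \<Rightarrow> 's set \<Rightarrow> 's set \<Rightarrow> ('s \<times> 's) set" where
  "kind_cong MuK = mu_cong"
| "kind_cong LambdaK = lambda_cong"
| "kind_cong RhoK = rho_cong"
| "kind_cong RK = R_cong"

definition kind_le :: "kind \<Rightarrow> kind \<Rightarrow> bool" where
  "kind_le k k' \<longleftrightarrow> k = k' \<or> k = MuK \<or> k' = RK"

section \<open>Partial rectangular bands\<close>

definition band_data :: "'i set \<Rightarrow> ('i \<Rightarrow> 'x set) \<Rightarrow> bool" where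
  "band_data C X \<longleftrightarrow> (\<forall>A\<in>C. X A \<noteq> {}) \<and> disjoint_family_on X C"

definition rect_band ::
  "'i set \<Rightarrow> ('i \<Rightarrow> 'x set) \<Rightarrow> ('i \<Rightarrow> 'y set) \<Rightarrow> ('x \<times> 'y, 'i) psg" where
  "rect_band C X Y =
     \<lparr>els = (\<Union>A\<in>C. \<Union>B\<in>C. X A \<times> Y B),
      src = (\<lambda>p. THE A. A \<in> C \<and> fst p \<in> X A),
      rng = (\<lambda>p. THE B. B \<in> C \<and> snd p \<in> Y B),
      prd = (\<lambda>p q. (fst p, snd q))\<rparr>"

definition band_sigma ::
  "'i set \<Rightarrow> ('i \<Rightarrow> 'x set) \<Rightarrow> ('i \<Rightarrow> 'y set) \<Rightarrow> ('i \<Rightarrow> ('x \<times> 'x) set) \<Rightarrow> ('i \<Rightarrow> ('y \<times> 'y) set)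
     \<Rightarrow> (('x \<times> 'y) \<times> ('x \<times> 'y)) set" where
  "band_sigma C X Y E1 E2 = {((x1, y1), (x2, y2)) | x1 y1 x2 y2.
     \<exists>A\<in>C. \<exists>B\<in>C. x1 \<in> X A \<and> x2 \<in> X A \<and> y1 \<in> Y B \<and> y2 \<in> Y B \<and>
       (x1, x2) \<in> E1 A \<and> (y1, y2) \<in> E2 B}"

section \<open>Lattices\<close>

definition incl_order :: "'b set set \<Rightarrow> 'b set gorder" where
  "incl_order F = \<lparr>carrier = F, eq = (=), le = (\<subseteq>)\<rparr>"

definition Cong_lattice :: "('s, 'o) psg \<Rightarrow> ('s \<times> 's) set gorder" where
  "Cong_lattice S = incl_order (Cong S)"

definition Eq_lattice :: "'z set \<Rightarrow> ('z \<times> 'z) set gorder" where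
  "Eq_lattice Z = incl_order {\<epsilon>. equiv Z \<epsilon>}"

definition prod_lattice :: "'b gorder \<Rightarrow> 'c gorder \<Rightarrow> ('b \<times> 'c) gorder" where
  "prod_lattice L M = \<lparr>carrier = carrier L \<times> carrier M, eq = (=),
     le = (\<lambda>p q. le L (fst p) (fst q) \<and> le M (snd p) (snd q))\<rparr>"

definition Prod_lattice :: "'i set \<Rightarrow> ('i \<Rightarrow> 'b gorder) \<Rightarrow> ('i \<Rightarrow> 'b) gorder" where
  "Prod_lattice J L = \<lparr>carrier = (\<Pi>\<^sub>E i\<in>J. carrier (L i)), eq = (=),
     le = (\<lambda>f g. \<forall>i\<in>J. le (L i) (f i) (g i))\<rparr>"

definition chain3 :: "nat gorder" where
  "chain3 = \<lparr>carrier = {0, 1, 2}, eq = (=), le = (\<le>)\<rparr>"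

text \<open>\<open>join_pres\<close> and \<open>meet_pres\<close> include the requirement that both orders be lattices.\<close>

definition lattice_isomorphic :: "'b gorder \<Rightarrow> 'c gorder \<Rightarrow> bool" where
  "lattice_isomorphic L M \<longleftrightarrow>
     (\<exists>f. bij_betw f (carrier L) (carrier M) \<and> join_pres L M f \<and> meet_pres L M f)"

definition Eq2 :: "'a set \<Rightarrow> ('a \<times> 'a) set set" where
  "Eq2 A = {\<epsilon>. equiv A \<epsilon> \<and> (\<forall>c\<in>A // \<epsilon>. card c = 2)}"

section \<open>The Brauer category\<close>

text \<open>The disjoint copies of a set are the summands of a sum type: \<open>Inl a\<close> stands for \<open>a\<close> and \<open>Inr b\<close>
  for \<open>b'\<close>.  A Brauer partition is given by its set of blocks; their union \<open>A <+> B\<close> determines \<open>A\<close> and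
  \<open>B\<close>.\<close>

definition Brauer :: "'a set \<Rightarrow> 'a set \<Rightarrow> ('a + 'a) set set set" where
  "Brauer A B = {\<alpha>. partition_on (A <+> B) \<alpha> \<and> (\<forall>b\<in>\<alpha>. card b = 2)}"

definition br_src :: "('a + 'a) set set \<Rightarrow> 'a set" where
  "br_src \<alpha> = {a. Inl a \<in> \<Union>\<alpha>}"

definition br_rng :: "('a + 'a) set set \<Rightarrow> 'a set" where
  "br_rng \<alpha> = {b. Inr b \<in> \<Union>\<alpha>}"

definition rel_of_part :: "'b set set \<Rightarrow> ('b \<times> 'b) set" where
  "rel_of_part P = {(u, v). \<exists>b\<in>P. u \<in> b \<and> v \<in> b}"

text \<open>In the three-fold sum, \<open>Inl a\<close> is \<open>a\<close>, \<open>Inr (Inl b)\<close> is \<open>b''\<close> and \<open>Inr (Inr c)\<close> is \<open>c'\<close>.  The union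
  of the renamed relations is reflexive on \<open>A \<union> B'' \<union> C'\<close> and symmetric, so its transitive closure is
  the join.\<close>

definition br_join ::
  "('a + 'a) set set \<Rightarrow> ('a + 'a) set set \<Rightarrow> (('a + ('a + 'a)) \<times> ('a + ('a + 'a))) set" where
  "br_join \<alpha> \<beta> = (map_prod (map_sum id Inl) (map_sum id Inl) ` rel_of_part \<alpha> \<union>
                  map_prod Inr Inr ` rel_of_part \<beta>)\<^sup>+"

definition br_prd :: "('a + 'a) set set \<Rightarrow> ('a + 'a) set set \<Rightarrow> ('a + 'a) set set" where
  "br_prd \<alpha> \<beta> = (br_src \<alpha> <+> br_rng \<beta>) //
     {(u, v). u \<in> br_src \<alpha> <+> br_rng \<beta> \<and> v \<in> br_src \<alpha> <+> br_rng \<beta> \<and>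
        (map_sum id Inr u, map_sum id Inr v) \<in> br_join \<alpha> \<beta>}"

definition BrauerCat :: "'a set set \<Rightarrow> (('a + 'a) set set, 'a set) psg" where
  "BrauerCat C = \<lparr>els = (\<Union>A\<in>C. \<Union>B\<in>C. Brauer A B), src = br_src, rng = br_rng, prd = br_prd\<rparr>"

definition br_rank :: "('a + 'a) set set \<Rightarrow> nat" where
  "br_rank \<alpha> = card {b \<in> \<alpha>. b \<inter> range Inl \<noteq> {} \<and> b \<inter> range Inr \<noteq> {}}"

text \<open>Since the members of \<open>C\<close> are finite, \<open>\<xi>\<close> is at most \<open>\<omega>\<close>, represented by \<open>\<infinity> :: enat\<close>.\<close>

definition xi :: "'a set set \<Rightarrow> enat" where
  "xi C = (LEAST k. \<forall>A\<in>C. enat (card A) < k)"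

definition rank_ideal :: "'a set set \<Rightarrow> enat \<Rightarrow> ('a + 'a) set set set" where
  "rank_ideal C r = {\<alpha> \<in> els (BrauerCat C). enat (br_rank \<alpha>) \<le> r}"

definition I_psg :: "'a set set \<Rightarrow> enat \<Rightarrow> (('a + 'a) set set, 'a set) psg" where
  "I_psg C r = sub_psg (BrauerCat C) (rank_ideal C r)"

text \<open>\<open>X q\<close> is enumerated as \<open>x q 1, \<dots>, x q (card (X q))\<close>.\<close>

definition enumerated_objects ::
  "'a set set \<Rightarrow> (nat \<Rightarrow> 'a set) \<Rightarrow> (nat \<Rightarrow> nat \<Rightarrow> 'a) \<Rightarrow> bool" where
  "enumerated_objects C X x \<longleftrightarrow>
     (\<forall>q. even q \<and> enat q < xi C \<longrightarrow>
        X q \<in> C \<and> q \<le> card (X q) \<and> bij_betw (x q) {1..card (X q)} (X q))"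

text \<open>As \<open>q\<close> is even, the pairs \<open>{j, j + 1}\<close> with \<open>j\<close> odd and \<open>q < j < card (X q)\<close> are
  \<open>{q+1, q+2}, {q+3, q+4}, \<dots>\<close>.\<close>

definition natural_perm ::
  "(nat \<Rightarrow> 'a set) \<Rightarrow> (nat \<Rightarrow> nat \<Rightarrow> 'a) \<Rightarrow> nat \<Rightarrow> (nat \<Rightarrow> nat) \<Rightarrow> ('a + 'a) set set" where
  "natural_perm X x q \<pi> =
     {{Inl (x q i), Inr (x q (\<pi> i))} | i. 1 \<le> i \<and> i \<le> q} \<union>
     {{Inl (x q j), Inl (x q (j + 1))} | j. odd j \<and> q < j \<and> j < card (X q)} \<union>
     {{Inr (x q j), Inr (x q (j + 1))} | j. odd j \<and> q < j \<and> j < card (X q)}"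

definition natural_group ::
  "(nat \<Rightarrow> 'a set) \<Rightarrow> (nat \<Rightarrow> nat \<Rightarrow> 'a) \<Rightarrow> nat \<Rightarrow> (nat \<Rightarrow> nat) set \<Rightarrow> ('a + 'a) set set set" where
  "natural_group X x q N = natural_perm X x q ` N"

definition klein :: "(nat \<Rightarrow> nat) set" where
  "klein = {id, transpose 1 2 \<circ> transpose 3 4, transpose 1 3 \<circ> transpose 2 4,
            transpose 1 4 \<circ> transpose 2 3}"

definition lex_le :: "nat \<times> (nat \<Rightarrow> nat) set \<Rightarrow> nat \<times> (nat \<Rightarrow> nat) set \<Rightarrow> bool" where
  "lex_le p p' \<longleftrightarrow> fst p < fst p' \<or> fst p = fst p' \<and> snd p \<subseteq> snd p'"

text \<open>In a pair \<open>(q, N)\<close> the group \<open>N\<close> is a normal subgroup of the symmetric group of degree \<open>q + 2\<close>.\<close>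

definition pairs4 :: "(nat \<times> (nat \<Rightarrow> nat) set) set" where
  "pairs4 = {(0, {id}), (0, carrier (sym_group 2)), (2, {id}), (2, klein)}"

definition upper_pairs :: "enat \<Rightarrow> (nat \<times> (nat \<Rightarrow> nat) set) set" where
  "upper_pairs r = {(q, N). even q \<and> enat q < r \<and> N \<lhd> sym_group (q + 2) \<and> lex_le (2, klein) (q, N)}"

definition pair_cong ::
  "'a set set \<Rightarrow> (nat \<Rightarrow> 'a set) \<Rightarrow> (nat \<Rightarrow> nat \<Rightarrow> 'a) \<Rightarrow> enat \<Rightarrow> kind \<Rightarrow> nat \<times> (nat \<Rightarrow> nat) set
     \<Rightarrow> (('a + 'a) set set \<times> ('a + 'a) set set) set" where
  "pair_cong C X x r k p = kind_cong k (I_psg C r) (rank_ideal C (enat (fst p)))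
     (natural_group X x (fst p + 2) (snd p))"

end

theory Submission
  imports Defs
begin

text \<open>Elements of rank 0 are pairs of perfect matchings, so \<open>I\<^sub>0\<close> is a rectangular band.  A congruence on
  a larger ideal is found from the largest rank \<open>q\<close> at which it relates an element to one of no larger
  rank that is not \<open>\<H>\<close>-related to it.  For \<open>q \<ge> 4\<close> multiplying down forces everything of rank at
  most \<open>q\<close> to be identified; for \<open>q = 2\<close> it forces every element of rank at most 2 to be related to
  its retract; and if \<open>r \<ge> 4\<close>, one pair of rank 0 with different upper (lower) hooks forces the upper
  (lower) hooks at rank 0 to be disregarded altogether.  What remains at the next rank is a normal
  subgroup of a symmetric group, where the Klein four-group is special: permuting the transversals of an
  element of rank 4 by it does not affect the retracts of products of rank at most 2.\<close>

section \<open>Lattices given by explicit bounds\<close>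

text \<open>Rank 2 is the threshold because the hooks of an element of rank at most 2 extend to a
  perfect matching in exactly one way, compatibly with products; at rank 4 the four free points
  admit three matchings. The Klein group consists of the permutations of four points that fix each
  of these three, whence its harmless action on retracts. Rank 4 is also what a multiplier needs in
  order to exchange two pairs of a matching for two others. Any two matchings are linked by such
  switches, so one related pair spreads over all of them if r is at least 4, while within rank 2 no
  multiplier is large enough and every congruence of the minimal ideal survives.

  All listed relations except the universal one are written as one relation \<open>Rel\<close> with
  two Booleans for the disregarded hooks and a normal subgroup. The reflection \<open>star\<close>
  exchanges the Booleans, so upper hooks and right multiplication are treated directly and the other
  side follows. Alternating paths of a product are traced only when short; otherwise equality of
  hook sets comes from an inclusion between matchings or from a count of free points.\<close>

lemma latticeI:
  fixes L :: "'b gorder"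
  assumes eq: "\<And>x y. eq L x y \<longleftrightarrow> x = y"
    and refl: "\<And>x. x \<in> carrier L \<Longrightarrow> le L x x"
    and antisym: "\<And>x y. x \<in> carrier L \<Longrightarrow> y \<in> carrier L \<Longrightarrow> le L x y \<Longrightarrow> le L y x \<Longrightarrow> x = y"
    and trans: "\<And>x y z. x \<in> carrier L \<Longrightarrow> y \<in> carrier L \<Longrightarrow> z \<in> carrier L \<Longrightarrow> le L x y \<Longrightarrow> le L y z \<Longrightarrow> le L x z"
    and sup: "\<And>x y. x \<in> carrier L \<Longrightarrow> y \<in> carrier L \<Longrightarrow>
      \<exists>s\<in>carrier L. le L x s \<and> le L y s \<and> (\<forall>z\<in>carrier L. le L x z \<and> le L y z \<longrightarrow> le L s z)"
    and inf: "\<And>x y. x \<in> carrier L \<Longrightarrow> y \<in> carrier L \<Longrightarrow>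
      \<exists>s\<in>carrier L. le L s x \<and> le L s y \<and> (\<forall>z\<in>carrier L. le L z x \<and> le L z y \<longrightarrow> le L z s)"
  shows "lattice L"
proof -
  have po: "partial_order L"
  proof unfold_locales
    show "eq L = (=)" by (intro ext) (rule eq)
  qed (simp_all only: eq, (blast intro: refl antisym trans)+)
  interpret partial_order L by (rule po)
  have "\<exists>s. least L s (Upper L {x, y})" if xy: "x \<in> carrier L" "y \<in> carrier L" for x y
    using sup[OF xy] xy unfolding least_def Upper_def by auto
  moreover have "\<exists>s. greatest L s (Lower L {x, y})" if xy: "x \<in> carrier L" "y \<in> carrier L" for x y
    using inf[OF xy] xy unfolding greatest_def Lower_def by auto
  ultimately show ?thesis
    by unfold_locales auto
qed

lemma lattice_bounds:
  fixes L :: "'b gorder"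
  assumes "lattice L" "x \<in> carrier L" "y \<in> carrier L"
  shows "\<exists>s\<in>carrier L. le L x s \<and> le L y s \<and> (\<forall>z\<in>carrier L. le L x z \<and> le L y z \<longrightarrow> le L s z)"
    and "\<exists>s\<in>carrier L. le L s x \<and> le L s y \<and> (\<forall>z\<in>carrier L. le L z x \<and> le L z y \<longrightarrow> le L z s)"
proof -
  interpret lattice L by (rule assms)
  show "\<exists>s\<in>carrier L. le L x s \<and> le L y s \<and> (\<forall>z\<in>carrier L. le L x z \<and> le L y z \<longrightarrow> le L s z)"
    using assms join_closed join_left join_right join_le by (intro bexI[of _ "x \<squnion>\<^bsub>L\<^esub> y"]) auto
  show "\<exists>s\<in>carrier L. le L s x \<and> le L s y \<and> (\<forall>z\<in>carrier L. le L z x \<and> le L z y \<longrightarrow> le L z s)"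
    using assms meet_closed meet_left meet_right meet_le by (intro bexI[of _ "x \<sqinter>\<^bsub>L\<^esub> y"]) auto
qed

text \<open>Bounds are pulled back along an order isomorphism. In this way the congruence lattices
  become lattices without any description of the join of two congruences.\<close>

lemma lattice_transfer:
  fixes L :: "'b gorder" and M :: "'c gorder"
  assumes f: "bij_betw f (carrier L) (carrier M)"
    and le: "\<And>x y. x \<in> carrier L \<Longrightarrow> y \<in> carrier L \<Longrightarrow> le L x y \<longleftrightarrow> le M (f x) (f y)"
    and eq: "\<And>x y. eq L x y \<longleftrightarrow> x = y" and M: "lattice M"
  shows "lattice L"
proof (rule latticeI[OF eq])
  interpret M: lattice M by (rule M)
  have fc: "f x \<in> carrier M" if "x \<in> carrier L" for x using f that by (auto simp: bij_betw_def)
  have fs: "\<exists>x\<in>carrier L. y = f x" if "y \<in> carrier M" for y using f that by (auto simp: bij_betw_def)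
  show "le L x x" if "x \<in> carrier L" for x using le[OF that that] M.le_refl[OF fc[OF that]] by simp
  show "x = y" if "x \<in> carrier L" "y \<in> carrier L" "le L x y" "le L y x" for x y
    using M.le_antisym[of "f x" "f y"] le that fc f by (auto simp: bij_betw_def dest: inj_onD)
  show "le L x z" if "x \<in> carrier L" "y \<in> carrier L" "z \<in> carrier L" "le L x y" "le L y z" for x y z
    using M.le_trans[of "f x" "f y" "f z"] le that fc by auto
  fix x y assume xy: "x \<in> carrier L" "y \<in> carrier L"
  show "\<exists>s\<in>carrier L. le L x s \<and> le L y s \<and> (\<forall>z\<in>carrier L. le L x z \<and> le L y z \<longrightarrow> le L s z)"
    using lattice_bounds(1)[OF M fc[OF xy(1)] fc[OF xy(2)]] fs fc le xy by (metis (no_types, lifting))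
  show "\<exists>s\<in>carrier L. le L s x \<and> le L s y \<and> (\<forall>z\<in>carrier L. le L z x \<and> le L z y \<longrightarrow> le L z s)"
    using lattice_bounds(2)[OF M fc[OF xy(1)] fc[OF xy(2)]] fs fc le xy by (metis (no_types, lifting))
qed

lemma lattice_isomorphicI:
  fixes L :: "'b gorder" and M :: "'c gorder"
  assumes f: "bij_betw f (carrier L) (carrier M)"
    and le: "\<And>x y. x \<in> carrier L \<Longrightarrow> y \<in> carrier L \<Longrightarrow> le L x y \<longleftrightarrow> le M (f x) (f y)"
    and L: "lattice L" and M: "lattice M"
  shows "lattice_isomorphic L M"
proof -
  interpret L: lattice L by (rule L)
  interpret M: lattice M by (rule M)
  have fc: "f x \<in> carrier M" if "x \<in> carrier L" for x using f that by (auto simp: bij_betw_def)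
  have fs: "\<exists>x\<in>carrier L. y = f x" if "y \<in> carrier M" for y using f that by (auto simp: bij_betw_def)
  have "f (x \<squnion>\<^bsub>L\<^esub> y) = f x \<squnion>\<^bsub>M\<^esub> f y" if xy: "x \<in> carrier L" "y \<in> carrier L" for x y
  proof (rule M.le_antisym)
    note j = L.join_closed[OF xy] and k = M.join_closed[OF fc[OF xy(1)] fc[OF xy(2)]]
    obtain z where z: "z \<in> carrier L" "f x \<squnion>\<^bsub>M\<^esub> f y = f z" using fs[OF k] by blast
    have "le L x z" "le L y z"
      using M.join_left[OF fc[OF xy(1)] fc[OF xy(2)]] M.join_right[OF fc[OF xy(1)] fc[OF xy(2)]] z le xy by auto
    then have "le L (x \<squnion>\<^bsub>L\<^esub> y) z" using L.join_le xy z by simp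
    then show "le M (f (x \<squnion>\<^bsub>L\<^esub> y)) (f x \<squnion>\<^bsub>M\<^esub> f y)" using z le j by simp
    show "le M (f x \<squnion>\<^bsub>M\<^esub> f y) (f (x \<squnion>\<^bsub>L\<^esub> y))"
      using M.join_le[OF _ _ fc[OF xy(1)] fc[OF xy(2)] fc[OF j]] le L.join_left[OF xy] L.join_right[OF xy] xy j by blast
    show "f (x \<squnion>\<^bsub>L\<^esub> y) \<in> carrier M" "f x \<squnion>\<^bsub>M\<^esub> f y \<in> carrier M" using fc j k by auto
  qed
  moreover have "f (x \<sqinter>\<^bsub>L\<^esub> y) = f x \<sqinter>\<^bsub>M\<^esub> f y" if xy: "x \<in> carrier L" "y \<in> carrier L" for x y
  proof (rule M.le_antisym)
    note j = L.meet_closed[OF xy] and k = M.meet_closed[OF fc[OF xy(1)] fc[OF xy(2)]]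
    obtain z where z: "z \<in> carrier L" "f x \<sqinter>\<^bsub>M\<^esub> f y = f z" using fs[OF k] by blast
    have "le L z x" "le L z y"
      using M.meet_left[OF fc[OF xy(1)] fc[OF xy(2)]] M.meet_right[OF fc[OF xy(1)] fc[OF xy(2)]] z le xy by auto
    then have "le L z (x \<sqinter>\<^bsub>L\<^esub> y)" using L.meet_le xy z by simp
    then show "le M (f x \<sqinter>\<^bsub>M\<^esub> f y) (f (x \<sqinter>\<^bsub>L\<^esub> y))" using z le j by simp
    show "le M (f (x \<sqinter>\<^bsub>L\<^esub> y)) (f x \<sqinter>\<^bsub>M\<^esub> f y)"
      using M.meet_le[OF _ _ fc[OF xy(1)] fc[OF xy(2)] fc[OF j]] le L.meet_left[OF xy] L.meet_right[OF xy] xy j by blast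
    show "f (x \<sqinter>\<^bsub>L\<^esub> y) \<in> carrier M" "f x \<sqinter>\<^bsub>M\<^esub> f y \<in> carrier M" using fc j k by auto
  qed
  ultimately show ?thesis
    unfolding lattice_isomorphic_def join_pres_def meet_pres_def using f L M by blast
qed

text \<open>The natural maps lead from parameters to congruences, so the order isomorphism is given
  in the reverse direction and only the parameter side has to be known as a lattice.\<close>

lemma lattice_isomorphicI_inv:
  fixes L :: "'b gorder" and M :: "'c gorder"
  assumes g: "bij_betw g (carrier M) (carrier L)"
    and le: "\<And>x y. x \<in> carrier M \<Longrightarrow> y \<in> carrier M \<Longrightarrow> le M x y \<longleftrightarrow> le L (g x) (g y)"
    and eq: "\<And>x y. eq L x y \<longleftrightarrow> x = y" and M: "lattice M"
  shows "lattice_isomorphic L M"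
proof -
  let ?f = "the_inv_into (carrier M) g"
  have f: "bij_betw ?f (carrier L) (carrier M)" by (rule bij_betw_the_inv_into[OF g])
  have gf: "g (?f x) = x" if "x \<in> carrier L" for x
    using f_the_inv_into_f_bij_betw[OF g] that by simp
  have le': "le L x y \<longleftrightarrow> le M (?f x) (?f y)" if "x \<in> carrier L" "y \<in> carrier L" for x y
    using le[of "?f x" "?f y"] gf that f by (auto simp: bij_betw_def)
  show ?thesis by (rule lattice_isomorphicI[OF f le' lattice_transfer[OF f le' eq M] M])
qed

lemma Eq_lattice: "lattice (Eq_lattice Z)"
proof (rule latticeI)
  fix \<delta> \<epsilon> assume "\<delta> \<in> carrier (Eq_lattice Z)" "\<epsilon> \<in> carrier (Eq_lattice Z)"
  then have e: "equiv Z \<delta>" "equiv Z \<epsilon>" by (simp_all add: Eq_lattice_def incl_order_def)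
  have "equiv Z (\<delta> \<inter> \<epsilon>)"
    using e by (intro equivI) (auto simp: equiv_def refl_on_def intro: sym_Int trans_Int)
  then show "\<exists>s\<in>carrier (Eq_lattice Z). le (Eq_lattice Z) s \<delta> \<and> le (Eq_lattice Z) s \<epsilon> \<and>
      (\<forall>z\<in>carrier (Eq_lattice Z). le (Eq_lattice Z) z \<delta> \<and> le (Eq_lattice Z) z \<epsilon> \<longrightarrow> le (Eq_lattice Z) z s)"
    by (intro bexI[of _ "\<delta> \<inter> \<epsilon>"]) (auto simp: Eq_lattice_def incl_order_def)
  have sub: "\<delta> \<union> \<epsilon> \<subseteq> Z \<times> Z" using e by (auto simp: equiv_def refl_on_def)
  have "equiv Z ((\<delta> \<union> \<epsilon>)\<^sup>+)"
  proof (rule equivI)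
    show "(\<delta> \<union> \<epsilon>)\<^sup>+ \<subseteq> Z \<times> Z" by (rule trancl_subset_Sigma[OF sub])
    show "refl_on Z ((\<delta> \<union> \<epsilon>)\<^sup>+)" using e by (auto simp: equiv_def refl_on_def)
    show "sym ((\<delta> \<union> \<epsilon>)\<^sup>+)" using e by (intro sym_trancl sym_Un) (auto simp: equiv_def)
  qed simp
  moreover have "(\<delta> \<union> \<epsilon>)\<^sup>+ \<subseteq> z" if "equiv Z z" "\<delta> \<subseteq> z" "\<epsilon> \<subseteq> z" for z
  proof -
    have "(\<delta> \<union> \<epsilon>)\<^sup>+ \<subseteq> z\<^sup>+" using that by (auto intro: trancl_mono)
    also have "z\<^sup>+ = z" using that(1) by (auto simp: equiv_def trancl_id)
    finally show ?thesis .
  qed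
  ultimately show "\<exists>s\<in>carrier (Eq_lattice Z). le (Eq_lattice Z) \<delta> s \<and> le (Eq_lattice Z) \<epsilon> s \<and>
      (\<forall>z\<in>carrier (Eq_lattice Z). le (Eq_lattice Z) \<delta> z \<and> le (Eq_lattice Z) \<epsilon> z \<longrightarrow> le (Eq_lattice Z) s z)"
    by (intro bexI[of _ "(\<delta> \<union> \<epsilon>)\<^sup>+"]) (auto simp: Eq_lattice_def incl_order_def)
qed (auto simp: Eq_lattice_def incl_order_def)

lemma lattice_basic:
  assumes "lattice L" "x \<in> carrier L" "y \<in> carrier L"
  shows "le L x x" "le L x y \<Longrightarrow> le L y x \<Longrightarrow> x = y" "z \<in> carrier L \<Longrightarrow> le L x y \<Longrightarrow> le L y z \<Longrightarrow> le L x z"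
proof -
  interpret lattice L by (rule assms)
  show "le L x x" using le_refl assms by simp
  show "le L x y \<Longrightarrow> le L y x \<Longrightarrow> x = y" using le_antisym assms by simp
  show "z \<in> carrier L \<Longrightarrow> le L x y \<Longrightarrow> le L y z \<Longrightarrow> le L x z" using le_trans assms by blast
qed

lemma prod_lattice:
  fixes L :: "'b gorder" and M :: "'c gorder"
  assumes L: "lattice L" and M: "lattice M"
  shows "lattice (prod_lattice L M)"
proof (rule latticeI)
  fix x y assume "x \<in> carrier (prod_lattice L M)" "y \<in> carrier (prod_lattice L M)"
  then have xy: "fst x \<in> carrier L" "fst y \<in> carrier L" "snd x \<in> carrier M" "snd y \<in> carrier M"
    by (auto simp: prod_lattice_def)
  obtain s t where "s\<in>carrier L" "le L (fst x) s" "le L (fst y) s" "\<forall>z\<in>carrier L. le L (fst x) z \<and> le L (fst y) z \<longrightarrow> le L s z"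
     "t\<in>carrier M" "le M (snd x) t" "le M (snd y) t" "\<forall>z\<in>carrier M. le M (snd x) z \<and> le M (snd y) z \<longrightarrow> le M t z"
    using lattice_bounds(1)[OF L xy(1,2)] lattice_bounds(1)[OF M xy(3,4)] by blast
  then show "\<exists>s\<in>carrier (prod_lattice L M). le (prod_lattice L M) x s \<and> le (prod_lattice L M) y s \<and>
      (\<forall>z\<in>carrier (prod_lattice L M). le (prod_lattice L M) x z \<and> le (prod_lattice L M) y z \<longrightarrow> le (prod_lattice L M) s z)"
    by (intro bexI[of _ "(s, t)"]) (auto simp: prod_lattice_def)
  obtain s t where "s\<in>carrier L" "le L s (fst x)" "le L s (fst y)" "\<forall>z\<in>carrier L. le L z (fst x) \<and> le L z (fst y) \<longrightarrow> le L z s"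
     "t\<in>carrier M" "le M t (snd x)" "le M t (snd y)" "\<forall>z\<in>carrier M. le M z (snd x) \<and> le M z (snd y) \<longrightarrow> le M z t"
    using lattice_bounds(2)[OF L xy(1,2)] lattice_bounds(2)[OF M xy(3,4)] by blast
  then show "\<exists>s\<in>carrier (prod_lattice L M). le (prod_lattice L M) s x \<and> le (prod_lattice L M) s y \<and>
      (\<forall>z\<in>carrier (prod_lattice L M). le (prod_lattice L M) z x \<and> le (prod_lattice L M) z y \<longrightarrow> le (prod_lattice L M) z s)"
    by (intro bexI[of _ "(s, t)"]) (auto simp: prod_lattice_def)
next
  fix x y z assume "x \<in> carrier (prod_lattice L M)" "y \<in> carrier (prod_lattice L M)" "z \<in> carrier (prod_lattice L M)"
    "le (prod_lattice L M) x y" "le (prod_lattice L M) y z"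
  then show "le (prod_lattice L M) x z"
    using lattice_basic(3)[OF L, of "fst x" "fst y" "fst z"] lattice_basic(3)[OF M, of "snd x" "snd y" "snd z"]
    by (auto simp: prod_lattice_def)
next
  fix x y assume "x \<in> carrier (prod_lattice L M)" "y \<in> carrier (prod_lattice L M)"
    "le (prod_lattice L M) x y" "le (prod_lattice L M) y x"
  then show "x = y"
    using lattice_basic(2)[OF L, of "fst x" "fst y"] lattice_basic(2)[OF M, of "snd x" "snd y"]
    by (auto simp: prod_lattice_def prod_eq_iff)
next
  fix x assume "x \<in> carrier (prod_lattice L M)"
  then show "le (prod_lattice L M) x x"
    using lattice_basic(1)[OF L, of "fst x" "fst x"] lattice_basic(1)[OF M, of "snd x" "snd x"]
    by (auto simp: prod_lattice_def)
qed (simp add: prod_lattice_def)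

lemma Prod_lattice:
  fixes L :: "'i \<Rightarrow> 'b gorder"
  assumes L: "\<And>i. i \<in> J \<Longrightarrow> lattice (L i)"
  shows "lattice (Prod_lattice J L)"
proof (rule latticeI)
  fix x y assume xy: "x \<in> carrier (Prod_lattice J L)" "y \<in> carrier (Prod_lattice J L)"
  then have c: "x i \<in> carrier (L i)" "y i \<in> carrier (L i)" if "i \<in> J" for i
    using that by (auto simp: Prod_lattice_def)
  have "\<forall>i\<in>J. \<exists>s. s\<in>carrier (L i) \<and> le (L i) (x i) s \<and> le (L i) (y i) s \<and>
      (\<forall>z\<in>carrier (L i). le (L i) (x i) z \<and> le (L i) (y i) z \<longrightarrow> le (L i) s z)"
    using lattice_bounds(1)[OF L c] by blast
  then obtain s where "\<forall>i\<in>J. s i\<in>carrier (L i) \<and> le (L i) (x i) (s i) \<and> le (L i) (y i) (s i) \<and>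
      (\<forall>z\<in>carrier (L i). le (L i) (x i) z \<and> le (L i) (y i) z \<longrightarrow> le (L i) (s i) z)"
    by metis
  then show "\<exists>s\<in>carrier (Prod_lattice J L). le (Prod_lattice J L) x s \<and> le (Prod_lattice J L) y s \<and>
      (\<forall>z\<in>carrier (Prod_lattice J L). le (Prod_lattice J L) x z \<and> le (Prod_lattice J L) y z \<longrightarrow> le (Prod_lattice J L) s z)"
    by (intro bexI[of _ "restrict s J"]) (auto simp: Prod_lattice_def dest: PiE_mem)
  have "\<forall>i\<in>J. \<exists>s. s\<in>carrier (L i) \<and> le (L i) s (x i) \<and> le (L i) s (y i) \<and>
      (\<forall>z\<in>carrier (L i). le (L i) z (x i) \<and> le (L i) z (y i) \<longrightarrow> le (L i) z s)"
    using lattice_bounds(2)[OF L c] by blast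
  then obtain s where "\<forall>i\<in>J. s i\<in>carrier (L i) \<and> le (L i) (s i) (x i) \<and> le (L i) (s i) (y i) \<and>
      (\<forall>z\<in>carrier (L i). le (L i) z (x i) \<and> le (L i) z (y i) \<longrightarrow> le (L i) z (s i))"
    by metis
  then show "\<exists>s\<in>carrier (Prod_lattice J L). le (Prod_lattice J L) s x \<and> le (Prod_lattice J L) s y \<and>
      (\<forall>z\<in>carrier (Prod_lattice J L). le (Prod_lattice J L) z x \<and> le (Prod_lattice J L) z y \<longrightarrow> le (Prod_lattice J L) z s)"
    by (intro bexI[of _ "restrict s J"]) (auto simp: Prod_lattice_def dest: PiE_mem)
next
  fix x y assume xy: "x \<in> carrier (Prod_lattice J L)" "y \<in> carrier (Prod_lattice J L)"
    "le (Prod_lattice J L) x y" "le (Prod_lattice J L) y x"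
  show "x = y"
  proof (rule PiE_ext[of x J "\<lambda>i. carrier (L i)" y])
    show "x i = y i" if "i \<in> J" for i
      using that xy lattice_basic(2)[OF L[OF that], of "x i" "y i"] by (auto simp: Prod_lattice_def dest: PiE_mem)
  qed (use xy in \<open>simp_all add: Prod_lattice_def\<close>)
next
  fix x y z assume "x \<in> carrier (Prod_lattice J L)" "y \<in> carrier (Prod_lattice J L)" "z \<in> carrier (Prod_lattice J L)"
    "le (Prod_lattice J L) x y" "le (Prod_lattice J L) y z"
  then show "le (Prod_lattice J L) x z"
    using lattice_basic(3)[OF L, of i "x i" "y i" "z i" for i] by (simp add: Prod_lattice_def PiE_iff)
qed (use lattice_basic(1)[OF L] in \<open>auto simp: Prod_lattice_def PiE_mem\<close>)

lemma chain3_lattice: "lattice chain3"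
  by (rule latticeI) (auto simp: chain3_def)

section \<open>Congruences of partial rectangular bands\<close>

text \<open>The isomorphism \<open>\<phi>\<close> is left arbitrary because the description of the
  congruences is claimed for every isomorphism onto the band. Closure under products is a separate
  assumption since \<open>psg_iso\<close> does not imply that the values of \<open>prd\<close> lie
  in the carrier.\<close>

locale band_iso =
  fixes C :: "'o set" and P :: "'o \<Rightarrow> 'x set" and Q :: "'o \<Rightarrow> 'y set" and S :: "('s, 'o) psg" and \<phi> :: "'s \<Rightarrow> 'x \<times> 'y"
  assumes P: "band_data C P" and Q: "band_data C Q" and iso: "psg_iso \<phi> S (rect_band C P Q)"
    and closed: "\<And>u v. u \<in> els S \<Longrightarrow> v \<in> els S \<Longrightarrow> rng S u = src S v \<Longrightarrow> prd S u v \<in> els S"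
begin

text \<open>The band congruence given by the two families of equivalences, transported back along
  \<open>\<phi>\<close>.\<close>

definition "pull E1 E2 = {(u, v) \<in> els S \<times> els S. (\<phi> u, \<phi> v) \<in> band_sigma C P Q E1 E2}"

lemma disj: "A \<in> C \<Longrightarrow> B \<in> C \<Longrightarrow> x \<in> P A \<Longrightarrow> x \<in> P B \<Longrightarrow> A = B"
    "A \<in> C \<Longrightarrow> B \<in> C \<Longrightarrow> y \<in> Q A \<Longrightarrow> y \<in> Q B \<Longrightarrow> A = B"
  using P Q by (fastforce simp: band_data_def disjoint_family_on_def)+

lemma ne: "A \<in> C \<Longrightarrow> \<exists>x. x \<in> P A" "A \<in> C \<Longrightarrow> \<exists>y. y \<in> Q A"
  using P Q by (auto simp: band_data_def)

lemma phi:
  assumes "u \<in> els S"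
  shows "src S u \<in> C" "rng S u \<in> C" "fst (\<phi> u) \<in> P (src S u)" "snd (\<phi> u) \<in> Q (rng S u)"
proof -
  have "\<phi> u \<in> els (rect_band C P Q)" using iso assms by (auto simp: psg_iso_def bij_betw_def)
  then obtain A B where AB: "A \<in> C" "B \<in> C" "fst (\<phi> u) \<in> P A" "snd (\<phi> u) \<in> Q B" by (auto simp: rect_band_def)
  have "src (rect_band C P Q) (\<phi> u) = A" "rng (rect_band C P Q) (\<phi> u) = B"
    using AB disj by (auto simp: rect_band_def intro!: the_equality)
  then have "src S u = A" "rng S u = B" using iso assms by (auto simp: psg_iso_def)
  then show "src S u \<in> C" "rng S u \<in> C" "fst (\<phi> u) \<in> P (src S u)" "snd (\<phi> u) \<in> Q (rng S u)" using AB by auto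
qed

lemma phi_prd: "u \<in> els S \<Longrightarrow> v \<in> els S \<Longrightarrow> rng S u = src S v \<Longrightarrow> \<phi> (prd S u v) = (fst (\<phi> u), snd (\<phi> v))"
  using iso by (auto simp: psg_iso_def rect_band_def)

lemma phi_inj: "u \<in> els S \<Longrightarrow> v \<in> els S \<Longrightarrow> \<phi> u = \<phi> v \<Longrightarrow> u = v"
  using iso by (auto simp: psg_iso_def bij_betw_def dest: inj_onD)

lemma psi:
  assumes "A \<in> C" "B \<in> C" "x \<in> P A" "y \<in> Q B"
  obtains u where "u \<in> els S" "\<phi> u = (x, y)" "src S u = A" "rng S u = B"
proof -
  have "(x, y) \<in> els (rect_band C P Q)" using assms by (auto simp: rect_band_def)
  then obtain u where u: "u \<in> els S" "\<phi> u = (x, y)" using iso unfolding psg_iso_def bij_betw_def by (metis imageE)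
  then show ?thesis using that phi[OF u(1)] disj assms by (metis fst_conv snd_conv)
qed

text \<open>Disjointness of the families forces the objects quantified in \<open>band_sigma\<close>
  to be the common source and the common range, so both quantifiers disappear.\<close>

lemma mem_pull:
  assumes E: "\<forall>A\<in>C. equiv (P A) (E1 A)" "\<forall>A\<in>C. equiv (Q A) (E2 A)"
  shows "(u, v) \<in> pull E1 E2 \<longleftrightarrow> u \<in> els S \<and> v \<in> els S \<and> psg_sim S u v \<and>
    (fst (\<phi> u), fst (\<phi> v)) \<in> E1 (src S u) \<and> (snd (\<phi> u), snd (\<phi> v)) \<in> E2 (rng S u)"
proof
  assume "(u, v) \<in> pull E1 E2"
  then have uv: "u \<in> els S" "v \<in> els S" and b: "(\<phi> u, \<phi> v) \<in> band_sigma C P Q E1 E2" by (auto simp: pull_def)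
  obtain A B where AB: "A \<in> C" "B \<in> C" "fst (\<phi> u) \<in> P A" "fst (\<phi> v) \<in> P A" "snd (\<phi> u) \<in> Q B" "snd (\<phi> v) \<in> Q B"
    "(fst (\<phi> u), fst (\<phi> v)) \<in> E1 A" "(snd (\<phi> u), snd (\<phi> v)) \<in> E2 B"
    using b unfolding band_sigma_def by auto
  have "src S u = A" "src S v = A" "rng S u = B" "rng S v = B"
    using AB phi[OF uv(1)] phi[OF uv(2)] disj by metis+
  then show "u \<in> els S \<and> v \<in> els S \<and> psg_sim S u v \<and>
    (fst (\<phi> u), fst (\<phi> v)) \<in> E1 (src S u) \<and> (snd (\<phi> u), snd (\<phi> v)) \<in> E2 (rng S u)"
    using uv AB by (simp add: psg_sim_def)
next
  assume *: "u \<in> els S \<and> v \<in> els S \<and> psg_sim S u v \<and>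
    (fst (\<phi> u), fst (\<phi> v)) \<in> E1 (src S u) \<and> (snd (\<phi> u), snd (\<phi> v)) \<in> E2 (rng S u)"
  then have "((fst (\<phi> u), snd (\<phi> u)), (fst (\<phi> v), snd (\<phi> v))) \<in> band_sigma C P Q E1 E2"
    unfolding band_sigma_def using phi[of u] phi[of v] by (fastforce simp: psg_sim_def)
  then show "(u, v) \<in> pull E1 E2" using * by (simp add: pull_def)
qed

lemma pull_Cong:
  assumes E: "\<forall>A\<in>C. equiv (P A) (E1 A)" "\<forall>A\<in>C. equiv (Q A) (E2 A)"
  shows "pull E1 E2 \<in> Cong S"
proof -
  note m = mem_pull[OF E]
  have r: "(x, x) \<in> E1 A" if "A \<in> C" "x \<in> P A" for x A using E that by (auto simp: equiv_def refl_on_def)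
  have r': "(y, y) \<in> E2 A" if "A \<in> C" "y \<in> Q A" for y A using E that by (auto simp: equiv_def refl_on_def)
  have sy: "(x', x) \<in> E1 A" if "A \<in> C" "(x, x') \<in> E1 A" for x x' A using E that by (meson equiv_def symD)
  have sy': "(x', x) \<in> E2 A" if "A \<in> C" "(x, x') \<in> E2 A" for x x' A using E that by (meson equiv_def symD)
  have t: "(x, x'') \<in> E1 A" if "A \<in> C" "(x, x') \<in> E1 A" "(x', x'') \<in> E1 A" for x x' x'' A using E that by (meson equiv_def transD)
  have t': "(x, x'') \<in> E2 A" if "A \<in> C" "(x, x') \<in> E2 A" "(x', x'') \<in> E2 A" for x x' x'' A using E that by (meson equiv_def transD)
  have "equiv (els S) (pull E1 E2)"
  proof (rule equivI)
    show "pull E1 E2 \<subseteq> els S \<times> els S" by (auto simp: pull_def)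
    show "refl_on (els S) (pull E1 E2)"
      by (rule refl_onI) (use m phi r r' in \<open>auto simp: psg_sim_def\<close>)
    show "sym (pull E1 E2)"
      by (rule symI) (use m phi sy sy' in \<open>auto simp: psg_sim_def\<close>)
    show "trans (pull E1 E2)"
    proof (rule transI)
      fix u v w assume "(u, v) \<in> pull E1 E2" "(v, w) \<in> pull E1 E2"
      then show "(u, w) \<in> pull E1 E2" unfolding m psg_sim_def using phi[of u] t t' by metis
    qed
  qed
  moreover have "psg_sim S u v" if "(u, v) \<in> pull E1 E2" for u v using that m by blast
  moreover have "(rng S u = src S w \<longrightarrow> (prd S u w, prd S v w) \<in> pull E1 E2) \<and>
        (rng S w = src S u \<longrightarrow> (prd S w u, prd S w v) \<in> pull E1 E2)"
    if uv: "(u, v) \<in> pull E1 E2" and w: "w \<in> els S" for u v w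
  proof -
    have *: "u \<in> els S" "v \<in> els S" "src S u = src S v" "rng S u = rng S v"
      "(fst (\<phi> u), fst (\<phi> v)) \<in> E1 (src S u)" "(snd (\<phi> u), snd (\<phi> v)) \<in> E2 (rng S u)"
      using uv unfolding m psg_sim_def by blast+
    have sr: "src S (prd S a b) = src S a \<and> rng S (prd S a b) = rng S b"
      if "a \<in> els S" "b \<in> els S" "rng S a = src S b" for a b
      using phi[OF closed[OF that]] phi_prd[OF that] phi[OF that(1)] phi[OF that(2)] disj by (metis fst_conv snd_conv)
    show ?thesis
      unfolding m psg_sim_def using * w closed sr phi_prd phi[OF w] r r' by simp
  qed
  ultimately show ?thesis unfolding Cong_def congruence_def by blast
qed

text \<open>Multiplication on the right overwrites the second coordinate and keeps the first, so a
  related pair stays related when its second coordinates are replaced by any common value. The dual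
  holds on the left, and the congruence splits into one relation per coordinate.\<close>

lemma Cong_pull:
  assumes "\<sigma> \<in> Cong S"
  obtains E1 E2 where "\<forall>A\<in>C. equiv (P A) (E1 A)" "\<forall>A\<in>C. equiv (Q A) (E2 A)" "\<sigma> = pull E1 E2"
proof -
  have eq: "equiv (els S) \<sigma>" and sim: "\<And>u v. (u, v) \<in> \<sigma> \<Longrightarrow> psg_sim S u v"
    and right: "\<And>u v w. (u, v) \<in> \<sigma> \<Longrightarrow> w \<in> els S \<Longrightarrow> rng S u = src S w \<Longrightarrow> (prd S u w, prd S v w) \<in> \<sigma>"
    and left: "\<And>u v w. (u, v) \<in> \<sigma> \<Longrightarrow> w \<in> els S \<Longrightarrow> rng S w = src S u \<Longrightarrow> (prd S w u, prd S w v) \<in> \<sigma>"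
    using assms unfolding Cong_def congruence_def by blast+
  have refl: "u \<in> els S \<Longrightarrow> (u, u) \<in> \<sigma>" and sym: "(u, v) \<in> \<sigma> \<Longrightarrow> (v, u) \<in> \<sigma>"
    and trans: "(u, v) \<in> \<sigma> \<Longrightarrow> (v, w) \<in> \<sigma> \<Longrightarrow> (u, w) \<in> \<sigma>" and mem: "(u, v) \<in> \<sigma> \<Longrightarrow> u \<in> els S \<and> v \<in> els S" for u v w
    using eq by (auto simp: equiv_def refl_on_def dest: symD transD)
  \<comment> \<open>Quantifying over all common second coordinates, of whatever range, makes this
    relation depend on the source alone; that a single related pair already yields all instances is
    shown by multiplication further down.\<close>
  define E1 where "E1 A = {(x, x') \<in> P A \<times> P A. \<forall>u\<in>els S. \<forall>v\<in>els S.
    fst (\<phi> u) = x \<and> fst (\<phi> v) = x' \<and> snd (\<phi> u) = snd (\<phi> v) \<longrightarrow> (u, v) \<in> \<sigma>}" for A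
  define E2 where "E2 A = {(y, y') \<in> Q A \<times> Q A. \<forall>u\<in>els S. \<forall>v\<in>els S.
    snd (\<phi> u) = y \<and> snd (\<phi> v) = y' \<and> fst (\<phi> u) = fst (\<phi> v) \<longrightarrow> (u, v) \<in> \<sigma>}" for A
  have e1: "equiv (P A) (E1 A)" if A: "A \<in> C" for A
  proof (rule equivI)
    show "E1 A \<subseteq> P A \<times> P A" by (auto simp: E1_def)
    show "refl_on (P A) (E1 A)"
    proof (rule refl_onI)
      fix x assume "x \<in> P A"
      moreover have "(u, v) \<in> \<sigma>" if "u \<in> els S" "v \<in> els S" "fst (\<phi> u) = fst (\<phi> v)" "snd (\<phi> u) = snd (\<phi> v)" for u v
        using phi_inj[OF that(1,2) prod_eqI[OF that(3,4)]] refl that by simp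
      ultimately show "(x, x) \<in> E1 A" by (simp add: E1_def)
    qed
    show "sym (E1 A)" by (rule symI) (use sym in \<open>auto simp: E1_def\<close>)
    show "trans (E1 A)"
    proof (rule transI)
      fix x x' x'' assume *: "(x, x') \<in> E1 A" "(x', x'') \<in> E1 A"
      have "(u, v) \<in> \<sigma>" if uv: "u \<in> els S" "v \<in> els S" "fst (\<phi> u) = x" "fst (\<phi> v) = x''" "snd (\<phi> u) = snd (\<phi> v)" for u v
      proof -
        have "x' \<in> P A" using * by (auto simp: E1_def)
        then obtain w where "w \<in> els S" "\<phi> w = (x', snd (\<phi> u))" using psi[OF A phi(2)[OF uv(1)] _ phi(4)[OF uv(1)]] by metis
        then show ?thesis using * uv trans[of u w v] by (auto simp: E1_def)
      qed
      then show "(x, x'') \<in> E1 A" using * by (auto simp: E1_def)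
    qed
  qed
  have e2: "equiv (Q A) (E2 A)" if A: "A \<in> C" for A
  proof (rule equivI)
    show "E2 A \<subseteq> Q A \<times> Q A" by (auto simp: E2_def)
    show "refl_on (Q A) (E2 A)"
    proof (rule refl_onI)
      fix y assume "y \<in> Q A"
      moreover have "(u, v) \<in> \<sigma>" if "u \<in> els S" "v \<in> els S" "fst (\<phi> u) = fst (\<phi> v)" "snd (\<phi> u) = snd (\<phi> v)" for u v
        using phi_inj[OF that(1,2) prod_eqI[OF that(3,4)]] refl that by simp
      ultimately show "(y, y) \<in> E2 A" by (simp add: E2_def)
    qed
    show "sym (E2 A)" by (rule symI) (use sym in \<open>auto simp: E2_def\<close>)
    show "trans (E2 A)"
    proof (rule transI)
      fix x x' x'' assume *: "(x, x') \<in> E2 A" "(x', x'') \<in> E2 A"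
      have "(u, v) \<in> \<sigma>" if uv: "u \<in> els S" "v \<in> els S" "snd (\<phi> u) = x" "snd (\<phi> v) = x''" "fst (\<phi> u) = fst (\<phi> v)" for u v
      proof -
        have "x' \<in> Q A" using * by (auto simp: E2_def)
        then obtain w where "w \<in> els S" "\<phi> w = (fst (\<phi> u), x')" using psi[OF phi(1)[OF uv(1)] A phi(3)[OF uv(1)]] by metis
        then show ?thesis using * uv trans[of u w v] by (auto simp: E2_def)
      qed
      then show "(x, x'') \<in> E2 A" using * by (auto simp: E2_def)
    qed
  qed
  have E: "\<forall>A\<in>C. equiv (P A) (E1 A)" "\<forall>A\<in>C. equiv (Q A) (E2 A)" using e1 e2 by blast+
  note m = mem_pull[OF E]
  have "\<sigma> = pull E1 E2"
  proof (intro equalityI subrelI)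
    fix u v assume uv: "(u, v) \<in> \<sigma>"
    then have us: "u \<in> els S" "v \<in> els S" using mem by auto
    have s: "src S u = src S v" "rng S u = rng S v" using sim[OF uv] by (auto simp: psg_sim_def)
    have "(u', v') \<in> \<sigma>" if *: "u' \<in> els S" "v' \<in> els S" "fst (\<phi> u') = fst (\<phi> u)" "fst (\<phi> v') = fst (\<phi> v)" "snd (\<phi> u') = snd (\<phi> v')" for u' v'
    proof -
      obtain x where x: "x \<in> P (rng S u)" using ne phi[OF us(1)] by blast
      obtain w where w: "w \<in> els S" "\<phi> w = (x, snd (\<phi> u'))" "src S w = rng S u"
        using psi[OF phi(2)[OF us(1)] phi(2)[OF *(1)] x phi(4)[OF *(1)]] by metis
      have "prd S u w = u'" "prd S v w = v'"
        using w s us * phi_prd[OF us(1) w(1)] phi_prd[OF us(2) w(1)]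
        by (auto intro!: phi_inj closed simp: prod_eq_iff)
      then show ?thesis using right[OF uv w(1)] w(3) by simp
    qed
    then have "(fst (\<phi> u), fst (\<phi> v)) \<in> E1 (src S u)" using phi[OF us(1)] phi[OF us(2)] s by (auto simp: E1_def)
    moreover have "(u', v') \<in> \<sigma>" if *: "u' \<in> els S" "v' \<in> els S" "snd (\<phi> u') = snd (\<phi> u)" "snd (\<phi> v') = snd (\<phi> v)" "fst (\<phi> u') = fst (\<phi> v')" for u' v'
    proof -
      obtain y where y: "y \<in> Q (src S u)" using ne phi[OF us(1)] by blast
      obtain w where w: "w \<in> els S" "\<phi> w = (fst (\<phi> u'), y)" "rng S w = src S u"
        using psi[OF phi(1)[OF *(1)] phi(1)[OF us(1)] phi(3)[OF *(1)] y] by metis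
      have "prd S w u = u'" "prd S w v = v'"
        using w s us * phi_prd[OF w(1) us(1)] phi_prd[OF w(1) us(2)]
        by (auto intro!: phi_inj closed simp: prod_eq_iff)
      then show ?thesis using left[OF uv w(1)] w(3) by simp
    qed
    then have "(snd (\<phi> u), snd (\<phi> v)) \<in> E2 (rng S u)" using phi[OF us(1)] phi[OF us(2)] s by (auto simp: E2_def)
    ultimately show "(u, v) \<in> pull E1 E2" unfolding m using us s by (simp add: psg_sim_def)
  next
    fix u v assume "(u, v) \<in> pull E1 E2"
    then have *: "u \<in> els S" "v \<in> els S" "src S u = src S v" "rng S u = rng S v"
      "(fst (\<phi> u), fst (\<phi> v)) \<in> E1 (src S u)" "(snd (\<phi> u), snd (\<phi> v)) \<in> E2 (rng S u)"
      unfolding m psg_sim_def by blast+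
    \<comment> \<open>The coordinates are changed one at a time, through the element with the first
      coordinate of v and the second of u.\<close>
    have "fst (\<phi> v) \<in> P (src S u)" using phi(3)[OF *(2)] *(3) by simp
    then obtain w where w: "w \<in> els S" "\<phi> w = (fst (\<phi> v), snd (\<phi> u))"
      using psi[OF phi(1)[OF *(1)] phi(2)[OF *(1)] _ phi(4)[OF *(1)]] by metis
    have "(u, w) \<in> \<sigma>" using *(1,5) w by (auto simp: E1_def)
    moreover have "(w, v) \<in> \<sigma>" using *(2,6) w by (auto simp: E2_def)
    ultimately show "(u, v) \<in> \<sigma>" by (rule trans)
  qed
  then show ?thesis using that[of E1 E2] e1 e2 by blast
qed

lemma Cong_eq: "Cong S = {pull E1 E2 | E1 E2. (\<forall>A\<in>C. equiv (P A) (E1 A)) \<and> (\<forall>A\<in>C. equiv (Q A) (E2 A))}"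
  using pull_Cong Cong_pull by (intro equalityI subsetI) (blast, blast)

lemma pull_subset:
  assumes E: "\<forall>A\<in>C. equiv (P A) (E1 A)" "\<forall>A\<in>C. equiv (Q A) (E2 A)"
    and F: "\<forall>A\<in>C. equiv (P A) (F1 A)" "\<forall>A\<in>C. equiv (Q A) (F2 A)"
  shows "pull E1 E2 \<subseteq> pull F1 F2 \<longleftrightarrow> (\<forall>A\<in>C. E1 A \<subseteq> F1 A) \<and> (\<forall>A\<in>C. E2 A \<subseteq> F2 A)"
proof
  note m = mem_pull[OF E] and n = mem_pull[OF F]
  assume sub: "pull E1 E2 \<subseteq> pull F1 F2"
  show "(\<forall>A\<in>C. E1 A \<subseteq> F1 A) \<and> (\<forall>A\<in>C. E2 A \<subseteq> F2 A)"
  proof (intro conjI ballI subrelI)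
    fix A x x' assume A: "A \<in> C" and x: "(x, x') \<in> E1 A"
    obtain y where y: "y \<in> Q A" using ne A by blast
    have xP: "x \<in> P A" "x' \<in> P A" using E A x by (auto simp: equiv_def refl_on_def)
    obtain u where u: "u \<in> els S" "\<phi> u = (x, y)" "src S u = A" "rng S u = A" by (rule psi[OF A A xP(1) y])
    obtain v where v: "v \<in> els S" "\<phi> v = (x', y)" "src S v = A" "rng S v = A" by (rule psi[OF A A xP(2) y])
    have "(y, y) \<in> E2 A" using E A y by (auto simp: equiv_def refl_on_def)
    then have "(u, v) \<in> pull E1 E2" unfolding m psg_sim_def using u v x by simp
    then show "(x, x') \<in> F1 A" using sub n[of u v] u v by auto
  next
    fix A y y' assume A: "A \<in> C" and y: "(y, y') \<in> E2 A"
    obtain x where x: "x \<in> P A" using ne A by blast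
    have yQ: "y \<in> Q A" "y' \<in> Q A" using E A y by (auto simp: equiv_def refl_on_def)
    obtain u where u: "u \<in> els S" "\<phi> u = (x, y)" "src S u = A" "rng S u = A" by (rule psi[OF A A x yQ(1)])
    obtain v where v: "v \<in> els S" "\<phi> v = (x, y')" "src S v = A" "rng S v = A" by (rule psi[OF A A x yQ(2)])
    have "(x, x) \<in> E1 A" using E A x by (auto simp: equiv_def refl_on_def)
    then have "(u, v) \<in> pull E1 E2" unfolding m psg_sim_def using u v y by simp
    then show "(y, y') \<in> F2 A" using sub n[of u v] u v by auto
  qed
next
  assume "(\<forall>A\<in>C. E1 A \<subseteq> F1 A) \<and> (\<forall>A\<in>C. E2 A \<subseteq> F2 A)"
  then show "pull E1 E2 \<subseteq> pull F1 F2"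
    using mem_pull[OF E] mem_pull[OF F] phi by (intro subrelI) blast
qed

lemma Cong_lattice_iso:
  "lattice_isomorphic (Cong_lattice S)
    (prod_lattice (Prod_lattice C (\<lambda>A. Eq_lattice (P A))) (Prod_lattice C (\<lambda>A. Eq_lattice (Q A))))"
  (is "lattice_isomorphic ?L ?M")
proof (rule lattice_isomorphicI_inv[of "\<lambda>E. pull (fst E) (snd E)"])
  have car: "(E1, E2) \<in> carrier ?M \<longleftrightarrow> E1 \<in> extensional C \<and> E2 \<in> extensional C \<and>
      (\<forall>A\<in>C. equiv (P A) (E1 A)) \<and> (\<forall>A\<in>C. equiv (Q A) (E2 A))" for E1 E2
    by (auto simp: prod_lattice_def Prod_lattice_def Eq_lattice_def incl_order_def PiE_def Pi_def)
  have le: "le ?M E F \<longleftrightarrow> (\<forall>A\<in>C. fst E A \<subseteq> fst F A) \<and> (\<forall>A\<in>C. snd E A \<subseteq> snd F A)" for E F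
    by (simp add: prod_lattice_def Prod_lattice_def Eq_lattice_def incl_order_def)
  have leL: "le ?L \<sigma> \<tau> \<longleftrightarrow> \<sigma> \<subseteq> \<tau>" for \<sigma> \<tau> by (simp add: Cong_lattice_def incl_order_def)
  have cL: "carrier ?L = Cong S" by (simp add: Cong_lattice_def incl_order_def)
  show emb: "le ?M E F \<longleftrightarrow> le ?L (pull (fst E) (snd E)) (pull (fst F) (snd F))"
    if "E \<in> carrier ?M" "F \<in> carrier ?M" for E F
    using that pull_subset[of "fst E" "snd E" "fst F" "snd F"] car[of "fst E" "snd E"] car[of "fst F" "snd F"]
    unfolding le leL by simp
  show "eq ?L x y \<longleftrightarrow> x = y" for x y by (simp add: Cong_lattice_def incl_order_def)
  show M: "lattice ?M" by (intro prod_lattice Prod_lattice Eq_lattice)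
  show "bij_betw (\<lambda>E. pull (fst E) (snd E)) (carrier ?M) (carrier ?L)"
    unfolding bij_betw_def cL
  proof
    show "inj_on (\<lambda>E. pull (fst E) (snd E)) (carrier ?M)"
    proof (rule inj_onI)
      fix E F assume EF: "E \<in> carrier ?M" "F \<in> carrier ?M" "pull (fst E) (snd E) = pull (fst F) (snd F)"
      then have "le ?M E F" "le ?M F E" using emb unfolding leL by simp_all
      then show "E = F" using lattice_basic(2)[OF M EF(1,2)] by simp
    qed
    show "(\<lambda>E. pull (fst E) (snd E)) ` carrier ?M = Cong S"
    proof (intro equalityI subsetI)
      fix \<sigma> assume "\<sigma> \<in> (\<lambda>E. pull (fst E) (snd E)) ` carrier ?M"
      then obtain E where "E \<in> carrier ?M" "\<sigma> = pull (fst E) (snd E)" by blast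
      then show "\<sigma> \<in> Cong S" using pull_Cong car[of "fst E" "snd E"] by simp
    next
      fix \<sigma> assume "\<sigma> \<in> Cong S"
      then obtain E1 E2 where E: "\<forall>A\<in>C. equiv (P A) (E1 A)" "\<forall>A\<in>C. equiv (Q A) (E2 A)" "\<sigma> = pull E1 E2"
        by (rule Cong_pull)
      \<comment> \<open>The product lattice consists of extensional families; values outside C do
        not influence \<open>pull\<close>.\<close>
      let ?F1 = "restrict E1 C" and ?F2 = "restrict E2 C"
      have F: "\<forall>A\<in>C. equiv (P A) (?F1 A)" "\<forall>A\<in>C. equiv (Q A) (?F2 A)" using E by simp_all
      have "\<sigma> = pull ?F1 ?F2"
        unfolding E(3) by (rule equalityI) (simp_all only: pull_subset[OF E(1,2) F] pull_subset[OF F E(1,2)], simp_all)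
      moreover have "(?F1, ?F2) \<in> carrier ?M" using car F by simp
      ultimately show "\<sigma> \<in> (\<lambda>E. pull (fst E) (snd E)) ` carrier ?M" by (intro image_eqI[of _ _ "(?F1, ?F2)"]) simp_all
    qed
  qed
qed

end

section \<open>Partitions into pairs (perfect matchings)\<close>

definition matching :: "'b set \<Rightarrow> 'b set set set" where
  "matching V = {M. partition_on V M \<and> (\<forall>b\<in>M. card b = 2)}"

lemma Brauer_matching: "Brauer A B = matching (A <+> B)"
  by (simp add: Brauer_def matching_def)

lemma matchingE:
  assumes "M \<in> matching V" "b \<in> M"
  obtains u v where "b = {u, v}" "u \<noteq> v" "u \<in> V" "v \<in> V"
proof -
  have "card b = 2" "b \<subseteq> V" using assms by (auto simp: matching_def partition_on_def)
  then obtain u v where "b = {u, v}" "u \<noteq> v" by (auto simp: card_2_iff)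
  then show ?thesis using that \<open>b \<subseteq> V\<close> by auto
qed

lemma matching_linkD:
  assumes "M \<in> matching V" "{u, v} \<in> M"
  shows "u \<noteq> v" "u \<in> V" "v \<in> V"
  using matchingE[OF assms] by (auto simp: doubleton_eq_iff)

lemma matching_unique:
  assumes "M \<in> matching V" "{u, v} \<in> M" "{u, w} \<in> M"
  shows "v = w"
proof -
  have "disjoint M" using assms by (auto simp: matching_def partition_on_def)
  then have "{u, v} = {u, w}" using assms(2,3) disjointD[of M "{u, v}" "{u, w}"] by auto
  then show ?thesis by (auto simp: doubleton_eq_iff)
qed

lemma doubleton_other: "u \<in> {p, q} \<Longrightarrow> \<exists>v. {p, q} = {u, v}"
  by auto

lemma matching_ex:
  assumes "M \<in> matching V" "u \<in> V"
  obtains v where "{u, v} \<in> M" "v \<in> V" "u \<noteq> v"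
proof -
  obtain b where b: "b \<in> M" "u \<in> b" using assms by (auto simp: matching_def partition_on_def)
  obtain p q where "b = {p, q}" "p \<noteq> q" "p \<in> V" "q \<in> V" using matchingE[OF assms(1) b(1)] .
  moreover obtain v where "{p, q} = {u, v}" using doubleton_other b(2) calculation(1) by metis
  ultimately show ?thesis using b that[of v] by (auto simp: doubleton_eq_iff)
qed

lemma matching_Union: "M \<in> matching V \<Longrightarrow> \<Union>M = V"
  by (auto simp: matching_def partition_on_def)

text \<open>Every point already has its partner in the smaller matching. Most later equalities of
  hook sets are therefore obtained from a single inclusion.\<close>

lemma matching_subset_eq:
  assumes "M \<in> matching V" "N \<in> matching V" "M \<subseteq> N"
  shows "M = N"
proof
  show "N \<subseteq> M"
  proof
    fix b assume b: "b \<in> N"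
    obtain u v where uv: "b = {u, v}" "u \<in> V" using matchingE[OF assms(2) b] by metis
    obtain w where "{u, w} \<in> M" using matching_ex[OF assms(1) uv(2)] by metis
    then show "b \<in> M" using matching_unique[OF assms(2), of u v w] assms(3) b uv by auto
  qed
qed fact

lemma matching_eqI:
  assumes "M \<in> matching V" "N \<in> matching V" "\<And>u v. {u, v} \<in> M \<Longrightarrow> {u, v} \<in> N"
  shows "M = N"
  by (rule matching_subset_eq[OF assms(1,2)]) (metis assms(1,3) matchingE subsetI)

lemma matchingI:
  assumes "\<And>b. b \<in> M \<Longrightarrow> \<exists>u v. b = {u, v} \<and> u \<noteq> v \<and> u \<in> V \<and> v \<in> V"
    and "\<And>u. u \<in> V \<Longrightarrow> \<exists>v. {u, v} \<in> M"
    and "\<And>u v w. {u, v} \<in> M \<Longrightarrow> {u, w} \<in> M \<Longrightarrow> v = w"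
  shows "M \<in> matching V"
proof -
  have "\<Union>M = V" using assms(1,2) by blast
  moreover have "disjoint M"
  proof (rule disjointI)
    fix a b assume ab: "a \<in> M" "b \<in> M" "a \<noteq> b"
    show "a \<inter> b = {}"
    proof (rule ccontr)
      assume "a \<inter> b \<noteq> {}"
      then obtain u where u: "u \<in> a" "u \<in> b" by auto
      obtain v where "a = {u, v}" using assms(1)[OF ab(1)] u doubleton_other[of u] by metis
      moreover obtain w where "b = {u, w}" using assms(1)[OF ab(2)] u doubleton_other[of u] by metis
      ultimately show False using assms(3) ab by metis
    qed
  qed
  moreover have "card b = 2" if "b \<in> M" for b
    using assms(1)[OF that] by auto
  moreover have "{} \<notin> M" using assms(1) by blast
  ultimately show ?thesis by (simp add: matching_def partition_on_def)
qed

lemma matching_image: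
  assumes "M \<in> matching V" "inj_on f V"
  shows "image f ` M \<in> matching (f ` V)"
proof (rule matchingI)
  fix b assume "b \<in> image f ` M"
  then obtain b' where b': "b' \<in> M" "b = f ` b'" by auto
  obtain u v where "b' = {u, v}" "u \<noteq> v" "u \<in> V" "v \<in> V" using matchingE[OF assms(1) b'(1)] .
  then show "\<exists>u v. b = {u, v} \<and> u \<noteq> v \<and> u \<in> f ` V \<and> v \<in> f ` V"
    using b'(2) assms(2) by (intro exI[of _ "f u"] exI[of _ "f v"]) (auto simp: inj_on_eq_iff)
next
  fix u assume "u \<in> f ` V"
  then obtain u' where u': "u' \<in> V" "u = f u'" by auto
  obtain v where "{u', v} \<in> M" using matching_ex[OF assms(1) u'(1)] .
  then have "f ` {u', v} \<in> image f ` M" by blast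
  then show "\<exists>v. {u, v} \<in> image f ` M" using u' by auto
next
  have *: "\<exists>u' v'. {u', v'} \<in> M \<and> f u' = u \<and> f v' = v \<and> u' \<in> V \<and> v' \<in> V"
    if *: "{u, v} \<in> image f ` M" for u v
  proof -
    obtain b' where b': "b' \<in> M" "{u, v} = f ` b'" using * by (rule imageE)
    obtain p q where "b' = {p, q}" "p \<noteq> q" "p \<in> V" "q \<in> V" using matchingE[OF assms(1) b'(1)] .
    then consider "u = f p" "v = f q" | "u = f q" "v = f p" using b' by (auto simp: doubleton_eq_iff)
    then show ?thesis
    proof cases
      case 1 then show ?thesis using \<open>b' = {p, q}\<close> b'(1) \<open>p \<in> V\<close> \<open>q \<in> V\<close> by blast
    next
      case 2
      moreover have "{q, p} \<in> M" using \<open>b' = {p, q}\<close> b'(1) by (simp add: insert_commute)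
      ultimately show ?thesis using \<open>p \<in> V\<close> \<open>q \<in> V\<close> by blast
    qed
  qed
  fix u v w assume "{u, v} \<in> image f ` M" "{u, w} \<in> image f ` M"
  then show "v = w" using *[of u v] *[of u w] matching_unique[OF assms(1)] assms(2)
    by (metis inj_onD)
qed

lemma mem_rel_of_part_matching:
  assumes "M \<in> matching V"
  shows "(u, v) \<in> rel_of_part M \<longleftrightarrow> (u = v \<and> u \<in> V) \<or> {u, v} \<in> M"
proof -
  have "(u = v \<and> u \<in> V) \<or> {u, v} \<in> M" if b: "b \<in> M" "u \<in> b" "v \<in> b" for b
  proof -
    obtain w where "b = {u, w}" using matchingE[OF assms b(1)] b(2) doubleton_other[of u] by metis
    then show ?thesis using b matching_linkD[OF assms] by auto
  qed
  then have *: "(u, v) \<in> rel_of_part M \<Longrightarrow> (u = v \<and> u \<in> V) \<or> {u, v} \<in> M"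
    by (auto simp: rel_of_part_def)
  have "(u, u) \<in> rel_of_part M" if "u \<in> V"
    using that matching_Union[OF assms] by (auto simp: rel_of_part_def)
  moreover have "(u, v) \<in> rel_of_part M" if "{u, v} \<in> M"
    using that by (auto simp: rel_of_part_def)
  ultimately show ?thesis using * by blast
qed

section \<open>Products of pair partitions\<close>

text \<open>A class of the join of two matchings is an orbit of the dihedral group generated by the two
  partner involutions, extended by fixed points; on the orbit of a fixed point \<open>x\<close> the rotation
  \<open>c = t \<circ> s\<close> has some order \<open>k\<close>, and \<open>c\<^sup>n x\<close> is fixed by \<open>s\<close> iff \<open>k dvd 2n\<close>, by \<open>t\<close> iff
  \<open>k dvd 2n - 1\<close>.\<close>

lemma dihedral_orbit_endpoints:
  fixes s t :: "'b \<Rightarrow> 'b"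
  assumes V: "finite V" "s permutes V" "t permutes V"
    and s: "\<And>u. s (s u) = u" and t: "\<And>u. t (t u) = u"
    and fix_disj: "\<And>u. u \<in> V \<Longrightarrow> \<not> (s u = u \<and> t u = u)"
    and x: "x \<in> V" "s x = x"
  defines "J \<equiv> {(u, v). v = s u \<or> v = t u}\<^sup>*"
  shows "\<exists>!y. y \<noteq> x \<and> (s y = y \<or> t y = y) \<and> (x, y) \<in> J"
proof -
  define c where "c = t \<circ> s"
  have c: "c permutes V" unfolding c_def by (rule permutes_compose[OF V(2,3)])
  then have perm: "permutation c" using V(1) by (auto simp: permutation_permutes)
  have inj: "inj (c ^^ n)" for n
    using permutes_inj[OF c] by (simp add: inj_fn)
  \<comment> \<open>Two exponents are at work: K annihilates the whole permutation and serves to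
    write inverses as natural powers, whereas k is the length of the rotation orbit of x.\<close>
  obtain K where K: "c ^^ K = id" "K > 0" using permutation_is_nilpotent[OF perm] by auto
  define k where "k = least_power c x"
  have k: "(c ^^ k) x = x" "k > 0"
    using least_power_of_permutation[OF perm] by (auto simp: k_def)
  have dvd: "(c ^^ n) x = x \<longleftrightarrow> k dvd n" for n
  proof
    show "(c ^^ n) x = x \<Longrightarrow> k dvd n" unfolding k_def by (rule least_power_minimal)
    assume "k dvd n"
    then obtain j where n: "n = j * k" by (metis dvdE mult.commute)
    have "(c ^^ (j * k)) x = x" for j
      by (induction j) (auto simp: funpow_add k)
    then show "(c ^^ n) x = x" using n by simp
  qed
  \<comment> \<open>The dihedral relation: the reflection s inverts the rotation, stated without
    inverses.\<close>
  have csc: "c (s (c y)) = s y" for y by (simp add: c_def s t)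
  have cns: "(c ^^ n) (s ((c ^^ n) y)) = s y" for n y
  proof (induction n arbitrary: y)
    case (Suc n)
    have "(c ^^ Suc n) (s ((c ^^ Suc n) y)) = c ((c ^^ n) (s ((c ^^ n) (c y))))"
      by (simp add: funpow_swap1)
    then show ?case using Suc csc by simp
  qed simp
  have KK: "(c ^^ (n * K)) y = y" for n y
    by (induction n) (auto simp: funpow_add K)
  have sc: "s ((c ^^ n) x) = (c ^^ (n * K - n)) x" for n
  proof -
    have "(c ^^ (n * K - n)) ((c ^^ n) (s ((c ^^ n) x))) = (c ^^ (n * K - n)) x"
      by (simp add: cns x)
    moreover have "(c ^^ (n * K - n)) ((c ^^ n) z) = z" for z
    proof -
      have "(c ^^ (n * K - n + n)) z = z" using K(2) KK by simp
      then show ?thesis by (simp add: funpow_add)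
    qed
    ultimately show ?thesis by simp
  qed
  have tc: "t z = c (s z)" for z by (simp add: c_def s)
  have orbit: "\<exists>n. y = (c ^^ n) x" if "(x, y) \<in> J" for y
    using that unfolding J_def
  proof (induction rule: rtrancl_induct)
    case base then show ?case by (metis funpow_0)
  next
    case (step y z)
    then obtain n where n: "y = (c ^^ n) x" by blast
    from step(2) have "z = s y \<or> z = t y" by simp
    then show ?case
    proof
      assume "z = s y" then show ?thesis using n sc by auto
    next
      assume "z = t y"
      then have "z = (c ^^ Suc (n * K - n)) x" using tc[of y] n sc by simp
      then show ?thesis by blast
    qed
  qed
  have reach: "(x, (c ^^ n) x) \<in> J" for n
  proof (induction n)
    case (Suc n)
    let ?y = "(c ^^ n) x"
    have "(?y, s ?y) \<in> J" "(s ?y, t (s ?y)) \<in> J" unfolding J_def by auto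
    then have "(x, t (s ?y)) \<in> J" using Suc unfolding J_def by (blast intro: rtrancl_trans)
    moreover have "t (s ?y) = (c ^^ Suc n) x" by (simp add: tc s)
    ultimately show ?case by simp
  qed (simp add: J_def)
  have k2: "k \<ge> 2"
  proof (rule ccontr)
    assume "\<not> k \<ge> 2"
    then have "k = 1" using k by simp
    then have "t x = x" using k x by (simp add: c_def)
    then show False using fix_disj x by blast
  qed
  have fs: "s ((c ^^ n) x) = (c ^^ n) x \<longleftrightarrow> k dvd 2 * n" for n
  proof -
    have "s ((c ^^ n) x) = (c ^^ n) x \<longleftrightarrow> (c ^^ n) (s ((c ^^ n) x)) = (c ^^ n) ((c ^^ n) x)"
      using inj[of n] by (metis injD)
    also have "\<dots> \<longleftrightarrow> x = (c ^^ (2 * n)) x" by (simp add: cns x mult_2 funpow_add)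
    finally show ?thesis using dvd by metis
  qed
  have ft: "t ((c ^^ n) x) = (c ^^ n) x \<longleftrightarrow> k dvd 2 * n - 1" if "n > 0" for n
  proof -
    have "t ((c ^^ n) x) = (c ^^ n) x \<longleftrightarrow> (c ^^ n) (c (s ((c ^^ n) x))) = (c ^^ n) ((c ^^ n) x)"
      using inj[of n] tc by (metis injD)
    also have "\<dots> \<longleftrightarrow> c x = (c ^^ Suc (2 * n - 1)) x"
    proof -
      have "(c ^^ n) (c (s ((c ^^ n) x))) = c x"
        by (metis cns funpow_swap1 x(2))
      moreover have "(c ^^ n) ((c ^^ n) x) = (c ^^ Suc (2 * n - 1)) x"
        using that by (simp add: mult_2 flip: funpow_add[THEN fun_cong, unfolded comp_def])
      ultimately show ?thesis by simp
    qed
    also have "\<dots> \<longleftrightarrow> x = (c ^^ (2 * n - 1)) x"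
      by (simp add: inj_eq[OF permutes_inj[OF c]])
    finally show ?thesis using dvd by metis
  qed
  \<comment> \<open>The far end of the orbit. If k is even then 2m = k and the point is fixed by s;
    if k is odd then 2m - 1 = k and it is fixed by t.\<close>
  let ?m = "(k + 1) div 2"
  have m: "0 < ?m" "?m < k" using k2 by auto
  show ?thesis
  proof (rule ex1I[of _ "(c ^^ ?m) x"])
    have "(c ^^ ?m) x \<noteq> x" using dvd[of ?m] m by (auto dest: dvd_imp_le)
    moreover have "s ((c ^^ ?m) x) = (c ^^ ?m) x \<or> t ((c ^^ ?m) x) = (c ^^ ?m) x"
    proof (cases "even k")
      case True
      then have "2 * ?m = k" by auto
      then show ?thesis using fs by simp
    next
      case False
      then have "2 * ?m - 1 = k" by (auto elim!: oddE)
      then show ?thesis using ft[OF m(1)] by simp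
    qed
    ultimately show "(c ^^ ?m) x \<noteq> x \<and> (s ((c ^^ ?m) x) = (c ^^ ?m) x \<or> t ((c ^^ ?m) x) = (c ^^ ?m) x)
      \<and> (x, (c ^^ ?m) x) \<in> J" using reach by simp
  next
    fix y assume y: "y \<noteq> x \<and> (s y = y \<or> t y = y) \<and> (x, y) \<in> J"
    then obtain n' where n': "y = (c ^^ n') x" using orbit by blast
    define n where "n = n' mod k"
    have "(c ^^ n') x = (c ^^ n) ((c ^^ (n' - n' mod k)) x)"
      by (simp add: n_def flip: funpow_add[THEN fun_cong, unfolded comp_def])
    also have "(c ^^ (n' - n' mod k)) x = x" using dvd by (simp add: dvd_minus_mod)
    finally have n: "y = (c ^^ n) x" using n' by simp
    have "n < k" using k by (simp add: n_def)
    have "n > 0" using n y by (cases n) auto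
    have "n = ?m"
    proof (cases "s y = y")
      case True
      then have "k dvd 2 * n" using fs n by simp
      then obtain j where j: "2 * n = k * j" by blast
      have "j > 0" using j \<open>n > 0\<close> by (cases j) auto
      \<comment> \<open>Since 0 < n < k, the positive multiple 2n of k lies below 2k and so equals
        k.\<close>
      moreover have "k * j < k * 2" using j \<open>n < k\<close> by linarith
      ultimately have "j = 1" using k by simp
      then show ?thesis using j by simp
    next
      case False
      then have "k dvd 2 * n - 1" using ft[OF \<open>n > 0\<close>] n y by simp
      then obtain j where j: "2 * n - 1 = k * j" by blast
      have "j > 0" using j \<open>n > 0\<close> by (cases j) auto
      moreover have "k * j < k * 2" using j \<open>n < k\<close> by linarith
      ultimately have "j = 1" using k by simp
      then show ?thesis using j by simp
    qed
    then show "y = (c ^^ ?m) x" using n by simp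
  qed
qed

definition partner :: "'b set set \<Rightarrow> 'b \<Rightarrow> 'b" where
  "partner M u = (if u \<in> \<Union>M then THE v. {u, v} \<in> M else u)"

lemma partner:
  assumes M: "M \<in> matching V"
  shows "u \<in> V \<Longrightarrow> {u, partner M u} \<in> M" "u \<notin> V \<Longrightarrow> partner M u = u"
    "{u, v} \<in> M \<Longrightarrow> partner M u = v" "partner M (partner M u) = u"
    "V \<subseteq> W \<Longrightarrow> partner M permutes W" "partner M u = u \<longleftrightarrow> u \<notin> V"
proof -
  have U: "\<Union>M = V" by (rule matching_Union[OF M])
  have 3: "partner M u = v" if "{u, v} \<in> M" for u v
  proof -
    have "u \<in> V" using matching_linkD[OF M that] by simp
    then have "partner M u = (THE v. {u, v} \<in> M)" using U by (simp add: partner_def)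
    also have "\<dots> = v" by (rule the_equality) (use that matching_unique[OF M] in metis)+
    finally show ?thesis .
  qed
  have 1: "{u, partner M u} \<in> M" if "u \<in> V" for u
    using matching_ex[OF M that] 3 by metis
  then show "u \<in> V \<Longrightarrow> {u, partner M u} \<in> M" .
  have 2: "partner M u = u" if "u \<notin> V" for u
    using that U by (simp add: partner_def)
  then show "u \<notin> V \<Longrightarrow> partner M u = u" .
  have 4: "partner M (partner M u) = u" for u
    using 1[of u] 2[of u] 3[of "partner M u" u] by (metis insert_commute)
  show "{u, v} \<in> M \<Longrightarrow> partner M u = v" by (rule 3)
  show "partner M (partner M u) = u" by (rule 4)
  show "V \<subseteq> W \<Longrightarrow> partner M permutes W"
    unfolding permutes_def using 2 4 by (metis subset_eq)
  show "partner M u = u \<longleftrightarrow> u \<notin> V" using 1[of u] 2[of u] matching_linkD[OF M] by metis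
qed

text \<open>The union of two matchings is a graph of paths and cycles, and a point covered by only
  one of them ends a path; the claim is that a path has exactly one other end. The orbit lemma wants
  x to be fixed by the first involution, so x is taken outside V and the other case follows by
  exchanging the matchings.\<close>

lemma join_endpoint:
  assumes M: "M \<in> matching V" and N: "N \<in> matching W" and fin: "finite V" "finite W"
    and x: "x \<in> (V - W) \<union> (W - V)"
  shows "\<exists>!y. y \<in> (V - W) \<union> (W - V) \<and> y \<noteq> x \<and> (x, y) \<in> (rel_of_part M \<union> rel_of_part N)\<^sup>+"
proof -
  have *: "\<exists>!y. y \<in> (V - W) \<union> (W - V) \<and> y \<noteq> x \<and> (x, y) \<in> (rel_of_part M \<union> rel_of_part N)\<^sup>+"
    if M: "M \<in> matching V" and N: "N \<in> matching W" and fin: "finite V" "finite W"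
      and x: "x \<in> W - V" for M N :: "'a set set" and V W
  proof -
    define s where "s = partner M"
    define t where "t = partner N"
    let ?J = "{(u, v). v = s u \<or> v = t u}\<^sup>*"
    have J: "(x, y) \<in> (rel_of_part M \<union> rel_of_part N)\<^sup>+ \<longleftrightarrow> (x, y) \<in> ?J" if "y \<noteq> x" for y
    proof
      assume "(x, y) \<in> (rel_of_part M \<union> rel_of_part N)\<^sup>+"
      then have "(x, y) \<in> (rel_of_part M \<union> rel_of_part N)\<^sup>*" by (rule trancl_into_rtrancl)
      moreover have "rel_of_part M \<union> rel_of_part N \<subseteq> ?J"
        unfolding s_def t_def
        by (auto simp: mem_rel_of_part_matching[OF M] mem_rel_of_part_matching[OF N] dest!: partner(3)[OF M]
            partner(3)[OF N])
      ultimately show "(x, y) \<in> ?J" using rtrancl_subset_rtrancl by blast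
    next
      assume "(x, y) \<in> ?J"
      moreover have "{(u, v). v = s u \<or> v = t u} \<subseteq> (rel_of_part M \<union> rel_of_part N)\<^sup>*"
      proof clarify
        fix u v assume "v = s u \<or> v = t u"
        moreover have "s u = u \<or> (u, s u) \<in> rel_of_part M" "t u = u \<or> (u, t u) \<in> rel_of_part N"
          using partner(1,2)[OF M, of u] partner(1,2)[OF N, of u]
          unfolding mem_rel_of_part_matching[OF M] mem_rel_of_part_matching[OF N] s_def t_def by metis+
        ultimately have "u = v \<or> (u, v) \<in> rel_of_part M \<union> rel_of_part N" by auto
        then show "(u, v) \<in> (rel_of_part M \<union> rel_of_part N)\<^sup>*" by auto
      qed
      ultimately have "(x, y) \<in> (rel_of_part M \<union> rel_of_part N)\<^sup>*"
        using rtrancl_subset_rtrancl by blast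
      then show "(x, y) \<in> (rel_of_part M \<union> rel_of_part N)\<^sup>+" using that
        by (metis rtranclD)
    qed
    have in_V: "y \<in> V \<union> W" if "(x, y) \<in> ?J" for y
      using that
    proof (induction rule: rtrancl_induct)
      case base then show ?case using x by simp
    next
      case (step y z)
      then show ?case unfolding s_def t_def
        using partner(1,2)[OF M, of y] partner(1,2)[OF N, of y] matching_linkD[OF M] matching_linkD[OF N]
        by (metis (mono_tags, lifting) UnCI case_prodD mem_Collect_eq)
    qed
    have ex: "\<exists>!y. y \<noteq> x \<and> (s y = y \<or> t y = y) \<and> (x, y) \<in> ?J"
    proof (rule dihedral_orbit_endpoints)
      show "finite (V \<union> W)" using fin by simp
      show "s permutes V \<union> W" unfolding s_def by (rule partner(5)[OF M]) simp
      show "t permutes V \<union> W" unfolding t_def by (rule partner(5)[OF N]) simp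
      show "s (s u) = u" "t (t u) = u" for u
        unfolding s_def t_def using partner(4)[OF M] partner(4)[OF N] by auto
      show "u \<in> V \<union> W \<Longrightarrow> \<not> (s u = u \<and> t u = u)" for u
        unfolding s_def t_def using partner(6)[OF M] partner(6)[OF N] by auto
      show "x \<in> V \<union> W" "s x = x" using x partner(6)[OF M] by (auto simp: s_def)
    qed
    have eq: "(y \<noteq> x \<and> (s y = y \<or> t y = y) \<and> (x, y) \<in> ?J) \<longleftrightarrow>
      (y \<in> (V - W) \<union> (W - V) \<and> y \<noteq> x \<and> (x, y) \<in> (rel_of_part M \<union> rel_of_part N)\<^sup>+)" for y
      using J[of y] in_V[of y] partner(6)[OF M, of y] partner(6)[OF N, of y]
      by (auto simp: s_def t_def)
    show ?thesis using ex unfolding eq .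
  qed
  from x show ?thesis
  proof
    assume "x \<in> W - V" then show ?thesis using *[OF M N fin] by blast
  next
    assume "x \<in> V - W"
    then have "\<exists>!y. y \<in> (W - V) \<union> (V - W) \<and> y \<noteq> x \<and> (x, y) \<in> (rel_of_part N \<union> rel_of_part M)\<^sup>+"
      using *[OF N M fin(2,1)] by blast
    then show ?thesis by (metis Un_commute)
  qed
qed

text \<open>Finiteness and parity of both objects are bundled with membership, so that products can
  be studied without reference to the category.\<close>

definition br :: "'a set \<Rightarrow> 'a set \<Rightarrow> ('a + 'a) set set set" where
  "br A B = {\<alpha> \<in> Brauer A B. finite A \<and> finite B \<and> even (card A) \<and> even (card B)}"

lemma br_matching: "\<alpha> \<in> br A B \<Longrightarrow> \<alpha> \<in> matching (A <+> B)"
  by (simp add: br_def Brauer_matching)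

lemma brI:
  "\<alpha> \<in> matching (A <+> B) \<Longrightarrow> finite A \<Longrightarrow> finite B \<Longrightarrow> even (card A) \<Longrightarrow> even (card B) \<Longrightarrow> \<alpha> \<in> br A B"
  by (simp add: br_def Brauer_matching)

lemma br_finite: "\<alpha> \<in> br A B \<Longrightarrow> finite A" "\<alpha> \<in> br A B \<Longrightarrow> finite B"
  "\<alpha> \<in> br A B \<Longrightarrow> even (card A)" "\<alpha> \<in> br A B \<Longrightarrow> even (card B)"
  by (simp_all add: br_def)

lemma br_src: "\<alpha> \<in> br A B \<Longrightarrow> br_src \<alpha> = A"
  using matching_Union[OF br_matching] by (fastforce simp: br_src_def)

lemma br_rng: "\<alpha> \<in> br A B \<Longrightarrow> br_rng \<alpha> = B"
  using matching_Union[OF br_matching] by (fastforce simp: br_rng_def)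

lemma rel_of_part_image: "rel_of_part (image f ` P) = map_prod f f ` rel_of_part P"
  by (force simp: rel_of_part_def)

lemma br_join_eq:
  "br_join \<alpha> \<beta> =
    (rel_of_part (image (map_sum id Inl) ` \<alpha>) \<union> rel_of_part (image Inr ` \<beta>))\<^sup>+"
  by (simp add: br_join_def rel_of_part_image)

lemma inj_map_sum: "inj f \<Longrightarrow> inj g \<Longrightarrow> inj (map_sum f g)"
  by (rule injI, rename_tac x y, case_tac x; case_tac y) (auto dest: injD)

definition jn where "jn \<alpha> \<beta> u v \<longleftrightarrow> (map_sum id Inr u, map_sum id Inr v) \<in> br_join \<alpha> \<beta>"

context
  fixes \<alpha> \<beta> :: "('a + 'a) set set" and A B D :: "'a set"
  assumes \<alpha>: "\<alpha> \<in> br A B" and \<beta>: "\<beta> \<in> br B D"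
begin

private lemma M: "image (map_sum id Inl) ` \<alpha> \<in> matching (map_sum id Inl ` (A <+> B))"
  and N: "image Inr ` \<beta> \<in> matching (Inr ` (B <+> D))"
  by (auto intro!: matching_image br_matching[OF \<alpha>] br_matching[OF \<beta>] inj_on_subset[OF inj_map_sum] )

lemma br_join_trans: "(u, v) \<in> br_join \<alpha> \<beta> \<Longrightarrow> (v, w) \<in> br_join \<alpha> \<beta> \<Longrightarrow> (u, w) \<in> br_join \<alpha> \<beta>"
  unfolding br_join_eq by (rule trancl_trans)

lemma br_join_sym: "(u, v) \<in> br_join \<alpha> \<beta> \<Longrightarrow> (v, u) \<in> br_join \<alpha> \<beta>"
proof -
  have "sym (rel_of_part P)" for P :: "'b set set" by (auto simp: sym_def rel_of_part_def)
  then have "sym (br_join \<alpha> \<beta>)" unfolding br_join_eq by (intro sym_trancl sym_Un)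
  then show "(u, v) \<in> br_join \<alpha> \<beta> \<Longrightarrow> (v, u) \<in> br_join \<alpha> \<beta>" by (rule symD)
qed

lemma br_join_left: "{u, v} \<in> \<alpha> \<Longrightarrow> (map_sum id Inl u, map_sum id Inl v) \<in> br_join \<alpha> \<beta>"
  unfolding br_join_def by (intro trancl.r_into_trancl UnI1 image_eqI[of _ _ "(u, v)"]) (auto simp: rel_of_part_def)

lemma br_join_right: "{u, v} \<in> \<beta> \<Longrightarrow> (Inr u, Inr v) \<in> br_join \<alpha> \<beta>"
  unfolding br_join_def by (intro trancl.r_into_trancl UnI2 image_eqI[of _ _ "(u, v)"]) (auto simp: rel_of_part_def)

lemma jn_refl: assumes "u \<in> A <+> D" shows "jn \<alpha> \<beta> u u"
proof -
  obtain w where "(map_sum id Inr u, w) \<in> br_join \<alpha> \<beta>"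
  proof (cases u)
    case (Inl a)
    then obtain v where "{u, v} \<in> \<alpha>" using matching_ex[OF br_matching[OF \<alpha>], of u] assms by auto
    from br_join_left[OF this] Inl show ?thesis using that by auto
  next
    case (Inr a)
    then obtain v where "{u, v} \<in> \<beta>" using matching_ex[OF br_matching[OF \<beta>], of u] assms by auto
    from br_join_right[OF this] Inr show ?thesis using that by auto
  qed
  then show ?thesis unfolding jn_def by (metis br_join_trans br_join_sym)
qed

lemma jn_sym: "jn \<alpha> \<beta> u v \<Longrightarrow> jn \<alpha> \<beta> v u"
  unfolding jn_def by (rule br_join_sym)

text \<open>After renaming, the middle points belong to both vertex sets and the outer points to
  exactly one, so the outer points are precisely the ends of the alternating paths.\<close>

lemma jn_unique: assumes "u \<in> A <+> D" shows "\<exists>!v. v \<in> A <+> D \<and> v \<noteq> u \<and> jn \<alpha> \<beta> u v"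
proof -
  let ?V = "map_sum id Inl ` (A <+> B)" and ?W = "Inr ` (B <+> D)" and ?f = "map_sum id Inr :: 'a + 'a \<Rightarrow> 'a + 'a + 'a"
  have D: "?f ` (A <+> D) = (?V - ?W) \<union> (?W - ?V)"
    by (auto simp: image_iff Bex_def split: sum.splits) (auto simp: Plus_def)
  have f: "inj ?f" by (rule inj_map_sum) auto
  have "finite ?V" "finite ?W" using br_finite[OF \<alpha>] br_finite[OF \<beta>] by auto
  from join_endpoint[OF M N this, of "?f u", folded br_join_eq D]
  have "\<exists>!y. y \<in> ?f ` (A <+> D) \<and> y \<noteq> ?f u \<and> (?f u, y) \<in> br_join \<alpha> \<beta>" using assms by blast
  then obtain y where y: "y \<in> ?f ` (A <+> D)" "y \<noteq> ?f u" "(?f u, y) \<in> br_join \<alpha> \<beta>"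
    and uniq: "\<And>z. z \<in> ?f ` (A <+> D) \<Longrightarrow> z \<noteq> ?f u \<Longrightarrow> (?f u, z) \<in> br_join \<alpha> \<beta> \<Longrightarrow> z = y" by blast
  obtain v where v: "v \<in> A <+> D" "y = ?f v" using y by blast
  show ?thesis
  proof (rule ex1I[of _ v])
    show "v \<in> A <+> D \<and> v \<noteq> u \<and> jn \<alpha> \<beta> u v" using v y by (auto simp: jn_def)
    fix w assume "w \<in> A <+> D \<and> w \<noteq> u \<and> jn \<alpha> \<beta> u w"
    then have "?f w = y" by (intro uniq) (auto simp: jn_def inj_eq[OF f])
    then show "w = v" using v inj_eq[OF f] by metis
  qed
qed

text \<open>Each outer point is joined to exactly one other outer point, so the classes of the
  quotient are pairs. The product has no other blocks, although its definition speaks of a general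
  join.\<close>

lemma br_prd_eq: "br_prd \<alpha> \<beta> = {{u, v} | u v. u \<in> A <+> D \<and> v \<in> A <+> D \<and> u \<noteq> v \<and> jn \<alpha> \<beta> u v}"
proof -
  define E where "E = {(u, v). u \<in> A <+> D \<and> v \<in> A <+> D \<and> jn \<alpha> \<beta> u v}"
  have E: "(u, v) \<in> E \<longleftrightarrow> u \<in> A <+> D \<and> v \<in> A <+> D \<and> jn \<alpha> \<beta> u v" for u v
    by (simp add: E_def)
  have cls: "E `` {u} = {u, v}" if "u \<in> A <+> D" "v \<in> A <+> D" "u \<noteq> v" "jn \<alpha> \<beta> u v" for u v
  proof (intro equalityI subsetI)
    fix w assume "w \<in> E `` {u}"
    then have "w \<in> A <+> D" "jn \<alpha> \<beta> u w" by (simp_all add: E)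
    then show "w \<in> {u, v}" using jn_unique[OF that(1)] that by (cases "w = u") blast+
  next
    fix w assume "w \<in> {u, v}"
    then show "w \<in> E `` {u}" using that jn_refl[OF that(1)] by (elim insertE) (simp_all add: E)
  qed
  have "br_prd \<alpha> \<beta> = (A <+> D) // E"
    by (simp add: br_prd_def br_src[OF \<alpha>] br_rng[OF \<beta>] jn_def E_def)
  also have "\<dots> = {{u, v} | u v. u \<in> A <+> D \<and> v \<in> A <+> D \<and> u \<noteq> v \<and> jn \<alpha> \<beta> u v}" (is "_ = ?R")
  proof
    show "(A <+> D) // E \<subseteq> ?R"
    proof
      fix b assume "b \<in> (A <+> D) // E"
      then obtain u where u: "u \<in> A <+> D" "b = E `` {u}" by (rule quotientE)
      obtain v where v: "v \<in> A <+> D" "u \<noteq> v" "jn \<alpha> \<beta> u v" using jn_unique[OF u(1)] by metis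
      then have "b = {u, v}" using cls u by simp
      then show "b \<in> ?R" using u v by blast
    qed
    show "?R \<subseteq> (A <+> D) // E"
    proof
      fix b assume "b \<in> ?R"
      then obtain u v where uv: "b = {u, v}" "u \<in> A <+> D" "v \<in> A <+> D" "u \<noteq> v" "jn \<alpha> \<beta> u v"
        by blast
      then have "b = E `` {u}" using cls by simp
      then show "b \<in> (A <+> D) // E" using uv(2) quotientI by metis
    qed
  qed
  finally show ?thesis .
qed

lemma br_prd_link: "{u, v} \<in> br_prd \<alpha> \<beta> \<longleftrightarrow> u \<in> A <+> D \<and> v \<in> A <+> D \<and> u \<noteq> v \<and> jn \<alpha> \<beta> u v"
  unfolding br_prd_eq by (auto simp: doubleton_eq_iff intro: jn_sym)

lemma br_prd_br: "br_prd \<alpha> \<beta> \<in> br A D"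
proof (rule brI[OF matchingI])
  show "\<exists>u v. b = {u, v} \<and> u \<noteq> v \<and> u \<in> A <+> D \<and> v \<in> A <+> D" if "b \<in> br_prd \<alpha> \<beta>" for b
    using that unfolding br_prd_eq by blast
  show "\<exists>v. {u, v} \<in> br_prd \<alpha> \<beta>" if "u \<in> A <+> D" for u
    using jn_unique[OF that] that unfolding br_prd_link by blast
  fix u v w assume "{u, v} \<in> br_prd \<alpha> \<beta>" "{u, w} \<in> br_prd \<alpha> \<beta>"
  then show "v = w"
    using jn_unique[of u] unfolding br_prd_link by metis
qed (use br_finite[OF \<alpha>] br_finite[OF \<beta>] in auto)

text \<open>This lemma and the next four list the short alternating paths: a hook that persists on
  either side, a direct transversal, one turn, and one turn on each side. No longer path is ever
  written out.\<close>

lemma link_ULU: assumes "{Inl a, Inl a'} \<in> \<alpha>" shows "{Inl a, Inl a'} \<in> br_prd \<alpha> \<beta>"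
  using br_join_left[OF assms] matching_linkD[OF br_matching[OF \<alpha>] assms]
  by (auto simp: br_prd_link jn_def)

lemma link_LRL: assumes "{Inr d, Inr d'} \<in> \<beta>" shows "{Inr d, Inr d'} \<in> br_prd \<alpha> \<beta>"
  using br_join_right[OF assms] matching_linkD[OF br_matching[OF \<beta>] assms]
  by (auto simp: br_prd_link jn_def)

lemma link_through: assumes "{Inl a, Inr b} \<in> \<alpha>" "{Inl b, Inr d} \<in> \<beta>"
  shows "{Inl a, Inr d} \<in> br_prd \<alpha> \<beta>"
  using br_join_left[OF assms(1)] br_join_right[OF assms(2)]
    matching_linkD[OF br_matching[OF \<alpha>] assms(1)] matching_linkD[OF br_matching[OF \<beta>] assms(2)]
  by (auto simp: br_prd_link jn_def intro: br_join_trans)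

lemma link_turn: assumes "{Inl a, Inr b} \<in> \<alpha>" "{Inl b, Inl b'} \<in> \<beta>" "{Inl a', Inr b'} \<in> \<alpha>"
  shows "{Inl a, Inl a'} \<in> br_prd \<alpha> \<beta>"
proof -
  have "a \<noteq> a'" using matching_unique[OF br_matching[OF \<alpha>] assms(1), of "Inr b'"] assms
      matching_linkD[OF br_matching[OF \<beta>] assms(2)] by auto
  then show ?thesis
    using br_join_left[OF assms(1)] br_join_right[OF assms(2)] br_join_left[OF assms(3), THEN br_join_sym]
      matching_linkD[OF br_matching[OF \<alpha>] assms(1)] matching_linkD[OF br_matching[OF \<alpha>] assms(3)]
    by (auto simp: br_prd_link jn_def intro: br_join_trans)
qed

text \<open>The transversal detours through an upper hook of \<beta> and then a lower hook of
  \<alpha>. It is what keeps a rank from falling when the hooks of a multiplier have been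
  rearranged.\<close>

lemma link_zigzag:
  assumes "{Inl a, Inr b} \<in> \<alpha>" "{Inl b, Inl c} \<in> \<beta>" "{Inr c, Inr d} \<in> \<alpha>" "{Inl d, Inr e} \<in> \<beta>"
  shows "{Inl a, Inr e} \<in> br_prd \<alpha> \<beta>"
  using br_join_left[OF assms(1)] br_join_right[OF assms(2)] br_join_left[OF assms(3)] br_join_right[OF assms(4)]
    matching_linkD[OF br_matching[OF \<alpha>] assms(1)] matching_linkD[OF br_matching[OF \<beta>] assms(4)]
  by (auto simp: br_prd_link jn_def) (blast intro: br_join_trans)

end

text \<open>A Brauer partition is determined by the sets that are unions of its blocks, and these sets
  compose like relations; this gives associativity without a four-layer graph.\<close>

definition saturates :: "('a + 'a) set set \<Rightarrow> 'a set \<Rightarrow> 'a set \<Rightarrow> bool" where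
  "saturates \<alpha> S T \<longleftrightarrow> (\<forall>u v. {u, v} \<in> \<alpha> \<longrightarrow> (u \<in> S <+> T \<longleftrightarrow> v \<in> S <+> T))"

text \<open>A single block of \<alpha> is saturated by \<alpha>. If \<beta> saturates it too, then
  the \<beta>-partner of one of its points has to be the other.\<close>

lemma saturates_ext:
  assumes "\<alpha> \<in> br A B" "\<beta> \<in> br A B" "\<And>S T. saturates \<alpha> S T \<Longrightarrow> saturates \<beta> S T"
  shows "\<alpha> = \<beta>"
proof (rule matching_eqI[OF br_matching br_matching, OF assms(1,2)])
  fix u v assume uv: "{u, v} \<in> \<alpha>"
  let ?S = "Inl -` {u, v}" and ?T = "Inr -` {u, v}"
  have ST: "?S <+> ?T = {u, v}" by (cases u; cases v) auto
  have vu: "{v, u} \<in> \<alpha>" using uv by (simp add: insert_commute)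
  note uniq = matching_unique[OF br_matching[OF assms(1)]]
  have "saturates \<alpha> ?S ?T" unfolding saturates_def ST
  proof (intro allI impI)
    fix p q assume pq: "{p, q} \<in> \<alpha>"
    then have qp: "{q, p} \<in> \<alpha>" by (simp add: insert_commute)
    have "p = u \<Longrightarrow> q = v" "p = v \<Longrightarrow> q = u" "q = u \<Longrightarrow> p = v" "q = v \<Longrightarrow> p = u"
      using uniq[OF uv] uniq[OF vu] pq qp by metis+
    then show "p \<in> {u, v} \<longleftrightarrow> q \<in> {u, v}" by fast
  qed
  then have "saturates \<beta> ?S ?T" by (rule assms)
  moreover obtain w where w: "{u, w} \<in> \<beta>" "u \<noteq> w"
    using matching_ex[OF br_matching[OF assms(2)], of u] matching_linkD[OF br_matching[OF assms(1)] uv] by metis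
  ultimately have "w \<in> {u, v}" unfolding saturates_def ST by blast
  then show "{u, v} \<in> \<beta>" using w by auto
qed

text \<open>A set saturated by the product extends to the middle layer along the alternating paths
  that start in it. Conversely, three matching layers are closed under the generators of the join
  and hence under the join.\<close>

lemma saturates_prd:
  assumes \<alpha>: "\<alpha> \<in> br A B" and \<beta>: "\<beta> \<in> br B D"
  shows "saturates (br_prd \<alpha> \<beta>) S T \<longleftrightarrow> (\<exists>Y. saturates \<alpha> S Y \<and> saturates \<beta> Y T)"
proof
  note L = br_join_left[OF \<alpha> \<beta>] and R = br_join_right[OF \<alpha> \<beta>] and tr = br_join_trans[OF \<alpha> \<beta>]
    and sy = br_join_sym[OF \<alpha> \<beta>] and link = br_prd_link[OF \<alpha> \<beta>]
  let ?f = "map_sum id Inr :: 'a + 'a \<Rightarrow> 'a + 'a + 'a"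
  assume sat: "saturates (br_prd \<alpha> \<beta>) S T"
  \<comment> \<open>Exactly the middle points joined to a chosen outer point; closed cycles inside
    the middle layer are left out, and either choice would do for them.\<close>
  define Y where "Y = {b. \<exists>z \<in> (S \<inter> A) <+> (T \<inter> D). (?f z, Inr (Inl b)) \<in> br_join \<alpha> \<beta>}"
  have *: "w \<in> S <+> T" if "w \<in> A <+> D" "b \<in> Y" "(?f w, Inr (Inl b)) \<in> br_join \<alpha> \<beta>" for w b
  proof -
    obtain z where z: "z \<in> (S \<inter> A) <+> (T \<inter> D)" "(?f z, Inr (Inl b)) \<in> br_join \<alpha> \<beta>"
      using \<open>b \<in> Y\<close> unfolding Y_def by blast
    have "jn \<alpha> \<beta> z w" unfolding jn_def using z that sy tr by blast
    then have "z = w \<or> {z, w} \<in> br_prd \<alpha> \<beta>" using link[of z w] z that by auto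
    then show ?thesis using sat z unfolding saturates_def by auto
  qed
  have YI: "b \<in> Y" if "w \<in> A <+> D" "w \<in> S <+> T" "(?f w, Inr (Inl b)) \<in> br_join \<alpha> \<beta>" for w b
    unfolding Y_def using that by (intro CollectI bexI[of _ w]) auto
  have YY: "b' \<in> Y" if "b \<in> Y" "(Inr (Inl b), Inr (Inl b')) \<in> br_join \<alpha> \<beta>" for b b'
    using that tr unfolding Y_def by blast
  have AY: "a \<in> S \<longleftrightarrow> b \<in> Y" if "{Inl a, Inr b} \<in> \<alpha>" for a b
    using *[of "Inl a" b] YI[of "Inl a" b] L[OF that] matching_linkD[OF br_matching[OF \<alpha>] that] by auto
  have DY: "d \<in> T \<longleftrightarrow> b \<in> Y" if "{Inl b, Inr d} \<in> \<beta>" for d b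
    using *[of "Inr d" b] YI[of "Inr d" b] R[OF that, THEN sy] matching_linkD[OF br_matching[OF \<beta>] that] by auto
  have "saturates \<alpha> S Y"
    unfolding saturates_def
  proof (intro allI impI)
    fix u v assume uv: "{u, v} \<in> \<alpha>"
    show "u \<in> S <+> Y \<longleftrightarrow> v \<in> S <+> Y"
    proof (cases u; cases v)
      fix a a' assume "u = Inl a" "v = Inl a'"
      then show ?thesis using link_ULU[OF \<alpha> \<beta>, of a a'] uv sat unfolding saturates_def by blast
    next
      fix a b assume "u = Inl a" "v = Inr b" then show ?thesis using AY[of a b] uv by auto
    next
      fix a b assume "u = Inr b" "v = Inl a"
      then show ?thesis using AY[of a b] uv by (auto simp: insert_commute)
    next
      fix b b' assume "u = Inr b" "v = Inr b'"
      then show ?thesis using YY[of b b'] YY[of b' b] L[OF uv] sy by auto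
    qed
  qed
  moreover have "saturates \<beta> Y T"
    unfolding saturates_def
  proof (intro allI impI)
    fix u v assume uv: "{u, v} \<in> \<beta>"
    show "u \<in> Y <+> T \<longleftrightarrow> v \<in> Y <+> T"
    proof (cases u; cases v)
      fix a a' assume "u = Inr a" "v = Inr a'"
      then show ?thesis using link_LRL[OF \<alpha> \<beta>, of a a'] uv sat unfolding saturates_def by blast
    next
      fix a b assume "u = Inl b" "v = Inr a" then show ?thesis using DY[of b a] uv by auto
    next
      fix a b assume "u = Inr a" "v = Inl b"
      then show ?thesis using DY[of b a] uv by (auto simp: insert_commute)
    next
      fix b b' assume "u = Inl b" "v = Inl b'"
      then show ?thesis using YY[of b b'] YY[of b' b] R[OF uv] sy by auto
    qed
  qed
  ultimately show "\<exists>Y. saturates \<alpha> S Y \<and> saturates \<beta> Y T" by blast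
next
  assume "\<exists>Y. saturates \<alpha> S Y \<and> saturates \<beta> Y T"
  then obtain Y where Y: "saturates \<alpha> S Y" "saturates \<beta> Y T" by blast
  have "p \<in> S <+> (Y <+> T) \<longleftrightarrow> q \<in> S <+> (Y <+> T)" if "(p, q) \<in> br_join \<alpha> \<beta>" for p q
    using that unfolding br_join_def
  proof (induction rule: trancl_induct)
    case (base q)
    then show ?case
    proof
      assume "(p, q) \<in> map_prod (map_sum id Inl) (map_sum id Inl) ` rel_of_part \<alpha>"
      then obtain u v where uv: "p = map_sum id Inl u" "q = map_sum id Inl v" "(u, v) \<in> rel_of_part \<alpha>" by auto
      then have "u \<in> S <+> Y \<longleftrightarrow> v \<in> S <+> Y"
        using Y(1) mem_rel_of_part_matching[OF br_matching[OF \<alpha>]] unfolding saturates_def by metis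
      then show ?thesis using uv by (cases u; cases v) auto
    next
      assume "(p, q) \<in> map_prod Inr Inr ` rel_of_part \<beta>"
      then obtain u v where uv: "p = Inr u" "q = Inr v" "(u, v) \<in> rel_of_part \<beta>" by auto
      then have "u \<in> Y <+> T \<longleftrightarrow> v \<in> Y <+> T"
        using Y(2) mem_rel_of_part_matching[OF br_matching[OF \<beta>]] unfolding saturates_def by metis
      then show ?thesis using uv by auto
    qed
  next
    case (step q q')
    from step(2) have "q \<in> S <+> (Y <+> T) \<longleftrightarrow> q' \<in> S <+> (Y <+> T)"
    proof
      assume "(q, q') \<in> map_prod (map_sum id Inl) (map_sum id Inl) ` rel_of_part \<alpha>"
      then obtain u v where uv: "q = map_sum id Inl u" "q' = map_sum id Inl v" "(u, v) \<in> rel_of_part \<alpha>" by auto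
      then have "u \<in> S <+> Y \<longleftrightarrow> v \<in> S <+> Y"
        using Y(1) mem_rel_of_part_matching[OF br_matching[OF \<alpha>]] unfolding saturates_def by metis
      then show ?thesis using uv by (cases u; cases v) auto
    next
      assume "(q, q') \<in> map_prod Inr Inr ` rel_of_part \<beta>"
      then obtain u v where uv: "q = Inr u" "q' = Inr v" "(u, v) \<in> rel_of_part \<beta>" by auto
      then have "u \<in> Y <+> T \<longleftrightarrow> v \<in> Y <+> T"
        using Y(2) mem_rel_of_part_matching[OF br_matching[OF \<beta>]] unfolding saturates_def by metis
      then show ?thesis using uv by auto
    qed
    then show ?case using step by blast
  qed
  then have "map_sum id Inr u \<in> S <+> (Y <+> T) \<longleftrightarrow> map_sum id Inr v \<in> S <+> (Y <+> T)"
    if "{u, v} \<in> br_prd \<alpha> \<beta>" for u v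
    using that unfolding br_prd_link[OF \<alpha> \<beta>] jn_def by metis
  moreover have "map_sum id Inr u \<in> S <+> (Y <+> T) \<longleftrightarrow> u \<in> S <+> T" for u by (cases u) auto
  ultimately show "saturates (br_prd \<alpha> \<beta>) S T" unfolding saturates_def by blast
qed

lemma br_prd_assoc:
  assumes "\<alpha> \<in> br A B" "\<beta> \<in> br B D" "\<gamma> \<in> br D E"
  shows "br_prd (br_prd \<alpha> \<beta>) \<gamma> = br_prd \<alpha> (br_prd \<beta> \<gamma>)"
proof (rule saturates_ext)
  have 1: "br_prd \<alpha> \<beta> \<in> br A D" "br_prd \<beta> \<gamma> \<in> br B E" using assms by (auto intro: br_prd_br)
  show "br_prd (br_prd \<alpha> \<beta>) \<gamma> \<in> br A E" "br_prd \<alpha> (br_prd \<beta> \<gamma>) \<in> br A E"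
    using 1 assms by (auto intro: br_prd_br)
  show "saturates (br_prd (br_prd \<alpha> \<beta>) \<gamma>) S T \<Longrightarrow> saturates (br_prd \<alpha> (br_prd \<beta> \<gamma>)) S T" for S T
    unfolding saturates_prd[OF 1(1) assms(3)] saturates_prd[OF assms(1) 1(2)]
      saturates_prd[OF assms(1,2)] saturates_prd[OF assms(2,3)] by blast
qed

section \<open>The involution that turns a diagram upside down\<close>

definition swap_sum :: "'a + 'a \<Rightarrow> 'a + 'a" where
  "swap_sum = case_sum Inr Inl"

lemma swap_sum_simps [simp]: "swap_sum (Inl a) = Inr a" "swap_sum (Inr a) = Inl a"
  by (simp_all add: swap_sum_def)

lemma swap_sum_swap_sum [simp]: "swap_sum (swap_sum u) = u"
  by (cases u) auto

lemma swap_sum_image: "swap_sum ` (A <+> B) = B <+> A"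
  by (force simp: Plus_def)

definition star :: "('a + 'a) set set \<Rightarrow> ('a + 'a) set set" where
  "star \<alpha> = image swap_sum ` \<alpha>"

lemma star_star [simp]: "star (star \<alpha>) = \<alpha>"
  by (simp add: star_def image_image)

lemma star_mem: "b \<in> star \<alpha> \<longleftrightarrow> swap_sum ` b \<in> \<alpha>"
proof -
  have *: "swap_sum ` b \<in> star \<alpha>" if "b \<in> \<alpha>" for b :: "('a + 'a) set" and \<alpha>
    using that unfolding star_def by (rule imageI)
  have "swap_sum ` swap_sum ` b = b" by (simp add: image_image)
  then show ?thesis using *[of b "star \<alpha>"] *[of "swap_sum ` b" \<alpha>] by auto
qed

lemma star_link: "{u, v} \<in> star \<alpha> \<longleftrightarrow> {swap_sum u, swap_sum v} \<in> \<alpha>"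
  by (simp add: star_mem)

lemma star_link_simps [simp]:
  "{Inl a, Inl b} \<in> star \<alpha> \<longleftrightarrow> {Inr a, Inr b} \<in> \<alpha>"
  "{Inr a, Inr b} \<in> star \<alpha> \<longleftrightarrow> {Inl a, Inl b} \<in> \<alpha>"
  "{Inl a, Inr b} \<in> star \<alpha> \<longleftrightarrow> {Inl b, Inr a} \<in> \<alpha>"
  by (simp_all add: star_link insert_commute)

lemma star_br: "\<alpha> \<in> br A B \<Longrightarrow> star \<alpha> \<in> br B A"
proof -
  assume a: "\<alpha> \<in> br A B"
  have "inj_on swap_sum (A <+> B)"
    by (rule inj_on_inverseI[of _ swap_sum]) simp
  then show ?thesis
    using matching_image[OF br_matching[OF a]] br_finite[OF a] swap_sum_image
    unfolding star_def by (metis brI)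
qed

lemma saturates_star: "saturates (star \<alpha>) S T \<longleftrightarrow> saturates \<alpha> T S"
proof -
  have 1: "swap_sum u \<in> T <+> S \<longleftrightarrow> u \<in> S <+> T" for u :: "'a + 'a" and S T by (cases u) auto
  show ?thesis unfolding saturates_def star_link by (metis 1 swap_sum_swap_sum)
qed

lemma star_prd:
  assumes "\<alpha> \<in> br A B" "\<beta> \<in> br B D"
  shows "star (br_prd \<alpha> \<beta>) = br_prd (star \<beta>) (star \<alpha>)"
  by (rule saturates_ext[of _ D A])
    (use assms in \<open>auto simp: saturates_star saturates_prd[OF assms] saturates_prd[OF star_br star_br, OF assms(2,1)]
      intro!: star_br br_prd_br\<close>)

section \<open>Counting, existence and decomposition of matchings\<close>

lemma card_matching:
  assumes "M \<in> matching V" "finite V"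
  shows "card V = 2 * card M" "finite M"
proof -
  have M: "disjoint M" "\<Union>M = V" "\<And>b. b \<in> M \<Longrightarrow> card b = 2"
    using assms(1) by (auto simp: matching_def partition_on_def)
  show "finite M" using assms(2) M(2) finite_UnionD by blast
  have "card V = (\<Sum>b\<in>M. card b)"
    using card_Union_disjoint[of M] M by (metis card.infinite zero_neq_numeral)
  then show "card V = 2 * card M" using M(3) by simp
qed

lemma matching_Un:
  assumes "M \<in> matching V" "N \<in> matching W" "V \<inter> W = {}"
  shows "M \<union> N \<in> matching (V \<union> W)"
proof (rule matchingI)
  show "\<exists>u v. b = {u, v} \<and> u \<noteq> v \<and> u \<in> V \<union> W \<and> v \<in> V \<union> W" if "b \<in> M \<union> N" for b
    using that matchingE[OF assms(1), of b] matchingE[OF assms(2), of b] by (metis UnCI UnE)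
  show "\<exists>v. {u, v} \<in> M \<union> N" if "u \<in> V \<union> W" for u
    using that matching_ex[OF assms(1), of u] matching_ex[OF assms(2), of u] by (metis UnCI UnE)
  fix u v w assume "{u, v} \<in> M \<union> N" "{u, w} \<in> M \<union> N"
  then show "v = w"
    using matching_unique[OF assms(1)] matching_unique[OF assms(2)] matching_linkD[OF assms(1)]
      matching_linkD[OF assms(2)] assms(3) by (metis UnE disjoint_iff)
qed

lemma matching_empty: "{} \<in> matching {}"
  by (rule matchingI) auto

lemma matching_empty_iff [simp]: "M \<in> matching {} \<longleftrightarrow> M = {}"
  using matching_subset_eq[OF matching_empty, of M] matching_empty by auto

lemma matching_pair: "a \<noteq> b \<Longrightarrow> {{a, b}} \<in> matching {a, b}"
  by (rule matchingI) (auto simp: doubleton_eq_iff)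

lemma matching_exists:
  assumes "finite V" "even (card V)"
  shows "\<exists>M. M \<in> matching V"
  using assms
proof (induction "card V" arbitrary: V rule: less_induct)
  case less
  show ?case
  proof (cases "V = {}")
    case True then show ?thesis using matching_empty by blast
  next
    case False
    then obtain a where a: "a \<in> V" by blast
    have "V \<noteq> {a}" using less by auto
    then obtain b where b: "b \<in> V" "b \<noteq> a" using a by blast
    let ?W = "V - {a, b}"
    have cW: "card V = card ?W + 2"
      using card_Diff_subset[of "{a, b}" V] less a b card_mono[of V "{a, b}"] by auto
    then have "card ?W < card V" "even (card ?W)" using less(3) by auto
    then obtain M where "M \<in> matching ?W" using less by blast
    then have "M \<union> {{a, b}} \<in> matching (?W \<union> {a, b})"
      using b by (intro matching_Un matching_pair) auto
    moreover have "?W \<union> {a, b} = V" using a b by auto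
    ultimately show ?thesis by auto
  qed
qed

lemma matching_diff:
  assumes "M \<in> matching V" "K \<subseteq> M"
  shows "M - K \<in> matching (V - \<Union>K)"
proof (rule matchingI)
  have notin: "u \<notin> \<Union>K" if "{u, v} \<in> M - K" for u v
  proof
    assume "u \<in> \<Union>K"
    then obtain b where b: "b \<in> K" "u \<in> b" by blast
    obtain w where "b = {u, w}" using matchingE[OF assms(1), of b] b assms(2) doubleton_other[of u]
      by (metis subsetD)
    then have "w = v" using matching_unique[OF assms(1), of u w v] b assms(2) that by blast
    then show False using \<open>b = {u, w}\<close> b that by blast
  qed
  show "\<exists>u v. b = {u, v} \<and> u \<noteq> v \<and> u \<in> V - \<Union> K \<and> v \<in> V - \<Union> K" if b: "b \<in> M - K" for b
  proof -
    obtain u v where uv: "b = {u, v}" "u \<noteq> v" "u \<in> V" "v \<in> V" using matchingE[OF assms(1), of b] b by blast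
    moreover have "u \<notin> \<Union>K" "v \<notin> \<Union>K"
      using notin[of u v] notin[of v u] b uv(1) by (simp_all add: insert_commute)
    ultimately show ?thesis by blast
  qed
  show "\<exists>v. {u, v} \<in> M - K" if u: "u \<in> V - \<Union>K" for u
  proof -
    obtain v where "{u, v} \<in> M" using matching_ex[OF assms(1), of u] u by blast
    moreover have "{u, v} \<notin> K" using u by blast
    ultimately show ?thesis by blast
  qed
  show "v = w" if "{u, v} \<in> M - K" "{u, w} \<in> M - K" for u v w
    using matching_unique[OF assms(1), of u v w] that by blast
qed

section \<open>Hooks, transversals and rank\<close>

definition up where "up \<alpha> = {c. Inl ` c \<in> \<alpha>}"
definition lo where "lo \<alpha> = {c. Inr ` c \<in> \<alpha>}"
text \<open>The domain, and below it the codomain: the two sets of ends of transversals. Each is the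
  complement of the points covered by the hooks on its side, so \<open>up\<close> and
  \<open>lo\<close> carry all the information about it.\<close>

definition dm where "dm \<alpha> = {a. \<exists>b. {Inl a, Inr b} \<in> \<alpha>}"
definition cd where "cd \<alpha> = {b. \<exists>a. {Inl a, Inr b} \<in> \<alpha>}"

lemma up_link: "{a, b} \<in> up \<alpha> \<longleftrightarrow> {Inl a, Inl b} \<in> \<alpha>"
  by (simp add: up_def)

lemma lo_link: "{a, b} \<in> lo \<alpha> \<longleftrightarrow> {Inr a, Inr b} \<in> \<alpha>"
  by (simp add: lo_def)

lemma up_star [simp]: "up (star \<alpha>) = lo \<alpha>" and lo_star [simp]: "lo (star \<alpha>) = up \<alpha>"
  by (simp_all add: up_def lo_def star_mem image_image)

lemma dm_star [simp]: "dm (star \<alpha>) = cd \<alpha>" and cd_star [simp]: "cd (star \<alpha>) = dm \<alpha>"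
  by (simp_all add: dm_def cd_def)

lemma dm_subset: "\<alpha> \<in> br A B \<Longrightarrow> dm \<alpha> \<subseteq> A"
  using matching_linkD[OF br_matching] by (fastforce simp: dm_def)

lemma cd_subset: "\<alpha> \<in> br A B \<Longrightarrow> cd \<alpha> \<subseteq> B"
  using matching_linkD[OF br_matching] by (fastforce simp: cd_def)

lemma br_unique: "\<alpha> \<in> br A B \<Longrightarrow> {u, v} \<in> \<alpha> \<Longrightarrow> {u, w} \<in> \<alpha> \<Longrightarrow> v = w"
  by (rule matching_unique[OF br_matching])

lemma br_unique': "\<alpha> \<in> br A B \<Longrightarrow> {v, u} \<in> \<alpha> \<Longrightarrow> {w, u} \<in> \<alpha> \<Longrightarrow> v = w"
  using br_unique[of \<alpha> A B u v w] by (simp add: insert_commute)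

lemma up_matching:
  fixes \<alpha> :: "('a + 'a) set set"
  assumes a: "\<alpha> \<in> br A B"
  shows "up \<alpha> \<in> matching (A - dm \<alpha>)"
proof (rule matchingI)
  note m = br_matching[OF a]
  show "\<exists>u v. b = {u, v} \<and> u \<noteq> v \<and> u \<in> A - dm \<alpha> \<and> v \<in> A - dm \<alpha>" if "b \<in> up \<alpha>" for b
  proof -
    have b: "Inl ` b \<in> \<alpha>" using that by (simp add: up_def)
    obtain p q where pq: "Inl ` b = {p, q}" "p \<noteq> q" "p \<in> A <+> B" "q \<in> A <+> B" using matchingE[OF m b] .
    then obtain u v where uv: "p = Inl u" "q = Inl v" by blast
    have "(Inl ` b :: ('a + 'a) set) = Inl ` {u, v}" using pq uv by simp
    then have "b = {u, v}" using inj_image_eq_iff[OF inj_Inl] by metis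
    moreover have l: "{Inl u, Inl v} \<in> \<alpha>" "{Inl v, Inl u} \<in> \<alpha>" using b pq uv by (simp_all add: insert_commute)
    have "u \<notin> dm \<alpha>" "v \<notin> dm \<alpha>"
      using br_unique[OF a l(1)] br_unique[OF a l(2)] unfolding dm_def by blast+
    ultimately show ?thesis using pq uv by auto
  qed
  show "\<exists>v. {u, v} \<in> up \<alpha>" if u: "u \<in> A - dm \<alpha>" for u
  proof -
    obtain p where p: "{Inl u, p} \<in> \<alpha>" using matching_ex[OF m, of "Inl u"] u by blast
    then show ?thesis using u by (cases p) (auto simp: up_link dm_def)
  qed
  show "v = w" if "{u, v} \<in> up \<alpha>" "{u, w} \<in> up \<alpha>" for u v w
    using br_unique[OF a, of "Inl u" "Inl v" "Inl w"] that by (simp add: up_link)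
qed

lemma lo_matching: "\<alpha> \<in> br A B \<Longrightarrow> lo \<alpha> \<in> matching (B - cd \<alpha>)"
  using up_matching[OF star_br] by simp

lemma br_eqI:
  assumes "\<alpha> \<in> br A B" "\<beta> \<in> br A B" "up \<alpha> \<subseteq> up \<beta>" "lo \<alpha> \<subseteq> lo \<beta>"
    "\<And>a b. {Inl a, Inr b} \<in> \<alpha> \<Longrightarrow> {Inl a, Inr b} \<in> \<beta>"
  shows "\<alpha> = \<beta>"
proof (rule matching_eqI[OF br_matching br_matching, OF assms(1,2)])
  fix u v assume uv: "{u, v} \<in> \<alpha>"
  show "{u, v} \<in> \<beta>"
  proof (cases u; cases v)
    fix a b assume "u = Inl a" "v = Inl b"
    then show ?thesis using uv assms(3) by (metis up_link subsetD)
  next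
    fix a b assume "u = Inr a" "v = Inr b"
    then show ?thesis using uv assms(4) by (metis lo_link subsetD)
  next
    fix a b assume "u = Inl a" "v = Inr b"
    then show ?thesis using uv assms(5) by simp
  next
    fix a b assume "u = Inr a" "v = Inl b"
    then show ?thesis using uv assms(5)[of b a] by (simp add: insert_commute)
  qed
qed

lemma dm_eq: "\<alpha> \<in> br A B \<Longrightarrow> dm \<alpha> = A - \<Union>(up \<alpha>)"
  using matching_Union[OF up_matching, of \<alpha> A B] dm_subset[of \<alpha> A B] by blast

lemma cd_eq: "\<alpha> \<in> br A B \<Longrightarrow> cd \<alpha> = B - \<Union>(lo \<alpha>)"
  using matching_Union[OF lo_matching, of \<alpha> A B] cd_subset[of \<alpha> A B] by blast

lemma br_rank_dm:
  fixes \<alpha> :: "('a + 'a) set set"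
  assumes a: "\<alpha> \<in> br A B"
  shows "br_rank \<alpha> = card (dm \<alpha>)"
proof -
  let ?f = "\<lambda>p :: 'a \<times> 'a. {Inl (fst p), Inr (snd p)} :: ('a + 'a) set"
  define R where "R = {p. ?f p \<in> \<alpha>}"
  let ?T = "{b \<in> \<alpha>. b \<inter> range Inl \<noteq> {} \<and> b \<inter> range Inr \<noteq> {}}"
  have "?f ` R = ?T"
  proof (intro equalityI subsetI)
    fix b assume "b \<in> ?f ` R"
    then obtain p where "b = ?f p" "?f p \<in> \<alpha>" unfolding R_def by blast
    then show "b \<in> ?T" by simp
  next
    fix b assume b: "b \<in> ?T"
    then obtain u v where uv: "Inl u \<in> b" "Inr v \<in> b" by blast
    obtain p q where pq: "b = {p, q}" using matchingE[OF br_matching[OF a], of b] b by blast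
    have "b = ?f (u, v)" using uv unfolding pq by auto
    then show "b \<in> ?f ` R" using b unfolding R_def by blast
  qed
  moreover have "inj_on ?f R"
    by (rule inj_onI) (auto simp: doubleton_eq_iff prod_eq_iff)
  then have "card (?f ` R) = card R" by (rule card_image)
  ultimately have "card ?T = card R" by simp
  moreover have "inj_on fst R"
  proof (rule inj_onI)
    fix p q assume "p \<in> R" "q \<in> R" "fst p = fst q"
    then show "p = q"
      using br_unique[OF a, of "Inl (fst p)" "Inr (snd p)" "Inr (snd q)"] by (simp add: R_def prod_eq_iff)
  qed
  moreover have "fst ` R = dm \<alpha>" unfolding R_def dm_def by (auto simp: image_iff)
  ultimately show ?thesis unfolding br_rank_def by (metis card_image)
qed

lemma br_rank_star [simp]:
  fixes \<alpha> :: "('a + 'a) set set"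
  shows "br_rank (star \<alpha>) = br_rank \<alpha>"
proof -
  have inj: "inj swap_sum" by (rule injI) (metis swap_sum_swap_sum)
  have r: "range Inl = swap_sum ` range Inr" "range Inr = swap_sum ` range Inl"
    by (simp_all add: image_image)
  have *: "swap_sum ` b \<inter> range Inl \<noteq> {} \<longleftrightarrow> b \<inter> range Inr \<noteq> {}"
       "swap_sum ` b \<inter> range Inr \<noteq> {} \<longleftrightarrow> b \<inter> range Inl \<noteq> {}" for b :: "('a + 'a) set"
  proof -
    have "swap_sum ` b \<inter> range Inl = swap_sum ` (b \<inter> range Inr)" "swap_sum ` b \<inter> range Inr = swap_sum ` (b \<inter> range Inl)"
      unfolding image_Int[OF inj] using r by metis+
    then show "swap_sum ` b \<inter> range Inl \<noteq> {} \<longleftrightarrow> b \<inter> range Inr \<noteq> {}"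
       "swap_sum ` b \<inter> range Inr \<noteq> {} \<longleftrightarrow> b \<inter> range Inl \<noteq> {}" by simp_all
  qed
  have "{b \<in> star \<alpha>. b \<inter> range Inl \<noteq> {} \<and> b \<inter> range Inr \<noteq> {}} =
    image swap_sum ` {b \<in> \<alpha>. b \<inter> range Inl \<noteq> {} \<and> b \<inter> range Inr \<noteq> {}}"
    unfolding star_def Compr_image_eq using * by (simp add: conj_commute)
  moreover have "card (image swap_sum ` S) = card S" for S :: "('a + 'a) set set"
    by (rule card_image, rule inj_onI) (simp add: inj_image_eq_iff[OF inj])
  ultimately show ?thesis unfolding br_rank_def by simp
qed

lemma br_rank_cd: "\<alpha> \<in> br A B \<Longrightarrow> br_rank \<alpha> = card (cd \<alpha>)"
  using br_rank_dm[OF star_br] by fastforce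

lemma br_card:
  assumes a: "\<alpha> \<in> br A B"
  shows "card A = br_rank \<alpha> + 2 * card (up \<alpha>)" "card B = br_rank \<alpha> + 2 * card (lo \<alpha>)"
proof -
  have *: "card A = br_rank \<alpha> + 2 * card (up \<alpha>)" if a: "\<alpha> \<in> br A B" for \<alpha> A B
  proof -
    have f: "finite A" using br_finite[OF a] by simp
    have "card (A - dm \<alpha>) = 2 * card (up \<alpha>)" using card_matching[OF up_matching[OF a]] f by simp
    moreover have "card A = card (dm \<alpha>) + card (A - dm \<alpha>)"
      using f dm_subset[OF a] by (metis card_Diff_subset card_mono finite_subset le_add_diff_inverse)
    ultimately show ?thesis using br_rank_dm[OF a] by simp
  qed
  from *[OF a] show "card A = br_rank \<alpha> + 2 * card (up \<alpha>)" .
  from *[OF star_br[OF a]] show "card B = br_rank \<alpha> + 2 * card (lo \<alpha>)" by simp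
qed

lemma br_rank_even: "\<alpha> \<in> br A B \<Longrightarrow> even (br_rank \<alpha>)"
  using br_card(1)[of \<alpha> A B] br_finite(3)[of \<alpha> A B] by auto

section \<open>Constructing Brauer partitions\<close>

definition mk_br :: "'a set set \<Rightarrow> 'a set \<Rightarrow> ('a \<Rightarrow> 'a) \<Rightarrow> 'a set set \<Rightarrow> ('a + 'a) set set" where
  "mk_br U D g L = image Inl ` U \<union> (\<lambda>a. {Inl a, Inr (g a)}) ` D \<union> image Inr ` L"

lemma mem_mk_br:
  assumes "c \<noteq> {}"
  shows "Inl ` c \<in> mk_br U D g L \<longleftrightarrow> c \<in> U" "Inr ` c \<in> mk_br U D g L \<longleftrightarrow> c \<in> L"
proof -
  have inj: "inj (image Inl :: 'a set \<Rightarrow> ('a + 'a) set)" "inj (image Inr :: 'a set \<Rightarrow> ('a + 'a) set)"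
    by (simp_all add: inj_image_eq_iff inj_def)
  obtain x where x: "x \<in> c" using assms by blast
  have 1: "Inl ` c \<notin> (\<lambda>a. {Inl a, Inr (g a)}) ` D" "Inr ` c \<notin> (\<lambda>a. {Inl a, Inr (g a)}) ` D"
    by blast+
  have 2: "Inl ` c \<notin> image Inr ` L" "Inr ` c \<notin> image Inl ` U" using x by blast+
  show "Inl ` c \<in> mk_br U D g L \<longleftrightarrow> c \<in> U" "Inr ` c \<in> mk_br U D g L \<longleftrightarrow> c \<in> L"
    unfolding mk_br_def Un_iff using 1 2 inj_image_mem_iff[OF inj(1)] inj_image_mem_iff[OF inj(2)] by simp_all
qed

lemma mk_br_links:
  "{Inl a, Inl b} \<in> mk_br U D g L \<longleftrightarrow> {a, b} \<in> U"
  "{Inr a, Inr b} \<in> mk_br U D g L \<longleftrightarrow> {a, b} \<in> L"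
  "{Inl a, Inr b} \<in> mk_br U D g L \<longleftrightarrow> a \<in> D \<and> b = g a"
proof -
  show "{Inl a, Inl b} \<in> mk_br U D g L \<longleftrightarrow> {a, b} \<in> U" "{Inr a, Inr b} \<in> mk_br U D g L \<longleftrightarrow> {a, b} \<in> L"
    using mem_mk_br[of "{a, b}" U D g L] by simp_all
  have "{Inl a, Inr b} \<noteq> Inl ` c" "{Inl a, Inr b} \<noteq> Inr ` c" for c :: "'a set" by blast+
  then have "{Inl a, Inr b} \<in> mk_br U D g L \<longleftrightarrow> {Inl a, Inr b} \<in> (\<lambda>a. {Inl a, Inr (g a)}) ` D"
    unfolding mk_br_def by blast
  also have "\<dots> \<longleftrightarrow> a \<in> D \<and> b = g a"
  proof
    assume "{Inl a, Inr b} \<in> (\<lambda>a. {Inl a, Inr (g a)}) ` D"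
    then obtain c where "c \<in> D" "{Inl a, Inr b} = {Inl c, Inr (g c)}" by (rule imageE)
    then show "a \<in> D \<and> b = g a" by (simp add: doubleton_eq_iff)
  qed blast
  finally show "{Inl a, Inr b} \<in> mk_br U D g L \<longleftrightarrow> a \<in> D \<and> b = g a" .
qed

lemma mk_br_br:
  assumes U: "U \<in> matching (A - D)" and L: "L \<in> matching (B - g ` D)"
    and g: "inj_on g D" "D \<subseteq> A" "g ` D \<subseteq> B"
    and fin: "finite A" "finite B" "even (card A)" "even (card B)"
  shows "mk_br U D g L \<in> br A B"
proof (rule brI[OF matchingI])
  let ?m = "mk_br U D g L"
  show "\<exists>u v. b = {u, v} \<and> u \<noteq> v \<and> u \<in> A <+> B \<and> v \<in> A <+> B" if "b \<in> ?m" for b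
    using that unfolding mk_br_def
  proof (elim UnE imageE)
    fix c assume c: "b = Inl ` c" "c \<in> U"
    obtain u v where "c = {u, v}" "u \<noteq> v" "u \<in> A - D" "v \<in> A - D" using matchingE[OF U c(2)] .
    then show ?thesis using c by (intro exI[of _ "Inl u"] exI[of _ "Inl v"]) auto
  next
    fix c assume c: "b = Inr ` c" "c \<in> L"
    obtain u v where "c = {u, v}" "u \<noteq> v" "u \<in> B - g ` D" "v \<in> B - g ` D" using matchingE[OF L c(2)] .
    then show ?thesis using c by (intro exI[of _ "Inr u"] exI[of _ "Inr v"]) auto
  next
    fix a assume "b = {Inl a, Inr (g a)}" "a \<in> D"
    then show ?thesis using g by (intro exI[of _ "Inl a"] exI[of _ "Inr (g a)"]) auto
  qed
  show "\<exists>v. {u, v} \<in> ?m" if u: "u \<in> A <+> B" for u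
  proof (cases u)
    case (Inl a)
    show ?thesis
    proof (cases "a \<in> D")
      case True
      then show ?thesis using mk_br_links(3)[of a "g a"] Inl by blast
    next
      case False
      then obtain b where "{a, b} \<in> U" using matching_ex[OF U, of a] u Inl by blast
      then show ?thesis using mk_br_links(1)[of a b] Inl by blast
    qed
  next
    case (Inr b)
    show ?thesis
    proof (cases "b \<in> g ` D")
      case True
      then obtain a where "a \<in> D" "b = g a" by blast
      then have "{Inl a, Inr b} \<in> ?m" by (simp add: mk_br_links(3))
      then show ?thesis using Inr by (metis insert_commute)
    next
      case False
      then obtain a where "{b, a} \<in> L" using matching_ex[OF L, of b] u Inr by blast
      then show ?thesis using mk_br_links(2)[of b a] Inr by blast
    qed
  qed
  have rl: "{Inr b, Inl a} \<in> ?m \<longleftrightarrow> a \<in> D \<and> b = g a" for a b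
    using mk_br_links(3)[of a b U D g L] by (simp add: insert_commute)
  show "v = w" if uv: "{u, v} \<in> ?m" and uw: "{u, w} \<in> ?m" for u v w
  proof (cases u)
    case u: (Inl a)
    have "\<not> (a \<in> D \<and> {a, b} \<in> U)" for b using matching_linkD[OF U, of a b] by blast
    moreover have "{a, b} \<in> U \<Longrightarrow> {a, c} \<in> U \<Longrightarrow> b = c" for b c using matching_unique[OF U] .
    ultimately show ?thesis using uv uw
      unfolding u by (cases v; cases w; simp only: mk_br_links) blast+
  next
    case u: (Inr b)
    have 1: "\<not> (b \<in> g ` D \<and> {b, c} \<in> L)" for c using matching_linkD[OF L, of b c] by blast
    have 2: "{b, c} \<in> L \<Longrightarrow> {b, d} \<in> L \<Longrightarrow> d = c" for c d using matching_unique[OF L] by blast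
    have 3: "c \<in> D \<Longrightarrow> d \<in> D \<Longrightarrow> g c = g d \<Longrightarrow> c = d" for c d using g(1) by (auto dest: inj_onD)
    show ?thesis using uv uw 1 2
      unfolding u by (cases v; cases w; simp only: mk_br_links rl) (use 3 in blast)+
  qed
qed (use fin in auto)

text \<open>The empty set has to be kept out because its images under \<open>Inl\<close> and
  \<open>Inr\<close> coincide and could not be attributed to one side.\<close>

lemma mk_br_parts:
  assumes "{} \<notin> U" "{} \<notin> L"
  shows "up (mk_br U D g L) = U" "lo (mk_br U D g L) = L"
    and "dm (mk_br U D g L) = D" "cd (mk_br U D g L) = g ` D"
proof -
  have 1: "Inl ` {} \<notin> mk_br U D g L" "Inr ` {} \<notin> mk_br U D g L"
    using assms unfolding mk_br_def by (simp_all add: image_iff)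
  have "c \<in> up (mk_br U D g L) \<longleftrightarrow> c \<in> U" "c \<in> lo (mk_br U D g L) \<longleftrightarrow> c \<in> L" for c
    using mem_mk_br[of c U D g L] 1 assms unfolding up_def lo_def by (cases "c = {}"; simp)+
  then show "up (mk_br U D g L) = U" "lo (mk_br U D g L) = L" by blast+
  show "dm (mk_br U D g L) = D" "cd (mk_br U D g L) = g ` D"
    by (auto simp: dm_def cd_def mk_br_links)
qed

lemma matching_no_empty: "M \<in> matching V \<Longrightarrow> {} \<notin> M"
  by (auto simp: matching_def partition_on_def)

section \<open>Kernels and ranks of products\<close>

context
  fixes \<alpha> \<beta> :: "('a + 'a) set set" and A B D :: "'a set"
  assumes \<alpha>: "\<alpha> \<in> br A B" and \<beta>: "\<beta> \<in> br B D"
begin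

lemma up_prd: "up \<alpha> \<subseteq> up (br_prd \<alpha> \<beta>)"
proof
  fix c assume c: "c \<in> up \<alpha>"
  obtain u v where "c = {u, v}" using matchingE[OF up_matching[OF \<alpha>] c] by metis
  then show "c \<in> up (br_prd \<alpha> \<beta>)" using c link_ULU[OF \<alpha> \<beta>] by (simp add: up_link)
qed

lemma lo_prd: "lo \<beta> \<subseteq> lo (br_prd \<alpha> \<beta>)"
proof
  fix c assume c: "c \<in> lo \<beta>"
  obtain u v where "c = {u, v}" using matchingE[OF lo_matching[OF \<beta>] c] by metis
  then show "c \<in> lo (br_prd \<alpha> \<beta>)" using c link_LRL[OF \<alpha> \<beta>] by (simp add: lo_link)
qed

lemma dm_prd: "dm (br_prd \<alpha> \<beta>) \<subseteq> dm \<alpha>"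
  using up_prd dm_eq[OF \<alpha>] dm_eq[OF br_prd_br[OF \<alpha> \<beta>]] by blast

lemma cd_prd: "cd (br_prd \<alpha> \<beta>) \<subseteq> cd \<beta>"
  using lo_prd cd_eq[OF \<beta>] cd_eq[OF br_prd_br[OF \<alpha> \<beta>]] by blast

lemma rank_prd_left: "br_rank (br_prd \<alpha> \<beta>) \<le> br_rank \<alpha>"
  unfolding br_rank_dm[OF \<alpha>] br_rank_dm[OF br_prd_br[OF \<alpha> \<beta>]]
  by (rule card_mono[OF _ dm_prd]) (use dm_subset[OF \<alpha>] br_finite[OF \<alpha>] finite_subset in blast)

lemma rank_prd_right: "br_rank (br_prd \<alpha> \<beta>) \<le> br_rank \<beta>"
  unfolding br_rank_cd[OF \<beta>] br_rank_cd[OF br_prd_br[OF \<alpha> \<beta>]]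
  by (rule card_mono[OF _ cd_prd]) (use cd_subset[OF \<beta>] br_finite[OF \<beta>] finite_subset in blast)

end

text \<open>More hooks leave fewer free points. The rank condition stops the domain from shrinking,
  and then both hook sets are matchings of the same set. Applied to products this is the stability
  of the \<J>-classes.\<close>

lemma up_subset_eq:
  assumes "\<alpha> \<in> br A B" "\<beta> \<in> br A D" "up \<alpha> \<subseteq> up \<beta>" "br_rank \<alpha> \<le> br_rank \<beta>"
  shows "up \<alpha> = up \<beta>"
proof (rule matching_subset_eq[OF up_matching[OF assms(1)] _ assms(3)])
  have "dm \<beta> \<subseteq> dm \<alpha>" using assms(3) dm_eq[OF assms(1)] dm_eq[OF assms(2)] by blast
  moreover have "finite (dm \<alpha>)" using dm_subset[OF assms(1)] br_finite[OF assms(1)] finite_subset by blast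
  ultimately have "dm \<beta> = dm \<alpha>"
    using assms(4) card_seteq by (metis br_rank_dm[OF assms(1)] br_rank_dm[OF assms(2)])
  then show "up \<beta> \<in> matching (A - dm \<alpha>)" using up_matching[OF assms(2)] by simp
qed

lemma lo_subset_eq:
  assumes "\<alpha> \<in> br B A" "\<beta> \<in> br D A" "lo \<alpha> \<subseteq> lo \<beta>" "br_rank \<alpha> \<le> br_rank \<beta>"
  shows "lo \<alpha> = lo \<beta>"
  using up_subset_eq[OF star_br[OF assms(1)] star_br[OF assms(2)]] assms by simp

lemma rank_eq_up:
  assumes "\<alpha> \<in> br A B" "\<beta> \<in> br B D" "br_rank (br_prd \<alpha> \<beta>) = br_rank \<alpha>"
  shows "up (br_prd \<alpha> \<beta>) = up \<alpha>"
  using up_subset_eq[OF assms(1) br_prd_br[OF assms(1,2)] up_prd[OF assms(1,2)]] assms(3) by simp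

lemma rank_eq_lo:
  assumes "\<alpha> \<in> br A B" "\<beta> \<in> br B D" "br_rank (br_prd \<alpha> \<beta>) = br_rank \<beta>"
  shows "lo (br_prd \<alpha> \<beta>) = lo \<beta>"
  using lo_subset_eq[OF assms(2) br_prd_br[OF assms(1,2)] lo_prd[OF assms(1,2)]] assms(3) by simp

text \<open>If the hooks that meet in the middle coincide, they only close up cycles, and the
  transversals are joined end to end. Nothing is lost on either side.\<close>

lemma matched_rank:
  assumes "\<alpha> \<in> br A B" "\<beta> \<in> br B D" "up \<beta> = lo \<alpha>"
  shows "br_rank (br_prd \<alpha> \<beta>) = br_rank \<alpha>" "br_rank \<beta> = br_rank \<alpha>"
    "up (br_prd \<alpha> \<beta>) = up \<alpha>" "lo (br_prd \<alpha> \<beta>) = lo \<beta>"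
proof -
  have dc: "dm \<beta> = cd \<alpha>" using dm_eq[OF assms(2)] cd_eq[OF assms(1)] assms(3) by simp
  show rr: "br_rank \<beta> = br_rank \<alpha>" using br_rank_dm[OF assms(2)] br_rank_cd[OF assms(1)] dc by simp
  have "dm \<alpha> \<subseteq> dm (br_prd \<alpha> \<beta>)"
  proof
    fix a assume "a \<in> dm \<alpha>"
    then obtain b where b: "{Inl a, Inr b} \<in> \<alpha>" by (auto simp: dm_def)
    then have "b \<in> dm \<beta>" using dc by (auto simp: cd_def)
    then obtain d where "{Inl b, Inr d} \<in> \<beta>" by (auto simp: dm_def)
    then show "a \<in> dm (br_prd \<alpha> \<beta>)" using link_through[OF assms(1,2) b] by (auto simp: dm_def)
  qed
  then have "dm (br_prd \<alpha> \<beta>) = dm \<alpha>" using dm_prd[OF assms(1,2)] by blast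
  then show r: "br_rank (br_prd \<alpha> \<beta>) = br_rank \<alpha>"
    by (simp add: br_rank_dm[OF assms(1)] br_rank_dm[OF br_prd_br[OF assms(1,2)]])
  show "up (br_prd \<alpha> \<beta>) = up \<alpha>" by (rule rank_eq_up[OF assms(1,2) r])
  show "lo (br_prd \<alpha> \<beta>) = lo \<beta>" by (rule rank_eq_lo[OF assms(1,2)]) (simp add: r rr)
qed

text \<open>The product of \<alpha> with its reflection is a projection: it acts as the identity on
  the domain of \<alpha> and carries the upper hooks of \<alpha>. An element that already has these
  hooks does not notice it. This is the source of all factorisations below.\<close>

lemma proj_absorb:
  assumes "\<alpha> \<in> br A B" "\<beta> \<in> br A D" "up \<alpha> \<subseteq> up \<beta>"
  shows "br_prd (br_prd \<alpha> (star \<alpha>)) \<beta> = \<beta>"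
proof -
  note sa = star_br[OF assms(1)]
  let ?p = "br_prd \<alpha> (star \<alpha>)"
  have p: "?p \<in> br A A" by (rule br_prd_br[OF assms(1) sa])
  have pl: "{Inl a, Inr a} \<in> ?p" if "a \<in> dm \<alpha>" for a
    using that link_through[OF assms(1) sa] by (auto simp: dm_def)
  have ppu: "{Inl a, Inl b} \<in> ?p" if "{a, b} \<in> up \<alpha>" for a b
    using that link_ULU[OF assms(1) sa] by (simp add: up_link)
  have "\<beta> = br_prd ?p \<beta>"
  proof (rule br_eqI[OF assms(2) br_prd_br[OF p assms(2)]])
    show "up \<beta> \<subseteq> up (br_prd ?p \<beta>)"
    proof
      fix c assume c: "c \<in> up \<beta>"
      obtain u v where uv: "c = {u, v}" "u \<in> A - dm \<beta>" "v \<in> A - dm \<beta>"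
        using matchingE[OF up_matching[OF assms(2)] c] by metis
      then have uvb: "{Inl u, Inl v} \<in> \<beta>" using c by (simp add: up_link)
      show "c \<in> up (br_prd ?p \<beta>)"
      proof (cases "c \<in> up \<alpha>")
        case True
        then show ?thesis using link_ULU[OF p assms(2)] ppu uv(1) by (simp add: up_link)
      next
        case False
        \<comment> \<open>A point outside the domain is hooked by \<alpha>, and by inclusion in the
          same way by \<beta>; the hook c would then belong to \<alpha>.\<close>
        have "u \<in> dm \<alpha>"
        proof (rule ccontr)
          assume "u \<notin> dm \<alpha>"
          then obtain w where "{u, w} \<in> up \<alpha>"
            using matching_ex[OF up_matching[OF assms(1)], of u] uv(2) by blast
          moreover have "w = v" using matching_unique[OF up_matching[OF assms(2)], of u w v]
              calculation assms(3) c uv(1) by blast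
          ultimately show False using False uv(1) by simp
        qed
        moreover have "v \<in> dm \<alpha>"
        proof (rule ccontr)
          assume "v \<notin> dm \<alpha>"
          then obtain w where "{v, w} \<in> up \<alpha>"
            using matching_ex[OF up_matching[OF assms(1)], of v] uv(3) by blast
          moreover have "w = u" using matching_unique[OF up_matching[OF assms(2)], of v w u]
              calculation assms(3) c uv(1) by (auto simp: insert_commute)
          ultimately show False using False uv(1) by (simp add: insert_commute)
        qed
        ultimately show ?thesis using link_turn[OF p assms(2) pl uvb pl] uv(1) by (simp add: up_link)
      qed
    qed
    show "lo \<beta> \<subseteq> lo (br_prd ?p \<beta>)" by (rule lo_prd[OF p assms(2)])
    fix a b assume ab: "{Inl a, Inr b} \<in> \<beta>"
    then have "a \<in> dm \<beta>" by (auto simp: dm_def)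
    then have "a \<in> dm \<alpha>" using assms(3) dm_eq[OF assms(1)] dm_eq[OF assms(2)] by blast
    then show "{Inl a, Inr b} \<in> br_prd ?p \<beta>" by (rule link_through[OF p assms(2) pl ab])
  qed
  then show ?thesis by simp
qed

lemma proj_absorb_right:
  assumes "\<alpha> \<in> br B A" "\<beta> \<in> br D A" "lo \<alpha> \<subseteq> lo \<beta>"
  shows "br_prd \<beta> (br_prd (star \<alpha>) \<alpha>) = \<beta>"
proof -
  note sa = star_br[OF assms(1)] and sb = star_br[OF assms(2)]
  have "br_prd (br_prd (star \<alpha>) \<alpha>) (star \<beta>) = star \<beta>"
    using proj_absorb[OF sa sb] assms(3) by simp
  then have "star (br_prd (br_prd (star \<alpha>) \<alpha>) (star \<beta>)) = \<beta>" by simp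
  then show ?thesis
    using star_prd[OF br_prd_br[OF sa assms(1)] sb] star_prd[OF sa assms(1)] by simp
qed

text \<open>The domain of \<alpha> is mapped injectively into that of \<epsilon>, and the surplus
  free points of \<epsilon> are paired off arbitrarily.\<close>

lemma exists_connecting:
  assumes a: "\<alpha> \<in> br A B" and e: "\<epsilon> \<in> br X Y" and le: "br_rank \<alpha> \<le> br_rank \<epsilon>"
  shows "\<exists>\<gamma> \<in> br A X. up \<gamma> = up \<alpha> \<and> up \<epsilon> \<subseteq> lo \<gamma> \<and> br_rank \<gamma> = br_rank \<alpha>"
proof -
  have fa: "finite A" "even (card A)" and fx: "finite X" "even (card X)" using br_finite[OF a] br_finite[OF e] by auto
  have fd: "finite (dm \<alpha>)" "finite (dm \<epsilon>)"
    using dm_subset[OF a] dm_subset[OF e] fa fx finite_subset by blast+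
  have "card (dm \<alpha>) \<le> card (dm \<epsilon>)" using le by (simp add: br_rank_dm[OF a] br_rank_dm[OF e])
  then obtain D' where D': "D' \<subseteq> dm \<epsilon>" "card D' = card (dm \<alpha>)" by (meson obtain_subset_with_card_n)
  have fD': "finite D'" using D' fd finite_subset by blast
  obtain g where g: "bij_betw g (dm \<alpha>) D'" using D'(2) fd fD' finite_same_card_bij by metis
  \<comment> \<open>Both ranks are even, so the surplus can be matched.\<close>
  have "even (card (dm \<epsilon> - D'))"
    using br_rank_even[OF a] br_rank_even[OF e] D' fd fD'
    by (simp add: br_rank_dm[OF a] br_rank_dm[OF e] card_Diff_subset)
  then obtain M where M: "M \<in> matching (dm \<epsilon> - D')" using matching_exists fd by blast
  have "up \<epsilon> \<union> M \<in> matching ((X - dm \<epsilon>) \<union> (dm \<epsilon> - D'))"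
    by (rule matching_Un[OF up_matching[OF e] M]) auto
  moreover have "(X - dm \<epsilon>) \<union> (dm \<epsilon> - D') = X - g ` dm \<alpha>"
    using D' dm_subset[OF e] g by (auto simp: bij_betw_def)
  ultimately have L: "up \<epsilon> \<union> M \<in> matching (X - g ` dm \<alpha>)" by simp
  let ?\<gamma> = "mk_br (up \<alpha>) (dm \<alpha>) g (up \<epsilon> \<union> M)"
  have gx: "g ` dm \<alpha> \<subseteq> X" using D' dm_subset[OF e] g by (auto simp: bij_betw_def)
  have \<gamma>: "?\<gamma> \<in> br A X"
    using mk_br_br[OF up_matching[OF a] L _ dm_subset[OF a] gx] g fa fx by (simp add: bij_betw_def)
  have "{} \<notin> up \<alpha>" "{} \<notin> up \<epsilon> \<union> M"
    using matching_no_empty[OF up_matching[OF a]] matching_no_empty[OF L] by blast+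
  note parts = mk_br_parts[OF this, of "dm \<alpha>" g]
  show ?thesis
    by (rule bexI[OF _ \<gamma>]) (use parts in \<open>auto simp: br_rank_dm[OF \<gamma>] br_rank_dm[OF a]\<close>)
qed

lemma exists_connecting_eq:
  assumes a: "\<alpha> \<in> br A B" and e: "\<epsilon> \<in> br X Y" and le: "br_rank \<alpha> = br_rank \<epsilon>"
  shows "\<exists>\<gamma> \<in> br A X. up \<gamma> = up \<alpha> \<and> lo \<gamma> = up \<epsilon>"
proof -
  obtain \<gamma> where g: "\<gamma> \<in> br A X" "up \<gamma> = up \<alpha>" "up \<epsilon> \<subseteq> lo \<gamma>" "br_rank \<gamma> = br_rank \<alpha>"
    using exists_connecting[OF a e] le by auto
  have "up \<epsilon> = up (star \<gamma>)"
    by (rule up_subset_eq[OF e star_br[OF g(1)]]) (use g le in auto)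
  then show ?thesis using g by auto
qed

text \<open>The connecting element \<gamma> is recovered from its product with \<epsilon>, so that
  product still has the rank and the upper hooks of \<alpha>; absorbing the projection then yields
  \<delta>. The rank bounds guarantee that both factors stay inside the ideal under
  consideration.\<close>

lemma factor_through:
  assumes a: "\<alpha> \<in> br A B" and e: "\<epsilon> \<in> br X Y" and le: "br_rank \<alpha> \<le> br_rank \<epsilon>"
  shows "\<exists>\<gamma> \<in> br A X. \<exists>\<delta> \<in> br Y B. br_prd (br_prd \<gamma> \<epsilon>) \<delta> = \<alpha> \<and>
    br_rank \<gamma> = br_rank \<alpha> \<and> br_rank \<delta> \<le> br_rank \<alpha>"
proof -
  obtain \<gamma> where g: "\<gamma> \<in> br A X" "up \<gamma> = up \<alpha>" "up \<epsilon> \<subseteq> lo \<gamma>" "br_rank \<gamma> = br_rank \<alpha>"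
    using exists_connecting[OF a e le] by auto
  note se = star_br[OF e]
  let ?z = "br_prd \<gamma> \<epsilon>"
  have z: "?z \<in> br A Y" by (rule br_prd_br[OF g(1) e])
  have "br_prd \<gamma> (br_prd \<epsilon> (star \<epsilon>)) = \<gamma>"
    using proj_absorb_right[OF se g(1)] g(3) by simp
  then have "br_prd ?z (star \<epsilon>) = \<gamma>" using br_prd_assoc[OF g(1) e se] by simp
  then have "br_rank \<gamma> \<le> br_rank ?z" using rank_prd_left[OF z se] by simp
  then have "br_rank ?z = br_rank \<gamma>" using rank_prd_left[OF g(1) e] by simp
  then have uz: "up ?z = up \<alpha>" using rank_eq_up[OF g(1) e] g(2) by simp
  note sz = star_br[OF z]
  have "br_prd (br_prd ?z (star ?z)) \<alpha> = \<alpha>" using proj_absorb[OF z a] uz by simp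
  then have "br_prd ?z (br_prd (star ?z) \<alpha>) = \<alpha>" using br_prd_assoc[OF z sz a] by simp
  then show ?thesis
    using g br_prd_br[OF sz a] rank_prd_right[OF sz a] by blast
qed

text \<open>Equality of lower hooks makes \<beta> a left multiple of \<alpha>, hence the product of
  \<beta> with \<zeta> a left multiple of that of \<alpha>. The situation is symmetric, so ranks and
  lower hooks agree.\<close>

lemma lo_eq_prd:
  assumes "\<alpha> \<in> br A B" "\<beta> \<in> br A' B" "lo \<alpha> = lo \<beta>" "\<zeta> \<in> br B D"
  shows "br_rank (br_prd \<alpha> \<zeta>) = br_rank (br_prd \<beta> \<zeta>)" "lo (br_prd \<alpha> \<zeta>) = lo (br_prd \<beta> \<zeta>)"
proof -
  have *: "br_rank (br_prd \<beta> \<zeta>) \<le> br_rank (br_prd \<alpha> \<zeta>) \<and> lo (br_prd \<alpha> \<zeta>) \<subseteq> lo (br_prd \<beta> \<zeta>)"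
    if a: "\<alpha> \<in> br A B" and b: "\<beta> \<in> br A' B" and eq: "lo \<alpha> = lo \<beta>" for \<alpha> \<beta> A A'
  proof -
    note sa = star_br[OF a]
    have "br_prd \<beta> (br_prd (star \<alpha>) \<alpha>) = \<beta>" using proj_absorb_right[OF a b] eq by simp
    then have "br_prd (br_prd \<beta> (star \<alpha>)) \<alpha> = \<beta>" using br_prd_assoc[OF b sa a] by simp
    then have eq: "br_prd \<beta> \<zeta> = br_prd (br_prd \<beta> (star \<alpha>)) (br_prd \<alpha> \<zeta>)"
      using br_prd_assoc[OF br_prd_br[OF b sa] a assms(4)] by simp
    show ?thesis unfolding eq
      using rank_prd_right[OF br_prd_br[OF b sa] br_prd_br[OF a assms(4)]]
        lo_prd[OF br_prd_br[OF b sa] br_prd_br[OF a assms(4)]] by blast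
  qed
  show "br_rank (br_prd \<alpha> \<zeta>) = br_rank (br_prd \<beta> \<zeta>)" "lo (br_prd \<alpha> \<zeta>) = lo (br_prd \<beta> \<zeta>)"
    using *[OF assms(1-3)] *[OF assms(2,1) assms(3)[symmetric]] by auto
qed

lemma up_eq_prd:
  assumes "\<alpha> \<in> br B A" "\<beta> \<in> br B A'" "up \<alpha> = up \<beta>" "\<zeta> \<in> br D B"
  shows "br_rank (br_prd \<zeta> \<alpha>) = br_rank (br_prd \<zeta> \<beta>)" "up (br_prd \<zeta> \<alpha>) = up (br_prd \<zeta> \<beta>)"
proof -
  have s: "br_prd (star \<alpha>) (star \<zeta>) = star (br_prd \<zeta> \<alpha>)" "br_prd (star \<beta>) (star \<zeta>) = star (br_prd \<zeta> \<beta>)"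
    using star_prd[OF assms(4,1)] star_prd[OF assms(4,2)] by simp_all
  note lo_eq_prd[OF star_br[OF assms(1)] star_br[OF assms(2)] _ star_br[OF assms(4)], unfolded s]
  then show "br_rank (br_prd \<zeta> \<alpha>) = br_rank (br_prd \<zeta> \<beta>)" "up (br_prd \<zeta> \<alpha>) = up (br_prd \<zeta> \<beta>)"
    using assms(3) by simp_all
qed

locale brauer_category =
  fixes C :: "'a set set"
  assumes C_nonempty: "C \<noteq> {}" and C_even: "\<And>A. A \<in> C \<Longrightarrow> finite A \<and> even (card A)"
begin

lemma rank_idealE:
  assumes "\<alpha> \<in> rank_ideal C r"
  obtains A B where "A \<in> C" "B \<in> C" "\<alpha> \<in> br A B" "enat (br_rank \<alpha>) \<le> r"
  using assms C_even by (auto simp: rank_ideal_def BrauerCat_def br_def)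

lemma rank_idealI: "A \<in> C \<Longrightarrow> B \<in> C \<Longrightarrow> \<alpha> \<in> br A B \<Longrightarrow> enat (br_rank \<alpha>) \<le> r \<Longrightarrow> \<alpha> \<in> rank_ideal C r"
  by (auto simp: rank_ideal_def BrauerCat_def br_def)

lemma I_psg_simps [simp]:
  "els (I_psg C r) = rank_ideal C r" "src (I_psg C r) = br_src" "rng (I_psg C r) = br_rng"
  "prd (I_psg C r) = br_prd"
  by (simp_all add: I_psg_def sub_psg_def BrauerCat_def)

lemma rank_ideal_src: "\<alpha> \<in> rank_ideal C r \<Longrightarrow> br_src \<alpha> \<in> C" "\<alpha> \<in> rank_ideal C r \<Longrightarrow> br_rng \<alpha> \<in> C"
  by (metis br_src br_rng rank_idealE)+

lemma rank_ideal_br: "\<alpha> \<in> rank_ideal C r \<Longrightarrow> \<alpha> \<in> br (br_src \<alpha>) (br_rng \<alpha>)"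
  by (metis br_src br_rng rank_idealE)

lemma rank_ideal_rank: "\<alpha> \<in> rank_ideal C r \<Longrightarrow> enat (br_rank \<alpha>) \<le> r"
  by (simp add: rank_ideal_def)

lemma rank_ideal_star: "\<alpha> \<in> rank_ideal C r \<Longrightarrow> star \<alpha> \<in> rank_ideal C r"
  by (metis br_rank_star rank_idealE rank_idealI star_br)

lemma rank_ideal_prd_left:
  assumes "\<alpha> \<in> rank_ideal C r" "\<beta> \<in> br (br_rng \<alpha>) B" "B \<in> C"
  shows "br_prd \<alpha> \<beta> \<in> rank_ideal C r"
  using rank_idealI[OF _ assms(3) br_prd_br[OF rank_ideal_br[OF assms(1)] assms(2)]]
    rank_ideal_src[OF assms(1)] rank_ideal_rank[OF assms(1)]
    rank_prd_left[OF rank_ideal_br[OF assms(1)] assms(2)] by (meson enat_ord_simps(1) order_trans)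

lemma rank_ideal_prd_right:
  assumes "\<alpha> \<in> rank_ideal C r" "\<beta> \<in> br B (br_src \<alpha>)" "B \<in> C"
  shows "br_prd \<beta> \<alpha> \<in> rank_ideal C r"
  using rank_idealI[OF assms(3) _ br_prd_br[OF assms(2) rank_ideal_br[OF assms(1)]]]
    rank_ideal_src[OF assms(1)] rank_ideal_rank[OF assms(1)]
    rank_prd_right[OF assms(2) rank_ideal_br[OF assms(1)]] by (meson enat_ord_simps(1) order_trans)

subsection \<open>Green's relations\<close>

lemma S1_ex: "(\<exists>b. b \<in> S1 S \<and> P b) \<longleftrightarrow> P None \<or> (\<exists>\<delta> \<in> els S. P (Some \<delta>))"
  by (auto simp: S1_def)

lemma mem_pright: "\<beta> \<in> pright (I_psg C r) \<alpha> \<longleftrightarrow>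
    \<beta> = \<alpha> \<or> (\<exists>\<delta> \<in> rank_ideal C r. br_rng \<alpha> = br_src \<delta> \<and> \<beta> = br_prd \<alpha> \<delta>)"
  unfolding pright_def mem_Collect_eq
  by (subst conj_commute, unfold conj_assoc S1_ex) (auto simp: sandwich_def sandwichable_def)

lemma mem_pleft: "\<beta> \<in> pleft (I_psg C r) \<alpha> \<longleftrightarrow>
    \<beta> = \<alpha> \<or> (\<exists>\<delta> \<in> rank_ideal C r. br_rng \<delta> = br_src \<alpha> \<and> \<beta> = br_prd \<delta> \<alpha>)"
  unfolding pleft_def mem_Collect_eq
  by (subst conj_commute, unfold conj_assoc S1_ex) (auto simp: sandwich_def sandwichable_def)

lemma mem_pideal: "\<beta> \<in> pideal (I_psg C r) \<alpha> \<longleftrightarrow>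
    \<beta> \<in> pright (I_psg C r) \<alpha> \<or>
    (\<exists>\<delta> \<in> rank_ideal C r. br_rng \<delta> = br_src \<alpha> \<and> (\<beta> = br_prd \<delta> \<alpha> \<or>
      (\<exists>\<eta> \<in> rank_ideal C r. br_rng \<alpha> = br_src \<eta> \<and> \<beta> = br_prd (br_prd \<delta> \<alpha>) \<eta>)))"
proof -
  have "\<beta> \<in> pideal (I_psg C r) \<alpha> \<longleftrightarrow> (\<exists>a. a \<in> S1 (I_psg C r) \<and> (\<exists>b. b \<in> S1 (I_psg C r) \<and>
      \<beta> = sandwich (I_psg C r) a \<alpha> b \<and> sandwichable (I_psg C r) a \<alpha> b))"
    unfolding pideal_def by blast
  then show ?thesis unfolding mem_pright S1_ex by (simp add: sandwich_def sandwichable_def) blast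
qed

text \<open>Given equal upper hooks, \<beta> is the product of \<alpha> with
  \<open>br_prd (star \<alpha>) \<beta>\<close>. The rank of this multiplier is at most that of
  \<alpha>, so Green's relation is the same in every ideal of bounded rank.\<close>

lemma green_R_iff: "(\<alpha>, \<beta>) \<in> green_R (I_psg C r) \<longleftrightarrow>
    \<alpha> \<in> rank_ideal C r \<and> \<beta> \<in> rank_ideal C r \<and> br_src \<alpha> = br_src \<beta> \<and> up \<alpha> = up \<beta>"
proof -
  have 1: "br_src \<alpha> = br_src \<beta> \<and> up \<beta> \<subseteq> up \<alpha>"
    if "\<alpha> \<in> rank_ideal C r" "\<beta> \<in> rank_ideal C r" "pright (I_psg C r) \<alpha> = pright (I_psg C r) \<beta>" for \<alpha> \<beta>
  proof -
    have "\<alpha> \<in> pright (I_psg C r) \<beta>" using that(3) mem_pright by blast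
    then consider "\<alpha> = \<beta>" | \<delta> where "\<delta> \<in> rank_ideal C r" "br_rng \<beta> = br_src \<delta>" "\<alpha> = br_prd \<beta> \<delta>"
      unfolding mem_pright by blast
    then show ?thesis
    proof cases
      case 2
      note b = rank_ideal_br[OF that(2)] and d = rank_ideal_br[OF 2(1)]
      have "\<alpha> \<in> br (br_src \<beta>) (br_rng \<delta>)" using br_prd_br[OF b] d 2 by simp
      moreover have "up \<beta> \<subseteq> up \<alpha>" using up_prd[OF b] d 2 by simp
      ultimately show ?thesis using br_src by blast
    qed simp
  qed
  have 2: "pright (I_psg C r) \<beta> \<subseteq> pright (I_psg C r) \<alpha>"
    if a: "\<alpha> \<in> rank_ideal C r" and b: "\<beta> \<in> rank_ideal C r" and eq: "br_src \<alpha> = br_src \<beta>" "up \<alpha> = up \<beta>" for \<alpha> \<beta>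
  proof
    fix \<gamma> assume g: "\<gamma> \<in> pright (I_psg C r) \<beta>"
    note ba = rank_ideal_br[OF a] and bb = rank_ideal_br[OF b]
    note sa = star_br[OF ba]
    have bb': "\<beta> \<in> br (br_src \<alpha>) (br_rng \<beta>)" using bb eq by simp
    have d: "br_prd (star \<alpha>) \<beta> \<in> br (br_rng \<alpha>) (br_rng \<beta>)" by (rule br_prd_br[OF sa bb'])
    have "br_prd (br_prd \<alpha> (star \<alpha>)) \<beta> = \<beta>" using proj_absorb[OF ba bb'] eq by simp
    then have be: "\<beta> = br_prd \<alpha> (br_prd (star \<alpha>) \<beta>)" using br_prd_assoc[OF ba sa bb'] by simp
    have sar: "star \<alpha> \<in> rank_ideal C r" "br_rng (star \<alpha>) = br_src \<alpha>"
      using rank_ideal_star[OF a] br_rng[OF sa] by simp_all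
    have dr: "br_prd (star \<alpha>) \<beta> \<in> rank_ideal C r"
      by (rule rank_ideal_prd_left[OF sar(1), of \<beta> "br_rng \<beta>"]) (use bb' sar rank_ideal_src[OF b] in auto)
    from g consider "\<gamma> = \<beta>" | \<delta> where "\<delta> \<in> rank_ideal C r" "br_rng \<beta> = br_src \<delta>" "\<gamma> = br_prd \<beta> \<delta>"
      unfolding mem_pright by blast
    then show "\<gamma> \<in> pright (I_psg C r) \<alpha>"
    proof cases
      case 1
      then show ?thesis unfolding mem_pright using be dr br_src[OF d] by metis
    next
      case 2
      have bd: "\<delta> \<in> br (br_rng \<beta>) (br_rng \<delta>)" using rank_ideal_br[OF 2(1)] 2(2) by simp
      have "\<gamma> = br_prd \<alpha> (br_prd (br_prd (star \<alpha>) \<beta>) \<delta>)"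
        using br_prd_assoc[OF ba d bd] be 2(3) by simp
      moreover have "br_prd (br_prd (star \<alpha>) \<beta>) \<delta> \<in> rank_ideal C r"
        by (rule rank_ideal_prd_left[OF dr, of \<delta> "br_rng \<delta>"]) (use bd br_rng[OF d] rank_ideal_src[OF 2(1)] in auto)
      ultimately show ?thesis unfolding mem_pright using br_src[OF br_prd_br[OF d bd]] by metis
    qed
  qed
  show ?thesis unfolding green_R_def using 1[of \<alpha> \<beta>] 1[of \<beta> \<alpha>] 2[of \<alpha> \<beta>] 2[of \<beta> \<alpha>] by auto
qed

text \<open>Reflection carries left multiples to right multiples, which reduces \<L> to
  \<R>.\<close>

lemma pleft_star: "\<alpha> \<in> rank_ideal C r \<Longrightarrow> pleft (I_psg C r) \<alpha> = star ` pright (I_psg C r) (star \<alpha>)"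
proof -
  assume a: "\<alpha> \<in> rank_ideal C r"
  have src: "br_src (star \<delta>) = br_rng \<delta> \<and> br_rng (star \<delta>) = br_src \<delta>" if "\<delta> \<in> rank_ideal C r" for \<delta>
    using star_br[OF rank_ideal_br[OF that]] br_src br_rng by blast
  have prd: "star (br_prd (star \<alpha>) (star \<delta>)) = br_prd \<delta> \<alpha>" if "\<delta> \<in> rank_ideal C r" "br_rng \<delta> = br_src \<alpha>" for \<delta>
    using star_prd[of \<delta> "br_src \<delta>" "br_rng \<delta>" \<alpha> "br_rng \<alpha>"] rank_ideal_br[OF that(1)] rank_ideal_br[OF a] that(2)
    by (metis star_star)
  show ?thesis
  proof (intro equalityI subsetI)
    fix \<beta> assume "\<beta> \<in> pleft (I_psg C r) \<alpha>"
    then consider "\<beta> = \<alpha>" | \<delta> where "\<delta> \<in> rank_ideal C r" "br_rng \<delta> = br_src \<alpha>" "\<beta> = br_prd \<delta> \<alpha>"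
      unfolding mem_pleft by blast
    then show "\<beta> \<in> star ` pright (I_psg C r) (star \<alpha>)"
    proof cases
      case 1
      then show ?thesis using mem_pright[of "star \<alpha>" r "star \<alpha>"] star_star[of \<alpha>] by (metis image_eqI)
    next
      case 2
      have "br_prd (star \<alpha>) (star \<delta>) \<in> pright (I_psg C r) (star \<alpha>)"
        unfolding mem_pright using 2 src[OF 2(1)] src[OF a] rank_ideal_star[OF 2(1)] by metis
      then show ?thesis using prd[OF 2(1,2)] 2(3) by (metis image_eqI)
    qed
  next
    fix \<beta> assume "\<beta> \<in> star ` pright (I_psg C r) (star \<alpha>)"
    then obtain \<gamma> where g: "\<beta> = star \<gamma>" "\<gamma> \<in> pright (I_psg C r) (star \<alpha>)" by blast
    then consider "\<gamma> = star \<alpha>" | \<delta> where "\<delta> \<in> rank_ideal C r" "br_rng (star \<alpha>) = br_src \<delta>" "\<gamma> = br_prd (star \<alpha>) \<delta>"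
      unfolding mem_pright by blast
    then show "\<beta> \<in> pleft (I_psg C r) \<alpha>"
    proof cases
      case 1 then show ?thesis using g mem_pleft by simp
    next
      case 2
      have "br_rng (star \<delta>) = br_src \<alpha>" using src[OF 2(1)] src[OF a] 2(2) by simp
      moreover have "\<beta> = br_prd (star \<delta>) \<alpha>"
        using prd[OF rank_ideal_star[OF 2(1)] calculation] 2(3) g(1) by simp
      ultimately show ?thesis unfolding mem_pleft using rank_ideal_star[OF 2(1)] by blast
    qed
  qed
qed

lemma green_L_iff: "(\<alpha>, \<beta>) \<in> green_L (I_psg C r) \<longleftrightarrow>
    \<alpha> \<in> rank_ideal C r \<and> \<beta> \<in> rank_ideal C r \<and> br_rng \<alpha> = br_rng \<beta> \<and> lo \<alpha> = lo \<beta>"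
proof -
  have inj: "star ` P = star ` Q \<longleftrightarrow> P = Q" for P Q :: "('a + 'a) set set set"
    by (rule inj_image_eq_iff) (metis injI star_star)
  have "(\<alpha>, \<beta>) \<in> green_L (I_psg C r) \<longleftrightarrow>
      \<alpha> \<in> rank_ideal C r \<and> \<beta> \<in> rank_ideal C r \<and> (star \<alpha>, star \<beta>) \<in> green_R (I_psg C r)"
    unfolding green_L_def green_R_def using pleft_star[of _ r] inj rank_ideal_star[of _ r] by auto
  moreover have "br_src (star \<delta>) = br_rng \<delta>" if "\<delta> \<in> rank_ideal C r" for \<delta>
    using star_br[OF rank_ideal_br[OF that]] br_src by blast
  ultimately show ?thesis unfolding green_R_iff using rank_ideal_star by auto
qed

text \<open>Products cannot raise the rank, and \<open>factor_through\<close> produces every element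
  of equal rank. The factors it supplies have rank at most that of \<alpha>, so they are available
  in the ideal itself.\<close>

lemma green_J_iff: "(\<alpha>, \<beta>) \<in> green_J (I_psg C r) \<longleftrightarrow>
    \<alpha> \<in> rank_ideal C r \<and> \<beta> \<in> rank_ideal C r \<and> br_rank \<alpha> = br_rank \<beta>"
proof -
  have 0: "br_rank \<beta> \<le> br_rank \<alpha>"
    if a: "\<alpha> \<in> rank_ideal C r" and b: "\<beta> \<in> pideal (I_psg C r) \<alpha>" for \<alpha> \<beta>
  proof -
    note ba = rank_ideal_br[OF a]
    have r: "br_rank (br_prd \<alpha> \<delta>) \<le> br_rank \<alpha>" if "\<delta> \<in> rank_ideal C r" "br_rng \<alpha> = br_src \<delta>" for \<delta>
      using rank_prd_left[OF ba] rank_ideal_br[OF that(1)] that(2) by simp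
    have l: "br_rank (br_prd \<delta> \<alpha>) \<le> br_rank \<alpha> \<and> br_prd \<delta> \<alpha> \<in> br (br_src \<delta>) (br_rng \<alpha>)"
      if "\<delta> \<in> rank_ideal C r" "br_rng \<delta> = br_src \<alpha>" for \<delta>
      using rank_prd_right[OF _ ba] br_prd_br[OF _ ba] rank_ideal_br[OF that(1)] that(2) by simp
    have lr: "br_rank (br_prd (br_prd \<delta> \<alpha>) \<eta>) \<le> br_rank \<alpha>"
      if "\<delta> \<in> rank_ideal C r" "br_rng \<delta> = br_src \<alpha>" "\<eta> \<in> rank_ideal C r" "br_rng \<alpha> = br_src \<eta>" for \<delta> \<eta>
    proof -
      have "\<eta> \<in> br (br_rng \<alpha>) (br_rng \<eta>)" using rank_ideal_br[OF that(3)] that(4) by simp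
      from rank_prd_left[OF conjunct2[OF l[OF that(1,2)]] this] l[OF that(1,2)] show ?thesis by linarith
    qed
    from b show ?thesis unfolding mem_pideal mem_pright using r l lr by blast
  qed
  have self: "\<alpha> \<in> pideal (I_psg C r) \<alpha>" for \<alpha> unfolding mem_pideal mem_pright by blast
  have 2: "pideal (I_psg C r) \<alpha> \<subseteq> pideal (I_psg C r) \<beta>"
    if a: "\<alpha> \<in> rank_ideal C r" and b: "\<beta> \<in> rank_ideal C r" and eq: "br_rank \<alpha> = br_rank \<beta>" for \<alpha> \<beta>
  proof
    fix \<zeta> assume z: "\<zeta> \<in> pideal (I_psg C r) \<alpha>"
    note ba = rank_ideal_br[OF a] and bb = rank_ideal_br[OF b]
    obtain \<gamma> \<delta> where gd: "\<gamma> \<in> br (br_src \<alpha>) (br_src \<beta>)" "\<delta> \<in> br (br_rng \<beta>) (br_rng \<alpha>)"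
      "br_prd (br_prd \<gamma> \<beta>) \<delta> = \<alpha>" "br_rank \<gamma> = br_rank \<alpha>" "br_rank \<delta> \<le> br_rank \<alpha>"
      using factor_through[OF ba bb] eq by auto
    have le: "enat (br_rank \<gamma>) \<le> r" "enat (br_rank \<delta>) \<le> r"
      using rank_ideal_rank[OF a] gd(4,5) by (metis enat_ord_simps(1) order_trans)+
    have in_r: "\<gamma> \<in> rank_ideal C r" "\<delta> \<in> rank_ideal C r"
      using rank_idealI[OF _ _ gd(1) le(1)] rank_idealI[OF _ _ gd(2) le(2)] rank_ideal_src[OF a] rank_ideal_src[OF b]
      by auto
    have main: "br_prd (br_prd \<gamma>' \<beta>) \<delta>' \<in> pideal (I_psg C r) \<beta>"
      if "\<gamma>' \<in> rank_ideal C r" "\<delta>' \<in> rank_ideal C r" "br_rng \<gamma>' = br_src \<beta>" "br_rng \<beta> = br_src \<delta>'" for \<gamma>' \<delta>'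
      unfolding mem_pideal using that by blast
    note gb = br_prd_br[OF gd(1) bb]
    have right: "br_prd \<alpha> \<eta> = br_prd (br_prd \<gamma> \<beta>) (br_prd \<delta> \<eta>) \<and> br_prd \<delta> \<eta> \<in> rank_ideal C r \<and> br_src (br_prd \<delta> \<eta>) = br_rng \<beta>"
      if "\<eta> \<in> rank_ideal C r" "br_rng \<alpha> = br_src \<eta>" for \<eta>
    proof -
      have e: "\<eta> \<in> br (br_rng \<alpha>) (br_rng \<eta>)" using rank_ideal_br[OF that(1)] that(2) by simp
      show ?thesis using br_prd_assoc[OF gb gd(2) e] gd(3) br_src[OF br_prd_br[OF gd(2) e]]
          rank_ideal_prd_left[OF in_r(2), of \<eta>] e br_rng[OF gd(2)] rank_ideal_src[OF that(1)] by auto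
    qed
    have left: "br_prd \<theta> (br_prd \<gamma> \<beta>) = br_prd (br_prd \<theta> \<gamma>) \<beta> \<and> br_prd \<theta> \<alpha> = br_prd (br_prd (br_prd \<theta> \<gamma>) \<beta>) \<delta> \<and>
        br_prd \<theta> \<gamma> \<in> rank_ideal C r \<and> br_rng (br_prd \<theta> \<gamma>) = br_src \<beta> \<and> br_prd \<theta> \<gamma> \<in> br (br_src \<theta>) (br_src \<beta>)"
      if "\<theta> \<in> rank_ideal C r" "br_rng \<theta> = br_src \<alpha>" for \<theta>
    proof -
      have e: "\<theta> \<in> br (br_src \<theta>) (br_src \<alpha>)" using rank_ideal_br[OF that(1)] that(2) by simp
      show ?thesis using br_prd_assoc[OF e gb gd(2)] br_prd_assoc[OF e gd(1) bb] gd(3) br_rng[OF br_prd_br[OF e gd(1)]]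
          rank_ideal_prd_right[OF in_r(1), of \<theta>] e br_src[OF gd(1)] rank_ideal_src[OF that(1)] br_prd_br[OF e gd(1)] by auto
    qed
    have src: "br_rng \<gamma> = br_src \<beta>" "br_rng \<beta> = br_src \<delta>" using br_rng[OF gd(1)] br_src[OF gd(2)] by simp_all
    from z consider "\<zeta> = \<alpha>" | \<eta> where "\<eta> \<in> rank_ideal C r" "br_rng \<alpha> = br_src \<eta>" "\<zeta> = br_prd \<alpha> \<eta>"
      | \<theta> where "\<theta> \<in> rank_ideal C r" "br_rng \<theta> = br_src \<alpha>" "\<zeta> = br_prd \<theta> \<alpha>"
      | \<theta> \<eta> where "\<theta> \<in> rank_ideal C r" "br_rng \<theta> = br_src \<alpha>" "\<eta> \<in> rank_ideal C r" "br_rng \<alpha> = br_src \<eta>"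
        "\<zeta> = br_prd (br_prd \<theta> \<alpha>) \<eta>"
      unfolding mem_pideal mem_pright by blast
    then show "\<zeta> \<in> pideal (I_psg C r) \<beta>"
    proof cases
      case 1 then show ?thesis using main[OF in_r src] gd(3) by simp
    next
      case 2 then show ?thesis using main[OF in_r(1) _ src(1)] right[OF 2(1,2)] by simp
    next
      case 3 then show ?thesis using main[OF _ in_r(2) _ src(2)] left[OF 3(1,2)] by simp
    next
      case 4
      note l = left[OF 4(1,2)] and rr = right[OF 4(3,4)]
      have t: "br_prd \<theta> \<gamma> \<in> br (br_src \<theta>) (br_src \<beta>)" using l by blast
      have e: "\<eta> \<in> br (br_rng \<alpha>) (br_rng \<eta>)" using rank_ideal_br[OF 4(3)] 4(4) by simp
      have "\<zeta> = br_prd (br_prd (br_prd \<theta> \<gamma>) \<beta>) (br_prd \<delta> \<eta>)"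
        using br_prd_assoc[OF br_prd_br[OF t bb] gd(2) e] l 4(5) by simp
      then show ?thesis using main l rr by metis
    qed
  qed
  show ?thesis
  proof
    assume "(\<alpha>, \<beta>) \<in> green_J (I_psg C r)"
    then have *: "\<alpha> \<in> rank_ideal C r" "\<beta> \<in> rank_ideal C r" "pideal (I_psg C r) \<alpha> = pideal (I_psg C r) \<beta>"
      by (auto simp: green_J_def)
    then show "\<alpha> \<in> rank_ideal C r \<and> \<beta> \<in> rank_ideal C r \<and> br_rank \<alpha> = br_rank \<beta>"
      using 0[of \<alpha> \<beta>] 0[of \<beta> \<alpha>] self by (metis order_antisym)
  next
    assume "\<alpha> \<in> rank_ideal C r \<and> \<beta> \<in> rank_ideal C r \<and> br_rank \<alpha> = br_rank \<beta>"
    then show "(\<alpha>, \<beta>) \<in> green_J (I_psg C r)"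
      unfolding green_J_def using 2[of \<alpha> \<beta>] 2[of \<beta> \<alpha>] by auto
  qed
qed

end

section \<open>Group elements of rank \<open>q\<close>\<close>

lemma normal_sym_group_iff:
  "N \<lhd> sym_group n \<longleftrightarrow> id \<in> N \<and> (\<forall>\<pi>\<in>N. \<pi> permutes {1..n}) \<and> (\<forall>\<pi>\<in>N. \<forall>\<rho>\<in>N. \<pi> \<circ> \<rho> \<in> N) \<and>
    (\<forall>\<pi>\<in>N. inv' \<pi> \<in> N) \<and> (\<forall>\<pi>\<in>N. \<forall>\<rho>. \<rho> permutes {1..n} \<longrightarrow> \<rho> \<circ> \<pi> \<circ> inv' \<rho> \<in> N)"
proof -
  interpret G: group "sym_group n" by (rule sym_group_is_group)
  have inv: "\<pi> permutes {1..n} \<Longrightarrow> inv\<^bsub>sym_group n\<^esub> \<pi> = inv' \<pi>" for \<pi>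
    by (simp add: sym_group_carrier)
  show ?thesis (is "_ \<longleftrightarrow> ?R")
  proof
    assume N: "N \<lhd> sym_group n"
    then have sg: "subgroup N (sym_group n)" by (simp add: G.normal_inv_iff)
    have p: "\<pi> permutes {1..n}" if "\<pi> \<in> N" for \<pi>
      using subgroup.subset[OF sg] that by (auto simp: sym_group_carrier)
    show ?R
      using subgroup.one_closed[OF sg] subgroup.m_closed[OF sg] subgroup.m_inv_closed[OF sg] p inv
        N[unfolded G.normal_inv_iff] by (auto simp: sym_group_one sym_group_mult sym_group_carrier)
  next
    assume R: ?R
    have "subgroup N (sym_group n)"
      by (rule G.subgroupI) (use R inv in \<open>auto simp: sym_group_mult sym_group_carrier\<close>)
    then show "N \<lhd> sym_group n"
      unfolding G.normal_inv_iff using R inv by (auto simp: sym_group_mult sym_group_carrier)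
  qed
qed

locale brauer_objects = brauer_category C for C :: "'a set set" +
  fixes X :: "nat \<Rightarrow> 'a set" and x :: "nat \<Rightarrow> nat \<Rightarrow> 'a"
  assumes X_x: "enumerated_objects C X x"

text \<open>Here q is the rank of the group elements. A relation attached to the ideal of rank q - 2
  is therefore treated under q, and a pair (q, N) of the classification under q + 2.\<close>

locale brauer_rank = brauer_objects +
  fixes q :: nat
  assumes q: "even q" "enat q < xi C"
begin

abbreviation "Y \<equiv> X q"
abbreviation "e \<equiv> x q"
abbreviation "n \<equiv> card (X q)"
text \<open>The common set of upper, and also of lower, hooks of all elements of the group
  \<H>-class.\<close>

definition "U = (\<lambda>j. {e j, e (j + 1)}) ` {j. odd j \<and> q < j \<and> j < n}"
definition "p \<pi> = natural_perm X x q \<pi>"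

lemma Y: "Y \<in> C" "q \<le> n" "bij_betw e {1..n} Y"
  using X_x q by (auto simp: enumerated_objects_def)

lemma finY: "finite Y" "even n" using C_even[OF Y(1)] by auto

lemma e_inj: "i \<in> {1..n} \<Longrightarrow> j \<in> {1..n} \<Longrightarrow> e i = e j \<longleftrightarrow> i = j"
  using Y(3) by (auto simp: bij_betw_def dest: inj_onD)

lemma e_ran: "e ` {1..n} = Y" using Y(3) by (simp add: bij_betw_def)

lemma e_q: "e ` {1..q} \<subseteq> Y" using e_ran Y(2) by auto

lemma U_matching: "U \<in> matching (Y - e ` {1..q})"
proof -
  let ?J = "{j. odd j \<and> q < j \<and> j < n}"
  have "(\<lambda>j. {j, j + 1}) ` ?J \<in> matching {q + 1..n}"
  proof (rule matchingI)
    show "\<exists>u v. b = {u, v} \<and> u \<noteq> v \<and> u \<in> {q + 1..n} \<and> v \<in> {q + 1..n}" if "b \<in> (\<lambda>j. {j, j + 1}) ` ?J" for b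
      using that by (elim imageE) (rule exI, rule exI, erule conjI, auto)
    show "\<exists>v. {u, v} \<in> (\<lambda>j. {j, j + 1}) ` ?J" if u: "u \<in> {q + 1..n}" for u
    proof (cases "odd u")
      case True
      \<comment> \<open>An odd index differs from n, which is even, so its successor is still in
        range; an even index differs from q + 1, so its predecessor is.\<close>
      then have "u \<in> ?J" using u finY(2) by (cases "u = n") auto
      then show ?thesis by blast
    next
      case False
      moreover have "u \<noteq> q + 1" using False q(1) by auto
      ultimately obtain j where j: "u = j + 1" "odd j" "q < j" "j < n"
        using u by (cases u) auto
      then have "{j, u} \<in> (\<lambda>j. {j, j + 1}) ` ?J" by blast
      then show ?thesis unfolding insert_commute[of j u "{}"] ..
    qed
    show "v = w" if uv: "{u, v} \<in> (\<lambda>j. {j, j + 1}) ` ?J" and uw: "{u, w} \<in> (\<lambda>j. {j, j + 1}) ` ?J" for u v w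
    proof -
      obtain i where i: "odd i" "{u, v} = {i, i + 1}" using uv by blast
      obtain j where j: "odd j" "{u, w} = {j, j + 1}" using uw by blast
      show ?thesis using i j by (auto simp: doubleton_eq_iff)
    qed
  qed
  moreover have "inj_on e {q + 1..n}" using Y(3) by (auto simp: bij_betw_def intro: inj_on_subset)
  ultimately have "image e ` (\<lambda>j. {j, j + 1}) ` ?J \<in> matching (e ` {q + 1..n})"
    by (rule matching_image)
  moreover have "e ` {q + 1..n} = Y - e ` {1..q}"
  proof -
    have "{q + 1..n} = {1..n} - {1..q}" by auto
    then show ?thesis
      using inj_on_image_set_diff[of e "{1..n}" "{1..n}" "{1..q}"] Y(2,3) by (auto simp: bij_betw_def)
  qed
  moreover have "image e ` (\<lambda>j. {j, j + 1}) ` ?J = U" by (simp add: U_def image_image)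
  ultimately show ?thesis by simp
qed

lemma p_mk: "p \<pi> = mk_br U (e ` {1..q}) (\<lambda>a. e (\<pi> (the_inv_into {1..n} e a))) U"
proof -
  have inj: "inj_on e {1..n}" using Y(3) by (simp add: bij_betw_def)
  have "the_inv_into {1..n} e (e i) = i" if "i \<in> {1..q}" for i
    by (rule the_inv_into_f_f[OF inj]) (use that Y(2) in auto)
  then have "(\<lambda>a. {Inl a, Inr (e (\<pi> (the_inv_into {1..n} e a)))}) ` e ` {1..q} =
      (\<lambda>i. {Inl (e i), Inr (e (\<pi> i))}) ` {1..q}"
    unfolding image_image by (intro image_cong) auto
  also have "\<dots> = {{Inl (e i), Inr (e (\<pi> i))} | i. 1 \<le> i \<and> i \<le> q}" by auto
  moreover have "(image Inl ` U :: ('a + 'a) set set) = {{Inl (e j), Inl (e (j + 1))} | j. odd j \<and> q < j \<and> j < n}"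
    unfolding U_def image_image by auto
  moreover have "(image Inr ` U :: ('a + 'a) set set) = {{Inr (e j), Inr (e (j + 1))} | j. odd j \<and> q < j \<and> j < n}"
    unfolding U_def image_image by auto
  ultimately show ?thesis unfolding p_def natural_perm_def mk_br_def by (simp only: Un_ac)
qed

lemma
  assumes "\<pi> permutes {1..q}"
  shows p_br: "p \<pi> \<in> br Y Y" and p_up: "up (p \<pi>) = U" and p_lo: "lo (p \<pi>) = U"
    and p_dm: "dm (p \<pi>) = e ` {1..q}" and p_cd: "cd (p \<pi>) = e ` {1..q}"
    and p_rank: "br_rank (p \<pi>) = q"
    and p_link: "\<And>a b. {Inl a, Inr b} \<in> p \<pi> \<longleftrightarrow> (\<exists>i \<in> {1..q}. a = e i \<and> b = e (\<pi> i))"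
proof -
  let ?g = "\<lambda>a. e (\<pi> (the_inv_into {1..n} e a))"
  have inj: "inj_on e {1..n}" using Y(3) by (simp add: bij_betw_def)
  have inv: "the_inv_into {1..n} e (e i) = i" if "i \<in> {1..q}" for i
    by (rule the_inv_into_f_f[OF inj]) (use that Y(2) in auto)
  then have gi: "?g (e i) = e (\<pi> i)" if "i \<in> {1..q}" for i using that by simp
  have g: "?g ` e ` {1..q} = e ` {1..q}"
  proof -
    have "?g ` e ` {1..q} = e ` \<pi> ` {1..q}" unfolding image_image by (rule image_cong[OF refl]) (fact gi)
    then show ?thesis using permutes_image[OF assms] by simp
  qed
  have gj: "inj_on ?g (e ` {1..q})" by (rule eq_card_imp_inj_on) (simp_all only: g finite_imageI finite_atLeastAtMost)
  show br: "p \<pi> \<in> br Y Y" unfolding p_mk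
    by (rule mk_br_br) (use U_matching g gj e_q finY in auto)
  have "{} \<notin> U" using U_matching matching_no_empty by blast
  note parts = mk_br_parts[OF this this, of "e ` {1..q}" ?g, folded p_mk]
  show "up (p \<pi>) = U" "lo (p \<pi>) = U" "cd (p \<pi>) = e ` {1..q}" using parts g by simp_all
  show dm: "dm (p \<pi>) = e ` {1..q}" using parts by simp
  have "card (e ` {1..q}) = q" using card_image[OF inj_on_subset[OF inj, of "{1..q}"]] Y(2) by simp
  then show "br_rank (p \<pi>) = q" using br_rank_dm[OF br] dm by simp
  show "{Inl a, Inr b} \<in> p \<pi> \<longleftrightarrow> (\<exists>i \<in> {1..q}. a = e i \<and> b = e (\<pi> i))" for a b
    unfolding p_mk mk_br_links using gi by auto
qed

lemma p_inj: assumes "\<pi> permutes {1..q}" "\<rho> permutes {1..q}" "p \<pi> = p \<rho>" shows "\<pi> = \<rho>"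
proof (rule ext)
  fix i
  show "\<pi> i = \<rho> i"
  proof (cases "i \<in> {1..q}")
    case True
    then have "{Inl (e i), Inr (e (\<pi> i))} \<in> p \<rho>" using p_link[OF assms(1)] assms(3) by blast
    then obtain j where j: "j \<in> {1..q}" "e i = e j" "e (\<pi> i) = e (\<rho> j)" using p_link[OF assms(2)] by blast
    have "i = j" using j True Y(2) e_inj[of i j] by simp
    moreover have "\<pi> i \<in> {1..q}" "\<rho> j \<in> {1..q}"
      using permutes_in_image[OF assms(1)] permutes_in_image[OF assms(2)] True j(1) by simp_all
    ultimately show ?thesis using j(3) Y(2) e_inj[of "\<pi> i" "\<rho> j"] by simp
  next
    case False
    then show ?thesis using assms(1,2) by (simp add: permutes_not_in)
  qed
qed

text \<open>Diagrams compose from left to right and functions from right to left, whence the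
  reversed order. Normal subgroups are the same for either order.\<close>

lemma p_prd:
  assumes "\<pi> permutes {1..q}" "\<rho> permutes {1..q}"
  shows "br_prd (p \<pi>) (p \<rho>) = p (\<rho> \<circ> \<pi>)"
proof -
  note c = permutes_compose[OF assms]
  note a = p_br[OF assms(1)] and b = p_br[OF assms(2)]
  have "p (\<rho> \<circ> \<pi>) = br_prd (p \<pi>) (p \<rho>)"
  proof (rule br_eqI[OF p_br[OF c] br_prd_br[OF a b]])
    show "up (p (\<rho> \<circ> \<pi>)) \<subseteq> up (br_prd (p \<pi>) (p \<rho>))" using up_prd[OF a b] p_up assms c by simp
    show "lo (p (\<rho> \<circ> \<pi>)) \<subseteq> lo (br_prd (p \<pi>) (p \<rho>))" using lo_prd[OF a b] p_lo assms c by simp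
    fix u v assume "{Inl u, Inr v} \<in> p (\<rho> \<circ> \<pi>)"
    then obtain i where i: "i \<in> {1..q}" "u = e i" "v = e (\<rho> (\<pi> i))" unfolding p_link[OF c] by auto
    have "\<pi> i \<in> {1..q}" using permutes_in_image[OF assms(1)] i(1) by simp
    then have "{Inl u, Inr (e (\<pi> i))} \<in> p \<pi>" "{Inl (e (\<pi> i)), Inr v} \<in> p \<rho>"
      unfolding p_link[OF assms(1)] p_link[OF assms(2)] using i by blast+
    then show "{Inl u, Inr v} \<in> br_prd (p \<pi>) (p \<rho>)" by (rule link_through[OF a b])
  qed
  then show ?thesis by simp
qed

lemma p_star: assumes "\<pi> permutes {1..q}" shows "star (p \<pi>) = p (inv' \<pi>)"
proof (rule br_eqI[OF star_br[OF p_br[OF assms]] p_br[OF permutes_inv[OF assms]]])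
  show "up (star (p \<pi>)) \<subseteq> up (p (inv' \<pi>))" "lo (star (p \<pi>)) \<subseteq> lo (p (inv' \<pi>))"
    using p_up[OF assms] p_lo[OF assms] p_up[OF permutes_inv[OF assms]] p_lo[OF permutes_inv[OF assms]] by simp_all
  fix a b assume "{Inl a, Inr b} \<in> star (p \<pi>)"
  then have "{Inl b, Inr a} \<in> p \<pi>" by simp
  then obtain i where i: "i \<in> {1..q}" "b = e i" "a = e (\<pi> i)" unfolding p_link[OF assms] by blast
  then have "\<pi> i \<in> {1..q}" "b = e (inv' \<pi> (\<pi> i))"
    using permutes_in_image[OF assms] permutes_inverses(2)[OF assms] by simp_all
  then show "{Inl a, Inr b} \<in> p (inv' \<pi>)" unfolding p_link[OF permutes_inv[OF assms]] using i(3) by blast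
qed

text \<open>With hooks U on both sides the transversals form a bijection of the first q points onto
  themselves. This identifies the whole \<H>-class of the idempotent with the symmetric
  group.\<close>

lemma group_elem:
  assumes g: "\<gamma> \<in> br Y Y" and up: "up \<gamma> = U" and lo: "lo \<gamma> = U"
  obtains \<pi> where "\<pi> permutes {1..q}" "\<gamma> = p \<pi>"
proof -
  have idp: "id permutes {1..q}" by (rule permutes_id)
  have dc: "dm \<gamma> = e ` {1..q}" "cd \<gamma> = e ` {1..q}"
    using dm_eq[OF g] cd_eq[OF g] up lo dm_eq[OF p_br[OF idp]] p_up[OF idp] p_dm[OF idp] by simp_all
  have "\<exists>j \<in> {1..q}. {Inl (e i), Inr (e j)} \<in> \<gamma>" if "i \<in> {1..q}" for i
  proof -
    have "e i \<in> dm \<gamma>" using that dc by blast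
    then obtain b where b: "{Inl (e i), Inr b} \<in> \<gamma>" by (auto simp: dm_def)
    then have "b \<in> e ` {1..q}" unfolding dc(2)[symmetric] cd_def by blast
    then show ?thesis using b by auto
  qed
  then obtain f where f: "\<And>i. i \<in> {1..q} \<Longrightarrow> f i \<in> {1..q} \<and> {Inl (e i), Inr (e (f i))} \<in> \<gamma>" by metis
  define \<pi> where "\<pi> i = (if i \<in> {1..q} then f i else i)" for i
  have inj: "inj_on f {1..q}"
  proof (rule inj_onI)
    fix i j assume ij: "i \<in> {1..q}" "j \<in> {1..q}" "f i = f j"
    then have "Inl (e i) = (Inl (e j) :: 'a + 'a)"
      using br_unique'[OF g, of "Inl (e i)" "Inr (e (f i))" "Inl (e j)"] f[of i] f[of j] by simp
    then show "i = j" using e_inj[of i j] ij Y(2) by simp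
  qed
  have "bij_betw \<pi> {1..q} {1..q}"
    unfolding bij_betw_def
  proof
    show inj': "inj_on \<pi> {1..q}" using inj inj_on_cong[of "{1..q}" \<pi> f] unfolding \<pi>_def by simp
    show "\<pi> ` {1..q} = {1..q}"
      by (rule endo_inj_surj[OF _ _ inj']) (use f in \<open>auto simp: \<pi>_def\<close>)
  qed
  then have \<pi>: "\<pi> permutes {1..q}" by (rule bij_imp_permutes) (auto simp: \<pi>_def)
  have "p \<pi> = \<gamma>"
  proof (rule br_eqI[OF p_br[OF \<pi>] g])
    show "up (p \<pi>) \<subseteq> up \<gamma>" "lo (p \<pi>) \<subseteq> lo \<gamma>" using p_up[OF \<pi>] p_lo[OF \<pi>] up lo by simp_all
    fix a b assume "{Inl a, Inr b} \<in> p \<pi>"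
    then obtain i where "i \<in> {1..q}" "a = e i" "b = e (\<pi> i)" using p_link[OF \<pi>] by blast
    then show "{Inl a, Inr b} \<in> \<gamma>" using f[of i] by (simp add: \<pi>_def)
  qed
  then show ?thesis using that \<pi> by blast
qed

definition "\<epsilon> = p id"

lemma eps: "\<epsilon> \<in> br Y Y" "up \<epsilon> = U" "lo \<epsilon> = U" "br_rank \<epsilon> = q" "star \<epsilon> = \<epsilon>" "br_prd \<epsilon> \<epsilon> = \<epsilon>"
  using p_br[OF permutes_id] p_up[OF permutes_id] p_lo[OF permutes_id] p_rank[OF permutes_id]
    p_star[OF permutes_id] p_prd[OF permutes_id permutes_id] by (simp_all add: \<epsilon>_def inv_id)

lemma eps_left: "\<beta> \<in> br Y B \<Longrightarrow> U \<subseteq> up \<beta> \<Longrightarrow> br_prd \<epsilon> \<beta> = \<beta>"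
  using proj_absorb[OF eps(1), of \<beta> B] eps by simp

lemma eps_right: "\<beta> \<in> br B Y \<Longrightarrow> U \<subseteq> lo \<beta> \<Longrightarrow> br_prd \<beta> \<epsilon> = \<beta>"
  using proj_absorb_right[OF eps(1), of \<beta> B] eps by simp

text \<open>\<open>lmate A\<close> consists of the elements of \<open>D\<^sub>q\<close> that are \<open>\<L>\<close>-related to the idempotent \<open>\<epsilon>\<close>.\<close>

definition "lmate A = {a \<in> br A Y. lo a = U}"
definition "rmate B = {b \<in> br Y B. up b = U}"

lemma lmate_star: "a \<in> lmate A \<Longrightarrow> star a \<in> rmate A" and rmate_star: "b \<in> rmate B \<Longrightarrow> star b \<in> lmate B"
  by (auto simp: lmate_def rmate_def intro: star_br)

lemma lmateD: "a \<in> lmate A \<Longrightarrow> a \<in> br A Y" "a \<in> lmate A \<Longrightarrow> lo a = U" "a \<in> lmate A \<Longrightarrow> br_rank a = q"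
proof -
  assume "a \<in> lmate A"
  then show 1: "a \<in> br A Y" "lo a = U" by (auto simp: lmate_def)
  show "br_rank a = q" using matched_rank(2)[OF 1(1) eps(1)] eps 1 by simp
qed

lemma rmateD: "b \<in> rmate B \<Longrightarrow> b \<in> br Y B" "b \<in> rmate B \<Longrightarrow> up b = U" "b \<in> rmate B \<Longrightarrow> br_rank b = q"
proof -
  assume "b \<in> rmate B"
  then show 1: "b \<in> br Y B" "up b = U" by (auto simp: rmate_def)
  show "br_rank b = q" using matched_rank(2)[OF eps(1) 1(1)] eps 1 by simp
qed

lemma star_lmate: assumes "a \<in> lmate A" shows "br_prd (star a) a = \<epsilon>"
proof -
  note a = lmateD[OF assms]
  note sa = star_br[OF a(1)]
  have "\<epsilon> = br_prd (star a) a"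
  proof (rule br_eqI[OF eps(1) br_prd_br[OF sa a(1)]])
    show "up \<epsilon> \<subseteq> up (br_prd (star a) a)" using up_prd[OF sa a(1)] a eps by simp
    show "lo \<epsilon> \<subseteq> lo (br_prd (star a) a)" using lo_prd[OF sa a(1)] a eps by simp
    fix u v assume "{Inl u, Inr v} \<in> \<epsilon>"
    then obtain i where i: "i \<in> {1..q}" "u = e i" "v = e i" unfolding \<epsilon>_def p_link[OF permutes_id] by auto
    have "cd a = cd \<epsilon>" using cd_eq[OF a(1)] cd_eq[OF eps(1)] a eps by simp
    then have "u \<in> cd a" using i p_cd[OF permutes_id] by (simp add: \<epsilon>_def)
    then obtain c where "{Inl c, Inr u} \<in> a" by (auto simp: cd_def)
    then show "{Inl u, Inr v} \<in> br_prd (star a) a" using link_through[OF sa a(1), of u c v] i by simp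
  qed
  then show ?thesis by simp
qed

lemma rmate_star_prd: assumes "b \<in> rmate B" shows "br_prd b (star b) = \<epsilon>"
  using star_lmate[OF rmate_star[OF assms]] by simp

lemma lmate_prd: assumes "a \<in> lmate A" "\<pi> permutes {1..q}" shows "br_prd a (p \<pi>) \<in> lmate A"
proof -
  have m: "up (p \<pi>) = lo a" using lmateD[OF assms(1)] p_up[OF assms(2)] by simp
  show ?thesis using matched_rank(4)[OF lmateD(1)[OF assms(1)] p_br[OF assms(2)] m] p_lo[OF assms(2)]
      br_prd_br[OF lmateD(1)[OF assms(1)] p_br[OF assms(2)]] by (simp add: lmate_def)
qed

text \<open>Coordinates of an element of rank q, as in a Rees matrix representation: a in the
  \<L>-class and b in the \<R>-class of the idempotent, with a permutation between them.\<close>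

definition tri where "tri a \<pi> b = br_prd (br_prd a (p \<pi>)) b"

context
  fixes a b \<pi> and A B :: "'a set"
  assumes a: "a \<in> lmate A" and b: "b \<in> rmate B" and \<pi>: "\<pi> permutes {1..q}"
begin

lemma tri: "tri a \<pi> b \<in> br A B" "up (tri a \<pi> b) = up a" "lo (tri a \<pi> b) = lo b" "br_rank (tri a \<pi> b) = q"
proof -
  note a' = lmate_prd[OF a \<pi>]
  note ab = lmateD(1)[OF a'] rmateD(1)[OF b]
  have m: "up b = lo (br_prd a (p \<pi>))" using lmateD(2)[OF a'] rmateD(2)[OF b] by simp
  show "tri a \<pi> b \<in> br A B" unfolding tri_def by (rule br_prd_br[OF ab])
  show "lo (tri a \<pi> b) = lo b" unfolding tri_def by (rule matched_rank(4)[OF ab m])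
  show "br_rank (tri a \<pi> b) = q" unfolding tri_def using matched_rank(1)[OF ab m] lmateD(3)[OF a'] by simp
  have "up (tri a \<pi> b) = up (br_prd a (p \<pi>))" unfolding tri_def by (rule matched_rank(3)[OF ab m])
  also have "\<dots> = up a"
    by (rule matched_rank(3)[OF lmateD(1)[OF a] p_br[OF \<pi>]]) (use lmateD[OF a] p_up[OF \<pi>] in simp)
  finally show "up (tri a \<pi> b) = up a" .
qed

text \<open>\<open>star a\<close> and \<open>star b\<close> are one-sided inverses of a and b
  relative to the idempotent, so the group coordinate is recovered by multiplications within rank
  q.\<close>

lemma tri_cancel: "br_prd (br_prd (star a) (tri a \<pi> b)) (star b) = p \<pi>"
proof -
  note sa = star_br[OF lmateD(1)[OF a]] and sb = star_br[OF rmateD(1)[OF b]]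
  note ba = lmateD(1)[OF a] and bb = rmateD(1)[OF b] and bp = p_br[OF \<pi>]
  have "br_prd (star a) (tri a \<pi> b) = br_prd (br_prd (star a) (br_prd a (p \<pi>))) b"
    unfolding tri_def by (rule br_prd_assoc[OF sa br_prd_br[OF ba bp] bb, symmetric])
  also have "br_prd (star a) (br_prd a (p \<pi>)) = br_prd \<epsilon> (p \<pi>)"
    using br_prd_assoc[OF sa ba bp] star_lmate[OF a] by simp
  also have "\<dots> = p \<pi>" using eps_left[OF bp] p_up[OF \<pi>] by simp
  finally have "br_prd (br_prd (star a) (tri a \<pi> b)) (star b) = br_prd (p \<pi>) (br_prd b (star b))"
    using br_prd_assoc[OF bp bb sb] by simp
  also have "\<dots> = p \<pi>" using rmate_star_prd[OF b] eps_right[OF bp] p_lo[OF \<pi>] by simp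
  finally show ?thesis .
qed

lemma tri_star: "star (tri a \<pi> b) = tri (star b) (inv' \<pi>) (star a)"
proof -
  note ba = lmateD(1)[OF a] and bb = rmateD(1)[OF b] and bp = p_br[OF \<pi>]
  have "star (tri a \<pi> b) = br_prd (star b) (br_prd (star (p \<pi>)) (star a))"
    unfolding tri_def using star_prd[OF br_prd_br[OF ba bp] bb] star_prd[OF ba bp] by simp
  also have "\<dots> = tri (star b) (inv' \<pi>) (star a)" unfolding tri_def p_star[OF \<pi>]
    by (rule br_prd_assoc[OF star_br[OF bb] p_br[OF permutes_inv[OF \<pi>]] star_br[OF ba], symmetric])
  finally show ?thesis .
qed

lemma tri_tri: assumes "\<rho> permutes {1..q}" shows "tri (br_prd a (p \<pi>)) \<rho> b = tri a (\<rho> \<circ> \<pi>) b"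
  unfolding tri_def using br_prd_assoc[OF lmateD(1)[OF a] p_br[OF \<pi>] p_br[OF assms]] p_prd[OF \<pi> assms] by simp

lemma tri_id: "tri a id b = br_prd a b"
  unfolding tri_def using eps_right[OF lmateD(1)[OF a]] lmateD(2)[OF a] by (simp add: \<epsilon>_def)

lemma tri_right:
  assumes "\<zeta> \<in> br B D"
  shows "br_prd (tri a \<pi> b) \<zeta> = br_prd (br_prd a (p \<pi>)) (br_prd b \<zeta>)"
  unfolding tri_def by (rule br_prd_assoc[OF lmateD(1)[OF lmate_prd[OF a \<pi>]] rmateD(1)[OF b] assms])

end

lemma tri_rep:
  assumes "a \<in> lmate A" "b \<in> rmate B" "\<beta> \<in> br A B" "up \<beta> = up a" "lo \<beta> = lo b"
  obtains \<pi> where "\<pi> permutes {1..q}" "\<beta> = tri a \<pi> b" "p \<pi> = br_prd (br_prd (star a) \<beta>) (star b)"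
proof -
  note ba = lmateD(1)[OF assms(1)] and bb = rmateD(1)[OF assms(2)]
  note sa = star_br[OF ba] and sb = star_br[OF bb]
  let ?g = "br_prd (br_prd (star a) \<beta>) (star b)"
  have m1: "up \<beta> = lo (star a)" using assms by simp
  have ab: "br_prd (star a) \<beta> \<in> br Y B" by (rule br_prd_br[OF sa assms(3)])
  have u1: "up (br_prd (star a) \<beta>) = U" "lo (br_prd (star a) \<beta>) = lo \<beta>"
    using matched_rank(3,4)[OF sa assms(3) m1] lmateD(2)[OF assms(1)] by simp_all
  have m2: "up (star b) = lo (br_prd (star a) \<beta>)" using u1 assms by simp
  have "up ?g = U" "lo ?g = U"
    using matched_rank(3,4)[OF ab sb m2] u1 rmateD(2)[OF assms(2)] by simp_all
  then obtain \<pi> where \<pi>: "\<pi> permutes {1..q}" "?g = p \<pi>" using group_elem[OF br_prd_br[OF ab sb]] by metis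
  have "br_prd a ?g = br_prd (br_prd a (br_prd (star a) \<beta>)) (star b)"
    by (rule br_prd_assoc[OF ba ab sb, symmetric])
  also have "br_prd a (br_prd (star a) \<beta>) = br_prd (br_prd a (star a)) \<beta>"
    by (rule br_prd_assoc[OF ba sa assms(3), symmetric])
  also have "\<dots> = \<beta>" using proj_absorb[OF ba assms(3)] assms by simp
  finally have "tri a \<pi> b = br_prd (br_prd \<beta> (star b)) b" unfolding tri_def using \<pi>(2) by simp
  also have "\<dots> = \<beta>" using br_prd_assoc[OF assms(3) sb bb] proj_absorb_right[OF bb assms(3)] assms by simp
  finally show ?thesis using that \<pi> by metis
qed

text \<open>The group coordinate can be absorbed into b, so a trivial one can always be
  arranged.\<close>

lemma tri_exists:
  assumes "\<alpha> \<in> br A B" "br_rank \<alpha> = q"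
  obtains a b where "a \<in> lmate A" "b \<in> rmate B" "\<alpha> = tri a id b" "up a = up \<alpha>" "lo b = lo \<alpha>"
proof -
  obtain a where a: "a \<in> br A Y" "up a = up \<alpha>" "lo a = U"
    using exists_connecting_eq[OF assms(1) eps(1)] assms eps by auto
  note sa = star_br[OF a(1)]
  have am: "a \<in> lmate A" using a by (simp add: lmate_def)
  let ?b = "br_prd (star a) \<alpha>"
  have m: "up \<alpha> = lo (star a)" using a by simp
  have bb: "?b \<in> br Y B" by (rule br_prd_br[OF sa assms(1)])
  have u: "up ?b = U" "lo ?b = lo \<alpha>" using matched_rank(3,4)[OF sa assms(1) m] a by simp_all
  have bm: "?b \<in> rmate B" using bb u by (simp add: rmate_def)
  have "br_prd a ?b = \<alpha>"
    using br_prd_assoc[OF a(1) sa assms(1)] proj_absorb[OF a(1) assms(1)] a by simp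
  then have "\<alpha> = tri a id ?b" using tri_id[OF am bm permutes_id] by simp
  then show ?thesis using that am bm a(2) u(2) by blast
qed

end

section \<open>Congruences\<close>

context brauer_category begin

lemma CongI:
  assumes typed: "\<And>\<alpha> \<beta>. (\<alpha>, \<beta>) \<in> \<sigma> \<Longrightarrow> \<exists>A\<in>C. \<exists>B\<in>C. \<alpha> \<in> br A B \<and> \<beta> \<in> br A B \<and>
      enat (br_rank \<alpha>) \<le> r \<and> enat (br_rank \<beta>) \<le> r"
    and refl: "\<And>\<alpha>. \<alpha> \<in> rank_ideal C r \<Longrightarrow> (\<alpha>, \<alpha>) \<in> \<sigma>"
    and sym: "\<And>\<alpha> \<beta>. (\<alpha>, \<beta>) \<in> \<sigma> \<Longrightarrow> (\<beta>, \<alpha>) \<in> \<sigma>"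
    and trans: "\<And>\<alpha> \<beta> \<gamma>. (\<alpha>, \<beta>) \<in> \<sigma> \<Longrightarrow> (\<beta>, \<gamma>) \<in> \<sigma> \<Longrightarrow> (\<alpha>, \<gamma>) \<in> \<sigma>"
    and right: "\<And>\<alpha> \<beta> \<zeta> A B D. (\<alpha>, \<beta>) \<in> \<sigma> \<Longrightarrow> \<alpha> \<in> br A B \<Longrightarrow> \<beta> \<in> br A B \<Longrightarrow> A \<in> C \<Longrightarrow> B \<in> C \<Longrightarrow> D \<in> C \<Longrightarrow>
      \<zeta> \<in> br B D \<Longrightarrow> \<zeta> \<in> rank_ideal C r \<Longrightarrow> (br_prd \<alpha> \<zeta>, br_prd \<beta> \<zeta>) \<in> \<sigma>"
    and left: "\<And>\<alpha> \<beta> \<zeta> A B D. (\<alpha>, \<beta>) \<in> \<sigma> \<Longrightarrow> \<alpha> \<in> br A B \<Longrightarrow> \<beta> \<in> br A B \<Longrightarrow> A \<in> C \<Longrightarrow> B \<in> C \<Longrightarrow> D \<in> C \<Longrightarrow>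
      \<zeta> \<in> br D A \<Longrightarrow> \<zeta> \<in> rank_ideal C r \<Longrightarrow> (br_prd \<zeta> \<alpha>, br_prd \<zeta> \<beta>) \<in> \<sigma>"
  shows "\<sigma> \<in> Cong (I_psg C r)"
proof -
  have sub: "\<sigma> \<subseteq> rank_ideal C r \<times> rank_ideal C r"
    using typed rank_idealI by (auto dest!: typed)
  have "equiv (rank_ideal C r) \<sigma>"
    using sub refl sym trans by (intro equivI refl_onI symI transI) blast+
  moreover have "psg_sim (I_psg C r) \<alpha> \<beta>" if ab: "(\<alpha>, \<beta>) \<in> \<sigma>" for \<alpha> \<beta>
  proof -
    obtain A B where "\<alpha> \<in> br A B" "\<beta> \<in> br A B" using typed[OF ab] by blast
    then show ?thesis by (simp add: psg_sim_def br_src br_rng)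
  qed
  moreover have "(br_rng \<alpha> = br_src \<zeta> \<longrightarrow> (br_prd \<alpha> \<zeta>, br_prd \<beta> \<zeta>) \<in> \<sigma>) \<and>
        (br_rng \<zeta> = br_src \<alpha> \<longrightarrow> (br_prd \<zeta> \<alpha>, br_prd \<zeta> \<beta>) \<in> \<sigma>)"
    if ab: "(\<alpha>, \<beta>) \<in> \<sigma>" and z: "\<zeta> \<in> rank_ideal C r" for \<alpha> \<beta> \<zeta>
  proof -
    obtain A B where AB: "A \<in> C" "B \<in> C" "\<alpha> \<in> br A B" "\<beta> \<in> br A B" using typed[OF ab] by blast
    obtain D E where DE: "D \<in> C" "E \<in> C" "\<zeta> \<in> br D E" using rank_idealE[OF z] by metis
    show ?thesis
      using right[OF ab AB(3,4,1,2) DE(2) _ z] left[OF ab AB(3,4,1,2) DE(1) _ z] DE(3)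
        br_src[OF AB(3)] br_rng[OF AB(3)] br_src[OF DE(3)] br_rng[OF DE(3)] by auto
  qed
  ultimately show ?thesis by (auto simp: Cong_def congruence_def)
qed

end

locale br_cong = brauer_category C for C :: "'a set set" +
  fixes r :: enat and \<sigma> :: "(('a + 'a) set set \<times> ('a + 'a) set set) set"
  assumes cong: "\<sigma> \<in> Cong (I_psg C r)"
begin

lemma cong_equiv: "equiv (rank_ideal C r) \<sigma>"
  using cong by (simp add: Cong_def congruence_def)

lemma cong_refl: "\<alpha> \<in> rank_ideal C r \<Longrightarrow> (\<alpha>, \<alpha>) \<in> \<sigma>"
  using cong_equiv by (simp add: equiv_def refl_on_def)

lemma cong_sym: "(\<alpha>, \<beta>) \<in> \<sigma> \<Longrightarrow> (\<beta>, \<alpha>) \<in> \<sigma>"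
  using cong_equiv by (auto simp: equiv_def dest: symD)

lemma cong_trans: "(\<alpha>, \<beta>) \<in> \<sigma> \<Longrightarrow> (\<beta>, \<gamma>) \<in> \<sigma> \<Longrightarrow> (\<alpha>, \<gamma>) \<in> \<sigma>"
  using cong_equiv by (auto simp: equiv_def dest: transD)

lemma cong_mem: assumes "(\<alpha>, \<beta>) \<in> \<sigma>" shows "\<alpha> \<in> rank_ideal C r" "\<beta> \<in> rank_ideal C r"
  using cong_equiv assms by (auto simp: equiv_def refl_on_def)

lemma cong_src: assumes "(\<alpha>, \<beta>) \<in> \<sigma>" shows "br_src \<alpha> = br_src \<beta>" "br_rng \<alpha> = br_rng \<beta>"
  using cong assms by (auto simp: Cong_def congruence_def psg_sim_def)

lemma congE:
  assumes "(\<alpha>, \<beta>) \<in> \<sigma>"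
  obtains A B where "A \<in> C" "B \<in> C" "\<alpha> \<in> br A B" "\<beta> \<in> br A B"
    "enat (br_rank \<alpha>) \<le> r" "enat (br_rank \<beta>) \<le> r"
  using that rank_ideal_src rank_ideal_br rank_ideal_rank cong_mem[OF assms] cong_src[OF assms] by metis

lemma cong_right:
  assumes "(\<alpha>, \<beta>) \<in> \<sigma>" "\<alpha> \<in> br A B" "\<zeta> \<in> br B D" "D \<in> C" "enat (br_rank \<zeta>) \<le> r"
  shows "(br_prd \<alpha> \<zeta>, br_prd \<beta> \<zeta>) \<in> \<sigma>"
proof -
  have "B \<in> C" using rank_ideal_src(2)[OF cong_mem(1)[OF assms(1)]] br_rng[OF assms(2)] by simp
  then have "\<zeta> \<in> rank_ideal C r" using rank_idealI[OF _ assms(4,3,5)] by simp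
  then show ?thesis using cong assms(1) br_rng[OF assms(2)] br_src[OF assms(3)]
    by (auto simp: Cong_def congruence_def)
qed

lemma cong_left:
  assumes "(\<alpha>, \<beta>) \<in> \<sigma>" "\<alpha> \<in> br A B" "\<zeta> \<in> br D A" "D \<in> C" "enat (br_rank \<zeta>) \<le> r"
  shows "(br_prd \<zeta> \<alpha>, br_prd \<zeta> \<beta>) \<in> \<sigma>"
proof -
  have "A \<in> C" using rank_ideal_src(1)[OF cong_mem(1)[OF assms(1)]] br_src[OF assms(2)] by simp
  then have "\<zeta> \<in> rank_ideal C r" using rank_idealI[OF assms(4) _ assms(3,5)] by simp
  then show ?thesis using cong assms(1) br_src[OF assms(2)] br_rng[OF assms(3)]
    by (auto simp: Cong_def congruence_def)
qed

text \<open>A fact about upper hooks proved for every congruence yields, for the reflected one, the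
  fact about lower hooks.\<close>

lemma star_cong: "br_cong C r ((\<lambda>(\<alpha>, \<beta>). (star \<alpha>, star \<beta>)) ` \<sigma>)"
proof (unfold_locales, rule CongI)
  let ?s = "(\<lambda>(\<alpha>, \<beta>). (star \<alpha>, star \<beta>)) ` \<sigma>"
  have mem: "(\<alpha>, \<beta>) \<in> ?s \<longleftrightarrow> (star \<alpha>, star \<beta>) \<in> \<sigma>" for \<alpha> \<beta>
    by (force simp: image_iff)
  show "\<exists>A\<in>C. \<exists>B\<in>C. \<alpha> \<in> br A B \<and> \<beta> \<in> br A B \<and> enat (br_rank \<alpha>) \<le> r \<and> enat (br_rank \<beta>) \<le> r"
    if "(\<alpha>, \<beta>) \<in> ?s" for \<alpha> \<beta>
    using that[unfolded mem] by (rule congE) (metis star_br star_star br_rank_star)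
  show "(\<alpha>, \<alpha>) \<in> ?s" if "\<alpha> \<in> rank_ideal C r" for \<alpha>
    unfolding mem by (rule cong_refl[OF rank_ideal_star[OF that]])
  show "(\<beta>, \<alpha>) \<in> ?s" if "(\<alpha>, \<beta>) \<in> ?s" for \<alpha> \<beta>
    using that unfolding mem by (rule cong_sym)
  show "(\<alpha>, \<gamma>) \<in> ?s" if "(\<alpha>, \<beta>) \<in> ?s" "(\<beta>, \<gamma>) \<in> ?s" for \<alpha> \<beta> \<gamma>
    using that unfolding mem by (rule cong_trans)
  fix \<alpha> \<beta> \<zeta> A B D
  assume ab: "(\<alpha>, \<beta>) \<in> ?s" "\<alpha> \<in> br A B" "\<beta> \<in> br A B" and D: "D \<in> C" and zr: "\<zeta> \<in> rank_ideal C r"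
  have rz: "enat (br_rank (star \<zeta>)) \<le> r" using rank_ideal_rank[OF zr] by simp
  show "(br_prd \<alpha> \<zeta>, br_prd \<beta> \<zeta>) \<in> ?s" if z: "\<zeta> \<in> br B D"
    unfolding mem star_prd[OF ab(2) z] star_prd[OF ab(3) z]
    by (rule cong_left[OF ab(1)[unfolded mem] star_br[OF ab(2)] star_br[OF z] D rz])
  show "(br_prd \<zeta> \<alpha>, br_prd \<zeta> \<beta>) \<in> ?s" if z: "\<zeta> \<in> br D A"
    unfolding mem star_prd[OF z ab(2)] star_prd[OF z ab(3)]
    by (rule cong_right[OF ab(1)[unfolded mem] star_br[OF ab(2)] star_br[OF z] D rz])
qed

lemma mem_star_cong: "(\<alpha>, \<beta>) \<in> (\<lambda>(\<alpha>, \<beta>). (star \<alpha>, star \<beta>)) ` \<sigma> \<longleftrightarrow> (star \<alpha>, star \<beta>) \<in> \<sigma>"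
  by (force simp: image_iff)

end

section \<open>The part of a congruence inside the \<H>-classes of rank q\<close>

context brauer_rank begin

text \<open>A normal form of \<open>nu\<close>: the outer factors are taken from the classes of the
  idempotent and the first group coordinate is trivial. Pairs with two arbitrary coordinates from N
  are regained by moving one permutation into a.\<close>

definition "nuq N = {(tri a id b, tri a \<pi> b) | a b \<pi>. \<exists>A\<in>C. \<exists>B\<in>C. a \<in> lmate A \<and> b \<in> rmate B \<and> \<pi> \<in> N}"

lemma nuqI: "A \<in> C \<Longrightarrow> B \<in> C \<Longrightarrow> a \<in> lmate A \<Longrightarrow> b \<in> rmate B \<Longrightarrow> \<pi> \<in> N \<Longrightarrow> (tri a id b, tri a \<pi> b) \<in> nuq N"
  unfolding nuq_def by blast

lemma nuqE:
  assumes "(\<alpha>, \<beta>) \<in> nuq N"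
  obtains A B a b \<pi> where "A \<in> C" "B \<in> C" "a \<in> lmate A" "b \<in> rmate B" "\<pi> \<in> N" "\<alpha> = tri a id b" "\<beta> = tri a \<pi> b"
  using assms unfolding nuq_def by blast

lemma nuq_mono: "N \<subseteq> N' \<Longrightarrow> nuq N \<subseteq> nuq N'"
  unfolding nuq_def by blast

lemma Y_eps: "id permutes {1..q}" "\<epsilon> \<in> lmate Y" "\<epsilon> \<in> rmate Y"
  using eps by (auto simp: lmate_def rmate_def permutes_id)

lemma tri_eps: "\<pi> permutes {1..q} \<Longrightarrow> tri \<epsilon> \<pi> \<epsilon> = p \<pi>"
  unfolding tri_def using eps_left[OF p_br] eps_right[OF p_br] p_up p_lo by simp

context
  fixes N
  assumes N: "N \<lhd> sym_group q"
begin

lemma N_perm: "\<pi> \<in> N \<Longrightarrow> \<pi> permutes {1..q}"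
  and N_id: "id \<in> N"
  using N unfolding normal_sym_group_iff by blast+

lemma nuq_typed:
  assumes "(\<alpha>, \<beta>) \<in> nuq N"
  obtains A B where "A \<in> C" "B \<in> C" "\<alpha> \<in> br A B" "\<beta> \<in> br A B" "up \<alpha> = up \<beta>" "lo \<alpha> = lo \<beta>"
    "br_rank \<alpha> = q" "br_rank \<beta> = q"
proof -
  obtain A B a b \<pi> where *: "A \<in> C" "B \<in> C" "a \<in> lmate A" "b \<in> rmate B" "\<pi> \<in> N" "\<alpha> = tri a id b" "\<beta> = tri a \<pi> b"
    using nuqE[OF assms] .
  show ?thesis
    using that[OF *(1,2)] tri[OF *(3,4) permutes_id] tri[OF *(3,4) N_perm[OF *(5)]] * by simp
qed

lemma nuq_gen:
  assumes "A \<in> C" "B \<in> C" "a \<in> lmate A" "b \<in> rmate B" "\<pi> \<in> N" "\<rho> \<in> N"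
  shows "(tri a \<pi> b, tri a \<rho> b) \<in> nuq N"
proof -
  have \<pi>: "\<pi> permutes {1..q}" using N_perm assms by blast
  have n: "\<rho> \<circ> inv' \<pi> \<in> N" using N assms(5,6) unfolding normal_sym_group_iff by blast
  have "(tri (br_prd a (p \<pi>)) id b, tri (br_prd a (p \<pi>)) (\<rho> \<circ> inv' \<pi>) b) \<in> nuq N"
    by (rule nuqI[OF assms(1,2) lmate_prd[OF assms(3) \<pi>] assms(4) n])
  moreover have "\<rho> \<circ> inv' \<pi> \<circ> \<pi> = \<rho>" using permutes_inv_o(2)[OF \<pi>] by (simp add: comp_assoc)
  ultimately show ?thesis
    using tri_tri[OF assms(3,4) \<pi> permutes_id] tri_tri[OF assms(3,4) \<pi> N_perm[OF n]] by simp
qed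

text \<open>Two choices of coordinates for \<alpha> differ by group elements on the left and on the
  right. As both choices give \<alpha> the trivial coordinate, these are inverse to each other, so
  the coordinate of \<beta> changes by a conjugation; here closure of N under conjugation is
  used.\<close>

lemma nuq_rep:
  assumes "(\<alpha>, \<beta>) \<in> nuq N" "A \<in> C" "B \<in> C" "a \<in> lmate A" "b \<in> rmate B" "\<alpha> = tri a id b"
  obtains \<pi> where "\<pi> \<in> N" "\<beta> = tri a \<pi> b"
proof -
  obtain A2 B2 a2 b2 \<pi> where *: "A2 \<in> C" "B2 \<in> C" "a2 \<in> lmate A2" "b2 \<in> rmate B2" "\<pi> \<in> N"
    "\<alpha> = tri a2 id b2" "\<beta> = tri a2 \<pi> b2"
    using nuqE[OF assms(1)] .
  have \<pi>: "\<pi> permutes {1..q}" using N_perm * by blast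
  note t1 = tri[OF assms(4,5) permutes_id] and t2 = tri[OF *(3,4) permutes_id] and t3 = tri[OF *(3,4) \<pi>]
  have AB: "A2 = A" "B2 = B"
    using br_src[OF t1(1)] br_src[OF t2(1)] br_rng[OF t1(1)] br_rng[OF t2(1)] assms(6) *(6) by simp_all
  have ul: "up a2 = up a" "lo b2 = lo b" using t1 t2 assms(6) *(6) by simp_all
  note a2 = *(3)[unfolded AB] and b2 = *(4)[unfolded AB]
  note ba = lmateD(1)[OF assms(4)] and bb = rmateD(1)[OF assms(5)]
  note sa = star_br[OF ba] and sb = star_br[OF bb]
  note ba2 = lmateD(1)[OF a2] and bb2 = rmateD(1)[OF b2]
  have m1: "up a2 = lo (star a)" and m2: "up (star b) = lo b2" using ul by simp_all
  have "up (br_prd (star a) a2) = U" "lo (br_prd (star a) a2) = U"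
    using matched_rank(3,4)[OF sa ba2 m1] lmateD(2)[OF assms(4)] lmateD(2)[OF a2] by simp_all
  then obtain \<gamma> where g: "\<gamma> permutes {1..q}" "br_prd (star a) a2 = p \<gamma>" using group_elem[OF br_prd_br[OF sa ba2]] by metis
  have "up (br_prd b2 (star b)) = U" "lo (br_prd b2 (star b)) = U"
    using matched_rank(3,4)[OF bb2 sb m2] rmateD(2)[OF assms(5)] rmateD(2)[OF b2] by simp_all
  then obtain \<delta> where d: "\<delta> permutes {1..q}" "br_prd b2 (star b) = p \<delta>" using group_elem[OF br_prd_br[OF bb2 sb]] by metis
  have conj: "br_prd (br_prd (star a) (tri a2 \<rho> b2)) (star b) = p (\<delta> \<circ> \<rho> \<circ> \<gamma>)" if r: "\<rho> permutes {1..q}" for \<rho>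
  proof -
    note bp = p_br[OF r] and gp = p_br[OF g(1)]
    have "br_prd (star a) (tri a2 \<rho> b2) = br_prd (br_prd (star a) (br_prd a2 (p \<rho>))) b2"
      unfolding tri_def by (rule br_prd_assoc[OF sa br_prd_br[OF ba2 bp] bb2, symmetric])
    also have "br_prd (star a) (br_prd a2 (p \<rho>)) = p (\<rho> \<circ> \<gamma>)"
      using br_prd_assoc[OF sa ba2 bp] g(2) p_prd[OF g(1) r] by simp
    finally have "br_prd (br_prd (star a) (tri a2 \<rho> b2)) (star b) = br_prd (p (\<rho> \<circ> \<gamma>)) (br_prd b2 (star b))"
      using br_prd_assoc[OF p_br[OF permutes_compose[OF g(1) r]] bb2 sb] by simp
    then show ?thesis using d(2) p_prd[OF permutes_compose[OF g(1) r] d(1)] by (simp add: comp_assoc)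
  qed
  have "p (\<delta> \<circ> id \<circ> \<gamma>) = p id"
    using conj[OF permutes_id] tri_cancel[OF assms(4,5) permutes_id] assms(6) *(6) by simp
  then have "\<delta> \<circ> \<gamma> = id"
    using p_inj[of "\<delta> \<circ> \<gamma>" id] permutes_compose[OF g(1) d(1)] permutes_id by simp
  then have gi: "\<gamma> = inv' \<delta>" using permutes_bij[OF d(1)]
    by (metis bij_is_inj comp_assoc id_comp inv_o_cancel comp_id)
  have bbeta: "\<beta> \<in> br A B" using t3(1) *(7) AB by simp
  obtain \<rho> where r: "\<rho> permutes {1..q}" "\<beta> = tri a \<rho> b" "p \<rho> = br_prd (br_prd (star a) \<beta>) (star b)"
    using tri_rep[OF assms(4,5) bbeta] t3 ul *(7) by metis
  have "p \<rho> = p (\<delta> \<circ> \<pi> \<circ> \<gamma>)" using conj[OF \<pi>] r(3) *(7) by simp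
  then have "\<rho> = \<delta> \<circ> \<pi> \<circ> inv' \<delta>"
    using p_inj[OF r(1) permutes_compose[OF g(1) permutes_compose[OF \<pi> d(1)]]] gi by simp
  then have "\<rho> \<in> N" using N d(1) *(5) unfolding normal_sym_group_iff by blast
  then show ?thesis using that r(2) by blast
qed

lemma nuq_refl:
  assumes "A \<in> C" "B \<in> C" "\<alpha> \<in> br A B" "br_rank \<alpha> = q"
  shows "(\<alpha>, \<alpha>) \<in> nuq N"
proof -
  obtain a b where "a \<in> lmate A" "b \<in> rmate B" "\<alpha> = tri a id b" using tri_exists[OF assms(3,4)] by metis
  then show ?thesis using nuqI[OF assms(1,2), of a b id N] N_id by simp
qed

lemma nuq_sym: assumes "(\<alpha>, \<beta>) \<in> nuq N" shows "(\<beta>, \<alpha>) \<in> nuq N"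
proof -
  obtain A B a b \<pi> where *: "A \<in> C" "B \<in> C" "a \<in> lmate A" "b \<in> rmate B" "\<pi> \<in> N"
    "\<alpha> = tri a id b" "\<beta> = tri a \<pi> b"
    using nuqE[OF assms] .
  then show ?thesis using nuq_gen[OF *(1-5) N_id] by simp
qed

lemma nuq_trans: assumes "(\<alpha>, \<beta>) \<in> nuq N" "(\<beta>, \<gamma>) \<in> nuq N" shows "(\<alpha>, \<gamma>) \<in> nuq N"
proof -
  obtain A B a b \<pi> where *: "A \<in> C" "B \<in> C" "a \<in> lmate A" "b \<in> rmate B" "\<pi> \<in> N"
    "\<beta> = tri a id b" "\<alpha> = tri a \<pi> b"
    using nuqE[OF nuq_sym[OF assms(1)]] .
  obtain \<rho> where "\<rho> \<in> N" "\<gamma> = tri a \<rho> b" using nuq_rep[OF assms(2) *(1-4,6)] .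
  then show ?thesis using nuq_gen[OF *(1-5)] *(7) by blast
qed

text \<open>If the rank is kept, the product of b with \<zeta> keeps its rank as well and remains
  \<R>-related to the idempotent. Only the coordinate b changes.\<close>

lemma nuq_right:
  assumes "(\<alpha>, \<beta>) \<in> nuq N" "\<alpha> \<in> br A B" "\<zeta> \<in> br B D" "D \<in> C" "br_rank (br_prd \<alpha> \<zeta>) = q"
  shows "(br_prd \<alpha> \<zeta>, br_prd \<beta> \<zeta>) \<in> nuq N"
proof -
  obtain A' B' a b \<pi> where *: "A' \<in> C" "B' \<in> C" "a \<in> lmate A'" "b \<in> rmate B'" "\<pi> \<in> N"
    "\<alpha> = tri a id b" "\<beta> = tri a \<pi> b"
    using nuqE[OF assms(1)] .
  have "B' = B" using br_rng[OF assms(2)] br_rng[OF tri(1)[OF *(3,4) permutes_id]] *(6) by simp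
  note z = assms(3)[folded this] and bb = rmateD(1)[OF *(4)]
  have eq: "br_prd (tri a \<rho> b) \<zeta> = tri a \<rho> (br_prd b \<zeta>)" if "\<rho> permutes {1..q}" for \<rho>
    using tri_right[OF *(3,4) that z] by (simp add: tri_def)
  have "q = br_rank (br_prd (br_prd a (p id)) (br_prd b \<zeta>))"
    using assms(5) eq[OF permutes_id] *(6) by (simp add: tri_def)
  also have "\<dots> \<le> br_rank (br_prd b \<zeta>)"
    by (rule rank_prd_right[OF lmateD(1)[OF lmate_prd[OF *(3) permutes_id]] br_prd_br[OF bb z]])
  finally have "br_rank (br_prd b \<zeta>) = br_rank b"
    using rank_prd_left[OF bb z] rmateD(3)[OF *(4)] by simp
  then have "br_prd b \<zeta> \<in> rmate D"
    using rank_eq_up[OF bb z] br_prd_br[OF bb z] rmateD(2)[OF *(4)] by (simp add: rmate_def)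
  from nuqI[OF *(1) assms(4) *(3) this *(5)] show ?thesis
    using eq[OF permutes_id] eq[OF N_perm[OF *(5)]] *(6,7) by simp
qed

lemma nuq_star: assumes "(\<alpha>, \<beta>) \<in> nuq N" shows "(star \<alpha>, star \<beta>) \<in> nuq N"
proof -
  obtain A B a b \<pi> where *: "A \<in> C" "B \<in> C" "a \<in> lmate A" "b \<in> rmate B" "\<pi> \<in> N"
    "\<alpha> = tri a id b" "\<beta> = tri a \<pi> b"
    using nuqE[OF assms] .
  have "inv' \<pi> \<in> N" using N *(5) unfolding normal_sym_group_iff by blast
  from nuqI[OF *(2,1) rmate_star[OF *(4)] lmate_star[OF *(3)] this] show ?thesis
    using tri_star[OF *(3,4) permutes_id] tri_star[OF *(3,4) N_perm[OF *(5)]] *(6,7) by (simp add: inv_id)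
qed

lemma nuq_p: assumes "\<pi> permutes {1..q}" shows "(\<epsilon>, p \<pi>) \<in> nuq N \<longleftrightarrow> \<pi> \<in> N"
proof
  assume "(\<epsilon>, p \<pi>) \<in> nuq N"
  then obtain \<rho> where "\<rho> \<in> N" "p \<pi> = tri \<epsilon> \<rho> \<epsilon>"
    using nuq_rep[OF _ Y(1) Y(1) Y_eps(2,3), of \<epsilon> "p \<pi>"] tri_eps[OF permutes_id] by (auto simp: \<epsilon>_def)
  moreover from this have "\<pi> = \<rho>" using tri_eps[OF N_perm] p_inj[OF assms N_perm] by simp
  ultimately show "\<pi> \<in> N" by simp
next
  assume "\<pi> \<in> N"
  from nuqI[OF Y(1) Y(1) Y_eps(2,3) this] show "(\<epsilon>, p \<pi>) \<in> nuq N"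
    using tri_eps[OF permutes_id] tri_eps[OF assms] by (simp add: \<epsilon>_def)
qed

lemma J_class: "enat q \<le> r \<Longrightarrow>
    green_J (I_psg C r) `` natural_group X x q N = {\<alpha> \<in> rank_ideal C r. br_rank \<alpha> = q}"
proof -
  assume r: "enat q \<le> r"
  have "p \<pi> \<in> rank_ideal C r" "br_rank (p \<pi>) = q" if "\<pi> \<in> N" for \<pi>
    using rank_idealI[OF Y(1) Y(1) p_br[OF N_perm[OF that]]] p_rank[OF N_perm[OF that]] r by simp_all
  moreover note N_id
  ultimately show ?thesis unfolding natural_group_def p_def[symmetric] Image_def
    by (auto simp: green_J_iff)
qed

text \<open>A sandwich that still has rank q forces its outer factors, cut down by the idempotent,
  into the classes of the idempotent; conversely such factors lie in the ideal.\<close>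

lemma nu_eq:
  assumes r: "enat q \<le> r"
  shows "nu (I_psg C r) (natural_group X x q N) = nuq N"
proof (intro equalityI subrelI)
  fix \<alpha> \<beta> assume "(\<alpha>, \<beta>) \<in> nu (I_psg C r) (natural_group X x q N)"
  then obtain a b u v where 0: "u \<in> natural_group X x q N" "v \<in> natural_group X x q N"
    "a \<in> S1 (I_psg C r)" "b \<in> S1 (I_psg C r)"
    "sandwichable (I_psg C r) a u b" "\<alpha> = sandwich (I_psg C r) a u b" "\<beta> = sandwich (I_psg C r) a v b"
    "\<alpha> \<in> green_J (I_psg C r) `` natural_group X x q N"
    unfolding nu_def by blast
  obtain \<pi> \<rho> where uv: "u = p \<pi>" "\<pi> \<in> N" "v = p \<rho>" "\<rho> \<in> N"
    using 0(1,2) unfolding natural_group_def p_def[symmetric] by blast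
  have rk: "br_rank \<alpha> = q" using 0(8) unfolding J_class[OF r] by simp
  note * = uv(2,4) 0(3,4) 0(5-7)[unfolded uv] rk
  note \<pi> = N_perm[OF *(1)] and \<rho> = N_perm[OF *(2)]
  \<comment> \<open>A missing factor becomes the idempotent and a present one is multiplied by it.
    No sandwich changes, because group elements absorb the idempotent.\<close>
  define a' where "a' = (case a of None \<Rightarrow> \<epsilon> | Some a \<Rightarrow> br_prd a \<epsilon>)"
  define b' where "b' = (case b of None \<Rightarrow> \<epsilon> | Some b \<Rightarrow> br_prd \<epsilon> b)"
  obtain A where A: "A \<in> C" "a' \<in> br A Y" "U \<subseteq> lo a'" "br_rank a' \<le> q"
    "\<And>\<pi>. \<pi> permutes {1..q} \<Longrightarrow> br_prd a' (p \<pi>) = (case a of None \<Rightarrow> p \<pi> | Some a \<Rightarrow> br_prd a (p \<pi>))"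
  proof (cases a)
    case None
    show ?thesis
      by (rule that[of Y]) (use Y eps None eps_left[OF p_br] p_up in \<open>auto simp: a'_def\<close>)
  next
    case (Some a0)
    have a0: "a0 \<in> rank_ideal C r" using *(3) Some by (auto simp: S1_def)
    have "br_rng a0 = Y" using *(5) Some br_src[OF p_br[OF \<pi>]] by (simp add: sandwichable_def)
    then have ba: "a0 \<in> br (br_src a0) Y" using rank_ideal_br[OF a0] by simp
    show ?thesis
      by (rule that[of "br_src a0"])
        (use ba br_prd_br[OF ba eps(1)] lo_prd[OF ba eps(1)] rank_prd_right[OF ba eps(1)] eps Some
          rank_ideal_src[OF a0] br_prd_assoc[OF ba eps(1) p_br] eps_left[OF p_br] p_up in \<open>auto simp: a'_def\<close>)
  qed
  obtain B where B: "B \<in> C" "b' \<in> br Y B" "U \<subseteq> up b'" "br_rank b' \<le> q"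
    "\<And>A c. c \<in> br A Y \<Longrightarrow> U \<subseteq> lo c \<Longrightarrow> br_prd c b' = (case b of None \<Rightarrow> c | Some b \<Rightarrow> br_prd c b)"
  proof (cases b)
    case None
    show ?thesis
      by (rule that[of Y]) (use Y eps None eps_right in \<open>auto simp: b'_def\<close>)
  next
    case (Some b0)
    have b0: "b0 \<in> rank_ideal C r" using *(4) Some by (auto simp: S1_def)
    have "br_src b0 = Y" using *(5) Some br_rng[OF p_br[OF \<pi>]] by (simp add: sandwichable_def)
    then have bb: "b0 \<in> br Y (br_rng b0)" using rank_ideal_br[OF b0] by simp
    show ?thesis
      by (rule that[of "br_rng b0"])
        (use bb br_prd_br[OF eps(1) bb] up_prd[OF eps(1) bb] rank_prd_left[OF eps(1) bb] eps Some
          rank_ideal_src[OF b0] br_prd_assoc[OF _ eps(1) bb, symmetric] eps_right in \<open>auto simp: b'_def\<close>)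
  qed
  have eq: "sandwich (I_psg C r) a (p \<pi>) b = tri a' \<pi> b'" if "\<pi> permutes {1..q}" for \<pi>
  proof -
    have c: "br_prd a' (p \<pi>) \<in> br A Y" "U \<subseteq> lo (br_prd a' (p \<pi>))"
      using br_prd_br[OF A(2) p_br[OF that]] lo_prd[OF A(2) p_br[OF that]] p_lo[OF that] by simp_all
    show ?thesis unfolding tri_def B(5)[OF c] unfolding A(5)[OF that]
      by (simp add: sandwich_def Let_def split: option.splits)
  qed
  \<comment> \<open>The rank of the sandwich bounds the ranks of both factors from below, and then
    their hooks facing the group cannot properly contain U.\<close>
  have "q = br_rank (tri a' \<pi> b')" using eq[OF \<pi>] * by simp
  then have q: "q \<le> br_rank b'" "q \<le> br_rank a'"
    unfolding tri_def
    using rank_prd_right[OF br_prd_br[OF A(2) p_br[OF \<pi>]] B(2)] rank_prd_left[OF br_prd_br[OF A(2) p_br[OF \<pi>]] B(2)]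
      rank_prd_left[OF A(2) p_br[OF \<pi>]] by linarith+
  have "lo \<epsilon> = lo a'" by (rule lo_subset_eq[OF eps(1) A(2)]) (use A(3) eps(3,4) q in simp_all)
  then have "lo a' = U" using eps(3) by simp
  then have am: "a' \<in> lmate A" using A by (simp add: lmate_def)
  have "up \<epsilon> = up b'" by (rule up_subset_eq[OF eps(1) B(2)]) (use B(3) eps(2,4) q in simp_all)
  then have "up b' = U" using eps(2) by simp
  then have bm: "b' \<in> rmate B" using B by (simp add: rmate_def)
  show "(\<alpha>, \<beta>) \<in> nuq N" using nuq_gen[OF A(1) B(1) am bm *(1,2)] eq[OF \<pi>] eq[OF \<rho>] * by simp
next
  fix \<alpha> \<beta> assume ab: "(\<alpha>, \<beta>) \<in> nuq N"
  then obtain A B a b \<pi> where *: "A \<in> C" "B \<in> C" "a \<in> lmate A" "b \<in> rmate B" "\<pi> \<in> N"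
    "\<alpha> = tri a id b" "\<beta> = tri a \<pi> b" by (rule nuqE)
  have \<pi>: "\<pi> permutes {1..q}" "id \<in> N" using N_perm[OF *(5)] N_id by blast+
  have S: "a \<in> rank_ideal C r" "b \<in> rank_ideal C r"
    using rank_idealI[OF *(1) Y(1) lmateD(1)[OF *(3)]] rank_idealI[OF Y(1) *(2) rmateD(1)[OF *(4)]]
      lmateD(3)[OF *(3)] rmateD(3)[OF *(4)] r by simp_all
  have sw: "sandwich (I_psg C r) (Some a) (p \<rho>) (Some b) = tri a \<rho> b" for \<rho>
    by (simp add: sandwich_def tri_def)
  have sb: "sandwichable (I_psg C r) (Some a) (p \<rho>) (Some b)" if "\<rho> permutes {1..q}" for \<rho>
    using br_src[OF p_br[OF that]] br_rng[OF p_br[OF that]] br_rng[OF lmateD(1)[OF *(3)]] br_src[OF rmateD(1)[OF *(4)]]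
    by (simp add: sandwichable_def)
  have J: "tri a \<rho> b \<in> {\<alpha> \<in> rank_ideal C r. br_rank \<alpha> = q}" if "\<rho> permutes {1..q}" for \<rho>
    using tri[OF *(3,4) that] rank_idealI[OF *(1,2)] r by simp
  show "(\<alpha>, \<beta>) \<in> nu (I_psg C r) (natural_group X x q N)"
    unfolding nu_def J_class[OF r] unfolding natural_group_def p_def[symmetric]
    using * S sw sb[OF permutes_id] sb[OF \<pi>(1)] J[OF permutes_id] J[OF \<pi>(1)] \<pi>(2)
    by (intro CollectI, rule_tac exI[of _ "Some a"], rule_tac exI[of _ "p id"], rule_tac exI[of _ "p \<pi>"],
        rule_tac exI[of _ "Some b"]) (simp add: S1_def)
qed

end

lemma nuq_trivial:
  assumes "(\<alpha>, \<beta>) \<in> nuq {id}" shows "\<alpha> = \<beta>"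
  using nuqE[OF assms] by blast

definition "Nsig \<sigma> = {\<pi>. \<pi> permutes {1..q} \<and> (\<epsilon>, p \<pi>) \<in> \<sigma>}"

text \<open>Two \<H>-related elements of rank q have common coordinates a and b. Multiplication by
  \<open>star a\<close> and \<open>star b\<close> moves the pair into the group, multiplication by a
  and b moves it back, and all four multipliers have rank q. So at this rank the congruence is
  described by the permutations related to the identity.\<close>

lemma
  assumes s: "br_cong C r \<sigma>" and r: "enat q \<le> r"
  shows Nsig_normal: "Nsig \<sigma> \<lhd> sym_group q"
    and Nsig_iff: "\<And>A B \<alpha> \<beta>. A \<in> C \<Longrightarrow> B \<in> C \<Longrightarrow> \<alpha> \<in> br A B \<Longrightarrow> \<beta> \<in> br A B \<Longrightarrow> br_rank \<alpha> = q \<Longrightarrow>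
      up \<alpha> = up \<beta> \<Longrightarrow> lo \<alpha> = lo \<beta> \<Longrightarrow> (\<alpha>, \<beta>) \<in> \<sigma> \<longleftrightarrow> (\<alpha>, \<beta>) \<in> nuq (Nsig \<sigma>)"
proof -
  interpret S: br_cong C r \<sigma> by (rule s)
  have pr: "enat (br_rank (p \<pi>)) \<le> r" if "\<pi> permutes {1..q}" for \<pi> using p_rank[OF that] r by simp
  have R: "(p (\<rho> \<circ> \<pi>), p (\<rho> \<circ> \<pi>')) \<in> \<sigma>"
    if "(p \<pi>, p \<pi>') \<in> \<sigma>" "\<pi> permutes {1..q}" "\<pi>' permutes {1..q}" "\<rho> permutes {1..q}" for \<pi> \<pi>' \<rho>
    using S.cong_right[OF that(1) p_br[OF that(2)] p_br[OF that(4)] Y(1) pr[OF that(4)]]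
      p_prd[OF that(2,4)] p_prd[OF that(3,4)] by simp
  have L: "(p (\<pi> \<circ> \<rho>), p (\<pi>' \<circ> \<rho>)) \<in> \<sigma>"
    if "(p \<pi>, p \<pi>') \<in> \<sigma>" "\<pi> permutes {1..q}" "\<pi>' permutes {1..q}" "\<rho> permutes {1..q}" for \<pi> \<pi>' \<rho>
    using S.cong_left[OF that(1) p_br[OF that(2)] p_br[OF that(4)] Y(1) pr[OF that(4)]]
      p_prd[OF that(4,2)] p_prd[OF that(4,3)] by simp
  have idp: "id permutes {1..q}" by (rule permutes_id)
  show nrm: "Nsig \<sigma> \<lhd> sym_group q"
    unfolding normal_sym_group_iff
  proof (intro conjI ballI allI impI)
    have "p id \<in> rank_ideal C r" using rank_idealI[OF Y(1) Y(1) p_br[OF idp] pr[OF idp]] .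
    then show "id \<in> Nsig \<sigma>" using S.cong_refl idp by (simp add: Nsig_def \<epsilon>_def)
    show "\<pi> permutes {1..q}" if "\<pi> \<in> Nsig \<sigma>" for \<pi> using that by (simp add: Nsig_def)
    show "\<pi> \<circ> \<rho> \<in> Nsig \<sigma>" if pi: "\<pi> \<in> Nsig \<sigma>" and rho: "\<rho> \<in> Nsig \<sigma>" for \<pi> \<rho>
      using L[of id \<pi> \<rho>] S.cong_trans[of "p id" "p \<rho>" "p (\<pi> \<circ> \<rho>)"] idp pi rho permutes_compose
      unfolding Nsig_def \<epsilon>_def by auto
    show "inv' \<pi> \<in> Nsig \<sigma>" if pi: "\<pi> \<in> Nsig \<sigma>" for \<pi>
    proof -
      have \<pi>: "\<pi> permutes {1..q}" "(p id, p \<pi>) \<in> \<sigma>" using pi by (auto simp: Nsig_def \<epsilon>_def)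
      from L[OF \<pi>(2) idp \<pi>(1) permutes_inv[OF \<pi>(1)]] S.cong_sym[of "p (inv' \<pi>)" "p id"]
      show ?thesis using permutes_inv[OF \<pi>(1)] permutes_inv_o(1)[OF \<pi>(1)] by (simp add: Nsig_def \<epsilon>_def)
    qed
    show "\<rho> \<circ> \<pi> \<circ> inv' \<rho> \<in> Nsig \<sigma>" if pi: "\<pi> \<in> Nsig \<sigma>" and rho: "\<rho> permutes {1..q}" for \<pi> \<rho>
    proof -
      have \<pi>: "\<pi> permutes {1..q}" "(p id, p \<pi>) \<in> \<sigma>" using pi by (auto simp: Nsig_def \<epsilon>_def)
      have "(p (\<rho> \<circ> id), p (\<rho> \<circ> \<pi>)) \<in> \<sigma>" by (rule R[OF \<pi>(2) idp \<pi>(1) rho])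
      from L[OF this permutes_compose[OF idp rho] permutes_compose[OF \<pi>(1) rho] permutes_inv[OF rho]]
      show ?thesis using permutes_inv_o(1)[OF rho] permutes_compose[OF permutes_inv[OF rho] permutes_compose[OF \<pi>(1) rho]]
        by (simp add: Nsig_def \<epsilon>_def comp_assoc)
    qed
  qed
  fix A B \<alpha> \<beta>
  assume *: "A \<in> C" "B \<in> C" "\<alpha> \<in> br A B" "\<beta> \<in> br A B" "br_rank \<alpha> = q" "up \<alpha> = up \<beta>" "lo \<alpha> = lo \<beta>"
  obtain a b where ab: "a \<in> lmate A" "b \<in> rmate B" "\<alpha> = tri a id b" "up a = up \<alpha>" "lo b = lo \<alpha>"
    using tri_exists[OF *(3,5)] .
  obtain \<pi> where \<pi>: "\<pi> permutes {1..q}" "\<beta> = tri a \<pi> b" using tri_rep[OF ab(1,2) *(4)] ab * by metis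
  have "(\<alpha>, \<beta>) \<in> \<sigma> \<longleftrightarrow> \<pi> \<in> Nsig \<sigma>"
  proof
    assume s: "(\<alpha>, \<beta>) \<in> \<sigma>"
    note ba = lmateD(1)[OF ab(1)] and bb = rmateD(1)[OF ab(2)]
    have "(br_prd (star a) \<alpha>, br_prd (star a) \<beta>) \<in> \<sigma>"
      by (rule S.cong_left[OF s *(3) star_br[OF ba] Y(1)]) (use lmateD(3)[OF ab(1)] r in simp)
    then have "(br_prd (br_prd (star a) \<alpha>) (star b), br_prd (br_prd (star a) \<beta>) (star b)) \<in> \<sigma>"
      by (rule S.cong_right[OF _ br_prd_br[OF star_br[OF ba] *(3)] star_br[OF bb] Y(1)])
        (use rmateD(3)[OF ab(2)] r in simp)
    then show "\<pi> \<in> Nsig \<sigma>"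
      using tri_cancel[OF ab(1,2) idp] tri_cancel[OF ab(1,2) \<pi>(1)] ab(3) \<pi> by (simp add: Nsig_def \<epsilon>_def)
  next
    assume "\<pi> \<in> Nsig \<sigma>"
    then have s: "(p id, p \<pi>) \<in> \<sigma>" by (simp add: Nsig_def \<epsilon>_def)
    note ba = lmateD(1)[OF ab(1)] and bb = rmateD(1)[OF ab(2)]
    have "(br_prd a (p id), br_prd a (p \<pi>)) \<in> \<sigma>"
      by (rule S.cong_left[OF s p_br[OF idp] ba *(1)]) (use lmateD(3)[OF ab(1)] r in simp)
    then have "(tri a id b, tri a \<pi> b) \<in> \<sigma>" unfolding tri_def
      by (rule S.cong_right[OF _ br_prd_br[OF ba p_br[OF idp]] bb *(2)])
        (use rmateD(3)[OF ab(2)] r in simp)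
    then show "(\<alpha>, \<beta>) \<in> \<sigma>" using ab \<pi> by simp
  qed
  also have "\<pi> \<in> Nsig \<sigma> \<longleftrightarrow> (\<alpha>, \<beta>) \<in> nuq (Nsig \<sigma>)"
  proof
    assume "\<pi> \<in> Nsig \<sigma>"
    then show "(\<alpha>, \<beta>) \<in> nuq (Nsig \<sigma>)" using nuqI[OF *(1,2) ab(1,2)] ab(3) \<pi>(2) by simp
  next
    assume "(\<alpha>, \<beta>) \<in> nuq (Nsig \<sigma>)"
    then show "\<pi> \<in> Nsig \<sigma>"
    proof (rule nuq_rep[OF nrm _ *(1,2) ab(1,2,3)])
      fix \<rho> assume *: "\<rho> \<in> Nsig \<sigma>" "\<beta> = tri a \<rho> b"
      then have r: "\<rho> permutes {1..q}" by (simp add: Nsig_def)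
      have "p \<pi> = p \<rho>"
        using tri_cancel[OF ab(1,2) \<pi>(1)] tri_cancel[OF ab(1,2) r] \<pi>(2) *(2) by simp
      then show ?thesis using p_inj[OF \<pi>(1) r] *(1) by simp
    qed
  qed
  finally show "(\<alpha>, \<beta>) \<in> \<sigma> \<longleftrightarrow> (\<alpha>, \<beta>) \<in> nuq (Nsig \<sigma>)" .
qed

end

section \<open>Small matchings and the completion of hooks at rank at most 2\<close>

lemma matching_two: assumes "M \<in> matching V" "card V = 2" shows "M = {V}"
proof -
  obtain a b where V: "V = {a, b}" "a \<noteq> b" using assms(2) by (auto simp: card_2_iff)
  obtain c where "{a, c} \<in> M" "c \<in> V" "a \<noteq> c" using matching_ex[OF assms(1), of a] V by blast
  then have "{{a, b}} \<subseteq> M" using V by auto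
  from matching_subset_eq[OF _ assms(1) this] show ?thesis using matching_pair[OF V(2)] V(1) by simp
qed

text \<open>On four points one pair determines the other. This is what replaces path chasing both in
  the argument for the Klein group and in switching.\<close>

lemma matching_four:
  assumes "M \<in> matching V" "card V = 4" "c \<in> M"
  shows "M = {c, V - c}"
proof -
  have c: "card c = 2" "c \<subseteq> V" using assms by (auto simp: matching_def partition_on_def)
  have "finite V" using assms(2) card.infinite by fastforce
  then have "card (V - c) = 2" using c assms(2) by (simp add: card_Diff_subset finite_subset)
  then have "M - {c} = {V - c}" using matching_two[of "M - {c}" "V - c"] matching_diff[OF assms(1), of "{c}"] assms(3) by simp
  then show ?thesis using assms(3) by blast
qed

text \<open>For rank at most 2, pairing off the two remaining points completes the upper hooks to a matching.\<close>

definition "hup \<alpha> = up \<alpha> \<union> (if dm \<alpha> = {} then {} else {dm \<alpha>})"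
definition "hlo \<alpha> = lo \<alpha> \<union> (if cd \<alpha> = {} then {} else {cd \<alpha>})"

lemma hup_star [simp]: "hup (star \<alpha>) = hlo \<alpha>" and hlo_star [simp]: "hlo (star \<alpha>) = hup \<alpha>"
  by (simp_all add: hup_def hlo_def)

lemma up_hup: "up \<alpha> \<subseteq> hup \<alpha>"
  by (auto simp: hup_def)

lemma hup_cong: "\<alpha> \<in> br A B \<Longrightarrow> \<beta> \<in> br A B' \<Longrightarrow> up \<alpha> = up \<beta> \<Longrightarrow> hup \<alpha> = hup \<beta>"
  by (simp add: hup_def dm_eq)

lemma hlo_cong: "\<alpha> \<in> br A B \<Longrightarrow> \<beta> \<in> br A' B \<Longrightarrow> lo \<alpha> = lo \<beta> \<Longrightarrow> hlo \<alpha> = hlo \<beta>"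
  by (simp add: hlo_def cd_eq)

lemma dm_finite: "\<alpha> \<in> br A B \<Longrightarrow> finite (dm \<alpha>)"
  using dm_subset br_finite finite_subset by metis

lemma rank_le_2:
  assumes "\<alpha> \<in> br A B" "br_rank \<alpha> \<le> 2"
  shows "dm \<alpha> = {} \<or> card (dm \<alpha>) = 2"
proof -
  have "br_rank \<alpha> \<noteq> 1" using br_rank_even[OF assms(1)] by auto
  then have "br_rank \<alpha> = 0 \<or> br_rank \<alpha> = 2" using assms(2) by linarith
  then show ?thesis using br_rank_dm[OF assms(1)] dm_finite[OF assms(1)] by auto
qed

text \<open>At most two points are free, so there is only one completion. It is uniqueness that is
  used later: a matching need only be seen to contain the hooks.\<close>

lemma
  assumes "\<alpha> \<in> br A B" "br_rank \<alpha> \<le> 2"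
  shows hup_matching: "hup \<alpha> \<in> matching A"
    and hup_unique: "\<And>M. M \<in> matching A \<Longrightarrow> up \<alpha> \<subseteq> M \<Longrightarrow> M = hup \<alpha>"
proof -
  note m = up_matching[OF assms(1)]
  have A: "(A - dm \<alpha>) \<union> dm \<alpha> = A" using dm_subset[OF assms(1)] by blast
  show h: "hup \<alpha> \<in> matching A"
  proof (cases "dm \<alpha> = {}")
    case True then show ?thesis using m by (simp add: hup_def)
  next
    case False
    then obtain a b where ab: "dm \<alpha> = {a, b}" "a \<noteq> b" using rank_le_2[OF assms] by (auto simp: card_2_iff)
    then have "{dm \<alpha>} \<in> matching (dm \<alpha>)" using matching_pair by metis
    then have "up \<alpha> \<union> {dm \<alpha>} \<in> matching ((A - dm \<alpha>) \<union> dm \<alpha>)" by (intro matching_Un m) auto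
    then show ?thesis using A False by (simp add: hup_def)
  qed
  fix M assume M: "M \<in> matching A" "up \<alpha> \<subseteq> M"
  have U: "A - \<Union>(up \<alpha>) = dm \<alpha>" using dm_eq[OF assms(1)] by simp
  have d: "M - up \<alpha> \<in> matching (dm \<alpha>)" using matching_diff[OF M] U by simp
  show "M = hup \<alpha>"
  proof (cases "dm \<alpha> = {}")
    case True then show ?thesis using d M by (auto simp: hup_def)
  next
    case False
    then have "M - up \<alpha> = {dm \<alpha>}" using matching_two[OF d] rank_le_2[OF assms] by simp
    then show ?thesis using M(2) False by (auto simp: hup_def)
  qed
qed

lemma
  assumes "\<alpha> \<in> br A B" "br_rank \<alpha> \<le> 2"
  shows hlo_matching: "hlo \<alpha> \<in> matching B"
    and hlo_unique: "\<And>M. M \<in> matching B \<Longrightarrow> lo \<alpha> \<subseteq> M \<Longrightarrow> M = hlo \<alpha>"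
  using hup_matching[OF star_br[OF assms(1)]] hup_unique[OF star_br[OF assms(1)]] assms(2) by simp_all

lemma rank0_hup: "\<alpha> \<in> br A B \<Longrightarrow> br_rank \<alpha> = 0 \<Longrightarrow> hup \<alpha> = up \<alpha>"
  using br_rank_dm dm_finite by (fastforce simp: hup_def)

lemma rank0_hlo: "\<alpha> \<in> br A B \<Longrightarrow> br_rank \<alpha> = 0 \<Longrightarrow> hlo \<alpha> = lo \<alpha>"
  using rank0_hup[OF star_br] by fastforce

lemma rank0_matching:
  assumes "\<alpha> \<in> br A B" "br_rank \<alpha> = 0"
  shows "up \<alpha> \<in> matching A" "lo \<alpha> \<in> matching B"
  using hup_matching[OF assms(1)] hlo_matching[OF assms(1)] rank0_hup[OF assms] rank0_hlo[OF assms] assms(2) by simp_all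

lemma rank0_eqI:
  assumes "\<alpha> \<in> br A B" "\<beta> \<in> br A B" "br_rank \<alpha> = 0" "up \<alpha> = up \<beta>" "lo \<alpha> = lo \<beta>"
  shows "\<alpha> = \<beta>"
proof (rule br_eqI[OF assms(1,2)])
  have "dm \<alpha> = {}" using assms(3) br_rank_dm[OF assms(1)] dm_finite[OF assms(1)] by simp
  then show "{Inl a, Inr b} \<in> \<alpha> \<Longrightarrow> {Inl a, Inr b} \<in> \<beta>" for a b by (auto simp: dm_def)
qed (use assms in auto)

definition "mk0 M L = mk_br M {} id L"

lemma mk0:
  assumes "M \<in> matching A" "L \<in> matching B" "finite A" "finite B" "even (card A)" "even (card B)"
  shows "mk0 M L \<in> br A B" "br_rank (mk0 M L) = 0" "up (mk0 M L) = M" "lo (mk0 M L) = L"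
proof -
  show br: "mk0 M L \<in> br A B" unfolding mk0_def by (rule mk_br_br) (use assms in auto)
  have e: "{} \<notin> M" "{} \<notin> L" using assms matching_no_empty by blast+
  show "up (mk0 M L) = M" "lo (mk0 M L) = L" using mk_br_parts[OF e] by (simp_all add: mk0_def)
  have "dm (mk0 M L) = {}" using mk_br_parts(3)[OF e, of "{}" id] by (simp add: mk0_def)
  then show "br_rank (mk0 M L) = 0" using br_rank_dm[OF br] by simp
qed

definition "ret \<alpha> = mk0 (hup \<alpha>) (hlo \<alpha>)"

lemma ret:
  assumes "\<alpha> \<in> br A B" "br_rank \<alpha> \<le> 2"
  shows "ret \<alpha> \<in> br A B" "br_rank (ret \<alpha>) = 0" "up (ret \<alpha>) = hup \<alpha>" "lo (ret \<alpha>) = hlo \<alpha>"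
  using mk0[OF hup_matching[OF assms] hlo_matching[OF assms] br_finite[OF assms(1)]] by (simp_all add: ret_def)

lemma ret_rank0: "\<alpha> \<in> br A B \<Longrightarrow> br_rank \<alpha> = 0 \<Longrightarrow> ret \<alpha> = \<alpha>"
  using ret[of \<alpha> A B] rank0_eqI[of "ret \<alpha>" A B \<alpha>] rank0_hup[of \<alpha> A B] rank0_hlo[of \<alpha> A B] by simp

text \<open>The hooks of \<alpha> persist in the product, so the completed hooks of the product are
  a matching containing them. The rank of \<beta> is unrestricted.\<close>

lemma hup_prd:
  assumes "\<alpha> \<in> br A B" "\<beta> \<in> br B D" "br_rank \<alpha> \<le> 2"
  shows "hup (br_prd \<alpha> \<beta>) = hup \<alpha>"
  using hup_unique[OF assms(1,3) hup_matching[OF br_prd_br[OF assms(1,2)]]]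
    rank_prd_left[OF assms(1,2)] assms(3) up_prd[OF assms(1,2)] up_hup[of "br_prd \<alpha> \<beta>"] by auto

lemma hlo_prd:
  assumes "\<alpha> \<in> br A B" "\<beta> \<in> br B D" "br_rank \<beta> \<le> 2"
  shows "hlo (br_prd \<alpha> \<beta>) = hlo \<beta>"
  using hup_prd[OF star_br[OF assms(2)] star_br[OF assms(1)]] assms(3) star_prd[OF assms(1,2), symmetric] by simp

lemma up_rank0_prd: "\<alpha> \<in> br A B \<Longrightarrow> br_rank \<alpha> = 0 \<Longrightarrow> \<beta> \<in> br B D \<Longrightarrow> up (br_prd \<alpha> \<beta>) = up \<alpha>"
  using rank_eq_up[of \<alpha> A B \<beta> D] rank_prd_left[of \<alpha> A B \<beta> D] by simp

lemma lo_rank0_prd: "\<alpha> \<in> br A B \<Longrightarrow> br_rank \<beta> = 0 \<Longrightarrow> \<beta> \<in> br B D \<Longrightarrow> lo (br_prd \<alpha> \<beta>) = lo \<beta>"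
  using rank_eq_lo[of \<alpha> A B \<beta> D] rank_prd_right[of \<alpha> A B \<beta> D] by simp

lemma ret_prd:
  assumes "\<alpha> \<in> br A B" "\<beta> \<in> br B D" "br_rank \<alpha> \<le> 2" "br_rank \<beta> \<le> 2"
  shows "ret (br_prd \<alpha> \<beta>) = br_prd (ret \<alpha>) (ret \<beta>)"
proof -
  note ra = ret[OF assms(1,3)] and rb = ret[OF assms(2,4)]
  have r: "br_rank (br_prd \<alpha> \<beta>) \<le> 2" using rank_prd_left[OF assms(1,2)] assms(3) by simp
  note rab = ret[OF br_prd_br[OF assms(1,2)] r]
  show ?thesis
    by (rule rank0_eqI[OF rab(1) br_prd_br[OF ra(1) rb(1)] rab(2)])
      (simp_all add: rab hup_prd[OF assms(1,2,3)] hlo_prd[OF assms(1,2,4)] up_rank0_prd[OF ra(1,2) rb(1)]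
        lo_rank0_prd[OF ra(1) rb(2,1)] ra rb)
qed

text \<open>Both products factor through the projection of \<alpha>, whose rank is at most 2. Hence
  they share a left factor of rank at most 2, and this factor alone determines their completed upper
  hooks. This handles multipliers \<zeta> of arbitrary rank.\<close>

lemma hup_left:
  assumes "\<alpha> \<in> br A B" "br_rank \<alpha> \<le> 2" "\<zeta> \<in> br D A"
  shows "hup (br_prd \<zeta> \<alpha>) = up (br_prd \<zeta> (ret \<alpha>))"
proof -
  note ra = ret[OF assms(1,2)] and sa = star_br[OF assms(1)]
  let ?e = "br_prd \<alpha> (star \<alpha>)"
  have e: "?e \<in> br A A" "br_rank ?e \<le> 2" using br_prd_br[OF assms(1) sa] rank_prd_left[OF assms(1) sa] assms(2) by simp_all
  have ze: "br_prd \<zeta> ?e \<in> br D A" "br_rank (br_prd \<zeta> ?e) \<le> 2"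
    using br_prd_br[OF assms(3) e(1)] rank_prd_right[OF assms(3) e(1)] e(2) by simp_all
  have 1: "br_prd (br_prd \<zeta> ?e) \<alpha> = br_prd \<zeta> \<alpha>"
    using br_prd_assoc[OF assms(3) e(1) assms(1)] proj_absorb[OF assms(1,1)] by simp
  have 2: "br_prd (br_prd \<zeta> ?e) (ret \<alpha>) = br_prd \<zeta> (ret \<alpha>)"
    using br_prd_assoc[OF assms(3) e(1) ra(1)] proj_absorb[OF assms(1) ra(1)] ra(3) up_hup[of \<alpha>] by simp
  have "br_rank (br_prd \<zeta> (ret \<alpha>)) = 0" using rank_prd_right[OF assms(3) ra(1)] ra(2) by simp
  then have "up (br_prd \<zeta> (ret \<alpha>)) = hup (br_prd \<zeta> (ret \<alpha>))"
    using rank0_hup[OF br_prd_br[OF assms(3) ra(1)]] by simp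
  then show ?thesis using hup_prd[OF ze(1) assms(1) ze(2)] hup_prd[OF ze(1) ra(1) ze(2)] 1 2 by simp
qed

lemma hup_left_cong:
  assumes "\<alpha> \<in> br A B" "\<beta> \<in> br A B'" "br_rank \<alpha> \<le> 2" "br_rank \<beta> \<le> 2" "\<zeta> \<in> br D A" "hup \<alpha> = hup \<beta>"
  shows "hup (br_prd \<zeta> \<alpha>) = hup (br_prd \<zeta> \<beta>)"
  using hup_left[OF assms(1,3,5)] hup_left[OF assms(2,4,5)]
    up_eq_prd(2)[OF ret(1)[OF assms(1,3)] ret(1)[OF assms(2,4)] _ assms(5)]
    ret(3)[OF assms(1,3)] ret(3)[OF assms(2,4)] assms(6) by simp

lemma hlo_right_cong:
  assumes "\<alpha> \<in> br B A" "\<beta> \<in> br B' A" "br_rank \<alpha> \<le> 2" "br_rank \<beta> \<le> 2" "\<zeta> \<in> br A D" "hlo \<alpha> = hlo \<beta>"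
  shows "hlo (br_prd \<alpha> \<zeta>) = hlo (br_prd \<beta> \<zeta>)"
  using hup_left_cong[OF star_br[OF assms(1)] star_br[OF assms(2)] _ _ star_br[OF assms(5)]] assms(3,4,6)
    star_prd[OF assms(1,5), symmetric] star_prd[OF assms(2,5), symmetric] by simp

section \<open>The retraction onto the minimal ideal\<close>

context brauer_category begin

lemma mk0_C:
  assumes "M \<in> matching A" "L \<in> matching B" "A \<in> C" "B \<in> C"
  shows "mk0 M L \<in> br A B" "br_rank (mk0 M L) = 0" "up (mk0 M L) = M" "lo (mk0 M L) = L" "mk0 M L \<in> rank_ideal C r"
proof -
  show m: "mk0 M L \<in> br A B" "br_rank (mk0 M L) = 0" "up (mk0 M L) = M" "lo (mk0 M L) = L"
    using mk0[OF assms(1,2)] C_even[OF assms(3)] C_even[OF assms(4)] by simp_all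
  show "mk0 M L \<in> rank_ideal C r" using rank_idealI[OF assms(3,4) m(1)] m(2) by (simp add: enat_0)
qed

lemma matching_C: "A \<in> C \<Longrightarrow> \<exists>M. M \<in> matching A"
  using C_even matching_exists by blast

lemma rank_ideal_0: "\<alpha> \<in> rank_ideal C 0 \<Longrightarrow> br_rank \<alpha> = 0"
  by (simp add: rank_ideal_def enat_0_iff)

lemma is_ideal_rank_ideal: "s \<le> r \<Longrightarrow> is_ideal (I_psg C r) (rank_ideal C s)"
  unfolding is_ideal_def
proof (intro conjI ballI impI)
  assume sr: "s \<le> r"
  obtain A where A: "A \<in> C" using C_nonempty by blast
  obtain M where "M \<in> matching A" using matching_C[OF A] by blast
  then show "rank_ideal C s \<noteq> {}" using mk0_C(5)[of M A M A] A by blast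
  show "rank_ideal C s \<subseteq> els (I_psg C r)" using sr by (auto simp: rank_ideal_def)
  fix \<alpha> \<beta> assume ab: "\<alpha> \<in> rank_ideal C s" "\<beta> \<in> els (I_psg C r)"
  then have b: "\<beta> \<in> br (br_src \<beta>) (br_rng \<beta>)" "br_src \<beta> \<in> C" "br_rng \<beta> \<in> C"
    using rank_ideal_br rank_ideal_src by auto
  show "prd (I_psg C r) \<alpha> \<beta> \<in> rank_ideal C s" if "rng (I_psg C r) \<alpha> = src (I_psg C r) \<beta>"
    using rank_ideal_prd_left[OF ab(1), of \<beta> "br_rng \<beta>"] b that by simp
  show "prd (I_psg C r) \<beta> \<alpha> \<in> rank_ideal C s" if "rng (I_psg C r) \<beta> = src (I_psg C r) \<alpha>"
    using rank_ideal_prd_right[OF ab(1), of \<beta> "br_src \<beta>"] b that by simp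
qed

text \<open>Any element can be sandwiched between elements of rank 0 with prescribed outer
  matchings, and an element of rank 0 is determined by its two matchings.\<close>

lemma rank_ideal_0_least:
  assumes J: "is_ideal (I_psg C r) J"
  shows "rank_ideal C 0 \<subseteq> J"
proof
  fix \<gamma> assume g: "\<gamma> \<in> rank_ideal C 0"
  obtain \<alpha> where a: "\<alpha> \<in> J" using J by (auto simp: is_ideal_def)
  then have ar: "\<alpha> \<in> rank_ideal C r" using J by (auto simp: is_ideal_def)
  note ba = rank_ideal_br[OF ar] and bg = rank_ideal_br[OF g] and sa = rank_ideal_src[OF ar] and sg = rank_ideal_src[OF g]
  have g0: "br_rank \<gamma> = 0" by (rule rank_ideal_0[OF g])
  obtain M L where mts: "M \<in> matching (br_src \<alpha>)" "L \<in> matching (br_rng \<alpha>)" using matching_C sa by blast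
  let ?a = "mk0 (up \<gamma>) M" and ?b = "mk0 L (lo \<gamma>)"
  note m1 = mk0_C[OF rank0_matching(1)[OF bg g0] mts(1) sg(1) sa(1)]
  note m2 = mk0_C[OF mts(2) rank0_matching(2)[OF bg g0] sa(2) sg(2)]
  have "br_prd ?a \<alpha> \<in> J" using J a m1(5)[of r] br_rng[OF m1(1)] by (auto simp: is_ideal_def)
  moreover have ab: "br_prd ?a \<alpha> \<in> br (br_src \<gamma>) (br_rng \<alpha>)" by (rule br_prd_br[OF m1(1) ba])
  ultimately have "br_prd (br_prd ?a \<alpha>) ?b \<in> J"
    using J m2(5)[of r] br_src[OF m2(1)] br_rng[OF ab] by (auto simp: is_ideal_def)
  moreover have "br_prd (br_prd ?a \<alpha>) ?b = \<gamma>"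
  proof (rule rank0_eqI[symmetric, OF bg br_prd_br[OF ab m2(1)] g0])
    have "br_rank (br_prd ?a \<alpha>) = 0" using rank_prd_left[OF m1(1) ba] m1(2) by simp
    then show "up \<gamma> = up (br_prd (br_prd ?a \<alpha>) ?b)"
      using up_rank0_prd[OF ab _ m2(1)] up_rank0_prd[OF m1(1,2) ba] m1(3) by simp
    show "lo \<gamma> = lo (br_prd (br_prd ?a \<alpha>) ?b)" using lo_rank0_prd[OF ab m2(2,1)] m2(4) by simp
  qed
  ultimately show "\<gamma> \<in> J" by simp
qed

lemma is_minimal_ideal_iff: "is_minimal_ideal (I_psg C r) M \<longleftrightarrow> M = rank_ideal C 0"
  unfolding is_minimal_ideal_def
  using is_ideal_rank_ideal[of 0 r] rank_ideal_0_least[of r] by (metis order_antisym zero_le)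

lemma minimal_ideal_eq: "minimal_ideal (I_psg C r) = rank_ideal C 0"
  unfolding minimal_ideal_def is_minimal_ideal_iff by simp

lemma ret_is_retraction:
  assumes "s \<le> 2" "s \<le> r"
  shows "is_retraction (I_psg C r) (rank_ideal C s) (restrict ret (rank_ideal C s))"
proof -
  have rk: "br_rank \<alpha> \<le> 2" if "\<alpha> \<in> rank_ideal C s" for \<alpha>
    using order_trans[OF rank_ideal_rank[OF that] assms(1)] by (metis enat_ord_simps(1) numeral_eq_enat)
  have r0: "ret \<alpha> \<in> rank_ideal C 0" if "\<alpha> \<in> rank_ideal C s" for \<alpha>
    using rank_idealI[OF rank_ideal_src[OF that] ret(1)[OF rank_ideal_br[OF that] rk[OF that]]]
      ret(2)[OF rank_ideal_br[OF that] rk[OF that]] by (simp add: enat_0)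
  have sub: "rank_ideal C 0 \<subseteq> rank_ideal C s" by (auto simp: rank_ideal_def enat_0_iff zero_enat_def[symmetric])
  show ?thesis
    unfolding is_retraction_def minimal_ideal_eq
  proof (intro conjI ballI impI)
    show "restrict ret (rank_ideal C s) \<in> rank_ideal C s \<rightarrow> rank_ideal C 0" using r0 by auto
    show "psg_sim (I_psg C r) \<alpha> (restrict ret (rank_ideal C s) \<alpha>)" if "\<alpha> \<in> rank_ideal C s" for \<alpha>
      using that br_src[OF ret(1)[OF rank_ideal_br[OF that] rk[OF that]]]
        br_rng[OF ret(1)[OF rank_ideal_br[OF that] rk[OF that]]] by (simp add: psg_sim_def)
    show "restrict ret (rank_ideal C s) \<alpha> = \<alpha>" if "\<alpha> \<in> rank_ideal C 0" for \<alpha>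
      using subsetD[OF sub that] ret_rank0[OF rank_ideal_br[OF that] rank_ideal_0[OF that]] by simp
    fix \<alpha> \<beta> assume ab: "\<alpha> \<in> rank_ideal C s" "\<beta> \<in> rank_ideal C s" "rng (I_psg C r) \<alpha> = src (I_psg C r) \<beta>"
    have b: "\<beta> \<in> br (br_rng \<alpha>) (br_rng \<beta>)" using rank_ideal_br[OF ab(2)] ab(3) by simp
    have "br_prd \<alpha> \<beta> \<in> rank_ideal C s" by (rule rank_ideal_prd_left[OF ab(1) b]) (use rank_ideal_src ab in auto)
    then show "restrict ret (rank_ideal C s) (prd (I_psg C r) \<alpha> \<beta>) =
        prd (I_psg C r) (restrict ret (rank_ideal C s) \<alpha>) (restrict ret (rank_ideal C s) \<beta>)"
      using ret_prd[OF rank_ideal_br[OF ab(1)] b rk[OF ab(1)] rk[OF ab(2)]] ab by simp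
  qed
qed

text \<open>A retraction fixes all products with elements of rank 0, so \<alpha> and its image have
  the same ones. A left multiple reveals the completed lower hooks and a right multiple the
  completed upper hooks.\<close>

lemma retraction_unique:
  assumes "s \<le> 2" "s \<le> r" and f: "is_retraction (I_psg C r) (rank_ideal C s) f" and a: "\<alpha> \<in> rank_ideal C s"
  shows "f \<alpha> = ret \<alpha>"
proof -
  have rk: "br_rank \<alpha> \<le> 2"
    using order_trans[OF rank_ideal_rank[OF a] assms(1)] by (metis enat_ord_simps(1) numeral_eq_enat)
  note ba = rank_ideal_br[OF a] and sa = rank_ideal_src[OF a]
  have fa: "f \<alpha> \<in> rank_ideal C 0" using f a by (auto simp: is_retraction_def minimal_ideal_eq)
  have "br_src (f \<alpha>) = br_src \<alpha>" "br_rng (f \<alpha>) = br_rng \<alpha>" using f a by (auto simp: is_retraction_def psg_sim_def)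
  then have bf: "f \<alpha> \<in> br (br_src \<alpha>) (br_rng \<alpha>)" using rank_ideal_br[OF fa] by simp
  have f0: "br_rank (f \<alpha>) = 0" by (rule rank_ideal_0[OF fa])
  obtain M L where mts: "M \<in> matching (br_src \<alpha>)" "L \<in> matching (br_rng \<alpha>)" using matching_C sa by blast
  let ?a = "mk0 M M" and ?b = "mk0 L L"
  note m1 = mk0_C[OF mts(1,1) sa(1,1)] and m2 = mk0_C[OF mts(2,2) sa(2,2)]
  have fix0: "f \<gamma> = \<gamma>" if "\<gamma> \<in> rank_ideal C 0" for \<gamma>
    using f that by (auto simp: is_retraction_def minimal_ideal_eq)
  have hom: "f (br_prd \<beta> \<gamma>) = br_prd (f \<beta>) (f \<gamma>)"
    if "\<beta> \<in> rank_ideal C s" "\<gamma> \<in> rank_ideal C s" "br_rng \<beta> = br_src \<gamma>" for \<beta> \<gamma>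
    using f that by (auto simp: is_retraction_def)
  have "br_prd ?a \<alpha> \<in> rank_ideal C 0"
    by (rule rank_ideal_prd_left[OF m1(5), of \<alpha> "br_rng \<alpha>"]) (use br_rng[OF m1(1)] ba sa in auto)
  then have ea: "br_prd ?a \<alpha> = br_prd ?a (f \<alpha>)"
    using hom[OF m1(5) a] fix0[of "br_prd ?a \<alpha>"] fix0[OF m1(5)] br_rng[OF m1(1)] by simp
  have "br_prd \<alpha> ?b \<in> rank_ideal C 0"
    by (rule rank_ideal_prd_right[OF m2(5), of \<alpha> "br_src \<alpha>"]) (use br_src[OF m2(1)] ba sa in auto)
  then have eb: "br_prd \<alpha> ?b = br_prd (f \<alpha>) ?b"
    using hom[OF a m2(5)] fix0[of "br_prd \<alpha> ?b"] fix0[OF m2(5)] br_src[OF m2(1)] by simp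
  have "hlo \<alpha> = lo (f \<alpha>)"
    using hlo_prd[OF m1(1) ba rk] hlo_prd[OF m1(1) bf] rank0_hlo[OF bf f0] f0 ea by simp
  moreover have "hup \<alpha> = up (f \<alpha>)"
    using hup_prd[OF ba m2(1) rk] hup_prd[OF bf m2(1)] rank0_hup[OF bf f0] f0 eb by simp
  ultimately show ?thesis
    using rank0_eqI[OF bf ret(1)[OF ba rk] f0] ret(3,4)[OF ba rk] by simp
qed

lemma retraction_of_eq:
  assumes "s \<le> 2" "s \<le> r"
  shows "retraction_of (I_psg C r) (rank_ideal C s) = restrict ret (rank_ideal C s)"
  unfolding retraction_of_def
proof (rule the_equality)
  show "restrict ret (rank_ideal C s) \<in> extensional (rank_ideal C s) \<and>
      is_retraction (I_psg C r) (rank_ideal C s) (restrict ret (rank_ideal C s))"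
    using ret_is_retraction[OF assms] by simp
  show "f = restrict ret (rank_ideal C s)"
    if f: "f \<in> extensional (rank_ideal C s) \<and> is_retraction (I_psg C r) (rank_ideal C s) f" for f
    using f retraction_unique[OF assms, of f] by (intro extensionalityI[of f "rank_ideal C s"]) auto
qed

lemma retractable_2: "r \<ge> 2 \<Longrightarrow> retractable (I_psg C r) (rank_ideal C 2)"
  unfolding retractable_def using is_ideal_rank_ideal[of 2 r] ret_is_retraction[of 2 r] by auto

text \<open>The flags \<open>eu\<close> and \<open>el\<close> say that the upper, respectively lower, hooks are disregarded.\<close>

definition "base eu el m = {(\<alpha>, \<beta>). \<exists>A\<in>C. \<exists>B\<in>C. \<alpha> \<in> br A B \<and> \<beta> \<in> br A B \<and>
    br_rank \<alpha> \<le> m \<and> br_rank \<beta> \<le> m \<and> (eu \<or> hup \<alpha> = hup \<beta>) \<and> (el \<or> hlo \<alpha> = hlo \<beta>)}"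

lemma base_star: "(star \<alpha>, star \<beta>) \<in> base el eu m \<longleftrightarrow> (\<alpha>, \<beta>) \<in> base eu el m"
proof -
  have "(star \<alpha>, star \<beta>) \<in> base el eu m" if "(\<alpha>, \<beta>) \<in> base eu el m" for \<alpha> \<beta> eu el
  proof -
    obtain A B where *: "A \<in> C" "B \<in> C" "\<alpha> \<in> br A B" "\<beta> \<in> br A B" "br_rank \<alpha> \<le> m" "br_rank \<beta> \<le> m"
      "eu \<or> hup \<alpha> = hup \<beta>" "el \<or> hlo \<alpha> = hlo \<beta>" using \<open>(\<alpha>, \<beta>) \<in> base eu el m\<close> unfolding base_def by blast
    show ?thesis unfolding base_def
      using * star_br[OF *(3)] star_br[OF *(4)] by (intro CollectI case_prodI bexI[of _ B] bexI[of _ A]) auto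
  qed
  from this[of \<alpha> \<beta> eu el] this[of "star \<alpha>" "star \<beta>" el eu] show ?thesis by auto
qed

lemma base_right:
  assumes m: "m \<le> 2 \<or> eu \<and> el" and ab: "(\<alpha>, \<beta>) \<in> base eu el m" "\<alpha> \<in> br A B" "\<beta> \<in> br A B"
    and z: "\<zeta> \<in> br B D" "A \<in> C" "D \<in> C"
  shows "(br_prd \<alpha> \<zeta>, br_prd \<beta> \<zeta>) \<in> base eu el m"
proof -
  have *: "br_rank \<alpha> \<le> m" "br_rank \<beta> \<le> m" "eu \<or> hup \<alpha> = hup \<beta>" "el \<or> hlo \<alpha> = hlo \<beta>"
    using ab(1) by (auto simp: base_def)
  have "br_rank (br_prd \<alpha> \<zeta>) \<le> m" "br_rank (br_prd \<beta> \<zeta>) \<le> m"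
    using rank_prd_left[OF ab(2) z(1)] rank_prd_left[OF ab(3) z(1)] * by simp_all
  moreover have "eu \<or> hup (br_prd \<alpha> \<zeta>) = hup (br_prd \<beta> \<zeta>)"
    using m * hup_prd[OF ab(2) z(1)] hup_prd[OF ab(3) z(1)] by auto
  moreover have "el \<or> hlo (br_prd \<alpha> \<zeta>) = hlo (br_prd \<beta> \<zeta>)"
    using m * hlo_right_cong[OF ab(2,3) _ _ z(1)] by auto
  ultimately show ?thesis
    unfolding base_def using z(2,3) br_prd_br[OF ab(2) z(1)] br_prd_br[OF ab(3) z(1)] by blast
qed

end

section \<open>The listed relations are congruences\<close>

lemma atLeastAtMost_1_4: "{1..4} = {1, 2, 3, 4 :: nat}" by auto

text \<open>A pair goes to itself or to its complement exactly if the matching formed by the two is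
  preserved. In this form the group can be tested on hooks, and closure properties follow without
  multiplying elements.\<close>

lemma klein_iff:
  assumes \<pi>: "\<pi> permutes {1..4}"
  shows "\<pi> \<in> klein \<longleftrightarrow>
    (\<forall>i\<in>{1..4}. \<forall>j\<in>{1..4}. i \<noteq> j \<longrightarrow> {\<pi> i, \<pi> j} = {i, j} \<or> {\<pi> i, \<pi> j} \<inter> {i, j} = {})" (is "_ \<longleftrightarrow> ?P")
proof
  assume "\<pi> \<in> klein"
  then show ?P unfolding klein_def atLeastAtMost_1_4
    by (elim insertE emptyE) (simp_all add: transpose_def doubleton_eq_iff)
next
  assume P: ?P
  have in4: "\<pi> i \<in> {1, 2, 3, 4}" if "i \<in> {1, 2, 3, 4}" for i
    using permutes_in_image[OF \<pi>, of i] that unfolding atLeastAtMost_1_4 by simp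
  have inj: "\<pi> i = \<pi> j \<Longrightarrow> i = j" for i j using permutes_inj[OF \<pi>] by (auto dest: injD)
  have out: "\<pi> i = i" if "i \<notin> {1, 2, 3, 4}" for i
    using permutes_not_in[OF \<pi>, of i] that unfolding atLeastAtMost_1_4 by simp
  have eqI: "\<pi> = \<rho>"
    if "\<pi> 1 = \<rho> 1" "\<pi> 2 = \<rho> 2" "\<pi> 3 = \<rho> 3" "\<pi> 4 = \<rho> 4" "\<And>i. i \<notin> {1, 2, 3, 4} \<Longrightarrow> \<rho> i = i" for \<rho>
  proof
    fix i show "\<pi> i = \<rho> i" using that out[of i] by (cases "i \<in> {1, 2, 3, 4}") auto
  qed
  have P': "{\<pi> i, \<pi> j} = {i, j} \<or> {\<pi> i, \<pi> j} \<inter> {i, j} = {}"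
    if "i \<in> {1, 2, 3, 4}" "j \<in> {1, 2, 3, 4}" "i \<noteq> j" for i j using P that unfolding atLeastAtMost_1_4 by blast
  have i1: "\<pi> 1 \<in> {1, 2, 3, 4}" and i2: "\<pi> 2 \<in> {1, 2, 3, 4}" and i3: "\<pi> 3 \<in> {1, 2, 3, 4}" and i4: "\<pi> 4 \<in> {1, 2, 3, 4}"
    using in4 by simp_all
  have d: "\<pi> 1 \<noteq> \<pi> 2" "\<pi> 1 \<noteq> \<pi> 3" "\<pi> 1 \<noteq> \<pi> 4" "\<pi> 2 \<noteq> \<pi> 3" "\<pi> 2 \<noteq> \<pi> 4" "\<pi> 3 \<noteq> \<pi> 4"
    using inj by fastforce+
  have p: "{\<pi> 1, \<pi> 2} = {1, 2} \<or> {\<pi> 1, \<pi> 2} \<inter> {1, 2} = {}" "{\<pi> 1, \<pi> 3} = {1, 3} \<or> {\<pi> 1, \<pi> 3} \<inter> {1, 3} = {}"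
    "{\<pi> 1, \<pi> 4} = {1, 4} \<or> {\<pi> 1, \<pi> 4} \<inter> {1, 4} = {}"
    using P'[of 1 2] P'[of 1 3] P'[of 1 4] by simp_all
  \<comment> \<open>The image of 1 together with the condition on the pairs containing 1 determines
    the remaining values.\<close>
  from i1 consider "\<pi> 1 = 1" | "\<pi> 1 = 2" | "\<pi> 1 = 3" | "\<pi> 1 = 4" by blast
  then show "\<pi> \<in> klein"
  proof cases
    case 1
    then have "\<pi> 2 = 2" "\<pi> 3 = 3" "\<pi> 4 = 4" using p by (auto simp: doubleton_eq_iff)
    then have "\<pi> = id" using 1 by (intro eqI) auto
    then show ?thesis by (simp add: klein_def)
  next
    case 2
    then have "\<pi> 2 = 1" "\<pi> 3 = 4" "\<pi> 4 = 3" using p i2 i3 i4 d by (auto simp: doubleton_eq_iff)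
    then have "\<pi> = transpose 1 2 \<circ> transpose 3 4" using 2 by (intro eqI) (auto simp: transpose_def)
    then show ?thesis by (simp add: klein_def)
  next
    case 3
    then have "\<pi> 3 = 1" "\<pi> 2 = 4" "\<pi> 4 = 2" using p i2 i3 i4 d by (auto simp: doubleton_eq_iff)
    then have "\<pi> = transpose 1 3 \<circ> transpose 2 4" using 3 by (intro eqI) (auto simp: transpose_def)
    then show ?thesis by (simp add: klein_def)
  next
    case 4
    then have "\<pi> 4 = 1" "\<pi> 2 = 3" "\<pi> 3 = 2" using p i2 i3 i4 d by (auto simp: doubleton_eq_iff)
    then have "\<pi> = transpose 1 4 \<circ> transpose 2 3" using 4 by (intro eqI) (auto simp: transpose_def)
    then show ?thesis by (simp add: klein_def)
  qed
qed

text \<open>The relation \<lambda> asks for \<L>-related retracts, that is for equal lower hooks; so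
  it is the upper hooks that it disregards, and dually for \<rho>.\<close>

definition eu_of :: "kind \<Rightarrow> bool" where "eu_of k \<longleftrightarrow> k = LambdaK \<or> k = RK"
definition el_of :: "kind \<Rightarrow> bool" where "el_of k \<longleftrightarrow> k = RhoK \<or> k = RK"

context brauer_rank begin

lemma E_card: "card (e ` {1..q}) = q"
  using p_rank[OF permutes_id] p_dm[OF permutes_id] br_rank_dm[OF p_br[OF permutes_id]] by simp

lemma up_minus_U: "M \<in> matching Y \<Longrightarrow> U \<subseteq> M \<Longrightarrow> M - U \<in> matching (e ` {1..q})"
  using matching_diff[of M Y U] matching_Union[OF U_matching] e_q by (metis Diff_Diff_Int inf.absorb2)

text \<open>Of the four free points, \<delta> hooks at least two. Multiplication by the permutation
  pulls this hook back to its preimage, which for a Klein permutation is the hook itself or the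
  complementary pair; the matching of the four points is the same in both cases.\<close>

lemma klein_hup:
  assumes q4: "q = 4" and \<pi>: "\<pi> \<in> klein" "\<pi> permutes {1..q}" and P: "\<delta> \<in> br Y D" "U \<subseteq> up \<delta>" "br_rank \<delta> \<le> 2"
  shows "hup (br_prd (p \<pi>) \<delta>) = hup \<delta>"
proof -
  let ?E = "e ` {1..q}"
  have pP: "br_prd (p \<pi>) \<delta> \<in> br Y D" by (rule br_prd_br[OF p_br[OF \<pi>(2)] P(1)])
  have rpP: "br_rank (br_prd (p \<pi>) \<delta>) \<le> 2" using rank_prd_right[OF p_br[OF \<pi>(2)] P(1)] P(3) by simp
  have UpP: "U \<subseteq> hup (br_prd (p \<pi>) \<delta>)" using up_prd[OF p_br[OF \<pi>(2)] P(1)] p_up[OF \<pi>(2)] up_hup by blast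
  have UP: "U \<subseteq> hup \<delta>" using P(2) up_hup by blast
  note m1 = up_minus_U[OF hup_matching[OF P(1,3)] UP] and m2 = up_minus_U[OF hup_matching[OF pP rpP] UpP]
  have cE: "card ?E = 4" using E_card q4 by simp
  \<comment> \<open>Equality would give \<delta> rank 4.\<close>
  have "up \<delta> \<noteq> U"
    using matched_rank(2)[OF eps(1) P(1)] eps P(3) q4 by auto
  then obtain c where c: "c \<in> up \<delta>" "c \<notin> U" using P(2) by blast
  then have cm: "c \<in> hup \<delta> - U" using up_hup by blast
  obtain u v where uv: "c = {u, v}" "u \<noteq> v" "u \<in> ?E" "v \<in> ?E" using matchingE[OF m1 cm] .
  obtain i j where ij: "i \<in> {1..q}" "j \<in> {1..q}" "u = e (\<pi> i)" "v = e (\<pi> j)"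
  proof -
    have "?E = e ` \<pi> ` {1..q}" using permutes_image[OF \<pi>(2)] by simp
    then show ?thesis using uv(3,4) that by blast
  qed
  have nij: "i \<noteq> j" using uv(2) ij by auto
  have pin: "\<pi> i \<in> {1..q}" "\<pi> j \<in> {1..q}" using permutes_in_image[OF \<pi>(2)] ij by simp_all
  have "{Inl u, Inl v} \<in> \<delta>" using c uv by (simp add: up_link)
  then have "{Inl (e i), Inl (e j)} \<in> br_prd (p \<pi>) \<delta>"
    using link_turn[OF p_br[OF \<pi>(2)] P(1), of "e i" u v "e j"] p_link[OF \<pi>(2)] ij by blast
  then have "{e i, e j} \<in> up (br_prd (p \<pi>) \<delta>)" by (simp add: up_link)
  then have c': "{e i, e j} \<in> hup (br_prd (p \<pi>) \<delta>)" by (rule subsetD[OF up_hup])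
  have E: "e ` {1..q} \<inter> \<Union>U = {}" using matching_Union[OF U_matching] by blast
  have c'U: "{e i, e j} \<in> hup (br_prd (p \<pi>) \<delta>) - U" using c' E ij by blast
  have einj: "e k = e l \<longleftrightarrow> k = l" if "k \<in> {1..q}" "l \<in> {1..q}" for k l using e_inj[of k l] that Y(2) by simp
  have "{\<pi> i, \<pi> j} = {i, j} \<or> {\<pi> i, \<pi> j} \<inter> {i, j} = {}"
    using klein_iff[of \<pi>] \<pi> q4 ij nij by simp
  then have "{e i, e j} = c \<or> {e i, e j} = ?E - c"
  proof
    assume "{\<pi> i, \<pi> j} = {i, j}"
    then have "e ` {\<pi> i, \<pi> j} = e ` {i, j}" by simp
    then show ?thesis using uv(1) ij by simp
  next
    assume "{\<pi> i, \<pi> j} \<inter> {i, j} = {}"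
    then have "{e i, e j} \<subseteq> ?E - c" using uv(1) ij pin einj by auto
    moreover have "card (?E - c) = 2"
      using cE uv by (simp add: card_Diff_subset)
    moreover have "card {e i, e j} = 2" using nij einj ij by simp
    ultimately show ?thesis using card_subset_eq[of "?E - c" "{e i, e j}"] by simp
  qed
  moreover have "?E - (?E - c) = c" using uv by (simp add: double_diff)
  ultimately have "hup (br_prd (p \<pi>) \<delta>) - U = {c, ?E - c}"
    using matching_four[OF m2 cE c'U] by (elim disjE) (simp_all only: insert_commute)
  then have "hup (br_prd (p \<pi>) \<delta>) - U = hup \<delta> - U" using matching_four[OF m1 cE cm] by simp
  then show ?thesis using UP UpP by blast
qed

text \<open>The ideal part below q, the group part at rank q, and equality elsewhere. As ranks are
  even, q - 2 is the largest rank below q.\<close>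

definition "Rel eu el N r = base eu el (q - 2) \<union> nuq N \<union> Id_on (rank_ideal C r)"

context
  fixes N r eu el
  assumes q2: "2 \<le> q" and r: "enat q \<le> r" and N: "N \<lhd> sym_group q"
    and adm: "eu \<and> el \<or> q = 2 \<or> q = 4 \<and> N \<subseteq> klein"
begin

text \<open>The critical case: an \<H>-related pair of rank q falls to a smaller rank. Common lower
  hooks make both products drop together with equal lower hooks. The upper ones are disregarded, or
  inherited from the left factors when q = 2, or preserved by the Klein group when q = 4; these are
  the alternatives of \<open>adm\<close>.\<close>

lemma nuq_drop:
  assumes ab: "(\<alpha>, \<beta>) \<in> nuq N" and z: "\<zeta> \<in> br B D" "\<alpha> \<in> br A B" "\<beta> \<in> br A B" "D \<in> C" "A \<in> C"
    and less: "br_rank (br_prd \<alpha> \<zeta>) \<noteq> q"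
  shows "(br_prd \<alpha> \<zeta>, br_prd \<beta> \<zeta>) \<in> base eu el (q - 2)"
proof -
  obtain A' B' where t: "up \<alpha> = up \<beta>" "lo \<alpha> = lo \<beta>" "br_rank \<alpha> = q" "br_rank \<beta> = q" using nuq_typed[OF N ab] by metis
  note ba = br_prd_br[OF z(2,1)] and bb = br_prd_br[OF z(3,1)]
  have rl: "br_rank (br_prd \<alpha> \<zeta>) = br_rank (br_prd \<beta> \<zeta>)" "lo (br_prd \<alpha> \<zeta>) = lo (br_prd \<beta> \<zeta>)"
    using lo_eq_prd[OF z(2,3) t(2) z(1)] .
  have "br_rank (br_prd \<alpha> \<zeta>) < q" using rank_prd_left[OF z(2,1)] t(3) less by simp
  then have le: "br_rank (br_prd \<alpha> \<zeta>) \<le> q - 2" using br_rank_even[OF ba] q(1) by (auto elim!: evenE)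
  have hl: "hlo (br_prd \<alpha> \<zeta>) = hlo (br_prd \<beta> \<zeta>)" by (rule hlo_cong[OF ba bb rl(2)])
  have "hup (br_prd \<alpha> \<zeta>) = hup (br_prd \<beta> \<zeta>)" if "\<not> (eu \<and> el)"
  proof -
    have "q = 2 \<or> q = 4 \<and> N \<subseteq> klein" using adm that by blast
    then show ?thesis
    proof
      assume "q = 2"
      then show ?thesis using hup_prd[OF z(2,1)] hup_prd[OF z(3,1)] t hup_cong[OF z(2,3)] by simp
    next
      assume q4: "q = 4 \<and> N \<subseteq> klein"
      obtain A' B' a b \<pi> where *: "A' \<in> C" "B' \<in> C" "a \<in> lmate A'" "b \<in> rmate B'" "\<pi> \<in> N"
        "\<alpha> = tri a id b" "\<beta> = tri a \<pi> b"
        using nuqE[OF ab] .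
      have \<pi>: "\<pi> permutes {1..q}" by (rule N_perm[OF N *(5)])
      note tt = tri(1)[OF *(3,4) permutes_id]
      have AB: "A' = A" "B' = B" using br_src[OF tt] br_src[OF z(2)] br_rng[OF tt] br_rng[OF z(2)] *(6) by simp_all
      note a = *(3)[unfolded AB] and b = *(4)[unfolded AB]
      note ba' = lmateD(1)[OF a] and bb' = rmateD(1)[OF b]
      let ?P = "br_prd b \<zeta>"
      have P: "?P \<in> br Y D" "U \<subseteq> up ?P" using br_prd_br[OF bb' z(1)] up_prd[OF bb' z(1)] rmateD(2)[OF b] by simp_all
      have eq: "br_prd (tri a \<rho> b) \<zeta> = br_prd a (br_prd (p \<rho>) ?P)" if "\<rho> permutes {1..q}" for \<rho>
        using tri_right[OF a b that z(1)] br_prd_assoc[OF ba' p_br[OF that] P(1)] by simp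
      have pid: "br_prd (p id) ?P = ?P" using eps_left[OF P] by (simp add: \<epsilon>_def)
      \<comment> \<open>Multiplication by \<open>star a\<close> recovers the product of b with
        \<zeta>, whose rank is therefore at most 2 as well.\<close>
      have "br_prd (star a) (br_prd \<alpha> \<zeta>) = br_prd (br_prd (star a) a) ?P"
        using eq[OF permutes_id] pid *(6) br_prd_assoc[OF star_br[OF ba'] ba' P(1)] by simp
      also have "\<dots> = ?P" using star_lmate[OF a] eps_left[OF P] by simp
      finally have "br_rank ?P \<le> 2"
        using rank_prd_right[OF star_br[OF ba'] ba] le q4 by simp
      then have rP: "br_rank ?P \<le> 2" "br_rank (br_prd (p \<pi>) ?P) \<le> 2"
        using rank_prd_right[OF p_br[OF \<pi>] P(1)] by simp_all
      have "hup (br_prd (p \<pi>) ?P) = hup ?P"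
        by (rule klein_hup) (use q4 *(5) \<pi> P rP in auto)
      then have "hup (br_prd a (br_prd (p \<pi>) ?P)) = hup (br_prd a ?P)"
        by (intro hup_left_cong[OF br_prd_br[OF p_br[OF \<pi>] P(1)] P(1) rP(2,1) ba'])
      then show ?thesis using eq[OF permutes_id] eq[OF \<pi>] pid *(6,7) by simp
    qed
  qed
  then show ?thesis unfolding base_def using z(4,5) ba bb le rl(1) hl by auto
qed

lemma Rel_right:
  assumes ab: "(\<alpha>, \<beta>) \<in> Rel eu el N r" and z: "\<alpha> \<in> br A B" "\<beta> \<in> br A B" "A \<in> C" "B \<in> C" "D \<in> C" "\<zeta> \<in> br B D"
    and zr: "\<zeta> \<in> rank_ideal C r"
  shows "(br_prd \<alpha> \<zeta>, br_prd \<beta> \<zeta>) \<in> Rel eu el N r"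
proof -
  from ab consider "(\<alpha>, \<beta>) \<in> base eu el (q - 2)" | "(\<alpha>, \<beta>) \<in> nuq N" | "\<alpha> = \<beta>" "\<alpha> \<in> rank_ideal C r"
    unfolding Rel_def by blast
  then show ?thesis
  proof cases
    case 1
    have "q - 2 \<le> 2 \<or> eu \<and> el" using adm by auto
    from base_right[OF this 1 z(1,2,6,3,5)] show ?thesis by (simp add: Rel_def)
  next
    case 2
    show ?thesis
    proof (cases "br_rank (br_prd \<alpha> \<zeta>) = q")
      case True
      from nuq_right[OF N 2 z(1,6,5) True] show ?thesis by (simp add: Rel_def)
    next
      case False
      from nuq_drop[OF 2 z(6,1,2,5,3) False] show ?thesis by (simp add: Rel_def)
    qed
  next
    case 3
    have "br_prd \<alpha> \<zeta> \<in> rank_ideal C r"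
      using rank_ideal_prd_left[OF 3(2), of \<zeta> D] z br_rng[OF z(1)] by simp
    then show ?thesis using 3 by (simp add: Rel_def Id_on_iff)
  qed
qed

end

lemma Rel_star:
  assumes "N \<lhd> sym_group q"
  shows "(star \<alpha>, star \<beta>) \<in> Rel el eu N r \<longleftrightarrow> (\<alpha>, \<beta>) \<in> Rel eu el N r"
proof -
  have "(star \<alpha>, star \<beta>) \<in> nuq N \<longleftrightarrow> (\<alpha>, \<beta>) \<in> nuq N" using nuq_star[OF assms] by (metis star_star)
  moreover have "(star \<alpha>, star \<beta>) \<in> Id_on (rank_ideal C r) \<longleftrightarrow> (\<alpha>, \<beta>) \<in> Id_on (rank_ideal C r)"
    unfolding Id_on_iff by (metis rank_ideal_star star_star)
  ultimately show ?thesis unfolding Rel_def Un_iff base_star by simp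
qed

lemma Rel_Cong:
  assumes q2: "2 \<le> q" and r: "enat q \<le> r" and N: "N \<lhd> sym_group q"
    and adm: "eu \<and> el \<or> q = 2 \<or> q = 4 \<and> N \<subseteq> klein"
  shows "Rel eu el N r \<in> Cong (I_psg C r)"
proof (rule CongI)
  have qr: "enat k \<le> r" if "k \<le> q" for k using r that by (metis enat_ord_simps(1) order_trans)
  fix \<alpha> \<beta> assume "(\<alpha>, \<beta>) \<in> Rel eu el N r"
  then consider "(\<alpha>, \<beta>) \<in> base eu el (q - 2)" | "(\<alpha>, \<beta>) \<in> nuq N" | "\<alpha> = \<beta>" "\<alpha> \<in> rank_ideal C r"
    unfolding Rel_def by blast
  then show "\<exists>A\<in>C. \<exists>B\<in>C. \<alpha> \<in> br A B \<and> \<beta> \<in> br A B \<and> enat (br_rank \<alpha>) \<le> r \<and> enat (br_rank \<beta>) \<le> r"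
  proof cases
    case 1
    then obtain A B where "A \<in> C" "B \<in> C" "\<alpha> \<in> br A B" "\<beta> \<in> br A B" "br_rank \<alpha> \<le> q - 2" "br_rank \<beta> \<le> q - 2"
      unfolding base_def by blast
    then show ?thesis using qr[of "br_rank \<alpha>"] qr[of "br_rank \<beta>"] by auto
  next
    case 2 then show ?thesis using nuq_typed[OF N 2] r by metis
  next
    case 3 then show ?thesis using rank_idealE by metis
  qed
next
  show "\<alpha> \<in> rank_ideal C r \<Longrightarrow> (\<alpha>, \<alpha>) \<in> Rel eu el N r" for \<alpha> by (simp add: Rel_def Id_on_iff)
  have bs: "(\<beta>, \<alpha>) \<in> base eu el (q - 2)" if "(\<alpha>, \<beta>) \<in> base eu el (q - 2)" for \<alpha> \<beta>
    using that unfolding base_def by auto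
  show "(\<alpha>, \<beta>) \<in> Rel eu el N r \<Longrightarrow> (\<beta>, \<alpha>) \<in> Rel eu el N r" for \<alpha> \<beta>
    using bs nuq_sym[OF N] unfolding Rel_def by blast
  have bt: "(\<alpha>, \<gamma>) \<in> base eu el (q - 2)"
    if ab: "(\<alpha>, \<beta>) \<in> base eu el (q - 2)" and bc: "(\<beta>, \<gamma>) \<in> base eu el (q - 2)" for \<alpha> \<beta> \<gamma>
  proof -
    obtain A B where 1: "A \<in> C" "B \<in> C" "\<alpha> \<in> br A B" "\<beta> \<in> br A B" "br_rank \<alpha> \<le> q - 2"
      "eu \<or> hup \<alpha> = hup \<beta>" "el \<or> hlo \<alpha> = hlo \<beta>" using ab unfolding base_def by blast
    obtain A' B' where 2: "\<beta> \<in> br A' B'" "\<gamma> \<in> br A' B'" "br_rank \<gamma> \<le> q - 2"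
      "eu \<or> hup \<beta> = hup \<gamma>" "el \<or> hlo \<beta> = hlo \<gamma>" using bc unfolding base_def by blast
    have "A' = A" "B' = B" using br_src[OF 1(4)] br_src[OF 2(1)] br_rng[OF 1(4)] br_rng[OF 2(1)] by simp_all
    then have "\<gamma> \<in> br A B" "eu \<or> hup \<alpha> = hup \<gamma>" "el \<or> hlo \<alpha> = hlo \<gamma>" using 1 2 by auto
    then show ?thesis using 1 2(3) unfolding base_def by blast
  qed
  \<comment> \<open>Elements in the ideal part have rank at most q - 2 and those in the group part
    rank q, so transitivity never composes the two parts.\<close>
  have disj: "\<not> ((\<alpha>, \<beta>) \<in> base eu el (q - 2) \<and> (\<beta>, \<gamma>) \<in> nuq N)" for \<alpha> \<beta> \<gamma>
  proof
    assume *: "(\<alpha>, \<beta>) \<in> base eu el (q - 2) \<and> (\<beta>, \<gamma>) \<in> nuq N"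
    then have "br_rank \<beta> \<le> q - 2" unfolding base_def by blast
    moreover have "br_rank \<beta> = q" using nuq_typed[OF N] * by metis
    ultimately show False using q2 by simp
  qed
  show "(\<alpha>, \<gamma>) \<in> Rel eu el N r" if "(\<alpha>, \<beta>) \<in> Rel eu el N r" "(\<beta>, \<gamma>) \<in> Rel eu el N r" for \<alpha> \<beta> \<gamma>
    using that bt[of \<alpha> \<beta> \<gamma>] nuq_trans[OF N, of \<alpha> \<beta> \<gamma>] disj[of \<alpha> \<beta> \<gamma>] disj[of \<gamma> \<beta> \<alpha>] bs[of \<beta> \<gamma>] nuq_sym[OF N, of \<alpha> \<beta>]
    unfolding Rel_def by blast
next
  fix \<alpha> \<beta> \<zeta> A B D
  assume ab: "(\<alpha>, \<beta>) \<in> Rel eu el N r" "\<alpha> \<in> br A B" "\<beta> \<in> br A B" and AB: "A \<in> C" "B \<in> C" "D \<in> C"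
    and zr: "\<zeta> \<in> rank_ideal C r"
  show "(br_prd \<alpha> \<zeta>, br_prd \<beta> \<zeta>) \<in> Rel eu el N r" if "\<zeta> \<in> br B D"
    by (rule Rel_right[OF q2 r N adm ab AB that zr])
  show "(br_prd \<zeta> \<alpha>, br_prd \<zeta> \<beta>) \<in> Rel eu el N r" if z: "\<zeta> \<in> br D A"
  proof -
    have adm': "el \<and> eu \<or> q = 2 \<or> q = 4 \<and> N \<subseteq> klein" using adm by blast
    have "(star \<alpha>, star \<beta>) \<in> Rel el eu N r" using ab(1) Rel_star[OF N] by blast
    from Rel_right[OF q2 r N adm' this star_br[OF ab(2)] star_br[OF ab(3)] AB(2,1,3) star_br[OF z] rank_ideal_star[OF zr]]
    have "(star (br_prd \<zeta> \<alpha>), star (br_prd \<zeta> \<beta>)) \<in> Rel el eu N r"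
      using star_prd[OF z ab(2)] star_prd[OF z ab(3)] by simp
    then show ?thesis using Rel_star[OF N] by blast
  qed
qed

lemma rank_le_enat: "m \<le> 2 \<Longrightarrow> \<alpha> \<in> rank_ideal C (enat m) \<Longrightarrow> br_rank \<alpha> \<le> 2"
  using rank_ideal_rank[of \<alpha> "enat m"] by simp

text \<open>Three of the four kinds are defined through the retraction, which is available for rank
  at most 2; \<open>R_cong\<close> does without it and is covered for every q.\<close>

lemma kind_cong_eq:
  assumes q2: "2 \<le> q" and r: "enat q \<le> r" and N: "N \<lhd> sym_group q"
    and k: "k = RK \<or> q = 2 \<or> q = 4"
  shows "kind_cong k (I_psg C r) (rank_ideal C (enat (q - 2))) (natural_group X x q N) = Rel (eu_of k) (el_of k) N r"
proof -
  let ?I = "rank_ideal C (enat (q - 2))"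
  have D: "Delta (I_psg C r) = Id_on (rank_ideal C r)" by (simp add: Delta_def)
  have b: "((\<alpha>, \<beta>) \<in> base eu el (q - 2)) \<longleftrightarrow> \<alpha> \<in> ?I \<and> \<beta> \<in> ?I \<and> psg_sim (I_psg C r) \<alpha> \<beta> \<and>
      (eu \<or> hup \<alpha> = hup \<beta>) \<and> (el \<or> hlo \<alpha> = hlo \<beta>)" for \<alpha> \<beta> eu el
  proof
    assume "(\<alpha>, \<beta>) \<in> base eu el (q - 2)"
    then obtain A B where *: "A \<in> C" "B \<in> C" "\<alpha> \<in> br A B" "\<beta> \<in> br A B" "br_rank \<alpha> \<le> q - 2" "br_rank \<beta> \<le> q - 2"
       "eu \<or> hup \<alpha> = hup \<beta>" "el \<or> hlo \<alpha> = hlo \<beta>" unfolding base_def by blast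
    then show "\<alpha> \<in> ?I \<and> \<beta> \<in> ?I \<and> psg_sim (I_psg C r) \<alpha> \<beta> \<and> (eu \<or> hup \<alpha> = hup \<beta>) \<and> (el \<or> hlo \<alpha> = hlo \<beta>)"
      using rank_idealI[OF *(1,2,3)] rank_idealI[OF *(1,2,4)]
        br_src[OF *(3)] br_src[OF *(4)] br_rng[OF *(3)] br_rng[OF *(4)] by (simp add: psg_sim_def)
  next
    assume *: "\<alpha> \<in> ?I \<and> \<beta> \<in> ?I \<and> psg_sim (I_psg C r) \<alpha> \<beta> \<and> (eu \<or> hup \<alpha> = hup \<beta>) \<and> (el \<or> hlo \<alpha> = hlo \<beta>)"
    then have "\<alpha> \<in> br (br_src \<alpha>) (br_rng \<alpha>)" "\<beta> \<in> br (br_src \<alpha>) (br_rng \<alpha>)"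
      using rank_ideal_br[of \<alpha> "enat (q - 2)"] rank_ideal_br[of \<beta> "enat (q - 2)"] by (simp_all add: psg_sim_def)
    moreover have "br_rank \<alpha> \<le> q - 2" "br_rank \<beta> \<le> q - 2" "br_src \<alpha> \<in> C" "br_rng \<alpha> \<in> C"
      using * rank_ideal_src[of \<alpha> "enat (q - 2)"] rank_ideal_rank[of \<alpha> "enat (q - 2)"]
        rank_ideal_rank[of \<beta> "enat (q - 2)"] by simp_all
    ultimately show "(\<alpha>, \<beta>) \<in> base eu el (q - 2)" unfolding base_def using * by blast
  qed
  have RKb: "Nabla_on (I_psg C r) ?I = base True True (q - 2)"
    unfolding Nabla_on_def using b[of _ _ True True] by auto
  show ?thesis
  proof (cases "k = RK")
    case True
    then show ?thesis using RKb nu_eq[OF N r] D by (auto simp: R_cong_def Rel_def eu_of_def el_of_def)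
  next
    case False
    then have q4: "q - 2 \<le> 2" using k by auto
    have s: "enat (q - 2) \<le> 2" "enat (q - 2) \<le> r"
      using q4 r by (auto simp: numeral_eq_enat intro: order_trans[rotated, of "enat q" r])
    note ro = retraction_of_eq[OF s]
    have g: "(ret \<alpha>, ret \<beta>) \<in> green_R (I_psg C r) \<longleftrightarrow> hup \<alpha> = hup \<beta>"
       "(ret \<alpha>, ret \<beta>) \<in> green_L (I_psg C r) \<longleftrightarrow> hlo \<alpha> = hlo \<beta>"
      if *: "\<alpha> \<in> ?I" "\<beta> \<in> ?I" "psg_sim (I_psg C r) \<alpha> \<beta>" for \<alpha> \<beta>
    proof -
      note ra = ret[OF rank_ideal_br[OF *(1)] rank_le_enat[OF q4 *(1)]]
      note rb = ret[OF rank_ideal_br[OF *(2)] rank_le_enat[OF q4 *(2)]]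
      have "ret \<alpha> \<in> rank_ideal C r" "ret \<beta> \<in> rank_ideal C r"
        using rank_idealI[OF rank_ideal_src[OF *(1)] ra(1)] rank_idealI[OF rank_ideal_src[OF *(2)] rb(1)] ra(2) rb(2)
        by (simp_all add: enat_0)
      then show "(ret \<alpha>, ret \<beta>) \<in> green_R (I_psg C r) \<longleftrightarrow> hup \<alpha> = hup \<beta>"
       "(ret \<alpha>, ret \<beta>) \<in> green_L (I_psg C r) \<longleftrightarrow> hlo \<alpha> = hlo \<beta>"
        unfolding green_R_iff green_L_iff using ra rb *(3) br_src[OF ra(1)] br_src[OF rb(1)] br_rng[OF ra(1)] br_rng[OF rb(1)]
        by (auto simp: psg_sim_def)
    qed
    have main: "retract_cong K (I_psg C r) ?I (natural_group X x q N) = Rel eu el N r"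
      if K: "\<And>\<alpha> \<beta>. \<alpha> \<in> ?I \<Longrightarrow> \<beta> \<in> ?I \<Longrightarrow> psg_sim (I_psg C r) \<alpha> \<beta> \<Longrightarrow>
        (ret \<alpha>, ret \<beta>) \<in> K \<longleftrightarrow> (eu \<or> hup \<alpha> = hup \<beta>) \<and> (el \<or> hlo \<alpha> = hlo \<beta>)" for K eu el
    proof -
      have "{(\<alpha>, \<beta>) \<in> ?I \<times> ?I. psg_sim (I_psg C r) \<alpha> \<beta> \<and>
          (retraction_of (I_psg C r) ?I \<alpha>, retraction_of (I_psg C r) ?I \<beta>) \<in> K} = base eu el (q - 2)"
        using K b[of _ _ eu el] ro by auto
      then show ?thesis unfolding retract_cong_def Rel_def nu_eq[OF N r] D by simp
    qed
    show ?thesis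
    proof (cases k)
      case MuK
      show ?thesis unfolding MuK kind_cong.simps mu_cong_def
        by (subst main[of "green_H (I_psg C r)" False False]) (use g in \<open>auto simp: green_H_def eu_of_def el_of_def\<close>)
    next
      case LambdaK
      show ?thesis unfolding LambdaK kind_cong.simps lambda_cong_def
        by (subst main[of "green_L (I_psg C r)" True False]) (use g in \<open>auto simp: green_H_def eu_of_def el_of_def\<close>)
    next
      case RhoK
      show ?thesis unfolding RhoK kind_cong.simps rho_cong_def
        by (subst main[of "green_R (I_psg C r)" False True]) (use g in \<open>auto simp: green_H_def eu_of_def el_of_def\<close>)
    qed (use False in simp)
  qed
qed

end

section \<open>Consequences of a single pair\<close>

text \<open>The elementary move between matchings: two pairs are exchanged for two others on the
  same four points, which are distinct as soon as a and c are distinct and not paired.\<close>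

lemma matching_switch:
  assumes M: "M \<in> matching A" and ab: "{a, b} \<in> M" and cd: "{c, d} \<in> M" and ac: "{a, c} \<notin> M" "a \<noteq> c"
  shows "M - {{a, b}, {c, d}} \<in> matching (A - {a, b, c, d})"
    and "(M - {{a, b}, {c, d}}) \<union> {{a, c}, {b, d}} \<in> matching A"
    and "a \<noteq> b" "c \<noteq> d" "b \<noteq> c" "a \<noteq> d" "b \<noteq> d" "{a, b, c, d} \<subseteq> A"
proof -
  show 1: "a \<noteq> b" "c \<noteq> d" using matching_linkD[OF M ab] matching_linkD[OF M cd] by auto
  show 2: "b \<noteq> c" using ab ac by auto
  show 3: "a \<noteq> d" using cd ac by (auto simp: insert_commute)
  have ba: "{b, a} \<in> M" "{d, c} \<in> M" using ab cd by (simp_all add: insert_commute)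
  show 4: "b \<noteq> d" using matching_unique[OF M, of b a c] ba ac(2) by auto
  show 5: "{a, b, c, d} \<subseteq> A" using matching_linkD[OF M ab] matching_linkD[OF M cd] by auto
  have "\<Union>{{a, b}, {c, d}} = {a, b, c, d}" by auto
  then show R: "M - {{a, b}, {c, d}} \<in> matching (A - {a, b, c, d})"
    using matching_diff[OF M, of "{{a, b}, {c, d}}"] ab cd by simp
  have "{{a, c}} \<union> {{b, d}} \<in> matching ({a, c} \<union> {b, d})"
    by (rule matching_Un[OF matching_pair matching_pair]) (use ac 1 2 3 4 in simp_all)
  then have "(M - {{a, b}, {c, d}}) \<union> ({{a, c}} \<union> {{b, d}}) \<in> matching ((A - {a, b, c, d}) \<union> ({a, c} \<union> {b, d}))"
    by (rule matching_Un[OF R]) auto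
  moreover have "(A - {a, b, c, d}) \<union> ({a, c} \<union> {b, d}) = A" using 5 by auto
  moreover have "{{a, c}} \<union> {{b, d}} = {{a, c}, {b, d}}" by auto
  ultimately show "(M - {{a, b}, {c, d}}) \<union> {{a, c}, {b, d}} \<in> matching A" by (simp only:)
qed

definition "pj L D = mk_br L D id L"

lemma pj:
  assumes "L \<in> matching (A - D)" "D \<subseteq> A" "finite A" "even (card A)"
  shows "pj L D \<in> br A A" "up (pj L D) = L" "lo (pj L D) = L" "dm (pj L D) = D" "cd (pj L D) = D"
    "br_rank (pj L D) = card D" "\<And>a b. {Inl a, Inr b} \<in> pj L D \<longleftrightarrow> a \<in> D \<and> b = a"
proof -
  show br: "pj L D \<in> br A A" unfolding pj_def by (rule mk_br_br) (use assms in auto)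
  have e: "{} \<notin> L" using matching_no_empty[OF assms(1)] .
  show "up (pj L D) = L" "lo (pj L D) = L" "dm (pj L D) = D" "cd (pj L D) = D"
    using mk_br_parts[OF e e, of D id] by (simp_all add: pj_def)
  then show "br_rank (pj L D) = card D" using br_rank_dm[OF br] by simp
  show "\<And>a b. {Inl a, Inr b} \<in> pj L D \<longleftrightarrow> a \<in> D \<and> b = a" by (simp add: pj_def mk_br_links)
qed

lemma proj_props:
  assumes "\<alpha> \<in> br A B"
  defines "\<epsilon> \<equiv> br_prd \<alpha> (star \<alpha>)"
  shows "\<epsilon> \<in> br A A" "up \<epsilon> = up \<alpha>" "lo \<epsilon> = up \<alpha>" "br_rank \<epsilon> = br_rank \<alpha>"
    "\<And>\<beta> D. \<beta> \<in> br A D \<Longrightarrow> up \<alpha> \<subseteq> up \<beta> \<Longrightarrow> br_prd \<epsilon> \<beta> = \<beta>"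
    "\<And>\<beta> D. \<beta> \<in> br D A \<Longrightarrow> up \<alpha> \<subseteq> lo \<beta> \<Longrightarrow> br_prd \<beta> \<epsilon> = \<beta>"
proof -
  note s = star_br[OF assms(1)]
  show "\<epsilon> \<in> br A A" unfolding \<epsilon>_def by (rule br_prd_br[OF assms(1) s])
  show "up \<epsilon> = up \<alpha>" "lo \<epsilon> = up \<alpha>" "br_rank \<epsilon> = br_rank \<alpha>"
    using matched_rank[OF assms(1) s] by (simp_all add: \<epsilon>_def)
  show "\<beta> \<in> br A D \<Longrightarrow> up \<alpha> \<subseteq> up \<beta> \<Longrightarrow> br_prd \<epsilon> \<beta> = \<beta>" for \<beta> D
    unfolding \<epsilon>_def by (rule proj_absorb[OF assms(1)])
  show "\<beta> \<in> br D A \<Longrightarrow> up \<alpha> \<subseteq> lo \<beta> \<Longrightarrow> br_prd \<beta> \<epsilon> = \<beta>" for \<beta> D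
    using proj_absorb_right[OF s, of \<beta> D] by (simp add: \<epsilon>_def)
qed

lemma exists_perm:
  assumes "b1 \<in> D" "b2 \<in> D" "a1 \<in> D" "a2 \<in> D" "b1 \<noteq> b2" "a1 \<noteq> a2"
  obtains g where "g permutes D" "g b1 = a1" "g b2 = a2"
proof -
  define g where "g = transpose (transpose b1 a1 b2) a2 \<circ> transpose b1 a1"
  have "g permutes D" unfolding g_def
    by (intro permutes_compose permutes_swap_id) (use assms in \<open>auto simp: transpose_def\<close>)
  moreover have "g b1 = a1" "g b2 = a2" using assms by (auto simp: g_def transpose_def)
  ultimately show ?thesis using that by blast
qed

context br_cong begin

text \<open>A hook {a, c} of \<beta> that is not one of \<alpha> is, seen from \<alpha>, half of a
  switch. A multiplier with at most four transversals carries the quadruple of \<alpha> to the given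
  one and installs the other pairs of M as upper hooks. This is where r must be at least 4.\<close>

lemma switch_related:
  assumes r4: "4 \<le> r" and \<alpha>\<beta>: "(\<alpha>, \<beta>) \<in> \<sigma>" "br_rank \<alpha> = 0" "br_rank \<beta> = 0" "up \<alpha> \<noteq> up \<beta>"
    and AB: "A \<in> C" "B \<in> C" and M: "M \<in> matching A" and L: "L \<in> matching B"
    and sw: "{a1, b1} \<in> M" "{c1, d1} \<in> M" "{a1, c1} \<notin> M" "a1 \<noteq> c1"
  shows "(mk0 M L, mk0 ((M - {{a1, b1}, {c1, d1}}) \<union> {{a1, c1}, {b1, d1}}) L) \<in> \<sigma>"
proof -
  note S1 = matching_switch[OF M sw]
  let ?M' = "(M - {{a1, b1}, {c1, d1}}) \<union> {{a1, c1}, {b1, d1}}"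
  let ?R = "M - {{a1, b1}, {c1, d1}}"
  obtain A0 B0 where 0: "A0 \<in> C" "B0 \<in> C" "\<alpha> \<in> br A0 B0" "\<beta> \<in> br A0 B0" using congE[OF \<alpha>\<beta>(1)] .
  note m1 = rank0_matching[OF 0(3) \<alpha>\<beta>(2)] and m2 = rank0_matching[OF 0(4) \<alpha>\<beta>(3)]
  have "\<not> up \<beta> \<subseteq> up \<alpha>" using matching_subset_eq[OF m2(1) m1(1)] \<alpha>\<beta>(4) by auto
  then obtain h where h: "h \<in> up \<beta>" "h \<notin> up \<alpha>" by blast
  obtain a c where ac: "h = {a, c}" "a \<noteq> c" "a \<in> A0" "c \<in> A0" using matchingE[OF m2(1) h(1)] .
  obtain b where b: "{a, b} \<in> up \<alpha>" using matching_ex[OF m1(1) ac(3)] .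
  obtain d where d: "{c, d} \<in> up \<alpha>" using matching_ex[OF m1(1) ac(4)] .
  have acn: "{a, c} \<notin> up \<alpha>" using h ac by simp
  note S2 = matching_switch[OF m1(1) b d acn ac(2)]
  let ?E = "{a1, b1, c1, d1}"
  \<comment> \<open>The correspondence of the two quadruples, in the order in which their pairs are
    named.\<close>
  define g where "g v = (if v = a1 then a else if v = b1 then b else if v = c1 then c else d)" for v
  have g: "g a1 = a" "g b1 = b" "g c1 = c" "g d1 = d"
    using S1 S2 sw(4) by (auto simp: g_def)
  have gE: "g ` ?E = {a, b, c, d}" using g by simp
  have inj: "inj_on g ?E" unfolding inj_on_def using g S2(3-7) ac(2) by auto
  let ?L0 = "up \<alpha> - {{a, b}, {c, d}}"
  let ?\<gamma> = "mk_br ?R ?E g ?L0"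
  have \<gamma>: "?\<gamma> \<in> br A A0"
    by (rule mk_br_br) (use S1 S2 gE inj C_even[OF AB(1)] C_even[OF 0(1)] in auto)
  have ne: "{} \<notin> ?R" "{} \<notin> ?L0" using matching_no_empty[OF S1(1)] matching_no_empty[OF S2(1)] by auto
  note parts = mk_br_parts[OF ne, of ?E g]
  have "br_rank ?\<gamma> = card ?E" using br_rank_dm[OF \<gamma>] parts by simp
  also have "\<dots> \<le> 4" by (simp add: card_insert_if)
  finally have "enat (br_rank ?\<gamma>) \<le> 4" by (simp add: numeral_eq_enat)
  then have rg: "enat (br_rank ?\<gamma>) \<le> r" using r4 by (rule order_trans)
  have "(br_prd ?\<gamma> \<alpha>, br_prd ?\<gamma> \<beta>) \<in> \<sigma>" by (rule cong_left[OF \<alpha>\<beta>(1) 0(3) \<gamma> AB(1) rg])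
  \<comment> \<open>A multiplier of rank 0 on the right sets the lower hooks to L; its upper
    matching may be chosen freely.\<close>
  obtain L2 where L2: "L2 \<in> matching B0" using matching_C[OF 0(2)] by blast
  note \<delta> = mk0_C[OF L2 L 0(2) AB(2)]
  have ga: "br_prd ?\<gamma> \<alpha> \<in> br A B0" "br_prd ?\<gamma> \<beta> \<in> br A B0" using br_prd_br[OF \<gamma>] 0 by auto
  have rk0: "br_rank (br_prd ?\<gamma> \<alpha>) = 0" "br_rank (br_prd ?\<gamma> \<beta>) = 0"
    using rank_prd_right[OF \<gamma> 0(3)] rank_prd_right[OF \<gamma> 0(4)] \<alpha>\<beta> by simp_all
  have gl: "{Inl v, Inr (g v)} \<in> ?\<gamma>" if "v \<in> ?E" for v using mk_br_links(3)[of v "g v" ?R ?E g ?L0] that by blast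
  have cE: "card ?E = 4" using S1(3-7) sw(4) by simp
  have AE: "A - \<Union>?R = ?E"
    using matching_Union[OF S1(1)] S1(8) by blast
  have up1: "up (br_prd ?\<gamma> \<alpha>) = M"
  proof -
    have "{Inl a, Inl b} \<in> \<alpha>" using b by (simp add: up_link)
    then have "{Inl a1, Inl b1} \<in> br_prd ?\<gamma> \<alpha>"
      by (rule link_turn[OF \<gamma> 0(3) _ _ _, rotated]) (use gl[of a1] gl[of b1] g in auto)
    then have h1: "{a1, b1} \<in> up (br_prd ?\<gamma> \<alpha>)" by (simp add: up_link)
    have R: "?R \<subseteq> up (br_prd ?\<gamma> \<alpha>)" using up_prd[OF \<gamma> 0(3)] parts by simp
    note m = rank0_matching(1)[OF ga(1) rk0(1)]
    have "{a1, b1} \<in> up (br_prd ?\<gamma> \<alpha>) - ?R" using h1 by simp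
    then have "up (br_prd ?\<gamma> \<alpha>) - ?R = {{a1, b1}, ?E - {a1, b1}}"
      by (rule matching_four[OF matching_diff[OF m R, unfolded AE] cE])
    moreover have "?E - {a1, b1} = {c1, d1}" using S1(3-7) sw(4) by auto
    ultimately have eq: "up (br_prd ?\<gamma> \<alpha>) - ?R = {{a1, b1}, {c1, d1}}" by (simp only:)
    have "up (br_prd ?\<gamma> \<alpha>) = (up (br_prd ?\<gamma> \<alpha>) - ?R) \<union> ?R" using R by blast
    also have "\<dots> = M" unfolding eq using sw(1,2) by blast
    finally show ?thesis .
  qed
  \<comment> \<open>Only one path through \<beta> is followed. All pairs outside the quadruple are
    inherited from the multiplier, so the second pair inside it is forced, whatever \<beta> does
    elsewhere.\<close>
  have up2: "up (br_prd ?\<gamma> \<beta>) = ?M'"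
  proof -
    have "{Inl a, Inl c} \<in> \<beta>" using h ac by (simp add: up_link)
    then have "{Inl a1, Inl c1} \<in> br_prd ?\<gamma> \<beta>"
      by (rule link_turn[OF \<gamma> 0(4) _ _ _, rotated]) (use gl[of a1] gl[of c1] g in auto)
    then have h1: "{a1, c1} \<in> up (br_prd ?\<gamma> \<beta>)" by (simp add: up_link)
    have R: "?R \<subseteq> up (br_prd ?\<gamma> \<beta>)" using up_prd[OF \<gamma> 0(4)] parts by simp
    note m = rank0_matching(1)[OF ga(2) rk0(2)]
    have "{a1, c1} \<in> up (br_prd ?\<gamma> \<beta>) - ?R" using h1 sw by simp
    then have "up (br_prd ?\<gamma> \<beta>) - ?R = {{a1, c1}, ?E - {a1, c1}}"
      by (rule matching_four[OF matching_diff[OF m R, unfolded AE] cE])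
    moreover have "?E - {a1, c1} = {b1, d1}" using S1(3-7) sw(4) by auto
    ultimately have eq: "up (br_prd ?\<gamma> \<beta>) - ?R = {{a1, c1}, {b1, d1}}" by (simp only:)
    have "up (br_prd ?\<gamma> \<beta>) = (up (br_prd ?\<gamma> \<beta>) - ?R) \<union> ?R" using R by blast
    also have "\<dots> = ?M'" unfolding eq by blast
    finally show ?thesis .
  qed
  have "(br_prd (br_prd ?\<gamma> \<alpha>) (mk0 L2 L), br_prd (br_prd ?\<gamma> \<beta>) (mk0 L2 L)) \<in> \<sigma>"
    by (rule cong_right[OF \<open>(br_prd ?\<gamma> \<alpha>, br_prd ?\<gamma> \<beta>) \<in> \<sigma>\<close> ga(1) \<delta>(1) AB(2)]) (use \<delta>(2) in \<open>simp add: enat_0\<close>)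
  moreover have "br_prd \<eta> (mk0 L2 L) = mk0 N L"
    if "\<eta> \<in> br A B0" "br_rank \<eta> = 0" "up \<eta> = N" "N \<in> matching A" for \<eta> N
  proof -
    note k = mk0_C[OF that(4) L AB]
    show ?thesis
      by (rule rank0_eqI[symmetric, OF k(1) br_prd_br[OF that(1) \<delta>(1)] k(2)])
        (simp_all add: k \<delta> up_rank0_prd[OF that(1,2) \<delta>(1)] lo_rank0_prd[OF that(1) \<delta>(2,1)] that)
  qed
  ultimately show ?thesis using ga rk0 up1 up2 M S1(2) by simp
qed

text \<open>Induction on the number of pairs of the target that are still missing; each switch
  creates one of them.\<close>

lemma matchings_related:
  assumes r4: "4 \<le> r" and \<alpha>\<beta>: "(\<alpha>, \<beta>) \<in> \<sigma>" "br_rank \<alpha> = 0" "br_rank \<beta> = 0" "up \<alpha> \<noteq> up \<beta>"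
    and AB: "A \<in> C" "B \<in> C" and M: "M \<in> matching A" "M' \<in> matching A" and L: "L \<in> matching B"
  shows "(mk0 M L, mk0 M' L) \<in> \<sigma>"
  using M(1)
proof (induction "card (M' - M)" arbitrary: M rule: less_induct)
  case less
  show ?case
  proof (cases "M' \<subseteq> M")
    case True
    then have "M' = M" using matching_subset_eq[OF M(2) less.prems] by simp
    then show ?thesis using cong_refl mk0_C(5)[OF M(2) L AB] by simp
  next
    case False
    then obtain h where h: "h \<in> M'" "h \<notin> M" by blast
    obtain a c where ac: "h = {a, c}" "a \<noteq> c" "a \<in> A" "c \<in> A" using matchingE[OF M(2) h(1)] .
    obtain b where b: "{a, b} \<in> M" using matching_ex[OF less.prems ac(3)] .
    obtain d where d: "{c, d} \<in> M" using matching_ex[OF less.prems ac(4)] .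
    have acn: "{a, c} \<notin> M" using h ac by simp
    note S = matching_switch[OF less.prems b d acn ac(2)]
    let ?M1 = "(M - {{a, b}, {c, d}}) \<union> {{a, c}, {b, d}}"
    \<comment> \<open>The target pairs a with c, so neither of the two pairs given up was already a
      pair of it.\<close>
    have "{a, b} \<notin> M'" using matching_unique[OF M(2), of a b c] h ac S(5) by auto
    moreover have "{c, d} \<notin> M'"
      using matching_unique[OF M(2), of c d a] h ac S(6) by (auto simp: insert_commute)
    ultimately have "M' - ?M1 \<subseteq> M' - M - {h}" using ac by auto
    moreover have "finite M'" using card_matching[OF M(2)] C_even[OF AB(1)] by blast
    ultimately have "card (M' - ?M1) \<le> card (M' - M - {h})" by (intro card_mono) auto
    also have "\<dots> < card (M' - M)" using h \<open>finite M'\<close> by (intro psubset_card_mono) auto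
    finally have "(mk0 ?M1 L, mk0 M' L) \<in> \<sigma>" using less.hyps S(2) by blast
    moreover have "(mk0 M L, mk0 ?M1 L) \<in> \<sigma>"
      by (rule switch_related[OF r4 \<alpha>\<beta> AB less.prems L b d acn ac(2)])
    ultimately show ?thesis by (rule cong_trans[rotated])
  qed
qed

text \<open>The Boolean \<open>eu\<close> that belongs to a given congruence, read off at rank 0;
  its companion gives \<open>el\<close>.\<close>

definition "eU \<longleftrightarrow> (\<exists>\<alpha> \<beta>. (\<alpha>, \<beta>) \<in> \<sigma> \<and> br_rank \<alpha> = 0 \<and> br_rank \<beta> = 0 \<and> up \<alpha> \<noteq> up \<beta>)"
definition "eL \<longleftrightarrow> (\<exists>\<alpha> \<beta>. (\<alpha>, \<beta>) \<in> \<sigma> \<and> br_rank \<alpha> = 0 \<and> br_rank \<beta> = 0 \<and> lo \<alpha> \<noteq> lo \<beta>)"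

lemma eU_related:
  assumes "4 \<le> r" eU "A \<in> C" "B \<in> C" "\<gamma> \<in> br A B" "\<delta> \<in> br A B" "br_rank \<gamma> = 0" "br_rank \<delta> = 0" "lo \<gamma> = lo \<delta>"
  shows "(\<gamma>, \<delta>) \<in> \<sigma>"
proof -
  obtain \<alpha> \<beta> where ab: "(\<alpha>, \<beta>) \<in> \<sigma>" "br_rank \<alpha> = 0" "br_rank \<beta> = 0" "up \<alpha> \<noteq> up \<beta>"
    using assms(2) unfolding eU_def by blast
  note m = rank0_matching[OF assms(5,7)] and n = rank0_matching[OF assms(6,8)]
  have "\<gamma> = mk0 (up \<gamma>) (lo \<gamma>)" "\<delta> = mk0 (up \<delta>) (lo \<delta>)"
    using mk0_C[OF m assms(3,4)] mk0_C[OF n assms(3,4)] assms rank0_eqI by metis+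
  then show ?thesis using matchings_related[OF assms(1) ab assms(3,4) m(1) n(1) m(2)] assms(9) by simp
qed

end

context br_cong begin

interpretation star: br_cong C r "(\<lambda>(\<alpha>, \<beta>). (star \<alpha>, star \<beta>)) ` \<sigma>" by (rule star_cong)

lemma star_eU: "star.eU \<longleftrightarrow> eL"
proof
  assume star.eU
  then obtain \<alpha> \<beta> where "(star \<alpha>, star \<beta>) \<in> \<sigma>" "br_rank \<alpha> = 0" "br_rank \<beta> = 0" "up \<alpha> \<noteq> up \<beta>"
    unfolding star.eU_def mem_star_cong by blast
  then show eL unfolding eL_def by (metis br_rank_star lo_star)
next
  assume eL
  then obtain \<alpha> \<beta> where "(\<alpha>, \<beta>) \<in> \<sigma>" "br_rank \<alpha> = 0" "br_rank \<beta> = 0" "lo \<alpha> \<noteq> lo \<beta>"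
    unfolding eL_def by blast
  then show star.eU unfolding star.eU_def mem_star_cong by (metis br_rank_star up_star star_star)
qed

lemma eL_related:
  assumes "4 \<le> r" eL "A \<in> C" "B \<in> C" "\<gamma> \<in> br A B" "\<delta> \<in> br A B" "br_rank \<gamma> = 0" "br_rank \<delta> = 0" "up \<gamma> = up \<delta>"
  shows "(\<gamma>, \<delta>) \<in> \<sigma>"
  using star.eU_related[OF assms(1) _ assms(4,3) star_br[OF assms(5)] star_br[OF assms(6)]] assms star_eU mem_star_cong
  by simp

text \<open>The upper and the lower hooks are changed one after the other, through an element with
  the upper hooks of \<delta> and the lower hooks of \<gamma>. Hence only four relations are
  possible at rank 0.\<close>

lemma zero_part:
  assumes "4 \<le> r" "A \<in> C" "B \<in> C" "\<gamma> \<in> br A B" "\<delta> \<in> br A B" "br_rank \<gamma> = 0" "br_rank \<delta> = 0"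
  shows "(\<gamma>, \<delta>) \<in> \<sigma> \<longleftrightarrow> (eU \<or> up \<gamma> = up \<delta>) \<and> (eL \<or> lo \<gamma> = lo \<delta>)"
proof
  show "(\<gamma>, \<delta>) \<in> \<sigma> \<Longrightarrow> (eU \<or> up \<gamma> = up \<delta>) \<and> (eL \<or> lo \<gamma> = lo \<delta>)"
    unfolding eU_def eL_def using assms by blast
  assume *: "(eU \<or> up \<gamma> = up \<delta>) \<and> (eL \<or> lo \<gamma> = lo \<delta>)"
  note m = rank0_matching[OF assms(4,6)] and n = rank0_matching[OF assms(5,7)]
  note k = mk0_C[OF n(1) m(2) assms(2,3)]
  let ?k = "mk0 (up \<delta>) (lo \<gamma>)"
  have "(\<gamma>, ?k) \<in> \<sigma>"
  proof (cases "up \<gamma> = up \<delta>")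
    case True
    then have "\<gamma> = ?k" using rank0_eqI[OF assms(4) k(1) assms(6)] k by simp
    then show ?thesis using cong_refl[OF k(5)] by simp
  next
    case False
    then show ?thesis using eU_related[OF assms(1) _ assms(2,3,4) k(1) assms(6) k(2)] k * by simp
  qed
  moreover have "(?k, \<delta>) \<in> \<sigma>"
  proof (cases "lo \<gamma> = lo \<delta>")
    case True
    then have "?k = \<delta>" using rank0_eqI[OF k(1) assms(5) k(2)] k by simp
    then show ?thesis using cong_refl[OF k(5)] by simp
  next
    case False
    then show ?thesis using eL_related[OF assms(1) _ assms(2,3) k(1) assms(5) k(2) assms(7)] k * by simp
  qed
  ultimately show "(\<gamma>, \<delta>) \<in> \<sigma>" by (rule cong_trans)
qed

end

text \<open>A hooked point b is exchanged for a free point d: the former partner of b is hooked to d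
  instead. The number of free points, and so the rank of the projection, stays the same.\<close>

lemma matching_repair1:
  assumes M: "M \<in> matching (A - D)" and D: "D \<subseteq> A" and bc: "{b, c} \<in> M" and d: "d \<in> D"
  shows "(M - {{b, c}}) \<union> {{c, d}} \<in> matching (A - (insert b (D - {d})))" "insert b (D - {d}) \<subseteq> A"
    "b \<notin> D" "c \<notin> D" "b \<noteq> c"
proof -
  show l: "b \<notin> D" "c \<notin> D" "b \<noteq> c" using matching_linkD[OF M bc] by auto
  have bA: "b \<in> A" "c \<in> A" using matching_linkD[OF M bc] by auto
  then show "insert b (D - {d}) \<subseteq> A" using D by blast
  have "M - {{b, c}} \<in> matching (A - D - {b, c})" using matching_diff[OF M, of "{{b, c}}"] bc by simp
  moreover have "{{c, d}} \<in> matching {c, d}" using l d by (intro matching_pair) auto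
  ultimately have "(M - {{b, c}}) \<union> {{c, d}} \<in> matching ((A - D - {b, c}) \<union> {c, d})"
    by (rule matching_Un) (use d in auto)
  moreover have "(A - D - {b, c}) \<union> {c, d} = A - (insert b (D - {d}))" using l d bA D by blast
  ultimately show "(M - {{b, c}}) \<union> {{c, d}} \<in> matching (A - (insert b (D - {d})))" by simp
qed

context br_cong begin

text \<open>Left multiplication by the projection \<open>pj L D\<close> keeps the rank of \<open>\<alpha>\<close> but joins the transversals of
  \<open>\<beta>\<close> at \<open>a\<close> and \<open>b\<close>.\<close>

lemma drop_by_projection:
  assumes s: "(\<alpha>, \<beta>) \<in> \<sigma>" "\<alpha> \<in> br A B" "\<beta> \<in> br A B" "A \<in> C"
    and L: "L \<in> matching (A - D)" "D \<subseteq> A" "card D = br_rank \<alpha>"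
    and ab: "a \<in> D" "b \<in> D" "{a, b} \<in> up \<beta>"
    and D: "\<And>d. d \<in> D \<Longrightarrow> d \<in> dm (br_prd (pj L D) \<alpha>)"
  shows "\<exists>\<alpha>' \<beta>'. (\<alpha>', \<beta>') \<in> \<sigma> \<and> br_rank \<alpha>' = br_rank \<alpha> \<and> br_rank \<beta>' < br_rank \<alpha>"
proof (intro exI conjI)
  note p = pj[OF L(1,2)] C_even[OF s(4)]
  have p: "pj L D \<in> br A A" "dm (pj L D) = D" "br_rank (pj L D) = card D"
    "\<And>a b. {Inl a, Inr b} \<in> pj L D \<longleftrightarrow> a \<in> D \<and> b = a"
    using pj[OF L(1,2)] C_even[OF s(4)] by simp_all
  have "enat (card D) \<le> r" using rank_ideal_rank[OF cong_mem(1)[OF s(1)]] L(3) by simp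
  then show "(br_prd (pj L D) \<alpha>, br_prd (pj L D) \<beta>) \<in> \<sigma>"
    using cong_left[OF s(1,2) p(1) s(4)] p(3) by simp
  note b1 = br_prd_br[OF p(1) s(2)] and b2 = br_prd_br[OF p(1) s(3)]
  have "dm (br_prd (pj L D) \<alpha>) = D" using D dm_prd[OF p(1) s(2)] p(2) by blast
  then show "br_rank (br_prd (pj L D) \<alpha>) = br_rank \<alpha>" using br_rank_dm[OF b1] L(3) by simp
  have "{Inl a, Inl b} \<in> \<beta>" using ab by (simp add: up_link)
  then have "{Inl a, Inl b} \<in> br_prd (pj L D) \<beta>"
    using link_turn[OF p(1) s(3), of a a b b] p(4) ab by simp
  then have "{a, b} \<in> up (br_prd (pj L D) \<beta>)" by (simp add: up_link)
  then have "a \<notin> dm (br_prd (pj L D) \<beta>)" unfolding dm_eq[OF b2] by blast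
  then have "dm (br_prd (pj L D) \<beta>) \<subset> D" using dm_prd[OF p(1) s(3)] p(2) ab(1) by blast
  moreover have "finite D" using L(2) C_even[OF s(4)] finite_subset by blast
  ultimately show "br_rank (br_prd (pj L D) \<beta>) < br_rank \<alpha>"
    using br_rank_dm[OF b2] L(3) psubset_card_mono by metis
qed

text \<open>Some hook {a, b} of \<beta> is not a hook of \<alpha>. A projection of the same rank
  with a and b among its free points is needed, which moreover loses no transversal of \<alpha>.
  Points not free in \<alpha> are made free by repairs, and the transversals then reach \<alpha> by
  a detour.\<close>

lemma nonH_drop:
  assumes s: "(\<alpha>, \<beta>) \<in> \<sigma>" and q: "2 \<le> br_rank \<alpha>" "br_rank \<beta> \<le> br_rank \<alpha>" and up: "up \<alpha> \<noteq> up \<beta>"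
  shows "\<exists>\<alpha>' \<beta>'. (\<alpha>', \<beta>') \<in> \<sigma> \<and> br_rank \<alpha>' = br_rank \<alpha> \<and> br_rank \<beta>' < br_rank \<alpha>"
proof (cases "br_rank \<beta> < br_rank \<alpha>")
  case True then show ?thesis using s by blast
next
  case False
  then have rk: "br_rank \<beta> = br_rank \<alpha>" using q by simp
  obtain A B where AB: "A \<in> C" "B \<in> C" "\<alpha> \<in> br A B" "\<beta> \<in> br A B" using congE[OF s] .
  note A = C_even[OF AB(1)]
  note uma = up_matching[OF AB(3)] and umb = up_matching[OF AB(4)]
  have "\<not> up \<beta> \<subseteq> up \<alpha>" using up_subset_eq[OF AB(4,3)] rk up by auto
  then obtain h where h: "h \<in> up \<beta>" "h \<notin> up \<alpha>" by blast
  obtain a b where ab: "h = {a, b}" "a \<noteq> b" "a \<in> A" "b \<in> A" using matchingE[OF umb h(1)] by blast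
  have abu: "{a, b} \<in> up \<beta>" "{a, b} \<notin> up \<alpha>" using h ab by simp_all
  let ?D = "dm \<alpha>"
  have DA: "?D \<subseteq> A" by (rule dm_subset[OF AB(3)])
  have fD: "finite ?D" by (rule dm_finite[OF AB(3)])
  have cD: "card ?D = br_rank \<alpha>" using br_rank_dm[OF AB(3)] by simp
  have tr: "\<exists>e. {Inl d, Inr e} \<in> \<alpha>" if "d \<in> ?D" for d using that by (auto simp: dm_def)
  have P: "pj L D \<in> br A A" "\<And>a b. {Inl a, Inr b} \<in> pj L D \<longleftrightarrow> a \<in> D \<and> b = a" "lo (pj L D) = L"
    if "L \<in> matching (A - D)" "D \<subseteq> A" for L D
    using pj[OF that] A by simp_all
  have thr: "d \<in> dm (br_prd (pj L D) \<alpha>)" if L: "L \<in> matching (A - D)" "D \<subseteq> A" and d: "d \<in> D" "d \<in> ?D" for L D d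
  proof -
    obtain e where "{Inl d, Inr e} \<in> \<alpha>" using tr[OF d(2)] by blast
    then have "{Inl d, Inr e} \<in> br_prd (pj L D) \<alpha>"
      using link_through[OF P(1)[OF L] AB(3), of d d e] P(2)[OF L] d by simp
    then show ?thesis by (auto simp: dm_def)
  qed
  \<comment> \<open>The detour: from v along its hook in \<alpha> to w, back along the repaired hook
    of the projection to d, and out along the transversal of \<alpha> at d.\<close>
  have zig: "v \<in> dm (br_prd (pj L D) \<alpha>)"
    if L: "L \<in> matching (A - D)" "D \<subseteq> A" and v: "v \<in> D" "{v, w} \<in> up \<alpha>" "{w, d} \<in> L" "d \<in> ?D" for L D v w d
  proof -
    obtain e where e: "{Inl d, Inr e} \<in> \<alpha>" using tr[OF v(4)] by blast
    have "{Inl v, Inr v} \<in> pj L D" using P(2)[OF L] v by simp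
    moreover have "{Inl v, Inl w} \<in> \<alpha>" using v by (simp add: up_link)
    moreover have "{Inr w, Inr d} \<in> pj L D" using P(3)[OF L] v by (simp add: lo_link[symmetric])
    ultimately have "{Inl v, Inr e} \<in> br_prd (pj L D) \<alpha>" using link_zigzag[OF P(1)[OF L] AB(3)] e by blast
    then show ?thesis by (auto simp: dm_def)
  qed
  \<comment> \<open>One end is free. Rank at least 2 supplies a second free point d, which is traded
    for b.\<close>
  have mixed: ?thesis if a: "a \<in> ?D" and b: "b \<notin> ?D" and abu: "{a, b} \<in> up \<beta>" and bA: "b \<in> A" for a b
  proof -
    obtain c where c: "{b, c} \<in> up \<alpha>" using matching_ex[OF uma, of b] b bA by blast
    have "\<not> ?D \<subseteq> {a}" using cD q(1) card_mono[of "{a}" ?D] by auto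
    then obtain d where d: "d \<in> ?D" "d \<noteq> a" by blast
    note m = matching_repair1[OF uma DA c d(1)]
    let ?L = "(up \<alpha> - {{b, c}}) \<union> {{c, d}}" and ?D' = "insert b (?D - {d})"
    show ?thesis
    proof (rule drop_by_projection[OF s AB(3,4,1) m(1,2) _ _ _ abu])
      show "card ?D' = br_rank \<alpha>" using cD d(1) m(3) fD q(1) by (simp add: card_Diff_singleton)
      show "a \<in> ?D'" "b \<in> ?D'" using a d by auto
      fix v assume v: "v \<in> ?D'"
      show "v \<in> dm (br_prd (pj ?L ?D') \<alpha>)"
      proof (cases "v = b")
        case True
        show ?thesis by (rule zig[OF m(1,2) v, of c d]) (use True c d in auto)
      next
        case False
        then show ?thesis using thr[OF m(1,2) v] v by blast
      qed
    qed
  qed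
  show ?thesis
  proof (cases "a \<in> ?D")
    case a: True
    show ?thesis
    proof (cases "b \<in> ?D")
      case True
      show ?thesis
        by (rule drop_by_projection[OF s AB(3,4,1) uma DA cD a True abu(1)]) (rule thr[OF uma DA])
    next
      case False
      then show ?thesis using mixed[OF a _ abu(1) ab(4)] by blast
    qed
  next
    case a: False
    show ?thesis
    proof (cases "b \<in> ?D")
      case True
      have "{b, a} \<in> up \<beta>" using abu(1) by (simp add: insert_commute)
      then show ?thesis using mixed[OF True a _ ab(3)] by blast
    next
      case b: False
      \<comment> \<open>Neither end is free: two repairs are carried out, at the expense of two
        different free points. That {a, b} is no hook of \<alpha> keeps them from
        interfering.\<close>
      obtain a' where a': "{a, a'} \<in> up \<alpha>" using matching_ex[OF uma, of a] a ab by blast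
      obtain b' where b': "{b, b'} \<in> up \<alpha>" using matching_ex[OF uma, of b] b ab by blast
      have a'b: "a' \<noteq> b" using a' abu(2) by auto
      have b'a: "b' \<noteq> a" using b' abu(2) by (auto simp: insert_commute)
      have "\<not> card ?D \<le> 1" using cD q(1) by simp
      then obtain d d' where d: "d \<in> ?D" "d' \<in> ?D" "d \<noteq> d'" using card_le_Suc0_iff_eq[OF fD] by auto
      note m1 = matching_repair1[OF uma DA a' d(1)]
      let ?L1 = "(up \<alpha> - {{a, a'}}) \<union> {{a', d}}" and ?D1 = "insert a (?D - {d})"
      have "{b, b'} \<noteq> {a, a'}" using a'b ab(2) by auto
      then have b'1: "{b, b'} \<in> ?L1" using b' by blast
      have d'1: "d' \<in> ?D1" using d by auto
      note m2 = matching_repair1[OF m1(1,2) b'1 d'1]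
      let ?L2 = "(?L1 - {{b, b'}}) \<union> {{b', d'}}" and ?D2 = "insert b (?D1 - {d'})"
      have ad: "a \<noteq> d'" using d a by auto
      have cD1: "card ?D1 = br_rank \<alpha>" using cD d(1) a fD q(1) by (simp add: card_Diff_singleton)
      have cD2: "card ?D2 = br_rank \<alpha>"
        using cD1 d'1 m2(3) fD q(1) by (simp add: card_Diff_singleton)
      show ?thesis
      proof (rule drop_by_projection[OF s AB(3,4,1) m2(1,2) cD2 _ _ abu(1)])
        show "a \<in> ?D2" "b \<in> ?D2" using ad by auto
        fix v assume v: "v \<in> ?D2"
        then consider "v = b" | "v = a" | "v \<in> ?D" by blast
        then show "v \<in> dm (br_prd (pj ?L2 ?D2) \<alpha>)"
        proof cases
          case 1
          show ?thesis by (rule zig[OF m2(1,2) v, of b' d']) (use 1 b' d in auto)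
        next
          case 2
          have "{a', d} \<noteq> {b, b'}" using a'b d b by (auto simp: doubleton_eq_iff)
          then show ?thesis by (intro zig[OF m2(1,2) v, of a' d]) (use 2 a' d in auto)
        next
          case 3
          then show ?thesis using thr[OF m2(1,2) v] by blast
        qed
      qed
    qed
  qed
qed

text \<open>The factorisation of the new element through \<alpha> is applied to \<beta>, whose rank
  cannot grow under multiplication.\<close>

lemma transfer_drop:
  assumes s: "(\<alpha>, \<beta>) \<in> \<sigma>" and AB: "A \<in> C" "B \<in> C" "\<alpha>' \<in> br A B" and rk: "br_rank \<alpha>' \<le> br_rank \<alpha>"
  obtains \<beta>' where "(\<alpha>', \<beta>') \<in> \<sigma>" "\<beta>' \<in> br A B" "br_rank \<beta>' \<le> br_rank \<beta>"
proof -
  obtain A0 B0 where 0: "A0 \<in> C" "B0 \<in> C" "\<alpha> \<in> br A0 B0" "\<beta> \<in> br A0 B0" "enat (br_rank \<alpha>) \<le> r" using congE[OF s] by metis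
  obtain \<gamma> \<delta> where g: "\<gamma> \<in> br A A0" "\<delta> \<in> br B0 B" "br_prd (br_prd \<gamma> \<alpha>) \<delta> = \<alpha>'"
    "br_rank \<gamma> = br_rank \<alpha>'" "br_rank \<delta> \<le> br_rank \<alpha>'"
    using factor_through[OF AB(3) 0(3) rk] by blast
  have "enat (br_rank \<gamma>) \<le> enat (br_rank \<alpha>)" "enat (br_rank \<delta>) \<le> enat (br_rank \<alpha>)" using g rk by simp_all
  then have le: "enat (br_rank \<gamma>) \<le> r" "enat (br_rank \<delta>) \<le> r" using 0(5) by (blast intro: order_trans)+
  have 1: "(br_prd \<gamma> \<alpha>, br_prd \<gamma> \<beta>) \<in> \<sigma>" by (rule cong_left[OF s 0(3) g(1) AB(1) le(1)])
  note b1 = br_prd_br[OF g(1) 0(3)] and b2 = br_prd_br[OF g(1) 0(4)]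
  have 2: "(\<alpha>', br_prd (br_prd \<gamma> \<beta>) \<delta>) \<in> \<sigma>" using cong_right[OF 1 b1 g(2) AB(2) le(2)] g(3) by simp
  have "br_rank (br_prd (br_prd \<gamma> \<beta>) \<delta>) \<le> br_rank \<beta>"
    using rank_prd_left[OF b2 g(2)] rank_prd_right[OF g(1) 0(4)] by simp
  then show ?thesis using that[OF 2 br_prd_br[OF b2 g(2)]] by blast
qed

text \<open>Multiplying on both sides by the projection leaves it unchanged and gives the other
  element all of its hooks, above and below.\<close>

lemma projection_drop:
  assumes s: "(\<alpha>, \<beta>) \<in> \<sigma>" and A: "A \<in> C" "B \<in> C" "\<alpha>' \<in> br A B" and rk: "br_rank \<alpha>' \<le> br_rank \<alpha>"
  obtains \<beta>' where "(br_prd \<alpha>' (star \<alpha>'), \<beta>') \<in> \<sigma>" "\<beta>' \<in> br A A" "br_rank \<beta>' \<le> br_rank \<beta>"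
    "up \<alpha>' \<subseteq> up \<beta>'" "up \<alpha>' \<subseteq> lo \<beta>'"
proof -
  let ?e = "br_prd \<alpha>' (star \<alpha>')"
  note e = proj_props[OF A(3)]
  obtain \<beta>1 where b: "(?e, \<beta>1) \<in> \<sigma>" "\<beta>1 \<in> br A A" "br_rank \<beta>1 \<le> br_rank \<beta>"
    using transfer_drop[OF s A(1,1) e(1)] e(4) rk by metis
  have re: "enat (br_rank ?e) \<le> r" using rank_ideal_rank[OF cong_mem(1)[OF b(1)]] .
  have ee: "br_prd ?e ?e = ?e" using e(5)[OF e(1)] e(2) by simp
  have 1: "(?e, br_prd ?e \<beta>1) \<in> \<sigma>" using cong_left[OF b(1) e(1) e(1) A(1) re] ee by simp
  note b2 = br_prd_br[OF e(1) b(2)]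
  have 2: "(?e, br_prd (br_prd ?e \<beta>1) ?e) \<in> \<sigma>" using cong_right[OF 1 e(1) e(1) A(1) re] ee by simp
  note b3 = br_prd_br[OF b2 e(1)]
  have "br_rank (br_prd (br_prd ?e \<beta>1) ?e) \<le> br_rank \<beta>"
    using rank_prd_left[OF b2 e(1)] rank_prd_right[OF e(1) b(2)] b(3) by simp
  moreover have "up \<alpha>' \<subseteq> up (br_prd (br_prd ?e \<beta>1) ?e)"
    using up_prd[OF e(1) b(2)] up_prd[OF b2 e(1)] e(2) by simp
  moreover have "up \<alpha>' \<subseteq> lo (br_prd (br_prd ?e \<beta>1) ?e)" using lo_prd[OF b2 e(1)] e(3) by simp
  ultimately show ?thesis using that[OF 2 b3] by blast
qed

text \<open>An element of rank 0 related to the projection contains the upper hooks of \<alpha>', so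
  its upper matching is their unique completion. Multiplying on the right by \<alpha>' yields rank 0
  and completes the lower hooks in the same forced way, which is the retract.\<close>

lemma collapse_to_retract:
  assumes s: "(\<alpha>, \<beta>) \<in> \<sigma>" "br_rank \<alpha> = 2" "br_rank \<beta> < 2"
    and A: "A \<in> C" "B \<in> C" "\<alpha>' \<in> br A B" "br_rank \<alpha>' = 2"
  shows "(\<alpha>', ret \<alpha>') \<in> \<sigma>"
proof -
  let ?e = "br_prd \<alpha>' (star \<alpha>')"
  note e = proj_props[OF A(3)]
  obtain \<beta>' where b: "(?e, \<beta>') \<in> \<sigma>" "\<beta>' \<in> br A A" "br_rank \<beta>' \<le> br_rank \<beta>" "up \<alpha>' \<subseteq> up \<beta>'"
    using projection_drop[OF s(1) A(1,2,3)] s(2) A(4) by (metis order_refl)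
  have "br_rank \<beta>' \<noteq> 1" using br_rank_even[OF b(2)] by auto
  then have b0: "br_rank \<beta>' = 0" using b(3) s(3) by simp
  have "enat (br_rank \<alpha>') \<le> r" using rank_ideal_rank[OF cong_mem(1)[OF s(1)]] s(2) A(4) by simp
  then have 1: "(\<alpha>', br_prd \<beta>' \<alpha>') \<in> \<sigma>" using cong_right[OF b(1) e(1) A(3,2)] e(5)[OF A(3)] by simp
  note bb = br_prd_br[OF b(2) A(3)]
  have rk: "br_rank (br_prd \<beta>' \<alpha>') = 0" using rank_prd_left[OF b(2) A(3)] b0 by simp
  have a2: "br_rank \<alpha>' \<le> 2" using A(4) by simp
  note rr = ret[OF A(3) a2]
  have "up \<beta>' = hup \<alpha>'" by (rule hup_unique[OF A(3) a2 rank0_matching(1)[OF b(2) b0] b(4)])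
  then have "up (br_prd \<beta>' \<alpha>') = up (ret \<alpha>')" using up_rank0_prd[OF b(2) b0 A(3)] rr by simp
  moreover have "lo (br_prd \<beta>' \<alpha>') = lo (ret \<alpha>')"
    using hlo_unique[OF A(3) a2 rank0_matching(2)[OF bb rk] lo_prd[OF b(2) A(3)]] rr by simp
  ultimately have "br_prd \<beta>' \<alpha>' = ret \<alpha>'" by (rule rank0_eqI[OF bb rr(1) rk])
  then show ?thesis using 1 by simp
qed

text \<open>Let k be the least rank related to the given one, attained by an element \<beta>1
  related to a projection. If k is positive, \<beta>1 has an additional hook above and two ends of
  transversals below; a conjugate of \<beta>1 with the hook moved to these ends closes them off, and
  the product of the two is related to the projection with rank below k.\<close>

lemma drop_to_zero:
  assumes s: "(\<alpha>, \<beta>) \<in> \<sigma>" "br_rank \<beta> < br_rank \<alpha>"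
  shows "\<exists>\<alpha>' \<beta>'. (\<alpha>', \<beta>') \<in> \<sigma> \<and> br_rank \<alpha>' = br_rank \<alpha> \<and> br_rank \<beta>' = 0"
proof -
  let ?P = "\<lambda>k. \<exists>\<alpha>' \<beta>'. (\<alpha>', \<beta>') \<in> \<sigma> \<and> br_rank \<alpha>' = br_rank \<alpha> \<and> br_rank \<beta>' = k"
  define k where "k = (LEAST k. ?P k)"
  have Pk: "?P k" unfolding k_def by (rule LeastI[of ?P "br_rank \<beta>"]) (use s in blast)
  have least: "k \<le> j" if "?P j" for j unfolding k_def using that by (rule Least_le)
  have kq: "k < br_rank \<alpha>" using least[of "br_rank \<beta>"] s by force
  have "k = 0"
  proof (rule ccontr)
    assume k0: "k \<noteq> 0"
    obtain \<alpha>' \<beta>' where ab: "(\<alpha>', \<beta>') \<in> \<sigma>" "br_rank \<alpha>' = br_rank \<alpha>" "br_rank \<beta>' = k" using Pk by blast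
    obtain A B where A: "A \<in> C" "B \<in> C" "\<alpha>' \<in> br A B" using congE[OF ab(1)] by metis
    let ?e = "br_prd \<alpha>' (star \<alpha>')"
    note e = proj_props[OF A(3)]
    obtain \<beta>1 where b: "(?e, \<beta>1) \<in> \<sigma>" "\<beta>1 \<in> br A A" "br_rank \<beta>1 \<le> k" "up \<alpha>' \<subseteq> up \<beta>1" "up \<alpha>' \<subseteq> lo \<beta>1"
      using projection_drop[OF ab(1) A order_refl] ab(3) by metis
    have b1k: "br_rank \<beta>1 = k" using least[of "br_rank \<beta>1"] b(1,3) e(4) ab(2) by force
    let ?D = "dm \<alpha>'"
    have fin: "finite A" "even (card A)" using C_even[OF A(1)] by auto
    have DA: "?D \<subseteq> A" by (rule dm_subset[OF A(3)])
    have De: "?D = A - \<Union>(up \<alpha>')" by (rule dm_eq[OF A(3)])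
    have k2: "\<not> card (cd \<beta>1) \<le> Suc 0"
      using br_rank_even[OF b(2)] b1k k0 br_rank_cd[OF b(2)] by (cases "k = 1") auto
    have fcd: "finite (cd \<beta>1)" using cd_subset[OF b(2)] fin(1) finite_subset by blast
    obtain b1 b2 where b12: "b1 \<in> cd \<beta>1" "b2 \<in> cd \<beta>1" "b1 \<noteq> b2"
      using k2 card_le_Suc0_iff_eq[OF fcd] by blast
    have cdD: "cd \<beta>1 \<subseteq> ?D" unfolding De cd_eq[OF b(2)] using b(5) by blast
    have "up \<beta>1 \<noteq> up \<alpha>'"
    proof
      assume "up \<beta>1 = up \<alpha>'"
      then have "br_rank \<beta>1 = br_rank \<alpha>'"
        using br_rank_dm[OF b(2)] br_rank_dm[OF A(3)] dm_eq[OF b(2)] De by simp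
      then show False using b1k kq ab(2) by simp
    qed
    then obtain h where h: "h \<in> up \<beta>1 - up \<alpha>'" using b(4) by blast
    have mt: "up \<beta>1 - up \<alpha>' \<in> matching (A - dm \<beta>1 - \<Union>(up \<alpha>'))" by (rule matching_diff[OF up_matching[OF b(2)] b(4)])
    obtain a1 a2 where a12': "h = {a1, a2}" "a1 \<noteq> a2" "a1 \<in> A - dm \<beta>1 - \<Union>(up \<alpha>')"
      "a2 \<in> A - dm \<beta>1 - \<Union>(up \<alpha>')"
      using matchingE[OF mt h] .
    have a12: "h = {a1, a2}" "a1 \<noteq> a2" "a1 \<in> ?D" "a2 \<in> ?D" using a12' unfolding De by simp_all
    \<comment> \<open>Chosen so that multiplication by its diagram pulls the hook {a1, a2} back to
      {b1, b2}.\<close>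
    obtain g where g: "g permutes ?D" "g b1 = a1" "g b2 = a2"
      using exists_perm[of b1 ?D b2 a1 a2] b12 cdD a12 by blast
    have gD: "g ` ?D = ?D" by (rule permutes_image[OF g(1)])
    let ?g = "mk_br (up \<alpha>') ?D g (up \<alpha>')"
    have ne: "{} \<notin> up \<alpha>'" by (rule matching_no_empty[OF up_matching[OF A(3)]])
    note parts = mk_br_parts[OF ne ne, of ?D g]
    have \<gamma>: "?g \<in> br A A"
      by (rule mk_br_br) (use up_matching[OF A(3)] gD DA fin permutes_inj_on[OF g(1)] in auto)
    note s\<gamma> = star_br[OF \<gamma>]
    have rg: "br_rank ?g = br_rank \<alpha>" using br_rank_dm[OF \<gamma>] parts(3) br_rank_dm[OF A(3)] ab(2) by simp
    have rr: "enat (br_rank \<alpha>) \<le> r" using rank_ideal_rank[OF cong_mem(1)[OF ab(1)]] ab(2) by simp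
    have ge: "br_prd ?g ?e = ?g" by (rule e(6)[OF \<gamma>]) (simp add: parts)
    \<comment> \<open>The diagram of g is a unit of the local group with its reflection as inverse,
      so conjugation fixes the projection.\<close>
    have gg: "br_prd ?g (star ?g) = ?e"
    proof -
      note pg = proj_props[OF \<gamma>]
      have "br_prd (br_prd ?g (star ?g)) ?e = ?e" by (rule pg(5)[OF e(1)]) (simp add: parts e(2))
      moreover have "br_prd (br_prd ?g (star ?g)) ?e = br_prd ?g (star ?g)"
        by (rule e(6)[OF pg(1)]) (simp add: pg(3) parts)
      ultimately show ?thesis by simp
    qed
    note gb = br_prd_br[OF \<gamma> b(2)]
    have "(br_prd ?g ?e, br_prd ?g \<beta>1) \<in> \<sigma>" by (rule cong_left[OF b(1) e(1) \<gamma> A(1)]) (simp add: rg rr)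
    then have "(?g, br_prd ?g \<beta>1) \<in> \<sigma>" using ge by simp
    then have "(br_prd ?g (star ?g), br_prd (br_prd ?g \<beta>1) (star ?g)) \<in> \<sigma>"
      by (rule cong_right[OF _ \<gamma> s\<gamma> A(1)]) (simp add: rg rr)
    then have 1: "(?e, br_prd (br_prd ?g \<beta>1) (star ?g)) \<in> \<sigma>" using gg by simp
    let ?b2 = "br_prd (br_prd ?g \<beta>1) (star ?g)"
    note bb2 = br_prd_br[OF gb s\<gamma>]
    have "enat (br_rank \<beta>1) \<le> r" using rank_ideal_rank[OF cong_mem(2)[OF b(1)]] .
    \<comment> \<open>Since \<beta>1 absorbs the projection, multiplying the conjugated pair by
      \<beta>1 relates \<beta>1, and hence the projection, to the shorter product.\<close>
    from cong_left[OF 1 e(1) b(2) A(1) this]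
    have "(\<beta>1, br_prd \<beta>1 ?b2) \<in> \<sigma>" using e(6)[OF b(2,5)] by simp
    then have 2: "(?e, br_prd \<beta>1 ?b2) \<in> \<sigma>" using cong_trans[OF b(1)] by blast
    note bb3 = br_prd_br[OF b(2) bb2]
    have lk: "{Inl a1, Inl a2} \<in> \<beta>1" using h a12 by (simp add: up_link)
    have "{Inl b1, Inr a1} \<in> ?g" "{Inl b2, Inr a2} \<in> ?g"
      using mk_br_links(3) g b12 cdD by (metis subsetD)+
    then have "{Inl b1, Inl b2} \<in> br_prd ?g \<beta>1" using link_turn[OF \<gamma> b(2) _ lk] by blast
    then have lk2: "{Inl b1, Inl b2} \<in> ?b2" by (rule link_ULU[OF gb s\<gamma>])
    \<comment> \<open>The two transversals of \<beta>1 that the hook {b1, b2} joins into a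
      hook.\<close>
    obtain x1 x2 where x: "{Inl x1, Inr b1} \<in> \<beta>1" "{Inl x2, Inr b2} \<in> \<beta>1" using b12 by (auto simp: cd_def)
    have "{x1, x2} \<in> up (br_prd \<beta>1 ?b2)"
      using link_turn[OF b(2) bb2 x(1) lk2 x(2)] by (simp add: up_link)
    then have "x1 \<notin> dm (br_prd \<beta>1 ?b2)" unfolding dm_eq[OF bb3] by blast
    moreover have "x1 \<in> dm \<beta>1" using x(1) by (auto simp: dm_def)
    ultimately have "dm (br_prd \<beta>1 ?b2) \<subset> dm \<beta>1" using dm_prd[OF b(2) bb2] by blast
    then have "br_rank (br_prd \<beta>1 ?b2) < k"
      using br_rank_dm[OF bb3] br_rank_dm[OF b(2)] dm_finite[OF b(2)] b1k psubset_card_mono by metis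
    moreover have "k \<le> br_rank (br_prd \<beta>1 ?b2)" using least 2 e(4) ab(2) by metis
    ultimately show False by simp
  qed
  then show ?thesis using Pk by simp
qed

text \<open>The projection commutes with the diagram of a transposition of free points, so an
  element \<beta>1 of rank 0 related to it has related products with that diagram from the left and
  from the right. The right product keeps the upper hooks and the left one moves a hook. A third
  free point, available from rank 4 on, makes the moved hook different.\<close>

lemma drop_eU:
  assumes s: "(\<alpha>, \<beta>) \<in> \<sigma>" "br_rank \<beta> < br_rank \<alpha>" and q: "4 \<le> br_rank \<alpha>"
  shows eU
proof -
  obtain \<alpha>' \<beta>' where ab: "(\<alpha>', \<beta>') \<in> \<sigma>" "br_rank \<alpha>' = br_rank \<alpha>" "br_rank \<beta>' = 0"
    using drop_to_zero[OF s] by blast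
  obtain A B where A: "A \<in> C" "B \<in> C" "\<alpha>' \<in> br A B" using congE[OF ab(1)] by metis
  let ?e = "br_prd \<alpha>' (star \<alpha>')"
  note e = proj_props[OF A(3)]
  obtain \<beta>1 where b: "(?e, \<beta>1) \<in> \<sigma>" "\<beta>1 \<in> br A A" "br_rank \<beta>1 \<le> 0" "up \<alpha>' \<subseteq> up \<beta>1" "up \<alpha>' \<subseteq> lo \<beta>1"
    using projection_drop[OF ab(1) A order_refl] ab(3) by metis
  have b0: "br_rank \<beta>1 = 0" using b(3) by simp
  let ?D = "dm \<alpha>'"
  have fin: "finite A" "even (card A)" using C_even[OF A(1)] by auto
  have DA: "?D \<subseteq> A" by (rule dm_subset[OF A(3)])
  have De: "?D = A - \<Union>(up \<alpha>')" by (rule dm_eq[OF A(3)])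
  have cD: "4 \<le> card ?D" using br_rank_dm[OF A(3)] ab(2) q by simp
  have M: "up \<beta>1 - up \<alpha>' \<in> matching ?D"
    using matching_diff[OF rank0_matching(1)[OF b(2) b0] b(4)] De by simp
  obtain a where a: "a \<in> ?D" using cD by (metis all_not_in_conv card.empty not_numeral_le_zero)
  obtain b where bb: "{a, b} \<in> up \<beta>1 - up \<alpha>'" "b \<in> ?D" "a \<noteq> b" using matching_ex[OF M a] .
  have "\<not> ?D \<subseteq> {a, b}" using cD card_mono[of "{a, b}" ?D] bb(3) by auto
  then obtain c where c: "c \<in> ?D" "c \<noteq> a" "c \<noteq> b" by blast
  let ?g = "mk_br (up \<alpha>') ?D (transpose b c) (up \<alpha>')"
  have g: "transpose b c permutes ?D" by (rule permutes_swap_id[OF bb(2) c(1)])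
  have gD: "transpose b c ` ?D = ?D" by (rule permutes_image[OF g])
  have ne: "{} \<notin> up \<alpha>'" by (rule matching_no_empty[OF up_matching[OF A(3)]])
  note parts = mk_br_parts[OF ne ne, of ?D "transpose b c"]
  have \<gamma>: "?g \<in> br A A"
    by (rule mk_br_br) (use up_matching[OF A(3)] gD DA fin permutes_inj_on[OF g] in auto)
  have rg: "br_rank ?g = br_rank \<alpha>" using br_rank_dm[OF \<gamma>] parts(3) br_rank_dm[OF A(3)] ab(2) by simp
  have rr: "enat (br_rank ?g) \<le> r" using rank_ideal_rank[OF cong_mem(1)[OF ab(1)]] ab(2) rg by simp
  have ge: "br_prd ?g ?e = ?g" by (rule e(6)[OF \<gamma>]) (simp add: parts)
  have eg: "br_prd ?e ?g = ?g" by (rule e(5)[OF \<gamma>]) (simp add: parts)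
  have "(br_prd ?g ?e, br_prd ?g \<beta>1) \<in> \<sigma>" by (rule cong_left[OF b(1) e(1) \<gamma> A(1) rr])
  moreover have "(br_prd ?e ?g, br_prd \<beta>1 ?g) \<in> \<sigma>" by (rule cong_right[OF b(1) e(1) \<gamma> A(1) rr])
  ultimately have 1: "(br_prd ?g \<beta>1, br_prd \<beta>1 ?g) \<in> \<sigma>" using ge eg cong_sym cong_trans by metis
  note gb = br_prd_br[OF \<gamma> b(2)] and bg = br_prd_br[OF b(2) \<gamma>]
  have r0: "br_rank (br_prd ?g \<beta>1) = 0" "br_rank (br_prd \<beta>1 ?g) = 0"
    using rank_prd_right[OF \<gamma> b(2)] rank_prd_left[OF b(2) \<gamma>] b0 by simp_all
  have lk: "{Inl a, Inl b} \<in> \<beta>1" using bb(1) by (simp add: up_link)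
  have "{Inl a, Inr a} \<in> ?g" "{Inl c, Inr b} \<in> ?g"
    unfolding mk_br_links(3) using a bb c by (auto simp: transpose_def)
  then have "{a, c} \<in> up (br_prd ?g \<beta>1)" using link_turn[OF \<gamma> b(2) _ lk] by (simp add: up_link)
  moreover have "up (br_prd \<beta>1 ?g) = up \<beta>1" by (rule up_rank0_prd[OF b(2) b0 \<gamma>])
  then have "{a, c} \<notin> up (br_prd \<beta>1 ?g)"
    using matching_unique[OF up_matching[OF b(2)], of a b c] bb(1) c(3) by auto
  ultimately have "up (br_prd ?g \<beta>1) \<noteq> up (br_prd \<beta>1 ?g)" by blast
  then show eU unfolding eU_def using 1 r0 by blast
qed

text \<open>In \<alpha> a transversal joins a to b, whereas in \<beta> it leads from a to b'. A
  projection that hooks b to a further point b'' turns a into an end of a hook in one product and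
  leaves it in the domain of the other. Both ranks fall by 2, as the lower hooks agree.\<close>

lemma H_drop:
  assumes s: "(\<alpha>, \<beta>) \<in> \<sigma>" "up \<alpha> = up \<beta>" "lo \<alpha> = lo \<beta>" "\<alpha> \<noteq> \<beta>" and q: "4 \<le> br_rank \<alpha>"
  shows "\<exists>\<alpha>' \<beta>'. (\<alpha>', \<beta>') \<in> \<sigma> \<and> br_rank \<alpha>' = br_rank \<alpha> - 2 \<and> br_rank \<beta>' = br_rank \<alpha> - 2 \<and> up \<alpha>' \<noteq> up \<beta>'"
proof -
  obtain A B where AB: "A \<in> C" "B \<in> C" "\<alpha> \<in> br A B" "\<beta> \<in> br A B" using congE[OF s(1)] .
  obtain a b where ab: "{Inl a, Inr b} \<in> \<alpha>" "{Inl a, Inr b} \<notin> \<beta>"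
    using br_eqI[OF AB(3,4)] s by blast
  have "a \<in> dm \<beta>" using ab(1) dm_eq[OF AB(3)] dm_eq[OF AB(4)] s(2) by (auto simp: dm_def)
  then obtain b' where b': "{Inl a, Inr b'} \<in> \<beta>" by (auto simp: dm_def)
  let ?D = "cd \<alpha>"
  have De: "?D = cd \<beta>" using cd_eq[OF AB(3)] cd_eq[OF AB(4)] s(3) by simp
  have "b \<in> ?D" "b' \<in> cd \<beta>" "b' \<noteq> b" using ab b' by (auto simp: cd_def)
  then have bD: "b \<in> ?D" "b' \<in> ?D" "b' \<noteq> b" by (simp_all add: De)
  have fD: "finite ?D" using cd_subset[OF AB(3)] C_even[OF AB(2)] finite_subset by blast
  have cD: "card ?D = br_rank \<alpha>" using br_rank_cd[OF AB(3)] by simp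
  \<comment> \<open>The third point b'' must differ from b' so that the transversal of \<beta> at a
    survives.\<close>
  have "\<not> ?D \<subseteq> {b, b'}" using cD q card_mono[of "{b, b'}" ?D] bD(3) by auto
  then obtain b'' where b'': "b'' \<in> ?D" "b'' \<noteq> b" "b'' \<noteq> b'" by blast
  let ?L = "lo \<alpha> \<union> {{b, b''}}" and ?D1 = "?D - {b, b''}"
  have DB: "?D \<subseteq> B" by (rule cd_subset[OF AB(3)])
  have "?L \<in> matching ((B - ?D) \<union> {b, b''})"
    by (rule matching_Un[OF lo_matching[OF AB(3)] matching_pair]) (use bD b'' in auto)
  moreover have "(B - ?D) \<union> {b, b''} = B - ?D1" using bD b'' DB by blast
  ultimately have L: "?L \<in> matching (B - ?D1)" by simp
  have D1: "?D1 \<subseteq> B" using DB by blast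
  note p = pj[OF L D1 C_even[OF AB(2), THEN conjunct1] C_even[OF AB(2), THEN conjunct2]]
  have cD1: "card ?D1 = br_rank \<alpha> - 2" using cD bD b'' fD by (simp add: card_Diff_subset)
  have rp: "enat (br_rank (pj ?L ?D1)) \<le> r"
    using rank_ideal_rank[OF cong_mem(1)[OF s(1)]] p(6) cD1 by (metis diff_le_self enat_ord_simps(1) order_trans)
  have 1: "(br_prd \<alpha> (pj ?L ?D1), br_prd \<beta> (pj ?L ?D1)) \<in> \<sigma>" by (rule cong_right[OF s(1) AB(3) p(1) AB(2) rp])
  note ba = br_prd_br[OF AB(3) p(1)] and bb = br_prd_br[OF AB(4) p(1)]
  have "?D1 \<subseteq> cd (br_prd \<alpha> (pj ?L ?D1))"
  proof
    fix d assume d: "d \<in> ?D1"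
    then obtain u where "{Inl u, Inr d} \<in> \<alpha>" by (auto simp: cd_def)
    then have "{Inl u, Inr d} \<in> br_prd \<alpha> (pj ?L ?D1)" using link_through[OF AB(3) p(1), of u d d] p(7) d by blast
    then show "d \<in> cd (br_prd \<alpha> (pj ?L ?D1))" by (auto simp: cd_def)
  qed
  then have "cd (br_prd \<alpha> (pj ?L ?D1)) = ?D1" using cd_prd[OF AB(3) p(1)] p(5) by blast
  then have r1: "br_rank (br_prd \<alpha> (pj ?L ?D1)) = br_rank \<alpha> - 2" using br_rank_cd[OF ba] cD1 by simp
  then have r2: "br_rank (br_prd \<beta> (pj ?L ?D1)) = br_rank \<alpha> - 2"
    using lo_eq_prd(1)[OF AB(3,4) s(3) p(1)] by simp
  obtain a'' where a'': "{Inl a'', Inr b''} \<in> \<alpha>" using b'' by (auto simp: cd_def)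
  have "{b, b''} \<in> up (pj ?L ?D1)" using p(2) by simp
  then have "{Inl b, Inl b''} \<in> pj ?L ?D1" by (simp add: up_link)
  from link_turn[OF AB(3) p(1) ab(1) this a''] have "{a, a''} \<in> up (br_prd \<alpha> (pj ?L ?D1))" by (simp add: up_link)
  moreover have "{a, a''} \<notin> up (br_prd \<beta> (pj ?L ?D1))"
  proof -
    have "b' \<in> ?D1" using bD b'' by auto
    then have "{Inl a, Inr b'} \<in> br_prd \<beta> (pj ?L ?D1)" using link_through[OF AB(4) p(1) b'] p(7) by blast
    then have "a \<in> dm (br_prd \<beta> (pj ?L ?D1))" by (auto simp: dm_def)
    then show ?thesis unfolding dm_eq[OF bb] by blast
  qed
  ultimately show ?thesis using 1 r1 r2 by blast
qed

end

section \<open>Every congruence is listed\<close>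

lemma star_ret:
  assumes "\<alpha> \<in> br A B" "br_rank \<alpha> \<le> 2"
  shows "star (ret \<alpha>) = ret (star \<alpha>)"
proof -
  note r = ret[OF assms] and s = ret[OF star_br[OF assms(1)]]
  show ?thesis by (rule rank0_eqI[OF star_br[OF r(1)] s(1)]) (use r s assms(2) in auto)
qed

context br_cong begin

definition "NH q \<longleftrightarrow> (\<exists>\<alpha> \<beta>. (\<alpha>, \<beta>) \<in> \<sigma> \<and> br_rank \<alpha> = q \<and> br_rank \<beta> \<le> q \<and> (up \<alpha> \<noteq> up \<beta> \<or> lo \<alpha> \<noteq> lo \<beta>))"

interpretation star: br_cong C r "(\<lambda>(\<alpha>, \<beta>). (star \<alpha>, star \<beta>)) ` \<sigma>" by (rule star_cong)

lemma star_mem: "(\<alpha>, \<beta>) \<in> \<sigma> \<Longrightarrow> (star \<alpha>, star \<beta>) \<in> (\<lambda>(\<alpha>, \<beta>). (star \<alpha>, star \<beta>)) ` \<sigma>"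
  unfolding mem_star_cong by simp

lemma NH_drop:
  assumes "NH q" "2 \<le> q"
  shows "\<exists>\<alpha> \<beta>. (\<alpha>, \<beta>) \<in> \<sigma> \<and> br_rank \<alpha> = q \<and> br_rank \<beta> < q"
proof -
  obtain \<alpha> \<beta> where ab: "(\<alpha>, \<beta>) \<in> \<sigma>" "br_rank \<alpha> = q" "br_rank \<beta> \<le> q" "up \<alpha> \<noteq> up \<beta> \<or> lo \<alpha> \<noteq> lo \<beta>"
    using assms(1) unfolding NH_def by blast
  from ab(4) show ?thesis
  proof
    assume "up \<alpha> \<noteq> up \<beta>"
    then show ?thesis using nonH_drop[OF ab(1)] ab assms(2) by blast
  next
    assume "lo \<alpha> \<noteq> lo \<beta>"
    then obtain \<alpha>' \<beta>' where "(star \<alpha>', star \<beta>') \<in> \<sigma>" "br_rank \<alpha>' = q" "br_rank \<beta>' < q"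
      using star.nonH_drop[OF star_mem[OF ab(1)]] ab assms(2) unfolding mem_star_cong by auto
    then show ?thesis by (metis br_rank_star)
  qed
qed

lemma drop_eL:
  assumes s: "(\<alpha>, \<beta>) \<in> \<sigma>" "br_rank \<beta> < br_rank \<alpha>" and q: "4 \<le> br_rank \<alpha>"
  shows eL
  using star.drop_eU[OF star_mem[OF s(1)]] s q star_eU by simp

text \<open>Any two elements concerned are moved to rank 0, where both flags are set and everything
  with the same source and range is related.\<close>

lemma full_below:
  assumes NH: "NH q" "4 \<le> q" and A: "A \<in> C" "B \<in> C" "\<gamma> \<in> br A B" "\<delta> \<in> br A B" "br_rank \<gamma> \<le> q" "br_rank \<delta> \<le> q"
  shows "(\<gamma>, \<delta>) \<in> \<sigma>"
proof -
  obtain \<alpha> \<beta> where ab: "(\<alpha>, \<beta>) \<in> \<sigma>" "br_rank \<alpha> = q" "br_rank \<beta> < q" using NH_drop[OF NH(1)] NH(2) by (metis numeral_le_iff order_trans semiring_norm(69,71,68))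
  obtain \<alpha>' \<beta>' where ab': "(\<alpha>', \<beta>') \<in> \<sigma>" "br_rank \<alpha>' = q" "br_rank \<beta>' = 0" using drop_to_zero[OF ab(1)] ab by auto
  have "enat 4 \<le> enat q" using NH by simp
  also have "\<dots> \<le> r" using rank_ideal_rank[OF cong_mem(1)[OF ab(1)]] ab(2) by simp
  finally have r4: "4 \<le> r" by (simp add: numeral_eq_enat)
  have e: eU eL using drop_eU[OF ab(1)] drop_eL[OF ab(1)] ab NH by auto
  obtain \<gamma>0 where g: "(\<gamma>, \<gamma>0) \<in> \<sigma>" "\<gamma>0 \<in> br A B" "br_rank \<gamma>0 = 0"
    using transfer_drop[OF ab'(1) A(1,2,3)] ab' A by (metis le_zero_eq)
  obtain \<delta>0 where d: "(\<delta>, \<delta>0) \<in> \<sigma>" "\<delta>0 \<in> br A B" "br_rank \<delta>0 = 0"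
    using transfer_drop[OF ab'(1) A(1,2,4)] ab' A by (metis le_zero_eq)
  have "(\<gamma>0, \<delta>0) \<in> \<sigma>" using zero_part[OF r4 A(1,2) g(2) d(2) g(3) d(3)] e by simp
  then show ?thesis using g(1) d(1) cong_trans cong_sym by blast
qed

lemma collapse:
  assumes NH: "NH 2" and A: "A \<in> C" "B \<in> C" "\<gamma> \<in> br A B" "br_rank \<gamma> \<le> 2"
  shows "(\<gamma>, ret \<gamma>) \<in> \<sigma>"
proof -
  obtain \<alpha> \<beta> where ab: "(\<alpha>, \<beta>) \<in> \<sigma>" "br_rank \<alpha> = 2" "br_rank \<beta> < 2" using NH_drop[OF NH order_refl] by blast
  have "br_rank \<gamma> \<noteq> 1" using br_rank_even[OF A(3)] by auto
  then consider "br_rank \<gamma> = 0" | "br_rank \<gamma> = 2" using A(4) by linarith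
  then show ?thesis
  proof cases
    case 1
    then have "\<gamma> \<in> rank_ideal C r" using rank_idealI[OF A(1,2,3)] by (simp add: enat_0)
    then show ?thesis using ret_rank0[OF A(3) 1] cong_refl by simp
  next
    case 2
    show ?thesis by (rule collapse_to_retract[OF ab A(1,2,3) 2])
  qed
qed

text \<open>A related pair above q - 2 is \<H>-related by assumption. Were its rank larger than q,
  lowering it by 2 would give a related pair that is not \<H>-related and still lies above q -
  2.\<close>

lemma top_H_pair:
  assumes no: "\<And>k. q - 2 < k \<Longrightarrow> \<not> NH k" and q: "2 \<le> q" "even q"
    and ab: "(\<alpha>, \<beta>) \<in> \<sigma>" "\<alpha> \<noteq> \<beta>" "br_rank \<beta> \<le> br_rank \<alpha>" "q - 2 < br_rank \<alpha>"
  shows "br_rank \<alpha> = q \<and> br_rank \<beta> = q \<and> up \<alpha> = up \<beta> \<and> lo \<alpha> = lo \<beta>"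
proof -
  obtain A B where AB: "A \<in> C" "B \<in> C" "\<alpha> \<in> br A B" "\<beta> \<in> br A B" using congE[OF ab(1)] .
  have H: "up \<alpha> = up \<beta>" "lo \<alpha> = lo \<beta>" using no[OF ab(4)] ab unfolding NH_def by blast+
  have rk: "br_rank \<beta> = br_rank \<alpha>" using br_rank_dm[OF AB(3)] br_rank_dm[OF AB(4)] dm_eq[OF AB(3)] dm_eq[OF AB(4)] H by simp
  have ev: "even (br_rank \<alpha>)" by (rule br_rank_even[OF AB(3)])
  have "br_rank \<alpha> \<le> q"
  proof (cases "4 \<le> br_rank \<alpha>")
    case True
    have "NH (br_rank \<alpha> - 2)" unfolding NH_def using H_drop[OF ab(1) H ab(2) True] by fastforce
    then have "\<not> q - 2 < br_rank \<alpha> - 2" using no by blast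
    then show ?thesis using True by linarith
  next
    case False
    then have "br_rank \<alpha> \<le> 2" using ev by (auto elim!: evenE)
    then show ?thesis using q by simp
  qed
  then have "br_rank \<alpha> = q" using ab(4) ev q by (auto elim!: evenE)
  then show ?thesis using rk H by simp
qed

end

context brauer_rank begin

text \<open>Above rank q - 2 only \<H>-related pairs of rank exactly q can be nontrivial, and these
  are given by a normal subgroup. So the congruence is determined by it and by what happens in rank
  at most q - 2.\<close>

lemma Rel_eqI:
  assumes s: "br_cong C r \<sigma>" and q2: "2 \<le> q" and r: "enat q \<le> r"
    and no: "\<And>k. q - 2 < k \<Longrightarrow> \<not> br_cong.NH \<sigma> k"
    and low: "\<And>A B \<gamma> \<delta>. A \<in> C \<Longrightarrow> B \<in> C \<Longrightarrow> \<gamma> \<in> br A B \<Longrightarrow> \<delta> \<in> br A B \<Longrightarrow> br_rank \<gamma> \<le> q - 2 \<Longrightarrow> br_rank \<delta> \<le> q - 2 \<Longrightarrow>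
      (\<gamma>, \<delta>) \<in> \<sigma> \<longleftrightarrow> (eu \<or> hup \<gamma> = hup \<delta>) \<and> (el \<or> hlo \<gamma> = hlo \<delta>)"
  shows "\<sigma> = Rel eu el (Nsig \<sigma>) r"
proof -
  interpret S: br_cong C r \<sigma> by (rule s)
  note N = Nsig_normal[OF s r] and iff = Nsig_iff[OF s r]
  show ?thesis
  proof (intro equalityI subrelI)
    fix \<alpha> \<beta> assume ab: "(\<alpha>, \<beta>) \<in> \<sigma>"
    obtain A B where AB: "A \<in> C" "B \<in> C" "\<alpha> \<in> br A B" "\<beta> \<in> br A B" using S.congE[OF ab] .
    show "(\<alpha>, \<beta>) \<in> Rel eu el (Nsig \<sigma>) r"
    proof (cases "br_rank \<alpha> \<le> q - 2 \<and> br_rank \<beta> \<le> q - 2")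
      case True
      then have "(\<alpha>, \<beta>) \<in> base eu el (q - 2)" unfolding base_def using AB ab low[OF AB] by blast
      then show ?thesis by (simp add: Rel_def)
    next
      case False
      show ?thesis
      proof (cases "\<alpha> = \<beta>")
        case True then show ?thesis using S.cong_mem[OF ab] by (simp add: Rel_def Id_on_iff)
      next
        case ne: False
        have "br_rank \<alpha> = q \<and> up \<alpha> = up \<beta> \<and> lo \<alpha> = lo \<beta>"
        proof (cases "br_rank \<beta> \<le> br_rank \<alpha>")
          case True
          then show ?thesis using S.top_H_pair[OF no q2 q(1) ab ne] False by simp
        next
          case F2: False
          then have "br_rank \<alpha> \<le> br_rank \<beta>" "q - 2 < br_rank \<beta>" using False by linarith+
          then show ?thesis using S.top_H_pair[OF no q2 q(1) S.cong_sym[OF ab] ne[symmetric]] by simp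
        qed
        then have "(\<alpha>, \<beta>) \<in> nuq (Nsig \<sigma>)" using iff[OF AB] ab by blast
        then show ?thesis by (simp add: Rel_def)
      qed
    qed
  next
    fix \<alpha> \<beta> assume "(\<alpha>, \<beta>) \<in> Rel eu el (Nsig \<sigma>) r"
    then consider "(\<alpha>, \<beta>) \<in> base eu el (q - 2)" | "(\<alpha>, \<beta>) \<in> nuq (Nsig \<sigma>)" | "\<alpha> = \<beta>" "\<alpha> \<in> rank_ideal C r"
      unfolding Rel_def by blast
    then show "(\<alpha>, \<beta>) \<in> \<sigma>"
    proof cases
      case 1
      then obtain A B where "A \<in> C" "B \<in> C" "\<alpha> \<in> br A B" "\<beta> \<in> br A B" "br_rank \<alpha> \<le> q - 2" "br_rank \<beta> \<le> q - 2"
        "eu \<or> hup \<alpha> = hup \<beta>" "el \<or> hlo \<alpha> = hlo \<beta>" unfolding base_def by blast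
      then show ?thesis using low by blast
    next
      case 2
      then obtain A B where "A \<in> C" "B \<in> C" "\<alpha> \<in> br A B" "\<beta> \<in> br A B" "up \<alpha> = up \<beta>" "lo \<alpha> = lo \<beta>" "br_rank \<alpha> = q"
        using nuq_typed[OF N 2] by metis
      then show ?thesis using iff 2 by blast
    next
      case 3 then show ?thesis using S.cong_refl by simp
    qed
  qed
qed

text \<open>For \<pi> outside the Klein group some pair overlaps its image in one point. A
  projection of rank 2 hooking the image is related to a product that hooks the pair itself.
  Overlapping but different pairs cannot lie in one matching, so the two retracts differ
  above.\<close>

lemma nonklein_eU:
  assumes s: "br_cong C r \<sigma>" and q4: "q = 4" and r: "4 \<le> r"
    and coll: "\<And>A B \<gamma>. A \<in> C \<Longrightarrow> B \<in> C \<Longrightarrow> \<gamma> \<in> br A B \<Longrightarrow> br_rank \<gamma> \<le> 2 \<Longrightarrow> (\<gamma>, ret \<gamma>) \<in> \<sigma>"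
    and \<pi>: "\<pi> permutes {1..q}" "(\<epsilon>, p \<pi>) \<in> \<sigma>" "\<pi> \<notin> klein"
  shows "br_cong.eU \<sigma>"
proof -
  interpret S: br_cong C r \<sigma> by (rule s)
  obtain i j where ij: "i \<in> {1..q}" "j \<in> {1..q}" "i \<noteq> j" "{\<pi> i, \<pi> j} \<noteq> {i, j}" "{\<pi> i, \<pi> j} \<inter> {i, j} \<noteq> {}"
    using klein_iff[OF \<pi>(1)[unfolded q4]] \<pi>(3) unfolding q4 by blast
  let ?E = "e ` {1..q}"
  have pin: "\<pi> i \<in> {1..q}" "\<pi> j \<in> {1..q}" using permutes_in_image[OF \<pi>(1)] ij by simp_all
  have pne: "\<pi> i \<noteq> \<pi> j" using permutes_inj[OF \<pi>(1)] ij(3) by (auto dest: injD)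
  have einj: "e k = e l \<longleftrightarrow> k = l" if "k \<in> {1..q}" "l \<in> {1..q}" for k l using e_inj[of k l] that Y(2) by simp
  let ?c = "{e (\<pi> i), e (\<pi> j)}" and ?c' = "{e i, e j}"
  have cE: "?c \<subseteq> ?E" using pin by blast
  have c2: "e (\<pi> i) \<noteq> e (\<pi> j)" using einj pin pne by simp
  let ?L = "U \<union> {?c}" and ?D = "?E - ?c"
  have EY: "?E \<subseteq> Y" by (rule e_q)
  have "?L \<in> matching ((Y - ?E) \<union> ?c)"
    by (rule matching_Un[OF U_matching matching_pair[OF c2]]) (use cE in blast)
  moreover have "(Y - ?E) \<union> ?c = Y - ?D" using cE EY by blast
  ultimately have L: "?L \<in> matching (Y - ?D)" by simp
  have DY: "?D \<subseteq> Y" using EY by blast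
  note d = pj[OF L DY finY]
  let ?d = "pj ?L ?D"
  have "card ?D = 2" using E_card q4 cE c2 by (simp add: card_Diff_subset)
  then have rd: "br_rank ?d = 2" using d(6) by simp
  have rr: "enat (br_rank ?d) \<le> r" using rd r order_trans[of "enat 2" "enat 4" r] by (simp add: numeral_eq_enat)
  have "U \<subseteq> up ?d" unfolding d(2) by blast
  then have ed: "br_prd \<epsilon> ?d = ?d" by (rule eps_left[OF d(1)])
  have 1: "(?d, br_prd (p \<pi>) ?d) \<in> \<sigma>" using S.cong_right[OF \<pi>(2) eps(1) d(1) Y(1) rr] ed by simp
  note b = br_prd_br[OF p_br[OF \<pi>(1)] d(1)]
  have rb: "br_rank (br_prd (p \<pi>) ?d) \<le> 2" using rank_prd_right[OF p_br[OF \<pi>(1)] d(1)] rd by simp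
  have rd2: "br_rank ?d \<le> 2" using rd by simp
  have lk: "{Inl (e (\<pi> i)), Inl (e (\<pi> j))} \<in> ?d" using d(2) by (simp add: up_link[symmetric])
  have "{Inl (e i), Inr (e (\<pi> i))} \<in> p \<pi>" "{Inl (e j), Inr (e (\<pi> j))} \<in> p \<pi>"
    using p_link[OF \<pi>(1)] ij by blast+
  from link_turn[OF p_br[OF \<pi>(1)] d(1) this(1) lk this(2)]
  have "?c' \<in> up (br_prd (p \<pi>) ?d)" by (simp add: up_link)
  then have c'h: "?c' \<in> hup (br_prd (p \<pi>) ?d)" by (rule subsetD[OF up_hup])
  have ch: "?c \<in> hup ?d" by (rule subsetD[OF up_hup]) (unfold d(2), blast)
  have "hup ?d \<noteq> hup (br_prd (p \<pi>) ?d)"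
  proof
    assume "hup ?d = hup (br_prd (p \<pi>) ?d)"
    then have both: "?c' \<in> hup ?d" using c'h by simp
    have "disjoint (hup ?d)" using hup_matching[OF d(1) rd2] by (auto simp: matching_def partition_on_def)
    then have "?c = ?c' \<or> ?c \<inter> ?c' = {}" using both ch by (metis disjointD)
    then show False
    proof
      assume "?c = ?c'"
      then have "e ` {\<pi> i, \<pi> j} = e ` {i, j}" by simp
      moreover have "inj_on e {1..q}" using einj by (auto simp: inj_on_def)
      ultimately have "{\<pi> i, \<pi> j} = {i, j}" using inj_on_image_eq_iff[of e "{1..q}" "{\<pi> i, \<pi> j}" "{i, j}"] ij pin by simp
      then show False using ij(4) by simp
    next
      assume "?c \<inter> ?c' = {}"
      then show False using ij(5) by auto
    qed
  qed
  then have "up (ret ?d) \<noteq> up (ret (br_prd (p \<pi>) ?d))" using ret(3)[OF d(1) rd2] ret(3)[OF b rb] by simp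
  moreover have "(ret ?d, ret (br_prd (p \<pi>) ?d)) \<in> \<sigma>"
    using coll[OF Y(1) Y(1) d(1) rd2] coll[OF Y(1) Y(1) b rb] 1 S.cong_sym S.cong_trans by blast
  ultimately show ?thesis unfolding S.eU_def using ret(2)[OF d(1) rd2] ret(2)[OF b rb] by blast
qed

text \<open>Reflection replaces \<pi> by its inverse, and the criterion on pairs shows at once that
  inverses of Klein permutations are Klein.\<close>

lemma nonklein_eL:
  assumes s: "br_cong C r \<sigma>" and q4: "q = 4" and r: "4 \<le> r"
    and coll: "\<And>A B \<gamma>. A \<in> C \<Longrightarrow> B \<in> C \<Longrightarrow> \<gamma> \<in> br A B \<Longrightarrow> br_rank \<gamma> \<le> 2 \<Longrightarrow> (\<gamma>, ret \<gamma>) \<in> \<sigma>"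
    and \<pi>: "\<pi> permutes {1..q}" "(\<epsilon>, p \<pi>) \<in> \<sigma>" "\<pi> \<notin> klein"
  shows "br_cong.eL \<sigma>"
proof -
  interpret S: br_cong C r \<sigma> by (rule s)
  let ?s = "(\<lambda>(\<alpha>, \<beta>). (star \<alpha>, star \<beta>)) ` \<sigma>"
  have ip: "inv' \<pi> permutes {1..q}" by (rule permutes_inv[OF \<pi>(1)])
  have "inv' \<pi> \<notin> klein"
  proof
    assume k: "inv' \<pi> \<in> klein"
    have "\<pi> \<in> klein" unfolding klein_iff[OF \<pi>(1)[unfolded q4]]
    proof (intro ballI impI)
      fix i j :: nat assume ij: "i \<in> {1..4}" "j \<in> {1..4}" "i \<noteq> j"
      have "\<pi> i \<in> {1..4}" "\<pi> j \<in> {1..4}" "\<pi> i \<noteq> \<pi> j"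
        using permutes_in_image[OF \<pi>(1)] q4 ij permutes_inj[OF \<pi>(1)] by (auto dest: injD)
      then have "{inv' \<pi> (\<pi> i), inv' \<pi> (\<pi> j)} = {\<pi> i, \<pi> j} \<or> {inv' \<pi> (\<pi> i), inv' \<pi> (\<pi> j)} \<inter> {\<pi> i, \<pi> j} = {}"
        using k[unfolded klein_iff[OF ip[unfolded q4]]] by blast
      then have "{i, j} = {\<pi> i, \<pi> j} \<or> {i, j} \<inter> {\<pi> i, \<pi> j} = {}"
        unfolding permutes_inverses(2)[OF \<pi>(1)] .
      then show "{\<pi> i, \<pi> j} = {i, j} \<or> {\<pi> i, \<pi> j} \<inter> {i, j} = {}" by (metis Int_commute)
    qed
    then show False using \<pi>(3) by simp
  qed
  moreover have "inv' (inv' \<pi>) = \<pi>" by (rule permutes_inv_inv[OF \<pi>(1)])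
  then have "(\<epsilon>, p (inv' \<pi>)) \<in> ?s" unfolding S.mem_star_cong eps(5) p_star[OF ip] using \<pi>(2) by simp
  moreover have "(\<gamma>, ret \<gamma>) \<in> ?s" if "A \<in> C" "B \<in> C" "\<gamma> \<in> br A B" "br_rank \<gamma> \<le> 2" for A B \<gamma>
    unfolding S.mem_star_cong star_ret[OF that(3,4)]
    using coll[OF that(2,1) star_br[OF that(3)]] that(4) by simp
  ultimately have "br_cong.eU ?s" using nonklein_eU[OF S.star_cong q4 r _ ip] by blast
  then show ?thesis using S.star_eU by simp
qed

end

definition r_ok :: "'a set set \<Rightarrow> enat \<Rightarrow> bool" where
  "r_ok C r \<longleftrightarrow> (\<exists>m. r = enat m \<and> even m \<and> 4 \<le> m \<and> r < xi C) \<or> (r = \<infinity> \<and> xi C = \<infinity>)"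

lemma r_ok_4: "r_ok C r \<Longrightarrow> 4 \<le> r"
  by (auto simp: r_ok_def numeral_eq_enat)

lemma r_ok_rank: "r_ok C r \<Longrightarrow> enat q \<le> r \<Longrightarrow> enat q < xi C"
  by (auto simp: r_ok_def intro: le_less_trans)

lemma r_ok_Suc: "r_ok C r \<Longrightarrow> even q \<Longrightarrow> enat q < r \<Longrightarrow> enat (q + 2) \<le> r"
  by (auto simp: r_ok_def elim!: evenE)

context brauer_objects begin

lemma kind_exists: "\<exists>k. eu_of k = a \<and> el_of k = b"
proof -
  have "eu_of MuK = False" "el_of MuK = False" "eu_of LambdaK = True" "el_of LambdaK = False"
    "eu_of RhoK = False" "el_of RhoK = True" "eu_of RK = True" "el_of RK = True"
    by (simp_all add: eu_of_def el_of_def)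
  then show ?thesis by (cases a; cases b) metis+
qed

theorem Cong_classification:
  assumes s: "\<sigma> \<in> Cong (I_psg C r)" and r: "r_ok C r" and ne: "\<sigma> \<noteq> Nabla (I_psg C r)"
  shows "\<exists>q N k. even q \<and> 2 \<le> q \<and> enat q \<le> r \<and> N \<lhd> sym_group q \<and> (k = RK \<or> q = 2 \<or> q = 4 \<and> N \<subseteq> klein) \<and>
    \<sigma> = kind_cong k (I_psg C r) (rank_ideal C (enat (q - 2))) (natural_group X x q N)"
proof -
  have bc: "br_cong C r \<sigma>" by unfold_locales (rule s)
  interpret S: br_cong C r \<sigma> by (rule bc)
  have brauer_rankI: "brauer_rank C X x q" if "even q" "enat q \<le> r" for q
    by unfold_locales (use that r_ok_rank[OF r] in auto)
  have fin: ?thesis if q: "even q" "2 \<le> q" "enat q \<le> r" "eu \<and> el \<or> q = 2 \<or> q = 4 \<and> brauer_rank.Nsig X x q \<sigma> \<subseteq> klein"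
     and eq: "\<sigma> = brauer_rank.Rel C X x q eu el (brauer_rank.Nsig X x q \<sigma>) r" for q eu el
  proof -
    interpret Q: brauer_rank C X x q by (rule brauer_rankI[OF q(1,3)])
    obtain k where k: "eu_of k = eu" "el_of k = el" using kind_exists by blast
    have "k = RK" if "eu \<and> el" using k that by (auto simp: eu_of_def el_of_def)
    then have adm: "k = RK \<or> q = 2 \<or> q = 4 \<and> Q.Nsig \<sigma> \<subseteq> klein" using q(4) by blast
    have N: "Q.Nsig \<sigma> \<lhd> sym_group q" by (rule Q.Nsig_normal[OF bc q(3)])
    have "\<sigma> = kind_cong k (I_psg C r) (rank_ideal C (enat (q - 2))) (natural_group X x q (Q.Nsig \<sigma>))"
      using Q.kind_cong_eq[OF q(2,3) N, of k] adm eq k by auto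
    then show ?thesis using q adm N by blast
  qed
  show ?thesis
  proof (cases "\<exists>q\<ge>4. S.NH q")
    case True
    have all: "(\<gamma>, \<delta>) \<in> Nabla (I_psg C r) \<Longrightarrow> (\<gamma>, \<delta>) \<in> \<sigma>"
      if big: "\<And>n. enat n \<le> r \<Longrightarrow> \<exists>q\<ge>n. q \<ge> 4 \<and> S.NH q" for \<gamma> \<delta>
    proof -
      assume nb: "(\<gamma>, \<delta>) \<in> Nabla (I_psg C r)"
      then have *: "\<gamma> \<in> rank_ideal C r" "\<delta> \<in> rank_ideal C r" "br_src \<gamma> = br_src \<delta>" "br_rng \<gamma> = br_rng \<delta>"
        by (auto simp: Nabla_on_def psg_sim_def)
      have "enat (max (br_rank \<gamma>) (br_rank \<delta>)) \<le> r"
        using rank_ideal_rank[OF *(1)] rank_ideal_rank[OF *(2)] by (simp add: max_def)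
      then obtain q where "q \<ge> max (br_rank \<gamma>) (br_rank \<delta>)" "q \<ge> 4" "S.NH q" using big by blast
      then show "(\<gamma>, \<delta>) \<in> \<sigma>"
        using S.full_below[OF _ _ rank_ideal_src[OF *(1)] rank_ideal_br[OF *(1)], of q \<delta>] rank_ideal_br[OF *(2)] *(3,4) by simp
    qed
    have sub: "\<sigma> \<subseteq> Nabla (I_psg C r)"
      using S.cong_mem S.cong_src by (auto simp: Nabla_on_def psg_sim_def)
    \<comment> \<open>A largest rank with \<open>NH\<close> need not exist when r is infinite. But
      if such ranks reach every rank occurring in the ideal, everything is identified and the
      congruence is the universal one, which is excluded.\<close>
    have "\<not> (\<forall>n. enat n \<le> r \<longrightarrow> (\<exists>q\<ge>n. q \<ge> 4 \<and> S.NH q))" 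
    proof
      assume "\<forall>n. enat n \<le> r \<longrightarrow> (\<exists>q\<ge>n. q \<ge> 4 \<and> S.NH q)"
      then have "Nabla (I_psg C r) \<subseteq> \<sigma>" by (intro subrelI all) blast+
      then show False using sub ne by blast
    qed
    then obtain n where n: "enat n \<le> r" "\<And>q. q \<ge> n \<Longrightarrow> q \<ge> 4 \<Longrightarrow> \<not> S.NH q" by blast
    let ?Q = "{q. q \<ge> 4 \<and> S.NH q}"
    have "?Q \<subseteq> {..n}" using n(2) by (auto simp: not_less intro: leI)
    then have fQ: "finite ?Q" "?Q \<noteq> {}" using True finite_subset by auto
    define m where "m = Max ?Q"
    have m: "m \<ge> 4" "S.NH m" using Max_in[OF fQ] by (auto simp: m_def)
    have mmax: "\<not> S.NH k" if "m < k" for k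
    proof
      assume "S.NH k"
      then have "k \<in> ?Q" using that m by simp
      then have "k \<le> m" unfolding m_def by (rule Max_ge[OF fQ(1)])
      then show False using that by simp
    qed
    have "m < n" using n(2)[of m] m by (auto simp: not_less[symmetric])
    then have mr: "enat m < r" using n(1) by (metis enat_ord_simps(2) less_le_trans)
    obtain \<alpha> \<beta> where "(\<alpha>, \<beta>) \<in> \<sigma>" "br_rank \<alpha> = m" using m(2) unfolding S.NH_def by blast
    then have em: "even m" using S.congE br_rank_even by metis
    \<comment> \<open>The group part sits one even step above the collapsed ideal, and this rank
      still occurs.\<close>
    have qr: "enat (m + 2) \<le> r" by (rule r_ok_Suc[OF r em mr])
    have eq: "even (m + 2)" using em by simp
    interpret Q: brauer_rank C X x "m + 2" by (rule brauer_rankI[OF eq qr])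
    have "\<sigma> = Q.Rel True True (Q.Nsig \<sigma>) r"
      by (rule Q.Rel_eqI[OF bc _ qr]) (use mmax S.full_below[OF m(2,1)] in auto)
    then show ?thesis using fin[OF eq _ qr, of True True] by simp
  next
    case False
    show ?thesis
    proof (cases "S.NH 2")
      case NH2: True
      have r4: "4 \<le> r" "enat 4 \<le> r" using r_ok_4[OF r] by (simp_all add: numeral_eq_enat)
      interpret Q: brauer_rank C X x 4 by (rule brauer_rankI) (use r4 in auto)
      have low: "(\<gamma>, \<delta>) \<in> \<sigma> \<longleftrightarrow> (S.eU \<or> hup \<gamma> = hup \<delta>) \<and> (S.eL \<or> hlo \<gamma> = hlo \<delta>)"
        if *: "A \<in> C" "B \<in> C" "\<gamma> \<in> br A B" "\<delta> \<in> br A B" "br_rank \<gamma> \<le> 2" "br_rank \<delta> \<le> 2" for A B \<gamma> \<delta>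
      proof -
        note rg = ret[OF *(3,5)] and rd = ret[OF *(4,6)]
        \<comment> \<open>All elements of rank at most 2 are related to their retracts, so the
          question is decided at rank 0.\<close>
        have "(\<gamma>, \<delta>) \<in> \<sigma> \<longleftrightarrow> (ret \<gamma>, ret \<delta>) \<in> \<sigma>"
          using S.collapse[OF NH2 *(1,2,3,5)] S.collapse[OF NH2 *(1,2,4,6)] S.cong_sym S.cong_trans by blast
        then show ?thesis using S.zero_part[OF r4(1) *(1,2) rg(1) rd(1) rg(2) rd(2)] rg rd by simp
      qed
      have nq: "\<not> S.NH k" if "4 - 2 < k" for k
      proof
        assume NHk: "S.NH k"
        then obtain \<alpha> \<beta> where "(\<alpha>, \<beta>) \<in> \<sigma>" "br_rank \<alpha> = k" unfolding S.NH_def by blast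
        then have "even k" using S.congE br_rank_even by metis
        then have "k \<ge> 4" using that by (auto elim!: evenE)
        then show False using False NHk by blast
      qed
      have eq: "\<sigma> = Q.Rel S.eU S.eL (Q.Nsig \<sigma>) r"
        by (rule Q.Rel_eqI[OF bc _ r4(2) nq]) (use low in auto)
      \<comment> \<open>A single permutation outside the Klein group sets both flags.\<close>
      have "S.eU \<and> S.eL \<or> Q.Nsig \<sigma> \<subseteq> klein"
        using Q.nonklein_eU[OF bc refl r4(1) S.collapse[OF NH2]] Q.nonklein_eL[OF bc refl r4(1) S.collapse[OF NH2]]
        by (auto simp: Q.Nsig_def)
      then show ?thesis using fin[of 4 S.eU S.eL] eq r4 by auto
    next
      case NH2: False
      have r4: "4 \<le> r" using r_ok_4[OF r] .
      have r2: "enat 2 \<le> r" using r4 by (simp add: numeral_eq_enat order_trans[of "enat 2" "enat 4" r])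
      interpret Q: brauer_rank C X x 2 by (rule brauer_rankI) (use r2 in auto)
      have low: "(\<gamma>, \<delta>) \<in> \<sigma> \<longleftrightarrow> (S.eU \<or> hup \<gamma> = hup \<delta>) \<and> (S.eL \<or> hlo \<gamma> = hlo \<delta>)"
        if *: "A \<in> C" "B \<in> C" "\<gamma> \<in> br A B" "\<delta> \<in> br A B" "br_rank \<gamma> \<le> 2 - 2" "br_rank \<delta> \<le> 2 - 2" for A B \<gamma> \<delta>
        using S.zero_part[OF r4 *(1-4)] *(5,6) rank0_hup[OF *(3)] rank0_hup[OF *(4)] rank0_hlo[OF *(3)] rank0_hlo[OF *(4)]
        by simp
      have nq: "\<not> S.NH k" if "2 - 2 < k" for k
      proof
        assume NHk: "S.NH k"
        then obtain \<alpha> \<beta> where "(\<alpha>, \<beta>) \<in> \<sigma>" "br_rank \<alpha> = k" unfolding S.NH_def by blast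
        then have "even k" using S.congE br_rank_even by metis
        then have "k = 2 \<or> k \<ge> 4" using that by (auto elim!: evenE)
        then show False using False NHk NH2 by blast
      qed
      have eq: "\<sigma> = Q.Rel S.eU S.eL (Q.Nsig \<sigma>) r"
        by (rule Q.Rel_eqI[OF bc _ r2 nq]) (use low in auto)
      then show ?thesis using fin[of 2 S.eU S.eL] r2 by auto
    qed
  qed
qed

end

section \<open>Normal subgroups of symmetric groups\<close>

lemma transpose_conj:
  assumes "bij \<pi>"
  shows "\<pi> \<circ> transpose a b \<circ> inv' \<pi> = transpose (\<pi> a) (\<pi> b)"
proof -
  have "\<pi> \<circ> transpose a b = transpose (\<pi> a) (\<pi> b) \<circ> \<pi>"
    using bij_is_inj[OF assms] by (auto simp: transpose_def fun_eq_iff dest: injD)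
  then have "\<pi> \<circ> transpose a b \<circ> inv' \<pi> = transpose (\<pi> a) (\<pi> b) \<circ> (\<pi> \<circ> inv' \<pi>)"
    by (simp add: comp_assoc)
  then show ?thesis using surj_iff[of \<pi>] bij_is_surj[OF assms] by simp
qed

lemma exists_perm3:
  assumes "a \<in> D" "b \<in> D" "c \<in> D" "a' \<in> D" "b' \<in> D" "c' \<in> D" "distinct [a, b, c]" "distinct [a', b', c']"
  obtains g where "g permutes D" "g a = a'" "g b = b'" "g c = c'"
proof -
  obtain g where g: "g permutes D" "g a = a'" "g b = b'"
    using exists_perm[of a D b a' b'] assms by auto
  have inj: "g u = g v \<Longrightarrow> u = v" for u v using permutes_inj[OF g(1)] by (auto dest: injD)
  have gc: "g c \<in> D" using permutes_in_image[OF g(1)] assms by simp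
  let ?h = "transpose (g c) c' \<circ> g"
  have "?h permutes D" by (rule permutes_compose[OF g(1) permutes_swap_id[OF gc assms(6)]])
  moreover have "?h a = a'" "?h b = b'" "?h c = c'"
    using g inj[of c a] inj[of c b] assms(7,8) by (auto simp: transpose_def)
  ultimately show ?thesis using that by blast
qed

context
  fixes N n assumes N: "N \<lhd> sym_group n"
begin

lemma N_props: "id \<in> N" "\<pi> \<in> N \<Longrightarrow> \<pi> permutes {1..n}" "\<pi> \<in> N \<Longrightarrow> \<rho> \<in> N \<Longrightarrow> \<pi> \<circ> \<rho> \<in> N"
  "\<pi> \<in> N \<Longrightarrow> inv' \<pi> \<in> N" "\<pi> \<in> N \<Longrightarrow> \<rho> permutes {1..n} \<Longrightarrow> \<rho> \<circ> \<pi> \<circ> inv' \<rho> \<in> N"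
  using N unfolding normal_sym_group_iff by blast+

text \<open>All 3-cycles are conjugate in the symmetric group and they generate the alternating
  group.\<close>

lemma alt_subset:
  assumes abc: "transpose a b \<circ> transpose b c \<in> N" "distinct [a, b, c]" "{a, b, c} \<subseteq> {1..n}"
  shows "carrier (alt_group n) \<subseteq> N"
proof -
  have cyc: "cycle_of_list [u, v, w] = transpose u v \<circ> transpose v w" for u v w :: nat by simp
  have three: "\<tau> \<in> N" if tau: "\<tau> \<in> three_cycles n" for \<tau>
  proof -
    obtain cs where cs: "\<tau> = cycle_of_list cs" "cycle cs" "length cs = 3" "set cs \<subseteq> {1..n}" using tau by blast
    obtain u v w where uvw: "cs = [u, v, w]" using stupid_lemma[OF cs(3)] by blast
    then have d: "distinct [u, v, w]" "{u, v, w} \<subseteq> {1..n}" using cs by auto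
    obtain g where g: "g permutes {1..n}" "g a = u" "g b = v" "g c = w"
      using exists_perm3[of a "{1..n}" b c u v w] abc(2,3) d unfolding insert_subset by metis
    have "g \<circ> cycle_of_list [a, b, c] \<circ> inv' g = cycle_of_list (map g [a, b, c])"
      by (rule conjugation_of_cycle[OF _ permutes_bij[OF g(1)]]) (use abc in simp)
    then have "\<tau> = g \<circ> cycle_of_list [a, b, c] \<circ> inv' g" using g cs(1) uvw by simp
    moreover have "cycle_of_list [a, b, c] \<in> N" using abc(1) unfolding cyc .
    ultimately show ?thesis using N_props(5) g(1) by simp
  qed
  show ?thesis
  proof
    fix \<tau> assume "\<tau> \<in> carrier (alt_group n)"
    then have "\<tau> \<in> generate (alt_group n) (three_cycles n)" using alt_group_carrier_as_three_cycles by blast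
    then show "\<tau> \<in> N"
    proof induction
      case one then show ?case using N_props(1) unfolding alt_group_one .
    next
      case (incl h) then show ?case by (rule three)
    next
      case (inv h)
      then have "h \<in> carrier (alt_group n)" using three_cycles_incl by blast
      then show ?case using alt_group_inv_equality N_props(4) three[OF inv] by simp
    next
      case (eng h1 h2) then show ?case using N_props(3) unfolding alt_group_mult by blast
    qed
  qed
qed

text \<open>Any odd permutation differs from a given odd member of N by an even one.\<close>

lemma above_alt:
  assumes "carrier (alt_group n) \<subseteq> N"
  shows "N = carrier (alt_group n) \<or> N = carrier (sym_group n)"
proof (cases "N \<subseteq> carrier (alt_group n)")
  case False
  then obtain \<pi> where \<pi>0: "\<pi> \<in> N" "\<pi> \<notin> carrier (alt_group n)" by blast
  then have \<pi>: "\<pi> \<in> N" "\<not> evenperm \<pi>" using N_props(2)[OF \<pi>0(1)] by (simp_all add: alt_group_carrier)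
  have p\<pi>: "\<pi> permutes {1..n}" by (rule N_props(2)[OF \<pi>(1)])
  have perm: "permutation \<tau>" if "\<tau> permutes {1..n}" for \<tau> using that permutation_permutes by blast
  have "\<rho> \<in> N" if \<rho>: "\<rho> permutes {1..n}" for \<rho>
  proof (cases "evenperm \<rho>")
    case True then show ?thesis using assms \<rho> by (auto simp: alt_group_carrier)
  next
    case F: False
    have "evenperm (\<rho> \<circ> inv' \<pi>)"
      using evenperm_comp[OF perm[OF \<rho>] perm[OF permutes_inv[OF p\<pi>]]] evenperm_inv[OF perm[OF p\<pi>]] F \<pi>(2) by simp
    then have "\<rho> \<circ> inv' \<pi> \<in> N" using assms permutes_compose[OF permutes_inv[OF p\<pi>] \<rho>] by (auto simp: alt_group_carrier)
    then have "\<rho> \<circ> inv' \<pi> \<circ> \<pi> \<in> N" using N_props(3) \<pi>(1) by blast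
    then show ?thesis using permutes_inv_o(2)[OF p\<pi>] by (simp add: comp_assoc)
  qed
  then have "N = carrier (sym_group n)" using N_props(2) by (auto simp: sym_group_carrier)
  then show ?thesis by simp
qed (use assms in blast)

text \<open>The commutator of \<pi> with the transposition of a and b. Conjugation turns the
  transposition into that of their images, and the product is a 3-cycle whenever the two pairs share
  exactly one point.\<close>

lemma commutator:
  assumes "\<pi> \<in> N" "a \<in> {1..n}" "b \<in> {1..n}"
  shows "transpose (\<pi> a) (\<pi> b) \<circ> transpose a b \<in> N"
proof -
  let ?t = "transpose a b"
  have t: "?t permutes {1..n}" by (rule permutes_swap_id[OF assms(2,3)])
  have "\<pi> \<circ> (?t \<circ> inv' \<pi> \<circ> inv' ?t) \<in> N" by (rule N_props(3)[OF assms(1) N_props(5)[OF N_props(4)[OF assms(1)] t]])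
  moreover have "inv' ?t = ?t" by simp
  ultimately have "(\<pi> \<circ> ?t \<circ> inv' \<pi>) \<circ> ?t \<in> N" by (simp add: comp_assoc)
  then show ?thesis using transpose_conj[OF permutes_bij[OF N_props(2)[OF assms(1)]]] by simp
qed

text \<open>A commutator with a transposition yields a 3-cycle or a product of two disjoint
  transpositions. In the second case a fifth point turns it into a 3-cycle.\<close>

lemma normal_5:
  assumes n: "5 \<le> n" and ne: "N \<noteq> {id}"
  shows "carrier (alt_group n) \<subseteq> N"
proof -
  obtain \<pi> where \<pi>: "\<pi> \<in> N" "\<pi> \<noteq> id" using ne N_props(1) by blast
  have p: "\<pi> permutes {1..n}" by (rule N_props(2)[OF \<pi>(1)])
  have inj: "\<pi> u = \<pi> v \<Longrightarrow> u = v" for u v using permutes_inj[OF p] by (auto dest: injD)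
  obtain a where a: "\<pi> a \<noteq> a" using \<pi>(2) by (auto simp: fun_eq_iff)
  then have aD: "a \<in> {1..n}" using permutes_not_in[OF p] by blast
  let ?b = "\<pi> a"
  have bD: "?b \<in> {1..n}" using permutes_in_image[OF p] aD by simp
  have "\<not> {1..n} \<subseteq> {a, ?b}" using n card_mono[of "{a, ?b}" "{1..n}"] a by auto
  then obtain c where c: "c \<in> {1..n}" "c \<noteq> a" "c \<noteq> ?b" by blast
  let ?d = "\<pi> c"
  have dD: "?d \<in> {1..n}" using permutes_in_image[OF p] c by simp
  have db: "?d \<noteq> ?b" using inj[of c a] c by blast
  have k: "transpose ?b ?d \<circ> transpose a c \<in> N" by (rule commutator[OF \<pi>(1) aD c(1)])
  show ?thesis
  proof (cases "?d = a \<or> ?d = c")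
    case True
    then show ?thesis
    proof
      assume "?d = a"
      then show ?thesis using alt_subset[of ?b a c] k a aD bD c by auto
    next
      assume "?d = c"
      then show ?thesis using alt_subset[of ?b c a] k a aD bD c by (auto simp: transpose_commute)
    qed
  next
    case False
    have "\<not> {1..n} \<subseteq> {a, ?b, c, ?d}"
    proof
      assume "{1..n} \<subseteq> {a, ?b, c, ?d}"
      then have "n \<le> card {a, ?b, c, ?d}" using card_mono[of "{a, ?b, c, ?d}" "{1..n}"] by simp
      also have "\<dots> \<le> 4" by (simp add: card_insert_if)
      finally show False using n by simp
    qed
    then obtain f where f: "f \<in> {1..n}" "f \<noteq> a" "f \<noteq> ?b" "f \<noteq> c" "f \<noteq> ?d" by blast
    \<comment> \<open>Conjugating by this transposition alters only the factor that moves d;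
      multiplying by the original cancels the other factor and leaves a 3-cycle on b, d and
      f.\<close>
    let ?g = "transpose ?d f" and ?k = "transpose ?b ?d \<circ> transpose a c"
    have g: "?g permutes {1..n}" by (rule permutes_swap_id[OF dD f(1)])
    have "?k \<circ> (?g \<circ> ?k \<circ> inv' ?g) \<in> N" by (rule N_props(3)[OF k N_props(5)[OF k g]])
    moreover have "?k \<circ> (?g \<circ> ?k \<circ> inv' ?g) = transpose ?d ?b \<circ> transpose ?b f"
      using False a c db f by (auto simp: transpose_def fun_eq_iff)
    ultimately have "transpose ?d ?b \<circ> transpose ?b f \<in> N" by simp
    then show ?thesis by (rule alt_subset) (use False a c db f dD bD in auto)
  qed
qed

end

text \<open>A permutation outside the Klein group maps some pair to one overlapping it in a single
  point, and the corresponding commutator is then a 3-cycle.\<close>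

lemma normal_4_nonklein:
  assumes N: "N \<lhd> sym_group 4" and nk: "\<not> N \<subseteq> klein"
  shows "carrier (alt_group 4) \<subseteq> N"
proof -
  obtain \<pi> where \<pi>: "\<pi> \<in> N" "\<pi> \<notin> klein" using nk by blast
  have p: "\<pi> permutes {1..4}" by (rule N_props(2)[OF N \<pi>(1)])
  obtain i j where ij: "i \<in> {1..4}" "j \<in> {1..4}" "i \<noteq> j" "{\<pi> i, \<pi> j} \<noteq> {i, j}" "{\<pi> i, \<pi> j} \<inter> {i, j} \<noteq> {}"
    using klein_iff[OF p] \<pi>(2) by blast
  have pin: "\<pi> i \<in> {1..4}" "\<pi> j \<in> {1..4}" "\<pi> i \<noteq> \<pi> j"
    using permutes_in_image[OF p] ij permutes_inj[OF p] by (auto dest: injD)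
  have k: "transpose (\<pi> i) (\<pi> j) \<circ> transpose i j \<in> N" by (rule commutator[OF N \<pi>(1) ij(1,2)])
  from ij(5) consider "\<pi> i = i" | "\<pi> i = j" | "\<pi> j = i" | "\<pi> j = j" by blast
  then show ?thesis
  proof cases
    case 1
    then have "transpose (\<pi> j) i \<circ> transpose i j \<in> N" using k by (simp add: transpose_commute)
    then show ?thesis by (rule alt_subset[OF N]) (use 1 ij pin in auto)
  next
    case 2
    then have "transpose (\<pi> j) j \<circ> transpose j i \<in> N" using k by (simp add: transpose_commute)
    then show ?thesis by (rule alt_subset[OF N]) (use 2 ij pin in auto)
  next
    case 3
    then have "transpose (\<pi> i) i \<circ> transpose i j \<in> N" using k by (simp add: transpose_commute)
    then show ?thesis by (rule alt_subset[OF N]) (use 3 ij pin in auto)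
  next
    case 4
    then have "transpose (\<pi> i) j \<circ> transpose j i \<in> N" using k by (simp add: transpose_commute)
    then show ?thesis by (rule alt_subset[OF N]) (use 4 ij pin in auto)
  qed
qed

lemma klein_permutes: "\<pi> \<in> klein \<Longrightarrow> \<pi> permutes {1..4}"
  unfolding klein_def by (auto intro!: permutes_compose permutes_swap_id permutes_id)

lemma two_sets_in_four:
  assumes "card E = 4" "c \<subseteq> E" "d \<subseteq> E" "card c = 2" "card d = 2" "c \<inter> d = {}"
  shows "d = E - c"
proof -
  have f: "finite E" using assms(1) card.infinite by fastforce
  then have "card (E - c) = 2" using assms finite_subset by (metis card_Diff_subset numeral_Bit0 add_diff_cancel_left')
  moreover have "d \<subseteq> E - c" using assms by blast
  ultimately show ?thesis using card_subset_eq[of "E - c" d] f assms(5) by simp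
qed

text \<open>All closure properties are read off from the action on pairs. For a product the only
  real case is that both factors pass to complements; in a set of four points this returns the
  original pair.\<close>

lemma klein_normal: "klein \<lhd> sym_group 4"
  unfolding normal_sym_group_iff
proof (intro conjI ballI allI impI)
  show "id \<in> klein" by (simp add: klein_def)
  show "\<pi> permutes {1..4}" if "\<pi> \<in> klein" for \<pi> by (rule klein_permutes[OF that])
  have inj: "\<pi> u = \<pi> v \<longleftrightarrow> u = v" if "\<pi> permutes {1..4}" for \<pi> u and v :: nat
    using permutes_inj[OF that] by (auto dest: injD)
  show "\<pi> \<circ> \<rho> \<in> klein" if k: "\<pi> \<in> klein" "\<rho> \<in> klein" for \<pi> \<rho>
  proof -
    note p = klein_permutes[OF k(1)] and q = klein_permutes[OF k(2)]
    show ?thesis unfolding klein_iff[OF permutes_compose[OF q p]]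
    proof (intro ballI impI)
      fix i j :: nat assume ij: "i \<in> {1..4}" "j \<in> {1..4}" "i \<noteq> j"
      let ?c = "{i, j}" and ?d = "{\<rho> i, \<rho> j}" and ?f = "{\<pi> (\<rho> i), \<pi> (\<rho> j)}"
      have r: "\<rho> i \<in> {1..4}" "\<rho> j \<in> {1..4}" "\<rho> i \<noteq> \<rho> j" using ij permutes_in_image[OF q] inj[OF q] by simp_all
      have pr: "\<pi> (\<rho> i) \<in> {1..4}" "\<pi> (\<rho> j) \<in> {1..4}" "\<pi> (\<rho> i) \<noteq> \<pi> (\<rho> j)"
        using r permutes_in_image[OF p] inj[OF p] by simp_all
      have 1: "?d = ?c \<or> ?d \<inter> ?c = {}" using k(2)[unfolded klein_iff[OF q]] ij by blast
      have 2: "?f = ?d \<or> ?f \<inter> ?d = {}" using k(1)[unfolded klein_iff[OF p]] r by blast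
      have s: "card {1..4::nat} = 4" "?c \<subseteq> {1..4}" "?d \<subseteq> {1..4}" "?f \<subseteq> {1..4}" "card ?c = 2" "card ?d = 2" "card ?f = 2"
        using ij r pr by simp_all
      have "?f = ?c \<or> ?f \<inter> ?c = {}"
      proof (cases "?d = ?c \<or> ?f = ?d")
        case True then show ?thesis using 1 2 by metis
      next
        case False
        then have "?d \<inter> ?c = {}" "?d \<inter> ?f = {}" using 1 2 by (metis, metis Int_commute)
        then have "?c = {1..4} - ?d" "?f = {1..4} - ?d"
          using two_sets_in_four[OF s(1) s(3) s(2) s(6) s(5)] two_sets_in_four[OF s(1) s(3) s(4) s(6) s(7)] by simp_all
        then show ?thesis by (metis)
      qed
      then show "{(\<pi> \<circ> \<rho>) i, (\<pi> \<circ> \<rho>) j} = {i, j} \<or> {(\<pi> \<circ> \<rho>) i, (\<pi> \<circ> \<rho>) j} \<inter> {i, j} = {}" by (simp only: comp_apply)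
    qed
  qed
  show "\<rho> \<circ> \<pi> \<circ> inv' \<rho> \<in> klein" if k: "\<pi> \<in> klein" and q: "\<rho> permutes {1..4}" for \<pi> \<rho>
  proof -
    note p = klein_permutes[OF k] and iq = permutes_inv[OF q]
    show ?thesis unfolding klein_iff[OF permutes_compose[OF iq permutes_compose[OF p q]]]
    proof (intro ballI impI)
      fix i j :: nat assume ij: "i \<in> {1..4}" "j \<in> {1..4}" "i \<noteq> j"
      let ?i = "inv' \<rho> i" and ?j = "inv' \<rho> j"
      have r: "?i \<in> {1..4}" "?j \<in> {1..4}" "?i \<noteq> ?j" using ij permutes_in_image[OF iq] inj[OF iq] by simp_all
      have "{\<pi> ?i, \<pi> ?j} = {?i, ?j} \<or> {\<pi> ?i, \<pi> ?j} \<inter> {?i, ?j} = {}" using k[unfolded klein_iff[OF p]] r by blast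
      then have "\<rho> ` {\<pi> ?i, \<pi> ?j} = \<rho> ` {?i, ?j} \<or> \<rho> ` {\<pi> ?i, \<pi> ?j} \<inter> \<rho> ` {?i, ?j} = {}"
        using image_Int[OF permutes_inj[OF q]] by (metis image_empty)
      then show "{(\<rho> \<circ> \<pi> \<circ> inv' \<rho>) i, (\<rho> \<circ> \<pi> \<circ> inv' \<rho>) j} = {i, j} \<or> {(\<rho> \<circ> \<pi> \<circ> inv' \<rho>) i, (\<rho> \<circ> \<pi> \<circ> inv' \<rho>) j} \<inter> {i, j} = {}"
        using permutes_inverses(1)[OF q] by simp
    qed
  qed
  show "inv' \<pi> \<in> klein" if k: "\<pi> \<in> klein" for \<pi>
  proof -
    note p = klein_permutes[OF k]
    show ?thesis unfolding klein_iff[OF permutes_inv[OF p]]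
    proof (intro ballI impI)
      fix i j :: nat assume ij: "i \<in> {1..4}" "j \<in> {1..4}" "i \<noteq> j"
      let ?i = "inv' \<pi> i" and ?j = "inv' \<pi> j"
      have r: "?i \<in> {1..4}" "?j \<in> {1..4}" "?i \<noteq> ?j"
        using ij permutes_in_image[OF permutes_inv[OF p]] inj[OF permutes_inv[OF p]] by simp_all
      have "{\<pi> ?i, \<pi> ?j} = {?i, ?j} \<or> {\<pi> ?i, \<pi> ?j} \<inter> {?i, ?j} = {}" using k[unfolded klein_iff[OF p]] r by blast
      then show "{?i, ?j} = {i, j} \<or> {?i, ?j} \<inter> {i, j} = {}"
        unfolding permutes_inverses(1)[OF p] by (metis Int_commute)
    qed
  qed
qed

text \<open>Conjugation by two transpositions links the three double transpositions, so one of them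
  in N brings in all.\<close>

lemma normal_in_klein:
  assumes N: "N \<lhd> sym_group 4" and sub: "N \<subseteq> klein"
  shows "N = {id} \<or> N = klein"
proof (cases "N = {id}")
  case False
  let ?a = "transpose 1 2 \<circ> transpose 3 4 :: nat \<Rightarrow> nat" and ?b = "transpose 1 3 \<circ> transpose 2 4 :: nat \<Rightarrow> nat"
    and ?c = "transpose 1 4 \<circ> transpose 2 3 :: nat \<Rightarrow> nat"
  obtain \<pi> where \<pi>: "\<pi> \<in> N" "\<pi> \<noteq> id" using False N_props(1)[OF N] by blast
  have cj: "transpose u v \<circ> \<tau> \<circ> transpose u v \<in> N" if "\<tau> \<in> N" "u \<in> {1..4}" "v \<in> {1..4}" for \<tau> u v
    using N_props(5)[OF N that(1) permutes_swap_id[OF that(2,3)]] by simp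
  have ab: "transpose 2 3 \<circ> ?a \<circ> transpose 2 3 = ?b" "transpose 2 3 \<circ> ?b \<circ> transpose 2 3 = ?a"
    by (auto simp: transpose_def fun_eq_iff)
  have bc: "transpose 3 4 \<circ> ?b \<circ> transpose 3 4 = ?c" "transpose 3 4 \<circ> ?c \<circ> transpose 3 4 = ?b"
    by (auto simp: transpose_def fun_eq_iff)
  have 23: "?a \<in> N \<longleftrightarrow> ?b \<in> N" using cj[of ?a 2 3] cj[of ?b 2 3] unfolding ab by auto
  have 34: "?b \<in> N \<longleftrightarrow> ?c \<in> N" using cj[of ?b 3 4] cj[of ?c 3 4] unfolding bc by auto
  have "\<pi> = ?a \<or> \<pi> = ?b \<or> \<pi> = ?c" using \<pi> sub unfolding klein_def by blast
  then have "?a \<in> N" "?b \<in> N" "?c \<in> N" using 23 34 \<pi>(1) by auto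
  then have "klein \<subseteq> N" unfolding klein_def using N_props(1)[OF N] by blast
  then show ?thesis using sub by blast
qed simp

text \<open>Each of the groups either lies below all competitors (trivial, or the Klein group when n
  = 4) or contains the alternating group, and above that there are only two groups.\<close>

lemma normal_chain:
  assumes "N \<lhd> sym_group n" "N' \<lhd> sym_group n" "5 \<le> n \<or> n = 4 \<and> klein \<subseteq> N \<and> klein \<subseteq> N'"
  shows "N \<subseteq> N' \<or> N' \<subseteq> N"
proof -
  have *: "(\<forall>M. M \<lhd> sym_group n \<and> (5 \<le> n \<or> n = 4 \<and> klein \<subseteq> M) \<longrightarrow> N \<subseteq> M) \<or> carrier (alt_group n) \<subseteq> N"
    if N: "N \<lhd> sym_group n" "5 \<le> n \<or> n = 4 \<and> klein \<subseteq> N" for N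
    using N(2)
  proof
    assume n: "5 \<le> n"
    show ?thesis
    proof (cases "N = {id}")
      case True then show ?thesis using N_props(1) by blast
    next
      case False then show ?thesis using normal_5[OF N(1) n] by blast
    qed
  next
    assume n: "n = 4 \<and> klein \<subseteq> N"
    show ?thesis
    proof (cases "N \<subseteq> klein")
      case True then show ?thesis using n by auto
    next
      case False then show ?thesis using normal_4_nonklein[of N] N(1) n by blast
    qed
  qed
  have "carrier (alt_group n) \<subseteq> carrier (sym_group n)"
    by (auto simp: alt_group_carrier sym_group_carrier)
  then show ?thesis using *[OF assms(1)] *[OF assms(2)] assms above_alt[OF assms(1)] above_alt[OF assms(2)] by blast
qed

lemma trivial_normal: "{id} \<lhd> sym_group n"
  unfolding normal_sym_group_iff using permutes_id permutes_inv_o(1) by (auto simp: inv_id)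

lemma full_normal: "carrier (sym_group n) \<lhd> sym_group n"
  unfolding normal_sym_group_iff
proof (intro conjI ballI allI impI)
  fix \<pi> \<rho> assume "\<pi> \<in> carrier (sym_group n)"
  then have \<pi>: "\<pi> permutes {1..n}" by (simp only: sym_group_carrier)
  then show "\<pi> permutes {1..n}" "inv' \<pi> \<in> carrier (sym_group n)"
    unfolding sym_group_carrier by (simp_all only: permutes_inv)
  show "\<pi> \<circ> \<rho> \<in> carrier (sym_group n)" if "\<rho> \<in> carrier (sym_group n)"
    using that unfolding sym_group_carrier by (rule permutes_compose[OF _ \<pi>])
  show "\<rho> \<circ> \<pi> \<circ> inv' \<rho> \<in> carrier (sym_group n)" if "\<rho> permutes {1..n}"
    unfolding sym_group_carrier by (rule permutes_compose[OF permutes_inv[OF that] permutes_compose[OF \<pi> that]])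
qed (simp only: sym_group_carrier permutes_id)

lemma normal_sym_2: "N \<lhd> sym_group 2 \<longleftrightarrow> N = {id} \<or> N = carrier (sym_group 2)"
proof
  assume N: "N \<lhd> sym_group 2"
  have two: "\<pi> = id \<or> \<pi> = transpose 1 2" if p: "\<pi> permutes {1..2}" for \<pi> :: "nat \<Rightarrow> nat"
  proof -
    have E: "{1..2} = {1, 2::nat}" by auto
    have i: "\<pi> 1 \<in> {1, 2}" "\<pi> 2 \<in> {1, 2}" "\<pi> 1 \<noteq> \<pi> 2"
      using permutes_in_image[OF p, of 1] permutes_in_image[OF p, of 2] inj_eq[OF permutes_inj[OF p], of 1 2] unfolding E
      by simp_all
    have o: "\<pi> k = k" if "k \<notin> {1, 2}" for k using permutes_not_in[OF p, of k] that unfolding E by simp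
    show ?thesis
    proof (cases "\<pi> 1 = 1")
      case True
      then have "\<pi> k = k" for k using i o[of k] by (cases "k \<in> {1, 2}") auto
      then show ?thesis by auto
    next
      case False
      then have "\<pi> k = transpose 1 2 k" for k using i o[of k] by (cases "k \<in> {1, 2}") (auto simp: transpose_def)
      then show ?thesis by auto
    qed
  qed
  show "N = {id} \<or> N = carrier (sym_group 2)"
  proof (cases "N = {id}")
    case False
    then obtain \<pi> where "\<pi> \<in> N" "\<pi> \<noteq> id" using N_props(1)[OF N] by blast
    then have "transpose 1 2 \<in> N" using two N_props(2)[OF N] by metis
    then have "carrier (sym_group 2) \<subseteq> N" using two N_props(1)[OF N] unfolding sym_group_carrier subset_iff by blast
    moreover have "N \<subseteq> carrier (sym_group 2)" using N_props(2)[OF N] unfolding sym_group_carrier subset_iff by blast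
    ultimately show ?thesis by blast
  qed simp
qed (use trivial_normal full_normal in auto)

section \<open>The inclusion order\<close>

lemma kind_le_iff: "kind_le k k' \<longleftrightarrow> (eu_of k \<longrightarrow> eu_of k') \<and> (el_of k \<longrightarrow> el_of k')"
  by (cases k; cases k') (auto simp: kind_le_def eu_of_def el_of_def)

context brauer_objects begin

lemma brauer_rankI: "r_ok C r \<Longrightarrow> even q \<Longrightarrow> enat q \<le> r \<Longrightarrow> brauer_rank C X x q"
  by unfold_locales (auto simp: r_ok_rank)

lemma pair_cong_Rel:
  assumes r: "r_ok C r" and q: "even q" "enat (q + 2) \<le> r" and N: "N \<lhd> sym_group (q + 2)" and k: "k = RK \<or> q \<le> 2"
  shows "pair_cong C X x r k (q, N) = brauer_rank.Rel C X x (q + 2) (eu_of k) (el_of k) N r"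
proof -
  have ev: "even (q + 2)" using q by simp
  interpret Q: brauer_rank C X x "q + 2" by (rule brauer_rankI[OF r ev q(2)])
  have "k = RK \<or> q + 2 = 2 \<or> q + 2 = 4" using k q(1) by (auto elim!: evenE)
  from Q.kind_cong_eq[OF _ q(2) N this] show ?thesis by (simp add: pair_cong_def)
qed

text \<open>Each parameter is detected by a witness: the flags by elements of rank 0 that differ on
  one side, q by the idempotent of rank q, which is related to an element of rank 0, and N by the
  group elements related to the idempotent.\<close>

lemma pair_cong_le_iff:
  assumes r: "r_ok C r"
    and q: "even q" "enat (q + 2) \<le> r" and N: "N \<lhd> sym_group (q + 2)" and k: "k = RK \<or> q \<le> 2"
    and q': "even q'" "enat (q' + 2) \<le> r" and N': "N' \<lhd> sym_group (q' + 2)" and k': "k' = RK \<or> q' \<le> 2"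
  shows "pair_cong C X x r k (q, N) \<subseteq> pair_cong C X x r k' (q', N') \<longleftrightarrow> lex_le (q, N) (q', N') \<and> kind_le k k'"
proof -
  have ev: "even (q + 2)" "even (q' + 2)" using q q' by simp_all
  interpret Q: brauer_rank C X x "q + 2" by (rule brauer_rankI[OF r ev(1) q(2)])
  interpret Q': brauer_rank C X x "q' + 2" by (rule brauer_rankI[OF r ev(2) q'(2)])
  let ?R = "Q.Rel (eu_of k) (el_of k) N r" and ?R' = "Q'.Rel (eu_of k') (el_of k') N' r"
  have "?R \<subseteq> ?R' \<longleftrightarrow> lex_le (q, N) (q', N') \<and> kind_le k k'"
  proof
    assume *: "lex_le (q, N) (q', N') \<and> kind_le k k'"
    then have qq: "q \<le> q'" by (auto simp: lex_le_def)
    have b: "base (eu_of k) (el_of k) q \<subseteq> base (eu_of k') (el_of k') q'"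
      using * qq unfolding base_def kind_le_iff by fastforce
    have "Q.nuq N \<subseteq> ?R'"
    proof (cases "q = q'")
      case True
      then have "Q.nuq N \<subseteq> Q'.nuq N'" using * Q.nuq_mono[of N N'] by (simp add: lex_le_def)
      then show ?thesis unfolding Q'.Rel_def by blast
    next
      case False
      then have q2: "q + 2 \<le> q'" using qq q(1) q'(1) by (auto elim!: evenE)
      have "(\<alpha>, \<beta>) \<in> base (eu_of k') (el_of k') q'" if ab: "(\<alpha>, \<beta>) \<in> Q.nuq N" for \<alpha> \<beta>
      proof -
        obtain A B where t: "A \<in> C" "B \<in> C" "\<alpha> \<in> br A B" "\<beta> \<in> br A B" "up \<alpha> = up \<beta>" "lo \<alpha> = lo \<beta>"
          "br_rank \<alpha> = q + 2" "br_rank \<beta> = q + 2" using Q.nuq_typed[OF N ab] .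
        then show ?thesis unfolding base_def using q2 hup_cong[OF t(3,4,5)] hlo_cong[OF t(3,4,6)] by auto
      qed
      then show ?thesis unfolding Q'.Rel_def by auto
    qed
    moreover have "base (eu_of k) (el_of k) q \<subseteq> ?R'" using b unfolding Q'.Rel_def add_diff_cancel_right' by blast
    moreover have "Id_on (rank_ideal C r) \<subseteq> ?R'" unfolding Q'.Rel_def by blast
    ultimately show "?R \<subseteq> ?R'" unfolding Q.Rel_def[of "eu_of k"] add_diff_cancel_right' by blast
  next
    assume sub: "?R \<subseteq> ?R'"
    have r4: "enat 4 \<le> r" using r_ok_4[OF r] by (simp add: numeral_eq_enat)
    interpret F: brauer_rank C X x 4 by (rule brauer_rankI[OF r _ r4]) simp
    have F: "X 4 \<in> C" "4 \<le> card (X 4)" using F.Y by simp_all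
    \<comment> \<open>Two different matchings need an object with at least four points; the chosen
      one of degree 4 exists since r is at least 4.\<close>
    obtain M where M: "M \<in> matching (X 4)" using matching_C[OF F(1)] by blast
    have fin: "finite (X 4)" using C_even[OF F(1)] by simp
    obtain a where a: "a \<in> X 4" using F(2) by (metis all_not_in_conv card.empty not_numeral_le_zero)
    obtain b where b: "{a, b} \<in> M" "b \<in> X 4" "a \<noteq> b" using matching_ex[OF M a] .
    have "\<not> X 4 \<subseteq> {a, b}" using F(2) card_mono[of "{a, b}" "X 4"] b(3) by auto
    then obtain c where c: "c \<in> X 4" "c \<noteq> a" "c \<noteq> b" by blast
    obtain d where d: "{c, d} \<in> M" using matching_ex[OF M c(1)] .
    have acn: "{a, c} \<notin> M" using matching_unique[OF M b(1)] c by auto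
    note sw = matching_switch[OF M b(1) d acn c(2)[symmetric]]
    define M' where "M' = (M - {{a, b}, {c, d}}) \<union> {{a, c}, {b, d}}"
    have MM: "M \<noteq> M'" using acn unfolding M'_def by blast
    have M': "M' \<in> matching (X 4)" using sw(2) unfolding M'_def .
    note m1 = mk0_C[OF M M F(1,1)] and m2 = mk0_C[OF M' M F(1,1)] and m3 = mk0_C[OF M M' F(1,1)]
    \<comment> \<open>A nontrivial pair that is not entirely of rank q' + 2 can only come from the
      ideal part.\<close>
    have zero: "(\<alpha>, \<beta>) \<in> base (eu_of k') (el_of k') q'"
      if "(\<alpha>, \<beta>) \<in> ?R" "\<alpha> \<noteq> \<beta>" "br_rank \<alpha> \<noteq> q' + 2 \<or> br_rank \<beta> \<noteq> q' + 2" for \<alpha> \<beta>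
      using sub that Q'.nuq_typed[OF N', of \<alpha> \<beta>] unfolding Q'.Rel_def by auto
    have rh: "hup \<alpha> = up \<alpha>" "hlo \<alpha> = lo \<alpha>" if "\<alpha> \<in> br A B" "br_rank \<alpha> = 0" for \<alpha> A B
      using rank0_hup[OF that] rank0_hlo[OF that] .
    have kl: "kind_le k k'" unfolding kind_le_iff
    proof (intro conjI impI)
      assume e: "eu_of k"
      have "(mk0 M M, mk0 M' M) \<in> base (eu_of k) (el_of k) q"
        unfolding base_def using e F(1) m1 m2 rh[OF m1(1,2)] rh[OF m2(1,2)] by auto
      then have "(mk0 M M, mk0 M' M) \<in> ?R" unfolding Q.Rel_def by simp
      moreover have "mk0 M M \<noteq> mk0 M' M" using MM m1(3) m2(3) by metis
      ultimately have "(mk0 M M, mk0 M' M) \<in> base (eu_of k') (el_of k') q'" using zero m1(2) by auto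
      then have "eu_of k' \<or> hup (mk0 M M) = hup (mk0 M' M)" unfolding base_def by blast
      then show "eu_of k'" using MM rh[OF m1(1,2)] rh[OF m2(1,2)] m1(3) m2(3) by simp
    next
      assume e: "el_of k"
      have "(mk0 M M, mk0 M M') \<in> base (eu_of k) (el_of k) q"
        unfolding base_def using e F(1) m1 m3 rh[OF m1(1,2)] rh[OF m3(1,2)] by auto
      then have "(mk0 M M, mk0 M M') \<in> ?R" unfolding Q.Rel_def by simp
      moreover have "mk0 M M \<noteq> mk0 M M'" using MM m1(4) m3(4) by metis
      ultimately have "(mk0 M M, mk0 M M') \<in> base (eu_of k') (el_of k') q'" using zero m1(2) by auto
      then have "el_of k' \<or> hlo (mk0 M M) = hlo (mk0 M M')" unfolding base_def by blast
      then show "el_of k'" using MM rh[OF m1(1,2)] rh[OF m3(1,2)] m1(4) m3(4) by simp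
    qed
    have le: "q \<le> q'"
    proof (rule ccontr)
      assume gt: "\<not> q \<le> q'"
      have "enat q \<le> r" using q(2) by (metis enat_ord_simps(1) le_add1 order_trans)
      then interpret P: brauer_rank C X x q by (intro brauer_rankI[OF r q(1)])
      \<comment> \<open>For q at most 2 the retract is a witness for every kind; for larger q the
        kind is R and any element of rank 0 with the right objects will do.\<close>
      have "\<exists>\<beta>. (P.\<epsilon>, \<beta>) \<in> base (eu_of k) (el_of k) q \<and> br_rank \<beta> = 0"
      proof (cases "q \<le> 2")
        case True
        then have e2: "br_rank P.\<epsilon> \<le> 2" using P.eps(4) by simp
        note re = ret[OF P.eps(1) e2]
        have "(P.\<epsilon>, ret P.\<epsilon>) \<in> base (eu_of k) (el_of k) q"
          unfolding base_def using P.Y(1) P.eps(1,4) re rh[OF re(1,2)] by auto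
        then show ?thesis using re by blast
      next
        case False
        then have kR: "eu_of k" "el_of k" using k by (auto simp: eu_of_def el_of_def)
        obtain L where L: "L \<in> matching (X q)" using matching_C[OF P.Y(1)] by blast
        note m = mk0_C[OF L L P.Y(1,1)]
        have "(P.\<epsilon>, mk0 L L) \<in> base (eu_of k) (el_of k) q"
          unfolding base_def using P.Y(1) P.eps(1,4) m kR by auto
        then show ?thesis using m by blast
      qed
      then obtain \<beta> where b: "(P.\<epsilon>, \<beta>) \<in> ?R" "br_rank \<beta> = 0" unfolding Q.Rel_def by auto
      have "P.\<epsilon> \<noteq> \<beta>" using P.eps(4) b(2) gt by auto
      from zero[OF b(1) this] b(2) have "br_rank P.\<epsilon> \<le> q'" by (auto simp: base_def)
      then show False using P.eps(4) gt by simp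
    qed
    have "lex_le (q, N) (q', N')"
    proof (cases "q = q'")
      case True
      have "\<pi> \<in> N'" if \<pi>: "\<pi> \<in> N" for \<pi>
      proof -
        have p: "\<pi> permutes {1..q + 2}" by (rule Q.N_perm[OF N \<pi>])
        \<comment> \<open>Rank q + 2 exceeds the ideal part of the right-hand side, so this pair is
          either trivial or witnesses membership in N'.\<close>
        have "(Q.\<epsilon>, Q.p \<pi>) \<in> ?R" using Q.nuq_p[OF N p] \<pi> unfolding Q.Rel_def by blast
        then have "(Q.\<epsilon>, Q.p \<pi>) \<in> ?R'" using sub by blast
        moreover have "(Q.\<epsilon>, Q.p \<pi>) \<notin> base (eu_of k') (el_of k') q'"
          using Q.eps(4) True by (auto simp: base_def)
        ultimately consider "(Q.\<epsilon>, Q.p \<pi>) \<in> Q'.nuq N'" | "Q.\<epsilon> = Q.p \<pi>" unfolding Q'.Rel_def by auto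
        then show ?thesis
        proof cases
          case 1 then show ?thesis using Q'.nuq_p[OF N'] p True by simp
        next
          case 2
          then have "\<pi> = id" using Q.p_inj[OF p permutes_id] unfolding Q.\<epsilon>_def by metis
          then show ?thesis using N_props(1)[OF N'] by simp
        qed
      qed
      then show ?thesis using True by (auto simp: lex_le_def)
    next
      case False then show ?thesis using le by (simp add: lex_le_def)
    qed
    then show "lex_le (q, N) (q', N') \<and> kind_le k k'" using kl by simp
  qed
  then show ?thesis using pair_cong_Rel[OF r q N k] pair_cong_Rel[OF r q' N' k'] by simp
qed

end

section \<open>The minimal ideal\<close>

lemma quotient_rel_of_part: "equiv A \<epsilon> \<Longrightarrow> rel_of_part (A // \<epsilon>) = \<epsilon>"
proof (intro equalityI subrelI)
  assume e: "equiv A \<epsilon>"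
  show "(u, v) \<in> \<epsilon>" if "(u, v) \<in> rel_of_part (A // \<epsilon>)" for u v
    using that in_quotient_imp_in_rel[OF e] by (auto simp: rel_of_part_def)
  show "(u, v) \<in> rel_of_part (A // \<epsilon>)" if uv: "(u, v) \<in> \<epsilon>" for u v
  proof -
    have "u \<in> A" using e uv by (auto simp: equiv_def refl_on_def)
    then have "\<epsilon> `` {u} \<in> A // \<epsilon>" "u \<in> \<epsilon> `` {u}" "v \<in> \<epsilon> `` {u}"
      using uv equiv_class_self[OF e] by (auto intro: quotientI)
    then show ?thesis unfolding rel_of_part_def by blast
  qed
qed

lemma partition_rel_of_part:
  assumes "partition_on A M"
  shows "equiv A (rel_of_part M)" "A // rel_of_part M = M"
  using equiv_partition_on[OF assms] partition_on_eq_quotient[OF assms] unfolding rel_of_part_def by simp_all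

text \<open>Hooks are stored as blocks, while the parameters of the band are equivalences; this is
  the change of encoding.\<close>

lemma bij_matching_Eq2: "bij_betw rel_of_part (matching A) (Eq2 A)"
proof (rule bij_betw_byWitness[where f' = "\<lambda>\<epsilon>. A // \<epsilon>"])
  show "\<forall>M\<in>matching A. A // rel_of_part M = M" using partition_rel_of_part(2) unfolding matching_def by blast
  show "\<forall>\<epsilon>\<in>Eq2 A. rel_of_part (A // \<epsilon>) = \<epsilon>" using quotient_rel_of_part by (auto simp: Eq2_def)
  show "rel_of_part ` matching A \<subseteq> Eq2 A"
    using partition_rel_of_part by (force simp: matching_def Eq2_def)
  show "(\<lambda>\<epsilon>. A // \<epsilon>) ` Eq2 A \<subseteq> matching A" using partition_on_quotient by (auto simp: matching_def Eq2_def)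
qed

lemma Eq2_disjoint: "\<epsilon> \<in> Eq2 A \<Longrightarrow> \<epsilon> \<in> Eq2 B \<Longrightarrow> A = B"
  by (auto simp: Eq2_def equiv_def refl_on_def)

context brauer_category begin

lemma Eq2_band_data: "band_data C Eq2"
proof -
  have "Eq2 A \<noteq> {}" if "A \<in> C" for A
    using matching_C[OF that] bij_betw_apply[OF bij_matching_Eq2[of A]] by blast
  then show ?thesis using Eq2_disjoint by (auto simp: band_data_def disjoint_family_on_def)
qed

lemma I_0_psg_iso: "psg_iso (\<lambda>\<alpha>. (rel_of_part (up \<alpha>), rel_of_part (lo \<alpha>))) (I_psg C 0) (rect_band C Eq2 Eq2)"
  (is "psg_iso ?\<phi> _ _")
proof -
  have z: "\<alpha> \<in> br (br_src \<alpha>) (br_rng \<alpha>)" "br_rank \<alpha> = 0" "br_src \<alpha> \<in> C" "br_rng \<alpha> \<in> C"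
    "up \<alpha> \<in> matching (br_src \<alpha>)" "lo \<alpha> \<in> matching (br_rng \<alpha>)" if "\<alpha> \<in> rank_ideal C 0" for \<alpha>
    using rank_ideal_br[OF that] rank_ideal_0[OF that] rank_ideal_src[OF that]
      rank0_matching[OF rank_ideal_br[OF that] rank_ideal_0[OF that]] by blast+
  have E: "rel_of_part (up \<alpha>) \<in> Eq2 (br_src \<alpha>)" "rel_of_part (lo \<alpha>) \<in> Eq2 (br_rng \<alpha>)" if "\<alpha> \<in> rank_ideal C 0" for \<alpha>
    using z(5,6)[OF that] bij_betw_apply[OF bij_matching_Eq2] by blast+
  have "bij_betw ?\<phi> (rank_ideal C 0) (\<Union>A\<in>C. \<Union>B\<in>C. Eq2 A \<times> Eq2 B)"
  proof (rule bij_betw_imageI)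
    show "inj_on ?\<phi> (rank_ideal C 0)"
    proof (rule inj_onI)
      fix \<alpha> \<beta> assume a: "\<alpha> \<in> rank_ideal C 0" and b: "\<beta> \<in> rank_ideal C 0" and eq: "?\<phi> \<alpha> = ?\<phi> \<beta>"
      have s: "br_src \<alpha> = br_src \<beta>" "br_rng \<alpha> = br_rng \<beta>"
        using E[OF a] E[OF b] eq Eq2_disjoint by auto
      have inj: "M = N" if "M \<in> matching A" "N \<in> matching A" "rel_of_part M = rel_of_part N" for M N and A :: "'a set"
        using that bij_betw_imp_inj_on[OF bij_matching_Eq2] by (auto dest: inj_onD)
      have "up \<alpha> = up \<beta>" "lo \<alpha> = lo \<beta>"
        using inj[OF z(5)[OF a], of "up \<beta>"] inj[OF z(6)[OF a], of "lo \<beta>"] z(5,6)[OF b] s eq by auto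
      then show "\<alpha> = \<beta>" using rank0_eqI[OF z(1)[OF a] _ z(2)[OF a]] z(1)[OF b] s by simp
    qed
    show "?\<phi> ` rank_ideal C 0 = (\<Union>A\<in>C. \<Union>B\<in>C. Eq2 A \<times> Eq2 B)"
    proof (intro equalityI subsetI)
      fix w assume "w \<in> ?\<phi> ` rank_ideal C 0"
      then show "w \<in> (\<Union>A\<in>C. \<Union>B\<in>C. Eq2 A \<times> Eq2 B)" using E z(3,4) by fastforce
    next
      fix w assume "w \<in> (\<Union>A\<in>C. \<Union>B\<in>C. Eq2 A \<times> Eq2 B)"
      then obtain A B where w: "A \<in> C" "B \<in> C" "fst w \<in> Eq2 A" "snd w \<in> Eq2 B" by auto
      obtain M where M: "M \<in> matching A" "rel_of_part M = fst w"
        using w(3) bij_betw_imp_surj_on[OF bij_matching_Eq2[of A]] by (metis imageE)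
      obtain L where L: "L \<in> matching B" "rel_of_part L = snd w"
        using w(4) bij_betw_imp_surj_on[OF bij_matching_Eq2[of B]] by (metis imageE)
      note m = mk0_C[OF M(1) L(1) w(1,2)]
      show "w \<in> ?\<phi> ` rank_ideal C 0"
        using m(3,4) M(2) L(2) by (intro image_eqI[OF _ m(5)]) simp
    qed
  qed
  moreover have "(THE A. A \<in> C \<and> rel_of_part (up \<alpha>) \<in> Eq2 A) = br_src \<alpha>"
    "(THE A. A \<in> C \<and> rel_of_part (lo \<alpha>) \<in> Eq2 A) = br_rng \<alpha>" if "\<alpha> \<in> rank_ideal C 0" for \<alpha>
    using E[OF that] z(3,4)[OF that] Eq2_disjoint by (auto intro!: the_equality)
  moreover have "up (br_prd \<alpha> \<beta>) = up \<alpha>" "lo (br_prd \<alpha> \<beta>) = lo \<beta>"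
    if "\<alpha> \<in> rank_ideal C 0" "\<beta> \<in> rank_ideal C 0" "br_rng \<alpha> = br_src \<beta>" for \<alpha> \<beta>
    using up_rank0_prd[OF z(1,2)[OF that(1)], of \<beta>] lo_rank0_prd[OF z(1)[OF that(1)] z(2)[OF that(2)]]
      z(1)[OF that(2)] that(3) by simp_all
  ultimately show ?thesis by (simp add: psg_iso_def rect_band_def)
qed

lemma I_0_band_iso:
  assumes "band_data C P" "band_data C Q" "psg_iso \<phi> (I_psg C 0) (rect_band C P Q)"
  shows "band_iso C P Q (I_psg C 0) \<phi>"
proof
  fix u v assume "u \<in> els (I_psg C 0)" "v \<in> els (I_psg C 0)" "rng (I_psg C 0) u = src (I_psg C 0) v"
  then show "prd (I_psg C 0) u v \<in> els (I_psg C 0)"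
    using rank_ideal_prd_left[of u 0 v] rank_ideal_br[of v 0] rank_ideal_src[of v 0] by simp
qed fact+

lemma Cong_I_0:
  assumes "band_data C P" "band_data C Q" "psg_iso \<phi> (I_psg C 0) (rect_band C P Q)"
  shows "Cong (I_psg C 0) =
    {{(\<alpha>, \<beta>) \<in> rank_ideal C 0 \<times> rank_ideal C 0. (\<phi> \<alpha>, \<phi> \<beta>) \<in> band_sigma C P Q E1 E2} | E1 E2.
      (\<forall>A\<in>C. equiv (P A) (E1 A)) \<and> (\<forall>A\<in>C. equiv (Q A) (E2 A))}"
proof -
  interpret band_iso C P Q "I_psg C 0" \<phi> by (rule I_0_band_iso[OF assms])
  show ?thesis using Cong_eq unfolding pull_def I_psg_simps .
qed

lemma Cong_I_0_lattice:
  "lattice_isomorphic (Cong_lattice (I_psg C 0))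
    (prod_lattice (Prod_lattice C (\<lambda>A. Eq_lattice (Eq2 A))) (Prod_lattice C (\<lambda>A. Eq_lattice (Eq2 A))))"
proof -
  interpret band_iso C Eq2 Eq2 "I_psg C 0" "\<lambda>\<alpha>. (rel_of_part (up \<alpha>), rel_of_part (lo \<alpha>))"
    by (rule I_0_band_iso[OF Eq2_band_data Eq2_band_data I_0_psg_iso])
  show ?thesis by (rule Cong_lattice_iso)
qed

lemma BrauerCat_eq: "BrauerCat C = I_psg C \<infinity>"
  by (auto simp: I_psg_def sub_psg_def rank_ideal_def BrauerCat_def)

section \<open>Congruences of the ideal of rank at most two\<close>

definition "theta \<tau> = {(\<alpha>, \<beta>) \<in> rank_ideal C 2 \<times> rank_ideal C 2. (ret \<alpha>, ret \<beta>) \<in> \<tau>}"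

lemma rank_ideal_2:
  assumes "\<alpha> \<in> rank_ideal C 2"
  shows "\<alpha> \<in> br (br_src \<alpha>) (br_rng \<alpha>)" "br_rank \<alpha> \<le> 2" "br_rank \<alpha> \<noteq> 0 \<Longrightarrow> br_rank \<alpha> = 2"
proof -
  show 1: "\<alpha> \<in> br (br_src \<alpha>) (br_rng \<alpha>)" by (rule rank_ideal_br[OF assms])
  have "enat (br_rank \<alpha>) \<le> enat 2" using rank_ideal_rank[OF assms] by (simp add: numeral_eq_enat)
  then show 2: "br_rank \<alpha> \<le> 2" by simp
  show "br_rank \<alpha> \<noteq> 0 \<Longrightarrow> br_rank \<alpha> = 2" using br_rank_even[OF 1] 2 by (auto elim!: evenE)
qed

lemma rank_ideal_2I: "A \<in> C \<Longrightarrow> B \<in> C \<Longrightarrow> \<alpha> \<in> br A B \<Longrightarrow> br_rank \<alpha> \<le> 2 \<Longrightarrow> \<alpha> \<in> rank_ideal C 2"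
  by (rule rank_idealI) (simp_all add: numeral_eq_enat)

lemma rank_ideal_0I: "A \<in> C \<Longrightarrow> B \<in> C \<Longrightarrow> \<alpha> \<in> br A B \<Longrightarrow> br_rank \<alpha> = 0 \<Longrightarrow> \<alpha> \<in> rank_ideal C 0"
  by (rule rank_idealI) (simp_all add: zero_enat_def)

lemma ret_ideal: "\<alpha> \<in> rank_ideal C 2 \<Longrightarrow> ret \<alpha> \<in> rank_ideal C 0"
  using ret[OF rank_ideal_2(1,2)] rank_ideal_0I rank_ideal_src by blast

lemma theta_cong_eq:
  assumes "br_cong C 0 \<tau>"
  shows "theta_cong (I_psg C 2) (rank_ideal C 2) \<tau> = theta \<tau>"
proof -
  interpret br_cong C 0 \<tau> by (rule assms)
  show ?thesis
    unfolding theta_cong_def retraction_of_eq[OF order_refl order_refl] theta_def Delta_def I_psg_simps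
    using cong_refl ret_ideal by auto
qed

end

context br_cong begin

lemma theta_Cong:
  assumes r: "r = 0"
  shows "theta \<sigma> \<in> Cong (I_psg C 2)"
proof (rule CongI)
  fix \<alpha> \<beta> assume "(\<alpha>, \<beta>) \<in> theta \<sigma>"
  then have *: "\<alpha> \<in> rank_ideal C 2" "\<beta> \<in> rank_ideal C 2" "(ret \<alpha>, ret \<beta>) \<in> \<sigma>" by (auto simp: theta_def)
  note a = ret[OF rank_ideal_2(1,2)[OF *(1)]] and b = ret[OF rank_ideal_2(1,2)[OF *(2)]]
  have "br_src \<alpha> = br_src \<beta>" "br_rng \<alpha> = br_rng \<beta>"
    using cong_src[OF *(3)] br_src[OF a(1)] br_src[OF b(1)] br_rng[OF a(1)] br_rng[OF b(1)] by simp_all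
  then show "\<exists>A\<in>C. \<exists>B\<in>C. \<alpha> \<in> br A B \<and> \<beta> \<in> br A B \<and> enat (br_rank \<alpha>) \<le> 2 \<and> enat (br_rank \<beta>) \<le> 2"
    using rank_ideal_src[OF *(1)] rank_ideal_br[OF *(1)] rank_ideal_br[OF *(2)] rank_ideal_rank[OF *(1)]
      rank_ideal_rank[OF *(2)] by metis
next
  show "\<alpha> \<in> rank_ideal C 2 \<Longrightarrow> (\<alpha>, \<alpha>) \<in> theta \<sigma>" for \<alpha>
    using ret_ideal cong_refl r by (simp add: theta_def)
  show "(\<alpha>, \<beta>) \<in> theta \<sigma> \<Longrightarrow> (\<beta>, \<alpha>) \<in> theta \<sigma>" for \<alpha> \<beta>
    using cong_sym by (auto simp: theta_def)
  show "(\<alpha>, \<beta>) \<in> theta \<sigma> \<Longrightarrow> (\<beta>, \<gamma>) \<in> theta \<sigma> \<Longrightarrow> (\<alpha>, \<gamma>) \<in> theta \<sigma>" for \<alpha> \<beta> \<gamma>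
    unfolding theta_def using cong_trans by blast
next
  fix \<alpha> \<beta> \<zeta> A B D
  assume ab: "(\<alpha>, \<beta>) \<in> theta \<sigma>" "\<alpha> \<in> br A B" "\<beta> \<in> br A B" "A \<in> C" "B \<in> C" "D \<in> C" and z: "\<zeta> \<in> rank_ideal C 2"
  then have *: "\<alpha> \<in> rank_ideal C 2" "\<beta> \<in> rank_ideal C 2" "(ret \<alpha>, ret \<beta>) \<in> \<sigma>" by (auto simp: theta_def)
  note rk = rank_ideal_2(2)[OF *(1)] rank_ideal_2(2)[OF *(2)] rank_ideal_2(2)[OF z]
  note a = ret[OF ab(2) rk(1)]
  show "(br_prd \<alpha> \<zeta>, br_prd \<beta> \<zeta>) \<in> theta \<sigma>" if zb: "\<zeta> \<in> br B D"
    using rank_ideal_prd_left[OF *(1), of \<zeta> D] rank_ideal_prd_left[OF *(2), of \<zeta> D] zb ab(6)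
      br_rng[OF ab(2)] br_rng[OF ab(3)] ret_prd[OF ab(2) zb rk(1,3)] ret_prd[OF ab(3) zb rk(2,3)]
      cong_right[OF *(3) a(1) ret(1)[OF zb rk(3)] ab(6)] ret(2)[OF zb rk(3)] r
    by (simp add: theta_def zero_enat_def)
  show "(br_prd \<zeta> \<alpha>, br_prd \<zeta> \<beta>) \<in> theta \<sigma>" if zb: "\<zeta> \<in> br D A"
    using rank_ideal_prd_right[OF *(1), of \<zeta> D] rank_ideal_prd_right[OF *(2), of \<zeta> D] zb ab(6)
      br_src[OF ab(2)] br_src[OF ab(3)] ret_prd[OF zb ab(2) rk(3,1)] ret_prd[OF zb ab(3) rk(3,2)]
      cong_left[OF *(3) a(1) ret(1)[OF zb rk(3)] ab(6)] ret(2)[OF zb rk(3)] r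
    by (simp add: theta_def zero_enat_def)
qed

lemma rank0_pair:
  assumes "r = 0" "(\<alpha>, \<beta>) \<in> \<sigma>"
  shows "br_rank \<alpha> = 0" "br_rank \<beta> = 0"
  using cong_mem[OF assms(2)] rank_ideal_0 assms(1) by auto

lemma restrict_0: "\<sigma> \<inter> rank_ideal C 0 \<times> rank_ideal C 0 \<in> Cong (I_psg C 0)" (is "?\<tau> \<in> _")
proof (rule CongI)
  fix \<alpha> \<beta> assume ab: "(\<alpha>, \<beta>) \<in> ?\<tau>"
  then obtain A B where "A \<in> C" "B \<in> C" "\<alpha> \<in> br A B" "\<beta> \<in> br A B" using congE by blast
  then show "\<exists>A\<in>C. \<exists>B\<in>C. \<alpha> \<in> br A B \<and> \<beta> \<in> br A B \<and> enat (br_rank \<alpha>) \<le> 0 \<and> enat (br_rank \<beta>) \<le> 0"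
    using ab rank_ideal_rank by blast
next
  show "\<alpha> \<in> rank_ideal C 0 \<Longrightarrow> (\<alpha>, \<alpha>) \<in> ?\<tau>" for \<alpha>
    using rank_idealI[of _ _ \<alpha> r] rank_ideal_0[of \<alpha>] rank_ideal_src[of \<alpha> 0] rank_ideal_br[of \<alpha> 0] cong_refl
    by (auto simp: zero_enat_def[symmetric])
  show "(\<alpha>, \<beta>) \<in> ?\<tau> \<Longrightarrow> (\<beta>, \<alpha>) \<in> ?\<tau>" for \<alpha> \<beta> using cong_sym by blast
  show "(\<alpha>, \<beta>) \<in> ?\<tau> \<Longrightarrow> (\<beta>, \<gamma>) \<in> ?\<tau> \<Longrightarrow> (\<alpha>, \<gamma>) \<in> ?\<tau>" for \<alpha> \<beta> \<gamma> using cong_trans by blast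
next
  fix \<alpha> \<beta> \<zeta> A B D
  assume ab: "(\<alpha>, \<beta>) \<in> ?\<tau>" "\<alpha> \<in> br A B" "\<beta> \<in> br A B" "A \<in> C" "B \<in> C" "D \<in> C" and z: "\<zeta> \<in> rank_ideal C 0"
  have zr: "enat (br_rank \<zeta>) \<le> r" using rank_ideal_0[OF z] by (simp add: zero_enat_def[symmetric])
  show "(br_prd \<alpha> \<zeta>, br_prd \<beta> \<zeta>) \<in> ?\<tau>" if zb: "\<zeta> \<in> br B D"
    using rank_ideal_prd_left[of \<alpha> 0 \<zeta> D] rank_ideal_prd_left[of \<beta> 0 \<zeta> D] br_rng[OF ab(2)] br_rng[OF ab(3)]
      cong_right[OF _ ab(2) zb ab(6) zr, of \<beta>] ab(1,6) zb by simp
  show "(br_prd \<zeta> \<alpha>, br_prd \<zeta> \<beta>) \<in> ?\<tau>" if zb: "\<zeta> \<in> br D A"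
    using rank_ideal_prd_right[of \<alpha> 0 \<zeta> D] rank_ideal_prd_right[of \<beta> 0 \<zeta> D] br_src[OF ab(2)] br_src[OF ab(3)]
      cong_left[OF _ ab(2) zb ab(6) zr, of \<beta>] ab(1,6) zb by simp
qed

end

context brauer_rank begin

text \<open>A multiplier of rank 2 acts on elements of rank 0 like its retract, so \<tau> is
  respected although it is only assumed to be a congruence of the minimal ideal. An \<H>-related
  pair that loses rank becomes equal, as its completed upper hooks and its lower hooks
  agree.\<close>

lemma low_nuq_right:
  assumes t: "br_cong C 0 \<tau>" and q2: "q = 2" and N: "N \<lhd> sym_group q"
    and ab: "(\<alpha>, \<beta>) \<in> \<tau> \<union> nuq N" "\<alpha> \<in> br A B" "\<beta> \<in> br A B" "A \<in> C" "B \<in> C" "D \<in> C"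
    and z: "\<zeta> \<in> br B D" "br_rank \<zeta> \<le> 2"
  shows "(br_prd \<alpha> \<zeta>, br_prd \<beta> \<zeta>) \<in> \<tau> \<union> nuq N"
proof -
  interpret T: br_cong C 0 \<tau> by (rule t)
  note pa = br_prd_br[OF ab(2) z(1)] and pb = br_prd_br[OF ab(3) z(1)]
  consider "(\<alpha>, \<beta>) \<in> \<tau>" | "(\<alpha>, \<beta>) \<in> nuq N" using ab(1) by blast
  then show ?thesis
  proof cases
    case 1
    have rz: "br_prd \<gamma> \<zeta> = br_prd \<gamma> (ret \<zeta>)" if g: "\<gamma> \<in> br A B" "br_rank \<gamma> = 0" for \<gamma>
    proof -
      have "br_rank (br_prd \<gamma> \<zeta>) = 0" using rank_prd_left[OF g(1) z(1)] g(2) by simp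
      then show ?thesis
        using ret_prd[OF g(1) z(1) _ z(2)] ret_rank0[OF g] ret_rank0[OF br_prd_br[OF g(1) z(1)]] g(2) by simp
    qed
    show ?thesis
      using T.cong_right[OF 1 ab(2) ret(1)[OF z] ab(6)] ret(2)[OF z]
        rz[OF ab(2) T.rank0_pair(1)[OF refl 1]] rz[OF ab(3) T.rank0_pair(2)[OF refl 1]]
      by (simp add: zero_enat_def)
  next
    case 2
    obtain A' B' where t: "\<alpha> \<in> br A' B'" "\<beta> \<in> br A' B'" "up \<alpha> = up \<beta>" "lo \<alpha> = lo \<beta>" "br_rank \<alpha> = q" "br_rank \<beta> = q"
      using nuq_typed[OF N 2] by metis
    show ?thesis
    proof (cases "br_rank (br_prd \<alpha> \<zeta>) = q")
      case True
      then show ?thesis using nuq_right[OF N 2 ab(2) z(1) ab(6)] by blast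
    next
      case False
      have a0: "br_rank (br_prd \<alpha> \<zeta>) = 0"
        using False br_rank_even[OF pa] rank_prd_left[OF ab(2) z(1)] t(5) q2 by (auto elim!: evenE)
      then have b0: "br_rank (br_prd \<beta> \<zeta>) = 0" using lo_eq_prd(1)[OF ab(2,3) t(4) z(1)] by simp
      have "up (br_prd \<alpha> \<zeta>) = up (br_prd \<beta> \<zeta>)"
        using hup_prd[OF ab(2) z(1)] hup_prd[OF ab(3) z(1)] hup_cong[OF ab(2,3) t(3)] t(5,6) q2
          rank0_hup[OF pa a0] rank0_hup[OF pb b0] by simp
      then have "br_prd \<alpha> \<zeta> = br_prd \<beta> \<zeta>"
        using rank0_eqI[OF pa pb a0] lo_eq_prd(2)[OF ab(2,3) t(4) z(1)] by simp
      then show ?thesis using T.cong_refl[OF rank_ideal_0I[OF ab(4,6) pa a0]] by simp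
    qed
  qed
qed

lemma low_nuq_Cong:
  assumes t: "br_cong C 0 \<tau>" and q2: "q = 2" and N: "N \<lhd> sym_group q"
  shows "\<tau> \<union> nuq N \<in> Cong (I_psg C 2)"
proof (rule CongI)
  interpret T: br_cong C 0 \<tau> by (rule t)
  let ?s = "(\<lambda>(\<alpha>, \<beta>). (star \<alpha>, star \<beta>)) ` \<tau>"
  have ts: "br_cong C 0 ?s" by (rule T.star_cong)
  have st: "(star \<alpha>, star \<beta>) \<in> ?s \<union> nuq N" if "(\<alpha>, \<beta>) \<in> \<tau> \<union> nuq N" for \<alpha> \<beta>
    using that nuq_star[OF N] unfolding Un_iff T.mem_star_cong star_star by blast
  have st': "(\<alpha>, \<beta>) \<in> \<tau> \<union> nuq N" if "(star \<alpha>, star \<beta>) \<in> ?s \<union> nuq N" for \<alpha> \<beta>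
    using that nuq_star[OF N, of "star \<alpha>" "star \<beta>"] unfolding Un_iff T.mem_star_cong star_star by blast
  show typed: "\<exists>A\<in>C. \<exists>B\<in>C. \<alpha> \<in> br A B \<and> \<beta> \<in> br A B \<and> enat (br_rank \<alpha>) \<le> 2 \<and> enat (br_rank \<beta>) \<le> 2"
    if "(\<alpha>, \<beta>) \<in> \<tau> \<union> nuq N" for \<alpha> \<beta>
    using that
  proof
    assume "(\<alpha>, \<beta>) \<in> \<tau>"
    then show ?thesis using T.congE[of \<alpha> \<beta>] T.rank0_pair[OF refl, of \<alpha> \<beta>] by (metis zero_enat_def zero_le)
  next
    assume "(\<alpha>, \<beta>) \<in> nuq N"
    then obtain A B where "A \<in> C" "B \<in> C" "\<alpha> \<in> br A B" "\<beta> \<in> br A B" "br_rank \<alpha> = q" "br_rank \<beta> = q"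
      by (rule nuq_typed[OF N])
    then show ?thesis using q2 by (auto simp: numeral_eq_enat)
  qed
  show "(\<alpha>, \<alpha>) \<in> \<tau> \<union> nuq N" if a: "\<alpha> \<in> rank_ideal C 2" for \<alpha>
    using rank_ideal_2(3)[OF a] T.cong_refl[of \<alpha>] nuq_refl[OF N rank_ideal_src[OF a] rank_ideal_br[OF a]]
      rank_ideal_0I[OF rank_ideal_src[OF a] rank_ideal_br[OF a]] q2 by blast
  show "(\<beta>, \<alpha>) \<in> \<tau> \<union> nuq N" if "(\<alpha>, \<beta>) \<in> \<tau> \<union> nuq N" for \<alpha> \<beta>
    using that T.cong_sym nuq_sym[OF N] by blast
  show "(\<alpha>, \<gamma>) \<in> \<tau> \<union> nuq N" if ab: "(\<alpha>, \<beta>) \<in> \<tau> \<union> nuq N" "(\<beta>, \<gamma>) \<in> \<tau> \<union> nuq N" for \<alpha> \<beta> \<gamma>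
  proof -
    have n: "br_rank \<delta> = 2 \<and> br_rank \<eta> = 2" if "(\<delta>, \<eta>) \<in> nuq N" for \<delta> \<eta>
      using nuq_typed[OF N that] q2 by metis
    have "(\<alpha>, \<beta>) \<in> \<tau> \<and> (\<beta>, \<gamma>) \<in> \<tau> \<or> (\<alpha>, \<beta>) \<in> nuq N \<and> (\<beta>, \<gamma>) \<in> nuq N"
      using ab n T.rank0_pair[OF refl] by fastforce
    then show ?thesis using T.cong_trans nuq_trans[OF N] by blast
  qed
  fix \<alpha> \<beta> \<zeta> A B D
  assume ab: "(\<alpha>, \<beta>) \<in> \<tau> \<union> nuq N" "\<alpha> \<in> br A B" "\<beta> \<in> br A B" "A \<in> C" "B \<in> C" "D \<in> C" and z: "\<zeta> \<in> rank_ideal C 2"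
  note z2 = rank_ideal_2(2)[OF z]
  show "(br_prd \<alpha> \<zeta>, br_prd \<beta> \<zeta>) \<in> \<tau> \<union> nuq N" if "\<zeta> \<in> br B D"
    by (rule low_nuq_right[OF t q2 N ab that z2])
  show "(br_prd \<zeta> \<alpha>, br_prd \<zeta> \<beta>) \<in> \<tau> \<union> nuq N" if zb: "\<zeta> \<in> br D A"
  proof (rule st')
    have "br_rank (star \<zeta>) \<le> 2" using z2 by simp
    from low_nuq_right[OF ts q2 N st[OF ab(1)] star_br[OF ab(2)] star_br[OF ab(3)] ab(5,4,6) star_br[OF zb] this]
    show "(star (br_prd \<zeta> \<alpha>), star (br_prd \<zeta> \<beta>)) \<in> ?s \<union> nuq N"
      using star_prd[OF zb ab(2)] star_prd[OF zb ab(3)] by simp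
  qed
qed

text \<open>Equality at rank 0 is contained in \<tau> and equality at rank 2 is the group part for
  the trivial subgroup. Liftability is thus the trivial-subgroup case of
  \<open>low_nuq_Cong\<close>.\<close>

lemma low_Delta:
  assumes t: "br_cong C 0 \<tau>" and q2: "q = 2"
  shows "\<tau> \<union> Delta (I_psg C 2) = \<tau> \<union> nuq {id}"
proof -
  interpret T: br_cong C 0 \<tau> by (rule t)
  have N: "{id} \<lhd> sym_group q" by (rule trivial_normal)
  have "\<alpha> = \<beta> \<and> \<alpha> \<in> rank_ideal C 2" if ab: "(\<alpha>, \<beta>) \<in> nuq {id}" for \<alpha> \<beta>
    using nuq_typed[OF N ab] nuq_trivial[OF ab] rank_ideal_2I q2 by (metis order_refl)
  moreover have "(\<alpha>, \<alpha>) \<in> \<tau> \<union> nuq {id}" if a: "\<alpha> \<in> rank_ideal C 2" for \<alpha>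
    using rank_ideal_2(3)[OF a] T.cong_refl[of \<alpha>] nuq_refl[OF N rank_ideal_src[OF a] rank_ideal_br[OF a]]
      rank_ideal_0I[OF rank_ideal_src[OF a] rank_ideal_br[OF a]] q2 by blast
  ultimately show ?thesis unfolding Delta_def I_psg_simps by auto
qed

text \<open>Either some element of rank 2 is related to one that is not \<H>-related to it, and
  everything collapses onto retracts, or the two ranks do not interact and rank 2 contributes only a
  normal subgroup.\<close>

lemma Cong_I_2_cases:
  assumes s: "\<sigma> \<in> Cong (I_psg C 2)" and q2: "q = 2"
  obtains \<tau> where "\<tau> \<in> Cong (I_psg C 0)" "\<sigma> = theta \<tau>"
  | \<tau> N where "\<tau> \<in> Cong (I_psg C 0)" "N \<lhd> sym_group q" "\<sigma> = \<tau> \<union> nuq N"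
proof -
  have bc: "br_cong C 2 \<sigma>" by unfold_locales (rule s)
  interpret S: br_cong C 2 \<sigma> by (rule bc)
  let ?\<tau> = "\<sigma> \<inter> rank_ideal C 0 \<times> rank_ideal C 0"
  have t: "?\<tau> \<in> Cong (I_psg C 0)" by (rule S.restrict_0)
  show ?thesis
  proof (cases "S.NH 2")
    case True
    have c: "(\<gamma>, ret \<gamma>) \<in> \<sigma>" if "\<gamma> \<in> rank_ideal C 2" for \<gamma>
      by (rule S.collapse[OF True rank_ideal_src[OF that] rank_ideal_2(1,2)[OF that]])
    have "(\<alpha>, \<beta>) \<in> \<sigma> \<longleftrightarrow> (\<alpha>, \<beta>) \<in> theta ?\<tau>" for \<alpha> \<beta>
    proof (cases "\<alpha> \<in> rank_ideal C 2 \<and> \<beta> \<in> rank_ideal C 2")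
      case True
      then have "(\<alpha>, \<beta>) \<in> \<sigma> \<longleftrightarrow> (ret \<alpha>, ret \<beta>) \<in> \<sigma>"
        using c[of \<alpha>] c[of \<beta>] S.cong_sym S.cong_trans by metis
      then show ?thesis using True ret_ideal by (simp add: theta_def)
    next
      case False
      then show ?thesis using S.cong_mem by (auto simp: theta_def)
    qed
    then have "\<sigma> = theta ?\<tau>" by (intro equalityI subrelI) simp_all
    then show ?thesis using that(1) t by blast
  next
    case False
    have r2: "enat q \<le> 2" using q2 by (simp add: numeral_eq_enat)
    have N: "Nsig \<sigma> \<lhd> sym_group q" by (rule Nsig_normal[OF bc r2])
    have no: "\<not> S.NH k" if "2 - 2 < k" for k
    proof
      assume NHk: "S.NH k"
      then obtain \<alpha> \<beta> where ab: "(\<alpha>, \<beta>) \<in> \<sigma>" "br_rank \<alpha> = k" unfolding S.NH_def by blast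
      have "k = 2" using rank_ideal_2(3)[OF S.cong_mem(1)[OF ab(1)]] ab(2) that by simp
      then show False using NHk False by simp
    qed
    have sub: "(\<alpha>, \<beta>) \<in> ?\<tau> \<union> nuq (Nsig \<sigma>)" if ab: "(\<alpha>, \<beta>) \<in> \<sigma>" "br_rank \<beta> \<le> br_rank \<alpha>" for \<alpha> \<beta>
    proof -
      note m = S.cong_mem[OF ab(1)]
      obtain A B where AB: "A \<in> C" "B \<in> C" "\<alpha> \<in> br A B" "\<beta> \<in> br A B" using S.congE[OF ab(1)] .
      consider "br_rank \<alpha> = 0" | "br_rank \<alpha> = 2" using rank_ideal_2(3)[OF m(1)] by blast
      then show ?thesis
      proof cases
        case 1
        then show ?thesis using rank_ideal_0I[OF AB(1,2,3)] rank_ideal_0I[OF AB(1,2,4)] ab by simp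
      next
        case 2
        have "up \<alpha> = up \<beta> \<and> lo \<alpha> = lo \<beta>"
        proof (cases "\<alpha> = \<beta>")
          case False
          then show ?thesis using S.top_H_pair[OF no order_refl _ ab(1) False ab(2)] 2 by simp
        qed simp
        then have "(\<alpha>, \<beta>) \<in> nuq (Nsig \<sigma>)" using Nsig_iff[OF bc r2 AB] 2 q2 ab(1) by simp
        then show ?thesis by blast
      qed
    qed
    have "(\<alpha>, \<beta>) \<in> ?\<tau> \<union> nuq (Nsig \<sigma>)" if ab: "(\<alpha>, \<beta>) \<in> \<sigma>" for \<alpha> \<beta>
    proof (cases "br_rank \<beta> \<le> br_rank \<alpha>")
      case True
      then show ?thesis by (rule sub[OF ab])
    next
      case False
      then show ?thesis using sub[OF S.cong_sym[OF ab]] nuq_sym[OF N, of \<beta> \<alpha>] ab by auto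
    qed
    moreover have "(\<alpha>, \<beta>) \<in> \<sigma>" if ab: "(\<alpha>, \<beta>) \<in> nuq (Nsig \<sigma>)" for \<alpha> \<beta>
    proof -
      obtain A B where "A \<in> C" "B \<in> C" "\<alpha> \<in> br A B" "\<beta> \<in> br A B" "up \<alpha> = up \<beta>" "lo \<alpha> = lo \<beta>" "br_rank \<alpha> = q"
        using nuq_typed[OF N ab] by metis
      then show ?thesis using Nsig_iff[OF bc r2] ab by blast
    qed
    ultimately have "\<sigma> = ?\<tau> \<union> nuq (Nsig \<sigma>)" by auto
    then show ?thesis using that(2) t N by blast
  qed
qed

text \<open>The three-element chain counts what happens at rank 2: nothing, identification within
  \<H>-classes, collapse onto the retracts.\<close>

definition "low_cong \<tau> i = (if i = 2 then theta \<tau> else \<tau> \<union> nuq (if i = (0 :: nat) then {id} else carrier (sym_group 2)))"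

lemma low_cong_subset:
  assumes q2: "q = 2" and t: "br_cong C 0 \<tau>" "br_cong C 0 \<tau>'" and i: "i \<in> {0, 1, 2}" "j \<in> {0, 1, 2}"
  shows "low_cong \<tau> i \<subseteq> low_cong \<tau>' j \<longleftrightarrow> \<tau> \<subseteq> \<tau>' \<and> i \<le> j"
proof -
  interpret T: br_cong C 0 \<tau> by (rule t(1))
  interpret T': br_cong C 0 \<tau>' by (rule t(2))
  let ?S2 = "carrier (sym_group 2)"
  have N: "{id} \<lhd> sym_group q" "?S2 \<lhd> sym_group q" using trivial_normal full_normal q2 by simp_all
  have z: "ret \<alpha> = \<alpha>" "\<alpha> \<in> rank_ideal C 2" if "\<alpha> \<in> rank_ideal C 0" for \<alpha>
    using ret_rank0[OF rank_ideal_br[OF that] rank_ideal_0[OF that]]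
      rank_ideal_2I[OF rank_ideal_src[OF that] rank_ideal_br[OF that]] rank_ideal_0[OF that] by simp_all
  have nz: "br_rank \<alpha> = 2 \<and> br_rank \<beta> = 2" if "(\<alpha>, \<beta>) \<in> nuq {id} \<or> (\<alpha>, \<beta>) \<in> nuq ?S2" for \<alpha> \<beta>
    using that nuq_typed[OF N(1), of \<alpha> \<beta>] nuq_typed[OF N(2), of \<alpha> \<beta>] q2 by metis
  have low: "(\<alpha>, \<beta>) \<in> low_cong \<rho> k \<longleftrightarrow> (\<alpha>, \<beta>) \<in> \<rho>"
    if "\<alpha> \<in> rank_ideal C 0" "\<beta> \<in> rank_ideal C 0" for \<alpha> \<beta> \<rho> k
    using that z nz[of \<alpha> \<beta>] rank_ideal_0[of \<alpha>] by (auto simp: low_cong_def theta_def)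
  have e2: "br_rank \<epsilon> \<le> 2" using eps(4) q2 by simp
  have eI: "\<epsilon> \<in> rank_ideal C 2" by (rule rank_ideal_2I[OF Y(1) Y(1) eps(1) e2])
  \<comment> \<open>The pair of the idempotent with this transposition separates levels 0 and 1; the
    pair of the idempotent with its retract separates level 2 from both.\<close>
  define s where "s = transpose (1::nat) 2"
  have s: "s permutes {1..q}" "s \<noteq> id" "s \<in> ?S2"
    unfolding s_def q2 sym_group_carrier by (auto intro!: permutes_swap_id dest: fun_cong[of _ _ 1])
  have er: "br_rank \<epsilon> = 2" using eps(4) q2 by simp
  have et: "(\<epsilon>, \<beta>) \<notin> \<tau>'" for \<beta> using T'.rank0_pair(1)[OF refl, of \<epsilon> \<beta>] er by auto
  have "(\<epsilon>, p s) \<in> low_cong \<tau> 1" using nuq_p[OF N(2) s(1)] s(3) by (simp add: low_cong_def)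
  moreover have "(\<epsilon>, p s) \<notin> low_cong \<tau>' 0"
    using nuq_p[OF N(1) s(1)] s(2) et by (simp add: low_cong_def)
  moreover have "(\<epsilon>, ret \<epsilon>) \<in> low_cong \<tau> 2"
    using eI ret_ideal[OF eI] z T.cong_refl by (simp add: low_cong_def theta_def)
  moreover have "(\<epsilon>, ret \<epsilon>) \<notin> low_cong \<tau>' 0" "(\<epsilon>, ret \<epsilon>) \<notin> low_cong \<tau>' 1"
    using nz[of \<epsilon> "ret \<epsilon>"] ret(2)[OF eps(1) e2] et by (auto simp: low_cong_def)
  ultimately have ij: "i \<le> j" if "low_cong \<tau> i \<subseteq> low_cong \<tau>' j" using i that by auto
  have tt: "\<tau> \<subseteq> \<tau>'" if sub: "low_cong \<tau> i \<subseteq> low_cong \<tau>' j"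
  proof (rule subrelI)
    fix \<alpha> \<beta> assume ab: "(\<alpha>, \<beta>) \<in> \<tau>"
    note low[OF T.cong_mem[OF ab]]
    then show "(\<alpha>, \<beta>) \<in> \<tau>'" using ab sub by blast
  qed
  have "low_cong \<tau> i \<subseteq> low_cong \<tau>' j" if sub: "\<tau> \<subseteq> \<tau>'" and le: "i \<le> j"
  proof -
    have m: "nuq {id} \<subseteq> nuq ?S2" by (rule nuq_mono) (simp add: sym_group_carrier permutes_id)
    have "\<tau> \<union> nuq ?S2 \<subseteq> theta \<tau>'"
    proof (rule subrelI, erule UnE)
      fix \<alpha> \<beta> assume ab: "(\<alpha>, \<beta>) \<in> \<tau>"
      then show "(\<alpha>, \<beta>) \<in> theta \<tau>'" using z[OF T.cong_mem(1)[OF ab]] z[OF T.cong_mem(2)[OF ab]] sub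
        by (auto simp: theta_def)
    next
      fix \<alpha> \<beta> assume ab: "(\<alpha>, \<beta>) \<in> nuq ?S2"
      then obtain A B where *: "A \<in> C" "B \<in> C" "\<alpha> \<in> br A B" "\<beta> \<in> br A B" "up \<alpha> = up \<beta>" "lo \<alpha> = lo \<beta>"
        "br_rank \<alpha> = q" "br_rank \<beta> = q" by (rule nuq_typed[OF N(2)])
      have I: "\<alpha> \<in> rank_ideal C 2" "\<beta> \<in> rank_ideal C 2" using rank_ideal_2I[OF *(1,2)] * q2 by simp_all
      have "ret \<alpha> = ret \<beta>" using hup_cong[OF *(3-5)] hlo_cong[OF *(3,4,6)] by (simp add: ret_def)
      then show "(\<alpha>, \<beta>) \<in> theta \<tau>'" using I ret_ideal[OF I(1)] T'.cong_refl by (simp add: theta_def)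
    qed
    moreover have "theta \<tau> \<subseteq> theta \<tau>'" using sub by (auto simp: theta_def)
    ultimately show ?thesis using m i sub le by (auto simp: low_cong_def)
  qed
  then show ?thesis using ij tt by blast
qed

lemma Cong_I_2:
  assumes q2: "q = 2"
  shows "Cong (I_psg C 2) =
    {\<tau> \<union> nu (I_psg C 2) (natural_group X x 2 N) | \<tau> N. \<tau> \<in> Cong (I_psg C 0) \<and> N \<lhd> sym_group 2} \<union>
    {theta_cong (I_psg C 2) (rank_ideal C 2) \<tau> | \<tau>. \<tau> \<in> Cong (I_psg C 0)}" (is "?L = ?R")
proof -
  have bc: "br_cong C 0 \<tau>" if "\<tau> \<in> Cong (I_psg C 0)" for \<tau> by unfold_locales (rule that)
  have r2: "enat q \<le> 2" using q2 by (simp add: numeral_eq_enat)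
  have nu: "nu (I_psg C 2) (natural_group X x 2 N) = nuq N" if "N \<lhd> sym_group 2" for N
    using nu_eq[OF _ r2, of N] that unfolding q2 by blast
  show ?thesis
  proof (intro equalityI subsetI)
    fix \<sigma> assume "\<sigma> \<in> ?L"
    then show "\<sigma> \<in> ?R"
    proof (cases rule: Cong_I_2_cases[OF _ q2, of \<sigma>])
      case (2 \<tau>)
      then show ?thesis using theta_cong_eq[OF bc] by blast
    next
      case (3 \<tau> N)
      then have "N \<lhd> sym_group 2" "\<sigma> = \<tau> \<union> nu (I_psg C 2) (natural_group X x 2 N)" using nu q2 by simp_all
      then show ?thesis using 3(1) by blast
    qed
  next
    fix \<sigma> assume "\<sigma> \<in> ?R"
    then show "\<sigma> \<in> ?L"
    proof
      assume "\<sigma> \<in> {\<tau> \<union> nu (I_psg C 2) (natural_group X x 2 N) | \<tau> N. \<tau> \<in> Cong (I_psg C 0) \<and> N \<lhd> sym_group 2}"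
      then obtain \<tau> N where *: "\<tau> \<in> Cong (I_psg C 0)" "N \<lhd> sym_group 2" "\<sigma> = \<tau> \<union> nuq N" using nu by blast
      then show ?thesis using low_nuq_Cong[OF bc[OF *(1)] q2, of N] q2 by simp
    next
      assume "\<sigma> \<in> {theta_cong (I_psg C 2) (rank_ideal C 2) \<tau> | \<tau>. \<tau> \<in> Cong (I_psg C 0)}"
      then obtain \<tau> where *: "\<tau> \<in> Cong (I_psg C 0)" "\<sigma> = theta \<tau>" using theta_cong_eq[OF bc] by blast
      then show ?thesis using br_cong.theta_Cong[OF bc[OF *(1)] refl] by simp
    qed
  qed
qed

lemma liftable_I_2:
  assumes "q = 2" "\<tau> \<in> Cong (I_psg C 0)"
  shows "liftable (I_psg C 2) \<tau>"
proof -
  have bc: "br_cong C 0 \<tau>" by unfold_locales (rule assms(2))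
  show ?thesis unfolding liftable_def low_Delta[OF bc assms(1)] by (rule low_nuq_Cong[OF bc assms(1) trivial_normal])
qed

lemma Cong_I_2_lattice:
  assumes q2: "q = 2"
  shows "lattice_isomorphic (Cong_lattice (I_psg C 2)) (prod_lattice (Cong_lattice (I_psg C 0)) chain3)"
    (is "lattice_isomorphic ?L ?M")
proof (rule lattice_isomorphicI_inv[of "\<lambda>w. low_cong (fst w) (snd w)"])
  have bc: "br_cong C 0 \<tau>" if "\<tau> \<in> Cong (I_psg C 0)" for \<tau> by unfold_locales (rule that)
  have car: "carrier ?L = Cong (I_psg C 2)" "carrier ?M = Cong (I_psg C 0) \<times> {0, 1, 2}"
    by (simp_all add: Cong_lattice_def incl_order_def prod_lattice_def chain3_def)
  have le: "le ?L \<sigma> \<rho> \<longleftrightarrow> \<sigma> \<subseteq> \<rho>" "le ?M w v \<longleftrightarrow> fst w \<subseteq> fst v \<and> snd w \<le> snd v" for \<sigma> \<rho> w v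
    by (simp_all add: Cong_lattice_def incl_order_def prod_lattice_def chain3_def)
  show emb: "le ?M w v \<longleftrightarrow> le ?L (low_cong (fst w) (snd w)) (low_cong (fst v) (snd v))"
    if "w \<in> carrier ?M" "v \<in> carrier ?M" for w v
  proof -
    have "br_cong C 0 (fst w)" "br_cong C 0 (fst v)" "snd w \<in> {0, 1, 2}" "snd v \<in> {0, 1, 2}"
      using that bc unfolding car by auto
    from low_cong_subset[OF q2 this] show ?thesis unfolding le by simp
  qed
  show "eq ?L y z \<longleftrightarrow> y = z" for y z by (simp add: Cong_lattice_def incl_order_def)
  \<comment> \<open>Preservation of joins includes the assertion that both orders are lattices, so
    the isomorphism at rank 0 supplies this.\<close>
  have "lattice (Cong_lattice (I_psg C 0))"
    using Cong_I_0_lattice unfolding lattice_isomorphic_def join_pres_def by blast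
  then show M: "lattice ?M" by (rule prod_lattice[OF _ chain3_lattice])
  show "bij_betw (\<lambda>w. low_cong (fst w) (snd w)) (carrier ?M) (carrier ?L)"
    unfolding bij_betw_def
  proof
    show "inj_on (\<lambda>w. low_cong (fst w) (snd w)) (carrier ?M)"
    proof (rule inj_onI)
      fix w v assume wv: "w \<in> carrier ?M" "v \<in> carrier ?M" "low_cong (fst w) (snd w) = low_cong (fst v) (snd v)"
      then have "le ?M w v" "le ?M v w" using emb[OF wv(1,2)] emb[OF wv(2,1)] unfolding le(1) by simp_all
      then show "w = v" by (rule lattice_basic(2)[OF M wv(1,2)])
    qed
    show "(\<lambda>w. low_cong (fst w) (snd w)) ` carrier ?M = carrier ?L"
    proof (intro equalityI subsetI)
      fix \<sigma> assume "\<sigma> \<in> (\<lambda>w. low_cong (fst w) (snd w)) ` carrier ?M"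
      then obtain w where w: "w \<in> Cong (I_psg C 0) \<times> {0, 1, 2}" "\<sigma> = low_cong (fst w) (snd w)" unfolding car by blast
      then have *: "fst w \<in> Cong (I_psg C 0)" "snd w \<in> {0, 1, 2}" by auto
      note b = bc[OF *(1)]
      have S2: "carrier (sym_group 2) \<lhd> sym_group q" unfolding q2 by (rule full_normal)
      show "\<sigma> \<in> carrier ?L"
        using *(2) br_cong.theta_Cong[OF b refl] low_nuq_Cong[OF b q2 trivial_normal] low_nuq_Cong[OF b q2 S2]
        unfolding car w(2) low_cong_def by auto
    next
      fix \<sigma> assume "\<sigma> \<in> carrier ?L"
      then have "\<sigma> \<in> Cong (I_psg C 2)" unfolding car .
      then obtain \<tau> i where *: "\<tau> \<in> Cong (I_psg C 0)" "i \<in> {0, 1, 2}" "\<sigma> = low_cong \<tau> i"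
      proof (cases rule: Cong_I_2_cases[OF _ q2, of \<sigma>])
        case (2 \<tau>)
        then show ?thesis by (intro that[of \<tau> 2]) (simp_all add: low_cong_def)
      next
        case (3 \<tau> N)
        then have "N \<lhd> sym_group 2" using q2 by simp
        then consider "N = {id}" | "N = carrier (sym_group 2)" unfolding normal_sym_2 by blast
        then show ?thesis
        proof cases
          case 1
          then show ?thesis using 3 by (intro that[of \<tau> 0]) (simp_all add: low_cong_def)
        next
          case 2
          then show ?thesis using 3 by (intro that[of \<tau> 1]) (simp_all add: low_cong_def)
        qed
      qed
      then show "\<sigma> \<in> (\<lambda>w. low_cong (fst w) (snd w)) ` carrier ?M"
        unfolding car by (intro image_eqI[of _ _ "(\<tau>, i)"]) auto
    qed
  qed
qed

end

section \<open>Congruences of larger ideals\<close>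

context brauer_objects begin

lemma Nabla_Cong: "Nabla (I_psg C r) \<in> Cong (I_psg C r)"
proof (rule CongI)
  have mem: "(\<alpha>, \<beta>) \<in> Nabla (I_psg C r) \<longleftrightarrow>
      \<alpha> \<in> rank_ideal C r \<and> \<beta> \<in> rank_ideal C r \<and> br_src \<alpha> = br_src \<beta> \<and> br_rng \<alpha> = br_rng \<beta>" for \<alpha> \<beta>
    by (simp add: Nabla_on_def psg_sim_def)
  show "\<exists>A\<in>C. \<exists>B\<in>C. \<alpha> \<in> br A B \<and> \<beta> \<in> br A B \<and> enat (br_rank \<alpha>) \<le> r \<and> enat (br_rank \<beta>) \<le> r"
    if "(\<alpha>, \<beta>) \<in> Nabla (I_psg C r)" for \<alpha> \<beta>
    using that rank_ideal_src[of \<alpha> r] rank_ideal_br[of \<alpha> r] rank_ideal_br[of \<beta> r] rank_ideal_rank[of \<alpha> r]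
      rank_ideal_rank[of \<beta> r] unfolding mem by metis
  show "\<alpha> \<in> rank_ideal C r \<Longrightarrow> (\<alpha>, \<alpha>) \<in> Nabla (I_psg C r)" for \<alpha> unfolding mem by simp
  show "(\<alpha>, \<beta>) \<in> Nabla (I_psg C r) \<Longrightarrow> (\<beta>, \<alpha>) \<in> Nabla (I_psg C r)" for \<alpha> \<beta> unfolding mem by simp
  show "(\<alpha>, \<beta>) \<in> Nabla (I_psg C r) \<Longrightarrow> (\<beta>, \<gamma>) \<in> Nabla (I_psg C r) \<Longrightarrow> (\<alpha>, \<gamma>) \<in> Nabla (I_psg C r)" for \<alpha> \<beta> \<gamma>
    unfolding mem by simp
  fix \<alpha> \<beta> \<zeta> A B D
  assume ab: "(\<alpha>, \<beta>) \<in> Nabla (I_psg C r)" "\<alpha> \<in> br A B" "\<beta> \<in> br A B" "A \<in> C" "B \<in> C" "D \<in> C"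
  note m = ab(1)[unfolded mem] and st = br_src[OF ab(2)] br_rng[OF ab(2)] br_src[OF ab(3)] br_rng[OF ab(3)]
  show "(br_prd \<alpha> \<zeta>, br_prd \<beta> \<zeta>) \<in> Nabla (I_psg C r)" if "\<zeta> \<in> br B D"
    unfolding mem
    using m st rank_ideal_prd_left[of \<alpha> r \<zeta> D] rank_ideal_prd_left[of \<beta> r \<zeta> D] that ab(6)
      br_src[OF br_prd_br[OF ab(2) that]] br_src[OF br_prd_br[OF ab(3) that]]
      br_rng[OF br_prd_br[OF ab(2) that]] br_rng[OF br_prd_br[OF ab(3) that]] by simp
  show "(br_prd \<zeta> \<alpha>, br_prd \<zeta> \<beta>) \<in> Nabla (I_psg C r)" if "\<zeta> \<in> br D A"
    unfolding mem
    using m st rank_ideal_prd_right[of \<alpha> r \<zeta> D] rank_ideal_prd_right[of \<beta> r \<zeta> D] that ab(6)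
      br_src[OF br_prd_br[OF that ab(2)]] br_src[OF br_prd_br[OF that ab(3)]]
      br_rng[OF br_prd_br[OF that ab(2)]] br_rng[OF br_prd_br[OF that ab(3)]] by simp
qed

lemma Cong_subset_Nabla: "\<sigma> \<in> Cong (I_psg C r) \<Longrightarrow> \<sigma> \<subseteq> Nabla (I_psg C r)"
  by (auto simp: Cong_def congruence_def Nabla_on_def equiv_def refl_on_def)

lemma kind_cong_Cong:
  assumes r: "r_ok C r" and q: "even q" "2 \<le> q" "enat q \<le> r" and N: "N \<lhd> sym_group q"
    and k: "k = RK \<or> q = 2 \<or> q = 4 \<and> N \<subseteq> klein"
  shows "kind_cong k (I_psg C r) (rank_ideal C (enat (q - 2))) (natural_group X x q N) \<in> Cong (I_psg C r)"
proof -
  interpret Q: brauer_rank C X x q by (rule brauer_rankI[OF r q(1,3)])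
  have k': "k = RK \<or> q = 2 \<or> q = 4" using k by blast
  have "eu_of k \<and> el_of k \<or> q = 2 \<or> q = 4 \<and> N \<subseteq> klein" using k by (auto simp: eu_of_def el_of_def)
  from Q.Rel_Cong[OF q(2,3) N this] show ?thesis unfolding Q.kind_cong_eq[OF q(2,3) N k'] .
qed

lemma Cong_I_r:
  assumes r: "r_ok C r"
  shows "Cong (I_psg C r) =
       (\<Union>N\<in>{N. N \<lhd> sym_group 2}.
          {mu_cong (I_psg C r) (rank_ideal C 0) (natural_group X x 2 N),
           lambda_cong (I_psg C r) (rank_ideal C 0) (natural_group X x 2 N),
           rho_cong (I_psg C r) (rank_ideal C 0) (natural_group X x 2 N),
           R_cong (I_psg C r) (rank_ideal C 0) (natural_group X x 2 N)}) \<union>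
       (\<Union>N\<in>{{id}, klein}.
          {mu_cong (I_psg C r) (rank_ideal C 2) (natural_group X x 4 N),
           lambda_cong (I_psg C r) (rank_ideal C 2) (natural_group X x 4 N),
           rho_cong (I_psg C r) (rank_ideal C 2) (natural_group X x 4 N),
           R_cong (I_psg C r) (rank_ideal C 2) (natural_group X x 4 N)}) \<union>
       {R_cong (I_psg C r) (rank_ideal C (enat q)) (natural_group X x (q + 2) N) | q N.
          2 \<le> q \<and> enat q < r \<and> even q \<and> N \<lhd> sym_group (q + 2)} \<union>
       {Nabla (I_psg C r)}" (is "_ = (\<Union>N\<in>_. ?A N) \<union> (\<Union>N\<in>_. ?B N) \<union> ?R \<union> _")
proof -
  have A: "?A N = range (\<lambda>k. kind_cong k (I_psg C r) (rank_ideal C (enat (2 - 2))) (natural_group X x 2 N))"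
    and B: "?B N = range (\<lambda>k. kind_cong k (I_psg C r) (rank_ideal C (enat (4 - 2))) (natural_group X x 4 N))" for N
  proof -
    have U: "range F = {F MuK, F LambdaK, F RhoK, F RK}" for F :: "kind \<Rightarrow> 'z"
    proof -
      have "k \<in> {MuK, LambdaK, RhoK, RK}" for k by (cases k) auto
      then show ?thesis by (auto simp: image_iff, metis)
    qed
    show "?A N = range (\<lambda>k. kind_cong k (I_psg C r) (rank_ideal C (enat (2 - 2))) (natural_group X x 2 N))"
      "?B N = range (\<lambda>k. kind_cong k (I_psg C r) (rank_ideal C (enat (4 - 2))) (natural_group X x 4 N))"
      unfolding U by (simp_all add: zero_enat_def numeral_eq_enat)
  qed
  \<comment> \<open>Parity and the form of r allow a strict bound on the ideal to be read as a bound
    on the rank of the group part.\<close>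
  have lt: "enat q < r \<longleftrightarrow> enat (q + 2) \<le> r" if "even q" for q
    using r_ok_Suc[OF r that] by (cases r) auto
  have le: "enat 2 \<le> r" "enat 4 \<le> r"
    using r_ok_4[OF r] by (simp_all add: numeral_eq_enat order_trans[of "enat 2" "enat 4" r])
  show ?thesis
  proof (intro equalityI subsetI)
    fix \<sigma> assume s: "\<sigma> \<in> Cong (I_psg C r)"
    show "\<sigma> \<in> (\<Union>N\<in>{N. N \<lhd> sym_group 2}. ?A N) \<union> (\<Union>N\<in>{{id}, klein}. ?B N) \<union> ?R \<union> {Nabla (I_psg C r)}"
    proof (cases "\<sigma> = Nabla (I_psg C r)")
      case False
      obtain q N k where *: "even q" "2 \<le> q" "enat q \<le> r" "N \<lhd> sym_group q" "k = RK \<or> q = 2 \<or> q = 4 \<and> N \<subseteq> klein"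
        "\<sigma> = kind_cong k (I_psg C r) (rank_ideal C (enat (q - 2))) (natural_group X x q N)"
        using Cong_classification[OF s r False] by blast
      consider "q = 2" | "q = 4" "N \<subseteq> klein" | "q \<noteq> 2" "k = RK" using *(5) by blast
      then show ?thesis
      proof cases
        case 1
        then have "\<sigma> \<in> ?A N" using *(6) unfolding A by blast
        moreover have "N \<lhd> sym_group 2" using *(4) 1 by simp
        ultimately show ?thesis by blast
      next
        case 2
        then have "\<sigma> \<in> ?B N" using *(6) unfolding B by blast
        moreover have "N \<in> {{id}, klein}" using normal_in_klein[of N] *(4) 2 by simp
        ultimately show ?thesis by blast
      next
        case 3
        define m where "m = q - 2"
        have m: "q = m + 2" "even m" "2 \<le> m" using *(1,2) 3(1) by (auto simp: m_def elim!: evenE)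
        have "\<sigma> = R_cong (I_psg C r) (rank_ideal C (enat m)) (natural_group X x (m + 2) N)"
          using *(6) 3(2) m(1) by simp
        moreover have "enat m < r" "N \<lhd> sym_group (m + 2)" using *(3,4) lt[OF m(2)] m(1) by simp_all
        ultimately have "\<sigma> \<in> ?R" using m by blast
        then show ?thesis by blast
      qed
    qed simp
  next
    fix \<sigma>
    assume "\<sigma> \<in> (\<Union>N\<in>{N. N \<lhd> sym_group 2}. ?A N) \<union> (\<Union>N\<in>{{id}, klein}. ?B N) \<union> ?R \<union> {Nabla (I_psg C r)}"
    then consider N where "N \<lhd> sym_group 2" "\<sigma> \<in> ?A N" | N where "N \<in> {{id}, klein}" "\<sigma> \<in> ?B N"
      | "\<sigma> \<in> ?R" | "\<sigma> = Nabla (I_psg C r)" by blast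
    then show "\<sigma> \<in> Cong (I_psg C r)"
    proof cases
      case 1
      then show ?thesis using kind_cong_Cong[OF r _ _ le(1) 1(1)] unfolding A by auto
    next
      case 2
      then have N: "N \<lhd> sym_group 4" "N \<subseteq> klein" using trivial_normal klein_normal by (auto simp: klein_def)
      have ev: "even (4 :: nat)" "2 \<le> (4 :: nat)" by simp_all
      obtain k where "\<sigma> = kind_cong k (I_psg C r) (rank_ideal C (enat (4 - 2))) (natural_group X x 4 N)"
        using 2(2) unfolding B by blast
      then show ?thesis using kind_cong_Cong[OF r ev le(2) N(1), of k] N(2) by blast
    next
      case 3
      then obtain q N where *: "enat q < r" "even q" "N \<lhd> sym_group (q + 2)"
        "\<sigma> = R_cong (I_psg C r) (rank_ideal C (enat q)) (natural_group X x (q + 2) N)" by blast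
      have "even (q + 2)" "2 \<le> q + 2" using *(2) by simp_all
      from kind_cong_Cong[OF r this lt[THEN iffD1, OF *(2,1)] *(3), of RK] show ?thesis using *(4) by simp
    next
      case 4
      then show ?thesis using Nabla_Cong by simp
    qed
  qed
qed

lemma pairs4_props:
  assumes r: "r_ok C r" and p: "p \<in> pairs4"
  shows "even (fst p)" "enat (fst p + 2) \<le> r" "snd p \<lhd> sym_group (fst p + 2)" "fst p \<le> 2" "lex_le p (2, klein)"
proof -
  have e: "(0::nat) + 2 = 2" "(2::nat) + 2 = 4" by simp_all
  have "enat (0 + 2) \<le> r" "enat (2 + 2) \<le> r"
    unfolding e using r_ok_4[OF r] by (simp_all add: numeral_eq_enat order_trans[of "enat 2" "enat 4" r])
  moreover have "carrier (sym_group 2) \<lhd> sym_group (0 + 2)" "klein \<lhd> sym_group (2 + 2)"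
    unfolding e by (rule full_normal, rule klein_normal)
  moreover have "id \<in> klein" by (simp add: klein_def)
  ultimately show "even (fst p)" "enat (fst p + 2) \<le> r" "snd p \<lhd> sym_group (fst p + 2)" "fst p \<le> 2" "lex_le p (2, klein)"
    using p trivial_normal unfolding pairs4_def by (auto simp: lex_le_def)
qed

lemma upper_pairs_props:
  assumes r: "r_ok C r" and p: "p \<in> upper_pairs r"
  shows "even (fst p)" "enat (fst p + 2) \<le> r" "snd p \<lhd> sym_group (fst p + 2)" "lex_le (2, klein) p"
  using p r_ok_Suc[OF r, of "fst p"] by (auto simp: upper_pairs_def)

lemma pairs4_le:
  assumes "r_ok C r" "p \<in> pairs4" "p' \<in> pairs4"
  shows "pair_cong C X x r k p \<subseteq> pair_cong C X x r k' p' \<longleftrightarrow> lex_le p p' \<and> kind_le k k'"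
  using pair_cong_le_iff[OF assms(1) pairs4_props(1-3)[OF assms(1,2)] _ pairs4_props(1-3)[OF assms(1,3)], of k k']
    pairs4_props(4)[OF assms(1,2)] pairs4_props(4)[OF assms(1,3)] by simp

lemma pairs4_inj:
  assumes "r_ok C r"
  shows "inj_on (\<lambda>(k, p). pair_cong C X x r k p) (UNIV \<times> pairs4)"
proof (rule inj_onI)
  fix u v
  assume uv: "u \<in> UNIV \<times> pairs4" "v \<in> UNIV \<times> pairs4"
    and eq: "(\<lambda>(k, p). pair_cong C X x r k p) u = (\<lambda>(k, p). pair_cong C X x r k p) v"
  obtain k p k' p' where u: "u = (k, p)" and v: "v = (k', p')" by (metis surj_pair)
  have p: "p \<in> pairs4" "p' \<in> pairs4" using uv u v by simp_all
  have *: "lex_le p p' \<and> kind_le k k'" "lex_le p' p \<and> kind_le k' k"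
    using pairs4_le[OF assms p, of k k'] pairs4_le[OF assms p(2,1), of k' k] eq u v by simp_all
  have "k = k'" using * unfolding kind_le_def by (metis kind.distinct)
  moreover have "fst p = fst p'" using * unfolding lex_le_def by linarith
  moreover have "snd p = snd p'" using * unfolding lex_le_def by auto
  ultimately show "u = v" using u v by (simp add: prod_eqI)
qed

lemma upper_pairs_le:
  assumes "r_ok C r" "p \<in> upper_pairs r" "p' \<in> upper_pairs r"
  shows "pair_cong C X x r RK p \<subseteq> pair_cong C X x r RK p' \<longleftrightarrow> lex_le p p'"
  using pair_cong_le_iff[OF assms(1) upper_pairs_props(1-3)[OF assms(1,2)] _ upper_pairs_props(1-3)[OF assms(1,3)], of RK RK]
  by (simp add: kind_le_def)

text \<open>Only equal first components need an argument. For q = 2 both subgroups contain the Klein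
  group; for larger q the degree is at least 6, and normal subgroups are comparable in either
  case.\<close>

lemma upper_pairs_chain:
  assumes "r_ok C r" "p \<in> upper_pairs r" "p' \<in> upper_pairs r"
  shows "lex_le p p' \<or> lex_le p' p"
proof (cases "fst p = fst p'")
  case True
  note u = upper_pairs_props[OF assms(1,2)] and u' = upper_pairs_props[OF assms(1,3)]
  have "fst p = 2 \<or> 4 \<le> fst p" using u(1,4) by (auto simp: lex_le_def elim!: evenE)
  then have "5 \<le> fst p + 2 \<or> fst p + 2 = 4 \<and> klein \<subseteq> snd p \<and> klein \<subseteq> snd p'"
    using u(4) u'(4) True by (auto simp: lex_le_def)
  then show ?thesis using normal_chain[OF u(3), of "snd p'"] u'(3) True by (auto simp: lex_le_def)
qed (auto simp: lex_le_def)

lemma pairs4_upper_pairs: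
  assumes "r_ok C r" "p \<in> pairs4" "p' \<in> upper_pairs r"
  shows "pair_cong C X x r k p \<subseteq> pair_cong C X x r RK p'"
proof -
  have "lex_le p p'" using pairs4_props(5)[OF assms(1,2)] upper_pairs_props(4)[OF assms(1,3)] by (auto simp: lex_le_def)
  then show ?thesis
    using pair_cong_le_iff[OF assms(1) pairs4_props(1-3)[OF assms(1,2)] _ upper_pairs_props(1-3)[OF assms(1,3)], of k RK]
      pairs4_props(4)[OF assms(1,2)] by (simp add: kind_le_def)
qed

end

theorem theorem7p12:
  fixes C :: "'a set set" and X :: "nat \<Rightarrow> 'a set" and x :: "nat \<Rightarrow> nat \<Rightarrow> 'a"
  assumes C_nonempty: "C \<noteq> {}"
    and C_even: "\<And>A. A \<in> C \<Longrightarrow> finite A \<and> even (card A)"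
    and X_x: "enumerated_objects C X x"
  shows
    "(\<comment> \<open>(i)\<close>
     (\<forall>M. is_minimal_ideal (BrauerCat C) M \<longleftrightarrow> M = rank_ideal C 0) \<and>
     (\<exists>(P :: 'a set \<Rightarrow> ('a \<times> 'a) set set) (Q :: 'a set \<Rightarrow> ('a \<times> 'a) set set).
        band_data C P \<and> band_data C Q \<and>
        (\<exists>\<phi>. psg_iso \<phi> (I_psg C 0) (rect_band C P Q)) \<and>
        (\<forall>\<phi>. psg_iso \<phi> (I_psg C 0) (rect_band C P Q) \<longrightarrow>
           Cong (I_psg C 0) =
             {{(\<alpha>, \<beta>) \<in> rank_ideal C 0 \<times> rank_ideal C 0. (\<phi> \<alpha>, \<phi> \<beta>) \<in> band_sigma C P Q E1 E2} | E1 E2.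
                (\<forall>A\<in>C. equiv (P A) (E1 A)) \<and> (\<forall>A\<in>C. equiv (Q A) (E2 A))})) \<and>
     lattice_isomorphic (Cong_lattice (I_psg C 0))
       (prod_lattice (Prod_lattice C (\<lambda>A. Eq_lattice (Eq2 A)))
                     (Prod_lattice C (\<lambda>A. Eq_lattice (Eq2 A))))) \<and>
     \<comment> \<open>(ii)\<close>
     (xi C > 2 \<longrightarrow>
     (\<forall>r\<ge>2. retractable (I_psg C r) (rank_ideal C 2)) \<and>
     (\<forall>\<tau>\<in>Cong (I_psg C 0). liftable (I_psg C 2) \<tau>) \<and>
     Cong (I_psg C 2) =
       {\<tau> \<union> nu (I_psg C 2) (natural_group X x 2 N) | \<tau> N.
          \<tau> \<in> Cong (I_psg C 0) \<and> N \<lhd> sym_group 2} \<union>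
       {theta_cong (I_psg C 2) (rank_ideal C 2) \<tau> | \<tau>. \<tau> \<in> Cong (I_psg C 0)} \<and>
     lattice_isomorphic (Cong_lattice (I_psg C 2)) (prod_lattice (Cong_lattice (I_psg C 0)) chain3)) \<and>
     \<comment> \<open>(iii)\<close>
     (\<forall>r. (\<exists>m. r = enat m \<and> even m \<and> 4 \<le> m \<and> r < xi C) \<or> (r = \<infinity> \<and> xi C = \<infinity>) \<longrightarrow>
     Cong (I_psg C r) =
       (\<Union>N\<in>{N. N \<lhd> sym_group 2}.
          {mu_cong (I_psg C r) (rank_ideal C 0) (natural_group X x 2 N),
           lambda_cong (I_psg C r) (rank_ideal C 0) (natural_group X x 2 N),
           rho_cong (I_psg C r) (rank_ideal C 0) (natural_group X x 2 N),
           R_cong (I_psg C r) (rank_ideal C 0) (natural_group X x 2 N)}) \<union>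
       (\<Union>N\<in>{{id}, klein}.
          {mu_cong (I_psg C r) (rank_ideal C 2) (natural_group X x 4 N),
           lambda_cong (I_psg C r) (rank_ideal C 2) (natural_group X x 4 N),
           rho_cong (I_psg C r) (rank_ideal C 2) (natural_group X x 4 N),
           R_cong (I_psg C r) (rank_ideal C 2) (natural_group X x 4 N)}) \<union>
       {R_cong (I_psg C r) (rank_ideal C (enat q)) (natural_group X x (q + 2) N) | q N.
          2 \<le> q \<and> enat q < r \<and> even q \<and> N \<lhd> sym_group (q + 2)} \<union>
       {Nabla (I_psg C r)} \<and>
     (\<forall>p\<in>pairs4. \<forall>p'\<in>pairs4. \<forall>k k'.
        pair_cong C X x r k p \<subseteq> pair_cong C X x r k' p' \<longleftrightarrow> lex_le p p' \<and> kind_le k k') \<and>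
     inj_on (\<lambda>(k, p). pair_cong C X x r k p) (UNIV \<times> pairs4) \<and>
     (\<forall>p\<in>upper_pairs r. \<forall>p'\<in>upper_pairs r.
        pair_cong C X x r RK p \<subseteq> pair_cong C X x r RK p' \<longleftrightarrow> lex_le p p') \<and>
     (\<forall>p\<in>upper_pairs r. \<forall>p'\<in>upper_pairs r. lex_le p p' \<or> lex_le p' p) \<and>
     (\<forall>p\<in>pairs4. \<forall>k. \<forall>p'\<in>upper_pairs r.
        pair_cong C X x r k p \<subseteq> pair_cong C X x r RK p') \<and>
     (\<forall>\<sigma>\<in>Cong (I_psg C r). \<sigma> \<subseteq> Nabla (I_psg C r)))"
proof -
  interpret brauer_objects C X x by unfold_locales (fact C_nonempty, fact C_even, fact X_x)
  have i: "\<exists>(P :: 'a set \<Rightarrow> ('a \<times> 'a) set set) (Q :: 'a set \<Rightarrow> ('a \<times> 'a) set set).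
        band_data C P \<and> band_data C Q \<and>
        (\<exists>\<phi>. psg_iso \<phi> (I_psg C 0) (rect_band C P Q)) \<and>
        (\<forall>\<phi>. psg_iso \<phi> (I_psg C 0) (rect_band C P Q) \<longrightarrow>
           Cong (I_psg C 0) =
             {{(\<alpha>, \<beta>) \<in> rank_ideal C 0 \<times> rank_ideal C 0. (\<phi> \<alpha>, \<phi> \<beta>) \<in> band_sigma C P Q E1 E2} | E1 E2.
                (\<forall>A\<in>C. equiv (P A) (E1 A)) \<and> (\<forall>A\<in>C. equiv (Q A) (E2 A))})"
    using Eq2_band_data I_0_psg_iso Cong_I_0[OF Eq2_band_data Eq2_band_data] by blast
  have rank2: "brauer_rank C X x 2" if "xi C > 2"
    by unfold_locales (use that in \<open>simp_all add: numeral_eq_enat\<close>)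
  show ?thesis
    unfolding r_ok_def[symmetric]
  proof (intro conjI impI)
    show "\<forall>M. is_minimal_ideal (BrauerCat C) M \<longleftrightarrow> M = rank_ideal C 0"
      unfolding BrauerCat_eq is_minimal_ideal_iff by simp
    show "lattice_isomorphic (Cong_lattice (I_psg C 0))
       (prod_lattice (Prod_lattice C (\<lambda>A. Eq_lattice (Eq2 A))) (Prod_lattice C (\<lambda>A. Eq_lattice (Eq2 A))))"
      by (rule Cong_I_0_lattice)
  next
    assume "xi C > 2"
    then interpret Q: brauer_rank C X x 2 by (rule rank2)
    show "\<forall>r\<ge>2. retractable (I_psg C r) (rank_ideal C 2)" using retractable_2 by blast
    show "\<forall>\<tau>\<in>Cong (I_psg C 0). liftable (I_psg C 2) \<tau>" using Q.liftable_I_2[OF refl] by blast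
    show "Cong (I_psg C 2) =
       {\<tau> \<union> nu (I_psg C 2) (natural_group X x 2 N) | \<tau> N.
          \<tau> \<in> Cong (I_psg C 0) \<and> N \<lhd> sym_group 2} \<union>
       {theta_cong (I_psg C 2) (rank_ideal C 2) \<tau> | \<tau>. \<tau> \<in> Cong (I_psg C 0)}"
      by (rule Q.Cong_I_2[OF refl])
    show "lattice_isomorphic (Cong_lattice (I_psg C 2)) (prod_lattice (Cong_lattice (I_psg C 0)) chain3)"
      by (rule Q.Cong_I_2_lattice[OF refl])
  qed (fact i, intro allI impI conjI ballI,
      (rule Cong_I_r pairs4_le pairs4_inj upper_pairs_le upper_pairs_chain pairs4_upper_pairs Cong_subset_Nabla;
        assumption)+)
qed

end
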